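(* Let $p$ be a prime. Let $P_{1}(t), \dots, P_{l}(t) \in \mathbb{Z}_{p}[t]$ be monic polynomials of degree at most $2$ whose images modulo $p$ are distinct and irreducible in $\mathbb{F}_{p}[t]$. For each $1 \le j \le l$, let $G_{j}$ be a finite module over $\mathbb{Z}_{p}[t]/(P_{j}(t))$. Then \[ \lim_{n \rightarrow \infty}\underset{X \in \mathrm{Mat}_{n}(\mathbb{Z}_{p})}{\mathrm{Prob}}\left( \mathrm{cok}(P_{j}(X)) \simeq G_{j} \text{ for all } 1 \leq j \leq l \right) = \prod_{j=1}^{l}\frac{1}{|\mathrm{Aut}_{\mathbb{Z}_{p}[t]/(P_{j}(t))}(G_{j})|}\prod_{i=1}^{\infty}\big(1 - p^{-i\deg(P_{j})}\big). \]
   Context: $\mathbb{Z}_p$ denotes the $p$-adic integers and $\mathrm{Mat}_n(\mathbb{Z}_p)$ the $n\times n$ matrices over it; the probability is with respect to the Haar probability measure on the additive compact group $\mathrm{Mat}_n(\mathbb{Z}_p)\cong\mathbb{Z}_p^{n^2}$. For a matrix $Y\in\mathrm{Mat}_n(\mathbb{Z}_p)$, $\mathrm{cok}(Y)=\mathbb{Z}_p^n/Y\mathbb{Z}_p^n$. For $X \in \mathrm{Mat}_n(\mathbb{Z}_p)$, $\mathrm{cok}(P_j(X))$ is a $\mathbb{Z}_{p}[t]/(P_{j}(t))$-module with $\bar t$ acting by left multiplication by $X$; isomorphism is as $\mathbb{Z}_{p}[t]/(P_{j}(t))$-modules (equivalently, as abelian groups). $\mathrm{Aut}_R(G)$ denotes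 the group of $R$-linear automorphisms of $G$. *)

theory Defs
  imports "HOL-Probability.Probability" "HOL-Algebra.Group" "HOL-Algebra.FiniteProduct"
    "Berlekamp_Zassenhaus.Poly_Mod"
begin

text \<open>An element x of Z_p is represented by the sequence of its reductions:
  x k is the residue of x modulo p^k, taken in 0 ..< p^k.\<close>

definition padic_int :: "nat \<Rightarrow> (nat \<Rightarrow> int) set" where
  "padic_int p = {x. \<forall>k. 0 \<le> x k \<and> x k < int p ^ k \<and> x k = x (Suc k) mod int p ^ k}"

definition padic_one :: "nat \<Rightarrow> nat \<Rightarrow> int" where
  "padic_one p = (\<lambda>k. 1 mod int p ^ k)"

definition padic_zero :: "nat \<Rightarrow> int" where
  "padic_zero = (\<lambda>k. 0)"

definition padic_of_digits :: "nat \<Rightarrow> (nat \<Rightarrow> nat) \<Rightarrow> nat \<Rightarrow> int" where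
  "padic_of_digits p d = (\<lambda>k. \<Sum>m<k. int (d m) * int p ^ m)"

type_synonym padic_mat = "nat \<Rightarrow> nat \<Rightarrow> nat \<Rightarrow> int"
type_synonym padic_vec = "nat \<Rightarrow> nat \<Rightarrow> int"

definition padic_vecs :: "nat \<Rightarrow> nat \<Rightarrow> padic_vec set" where
  "padic_vecs p n = {v. (\<forall>i<n. v i \<in> padic_int p) \<and> (\<forall>i\<ge>n. v i = padic_zero)}"

definition vec_add :: "nat \<Rightarrow> nat \<Rightarrow> padic_vec \<Rightarrow> padic_vec \<Rightarrow> padic_vec" where
  "vec_add p n u v = (\<lambda>i k. if i < n then (u i k + v i k) mod int p ^ k else 0)"

definition mat_vec :: "nat \<Rightarrow> nat \<Rightarrow> padic_mat \<Rightarrow> padic_vec \<Rightarrow> padic_vec" where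
  "mat_vec p n A v = (\<lambda>i k. if i < n then (\<Sum>l<n. A i l k * v l k) mod int p ^ k else 0)"

definition mat_id :: "nat \<Rightarrow> nat \<Rightarrow> padic_mat" where
  "mat_id p n = (\<lambda>i j k. if i < n \<and> j < n \<and> i = j then 1 mod int p ^ k else 0)"

definition mat_mul :: "nat \<Rightarrow> nat \<Rightarrow> padic_mat \<Rightarrow> padic_mat \<Rightarrow> padic_mat" where
  "mat_mul p n A B = (\<lambda>i j k. if i < n \<and> j < n then (\<Sum>l<n. A i l k * B l j k) mod int p ^ k else 0)"

fun mat_pow :: "nat \<Rightarrow> nat \<Rightarrow> padic_mat \<Rightarrow> nat \<Rightarrow> padic_mat" where
  "mat_pow p n X 0 = mat_id p n"
| "mat_pow p n X (Suc m) = mat_mul p n (mat_pow p n X m) X"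

definition mat_poly_eval :: "nat \<Rightarrow> nat \<Rightarrow> (nat \<Rightarrow> nat \<Rightarrow> int) \<Rightarrow> nat \<Rightarrow> padic_mat \<Rightarrow> padic_mat" where
  "mat_poly_eval p n c d X =
     (\<lambda>i j k. if i < n \<and> j < n then (\<Sum>m\<le>d. c m k * mat_pow p n X m i j k) mod int p ^ k else 0)"

definition mat_of_digits :: "nat \<Rightarrow> nat \<Rightarrow> ((nat \<times> nat) \<times> nat \<Rightarrow> nat) \<Rightarrow> padic_mat" where
  "mat_of_digits p n d = (\<lambda>i j. if i < n \<and> j < n then padic_of_digits p (\<lambda>m. d ((i, j), m)) else padic_zero)"

text \<open>Haar measure on Z_p^{n*n} is the image of the product of uniform measures on the
  base-p digits {0..<p} of all n*n entries.\<close>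
definition digit_space :: "nat \<Rightarrow> nat \<Rightarrow> ((nat \<times> nat) \<times> nat \<Rightarrow> nat) measure" where
  "digit_space p n = PiM (({..<n} \<times> {..<n}) \<times> UNIV) (\<lambda>_. measure_pmf (pmf_of_set {0..<p}))"

definition haar_prob :: "nat \<Rightarrow> nat \<Rightarrow> (padic_mat \<Rightarrow> bool) \<Rightarrow> real" where
  "haar_prob p n E = measure (digit_space p n) {d \<in> space (digit_space p n). E (mat_of_digits p n d)}"

text \<open>Scalar action of c in Z_p on an element of a finite abelian p-group G (written
  multiplicatively in HOL-Algebra): c acts through its residue modulo p^|G|, which kills G.\<close>
definition padic_smul :: "('a, 'b) monoid_scheme \<Rightarrow> nat \<Rightarrow> (nat \<Rightarrow> int) \<Rightarrow> 'a \<Rightarrow> 'a" where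
  "padic_smul G p c g = g [^]\<^bsub>G\<^esub> nat (c (card (carrier G)))"

text \<open>(G, T) is a finite module over Z_p[t]/(P(t)), P = sum_{m \<le> d} c m t^m, with t acting by T.\<close>
definition finite_quot_module :: "nat \<Rightarrow> (nat \<Rightarrow> nat \<Rightarrow> int) \<Rightarrow> nat \<Rightarrow> ('a, 'b) monoid_scheme \<Rightarrow> ('a \<Rightarrow> 'a) \<Rightarrow> bool" where
  "finite_quot_module p c d G T \<longleftrightarrow>
     comm_group G \<and> finite (carrier G) \<and> (\<exists>e. card (carrier G) = p ^ e) \<and>
     T \<in> hom G G \<and>
     (\<forall>g \<in> carrier G. finprod G (\<lambda>m. padic_smul G p (c m) ((T ^^ m) g)) {..d} = \<one>\<^bsub>G\<^esub>)"

text \<open>Aut_R(G): R-linear automorphisms, i.e. group automorphisms commuting with t,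
  as functions on the carrier.\<close>
definition mod_auts :: "('a, 'b) monoid_scheme \<Rightarrow> ('a \<Rightarrow> 'a) \<Rightarrow> ('a \<Rightarrow> 'a) set" where
  "mod_auts G T = {\<phi>. \<phi> \<in> iso G G \<and> \<phi> \<in> extensional (carrier G) \<and> (\<forall>g \<in> carrier G. \<phi> (T g) = T (\<phi> g))}"

text \<open>cok(Y) = Z_p^n / Y Z_p^n, with t acting via X, is isomorphic to (G, T):
  there is an additive surjection Z_p^n \<rightarrow> G with kernel exactly Y Z_p^n that
  intertwines X with T (equivalently an isomorphism of the quotient onto G).\<close>
definition cok_iso :: "nat \<Rightarrow> nat \<Rightarrow> padic_mat \<Rightarrow> padic_mat \<Rightarrow> ('a, 'b) monoid_scheme \<Rightarrow> ('a \<Rightarrow> 'a) \<Rightarrow> bool" where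
  "cok_iso p n Y X G T \<longleftrightarrow>
     (\<exists>\<phi>. \<phi> ` padic_vecs p n = carrier G \<and>
          (\<forall>u \<in> padic_vecs p n. \<forall>v \<in> padic_vecs p n. \<phi> (vec_add p n u v) = \<phi> u \<otimes>\<^bsub>G\<^esub> \<phi> v) \<and>
          (\<forall>v \<in> padic_vecs p n. \<phi> v = \<one>\<^bsub>G\<^esub> \<longleftrightarrow> (\<exists>w \<in> padic_vecs p n. v = mat_vec p n Y w)) \<and>
          (\<forall>v \<in> padic_vecs p n. \<phi> (mat_vec p n X v) = T (\<phi> v)))"

definition poly_mod_p :: "(nat \<Rightarrow> nat \<Rightarrow> int) \<Rightarrow> nat \<Rightarrow> int poly" where
  "poly_mod_p c d = Poly (map (\<lambda>m. c m 1) [0..<Suc d])"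

end

theory Submission
  imports Defs "HOL-Library.Function_Algebras"
begin

text \<open>Everything is decided modulo \<open>p ^ N\<close> with \<open>N\<close> one more than an exponent killing all \<open>G j\<close>,
  so the probability is a proportion of integer matrices. Isomorphisms of \<open>cok (P j (X))\<close> with \<open>G j\<close>
  form a torsor under \<open>Aut (G j)\<close>; hence one counts pairs of \<open>X\<close> and a tuple of surjections
  \<open>F j\<close> from \<open>Z ^ n\<close> to \<open>G j\<close> with \<open>F j X = T j F j\<close> whose kernel is the image of \<open>P j (X)\<close>.
  Fix \<open>F\<close> with joint kernel \<open>K\<close>. The kernel condition says that
  \<open>U j = {v. P j (X) v \<in> p K}\<close> vanishes modulo \<open>p\<close>. Each \<open>U j\<close> is a vector space over the field with
  \<open>q = p ^ deg (P j)\<close> elements, and the expected number of independent \<open>i\<close>-tuples in it is computed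
  up to an error \<open>O(p ^ - n)\<close>, since an intertwining \<open>X\<close> can be prescribed freely modulo \<open>p K\<close> on
  independent vectors. The indicator of dimension \<open>0\<close> is a combination of these counts with the
  coefficients of Euler's expansion of \<open>\<Prod>i. 1 - q ^ - i\<close>, which yields the limit.\<close>

text \<open>The condition \<open>P j (X) v \<in> p K\<close> is not linear in \<open>X\<close> once
  the degree is 2. Recording the whole orbit of \<open>v\<close> modulo \<open>p K\<close> removes
  this obstacle: a chain of \<open>degree (P j)\<close> vectors, each with a prescribed image under
  \<open>X\<close>, encodes the same condition, and every independent chain compatible modulo
  \<open>K\<close> is realised by equally many \<open>X\<close>. The exact image condition reduces
  to one modulo \<open>p\<close> by Nakayama's argument: it suffices to reach \<open>K j\<close>
  modulo \<open>p K j\<close>, and \<open>p K j\<close> contains \<open>p ^ N Z ^ n\<close>. As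
  \<open>Z ^ n / p\<close> and \<open>K j / p K j\<close> both have \<open>p ^ n\<close> elements,
  surjectivity may be traded for injectivity. Coprimality of the \<open>P j\<close> modulo
  \<open>p\<close> allows the joint kernel \<open>K\<close> in place of each \<open>K j\<close>, so
  that one coset of matrices serves all \<open>j\<close>. The errors stay summable: for one
  polynomial, the moment of order \<open>i\<close> is off by at most a constant times
  \<open>q ^ i / p ^ n\<close>, while the coefficients decay like
  \<open>q ^ (- i (i + 1) / 2)\<close>. Tuples \<open>F\<close> that are not jointly surjective
  contribute nothing, and their share is \<open>O(2 ^ - n)\<close>.\<close>

section \<open>Integer vectors and lattices of finite index\<close>

definition zvecs :: "nat \<Rightarrow> (nat \<Rightarrow> int) set" where
  "zvecs n = {v. \<forall>i\<ge>n. v i = 0}"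

definition zscale :: "int \<Rightarrow> (nat \<Rightarrow> int) \<Rightarrow> nat \<Rightarrow> int" (infixr \<open>*z\<close> 75) where
  "a *z v = (\<lambda>i. a * v i)"

definition zbox :: "nat \<Rightarrow> int \<Rightarrow> (nat \<Rightarrow> int) set" where
  "zbox n M = {v \<in> zvecs n. \<forall>i<n. 0 \<le> v i \<and> v i < M}"

definition zred :: "int \<Rightarrow> (nat \<Rightarrow> int) \<Rightarrow> nat \<Rightarrow> int" where
  "zred M v = (\<lambda>i. v i mod M)"

text \<open>A matrix is the sequence of its columns.\<close>
definition lin :: "nat \<Rightarrow> (nat \<Rightarrow> nat \<Rightarrow> int) \<Rightarrow> (nat \<Rightarrow> int) \<Rightarrow> nat \<Rightarrow> int" where
  "lin n X v = (\<lambda>i. \<Sum>l<n. v l * X l i)"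

text \<open>Containing all multiples of \<open>M\<close> makes membership a condition on residues,
  so \<open>S \<inter> zbox n M\<close> represents \<open>S / M Z ^ n\<close>. Indices of lattices
  thus become ratios of finite cardinalities, and no quotient group has to be formed.\<close>

definition zlattice :: "nat \<Rightarrow> int \<Rightarrow> (nat \<Rightarrow> int) set \<Rightarrow> bool" where
  "zlattice n M S \<longleftrightarrow> S \<subseteq> zvecs n \<and> 0 \<in> S \<and> (\<forall>u\<in>S. \<forall>v\<in>S. u + v \<in> S) \<and> (\<forall>u\<in>S. - u \<in> S)
     \<and> (\<forall>v\<in>zvecs n. M *z v \<in> S)"

lemma zscale_apply: "(a *z v) i = a * v i"
  by (simp add: zscale_def)

lemmas pointwise = zscale_apply plus_fun_apply zero_fun_apply minus_apply uminus_apply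

(* The induction methods leave eta-expanded function terms, which these rules would unfold. *)
declare pointwise [simp del]

lemma zscale_simps [simp]:
  "0 *z v = 0" "1 *z v = v" "a *z (0 :: nat \<Rightarrow> int) = 0" "- 1 *z v = - v"
  by (auto simp: fun_eq_iff pointwise)

lemma zscale_add: "a *z (u + v) = a *z u + a *z v"
  by (auto simp: fun_eq_iff pointwise algebra_simps)

lemma zscale_diff: "a *z (u - v) = a *z u - a *z v"
  by (auto simp: fun_eq_iff pointwise algebra_simps)

lemma zscale_minus: "a *z (- v) = - (a *z v)"
  by (auto simp: fun_eq_iff pointwise)

lemma zscale_add_left: "(a + b) *z v = a *z v + b *z v"
  by (auto simp: fun_eq_iff pointwise algebra_simps)

lemma zscale_diff_left: "(a - b) *z v = a *z v - b *z v"
  by (auto simp: fun_eq_iff pointwise algebra_simps)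

lemma zscale_zscale: "a *z b *z v = (a * b) *z v"
  by (auto simp: fun_eq_iff pointwise)

lemma sum_fun_apply: "(\<Sum>i\<in>A. f i) x = (\<Sum>i\<in>A. f i x)"
  by (induction A rule: infinite_finite_induct) (auto simp: pointwise)

lemma zscale_sum: "a *z (\<Sum>i\<in>A. f i) = (\<Sum>i\<in>A. a *z f i)"
  by (auto simp: fun_eq_iff pointwise sum_fun_apply sum_distrib_left)

lemma zvecs_closed [simp, intro]:
  "0 \<in> zvecs n"
  "u \<in> zvecs n \<Longrightarrow> v \<in> zvecs n \<Longrightarrow> u + v \<in> zvecs n"
  "u \<in> zvecs n \<Longrightarrow> v \<in> zvecs n \<Longrightarrow> u - v \<in> zvecs n"
  "u \<in> zvecs n \<Longrightarrow> - u \<in> zvecs n"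
  "u \<in> zvecs n \<Longrightarrow> a *z u \<in> zvecs n"
  "u \<in> zvecs n \<Longrightarrow> zred M u \<in> zvecs n"
  by (auto simp: zvecs_def pointwise zred_def)

lemma zvecs_sum [simp, intro]: "(\<And>i. i \<in> A \<Longrightarrow> f i \<in> zvecs n) \<Longrightarrow> (\<Sum>i\<in>A. f i) \<in> zvecs n"
  by (auto simp: zvecs_def pointwise sum_fun_apply)

lemma zbox_zvecs: "v \<in> zbox n M \<Longrightarrow> v \<in> zvecs n"
  by (simp add: zbox_def)

lemma zred_in_zbox: "M > 0 \<Longrightarrow> v \<in> zvecs n \<Longrightarrow> zred M v \<in> zbox n M"
  by (auto simp: zbox_def zred_def zvecs_def pointwise)

lemma zred_zbox: "v \<in> zbox n M \<Longrightarrow> zred M v = v"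
  by (auto simp: zbox_def zred_def zvecs_def fun_eq_iff pointwise) (metis mod_0 mod_pos_pos_trivial not_le)

lemma zred_diff_obtain:
  assumes "v \<in> zvecs n" obtains u where "u \<in> zvecs n" "zred M v = v - M *z u"
proof
  show "(\<lambda>i. v i div M) \<in> zvecs n" using assms by (auto simp: zvecs_def pointwise)
  show "zred M v = v - M *z (\<lambda>i. v i div M)"
    by (auto simp: zred_def fun_eq_iff pointwise minus_mult_div_eq_mod)
qed

lemma card_zbox: assumes "M > 0" shows "card (zbox n M) = nat M ^ n" "finite (zbox n M)"
proof -
  have bij: "bij_betw (\<lambda>v. restrict v {..<n}) (zbox n M) (PiE {..<n} (\<lambda>_. {0..<M}))"
    by (rule bij_betw_byWitness[where f' = "\<lambda>f i. if i < n then f i else 0"])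
      (auto simp: zbox_def zvecs_def fun_eq_iff pointwise PiE_def extensional_def Pi_def)
  then show "card (zbox n M) = nat M ^ n"
    by (auto simp: bij_betw_same_card[OF bij] card_PiE)
  show "finite (zbox n M)" using bij_betw_finite[OF bij] by (simp add: finite_PiE)
qed

lemma zlattice_sub: "zlattice n M S \<Longrightarrow> S \<subseteq> zvecs n"
  and zlattice_zvecs: "zlattice n M S \<Longrightarrow> v \<in> S \<Longrightarrow> v \<in> zvecs n"
  and zlattice_0: "zlattice n M S \<Longrightarrow> 0 \<in> S"
  and zlattice_add: "zlattice n M S \<Longrightarrow> u \<in> S \<Longrightarrow> v \<in> S \<Longrightarrow> u + v \<in> S"
  and zlattice_minus: "zlattice n M S \<Longrightarrow> u \<in> S \<Longrightarrow> - u \<in> S"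
  and zlattice_modulus: "zlattice n M S \<Longrightarrow> v \<in> zvecs n \<Longrightarrow> M *z v \<in> S"
  by (auto simp: zlattice_def)

lemma zlattice_diff: "zlattice n M S \<Longrightarrow> u \<in> S \<Longrightarrow> v \<in> S \<Longrightarrow> u - v \<in> S"
  using zlattice_add[of n M S u "- v"] zlattice_minus[of n M S v] by simp

lemma zlattice_scale: assumes "zlattice n M S" "v \<in> S" shows "a *z v \<in> S"
proof -
  have *: "int k *z v \<in> S" for k
    by (induction k) (use assms in \<open>simp_all add: zscale_add_left zlattice_0 zlattice_add\<close>)
  show ?thesis
  proof (cases "a \<ge> 0")
    case True then show ?thesis using *[of "nat a"] by simp
  next
    case False
    have "a *z v = - (int (nat (- a)) *z v)" using False by (auto simp: fun_eq_iff pointwise)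
    then show ?thesis using *[of "nat (- a)"] assms zlattice_minus by metis
  qed
qed

lemma zlattice_sum: "zlattice n M S \<Longrightarrow> (\<And>i. i \<in> A \<Longrightarrow> f i \<in> S) \<Longrightarrow> (\<Sum>i\<in>A. f i) \<in> S"
  by (induction A rule: infinite_finite_induct) (auto intro: zlattice_add zlattice_0)

lemma zlattice_cong: "zlattice n M S \<Longrightarrow> u - v \<in> S \<Longrightarrow> u \<in> S \<longleftrightarrow> v \<in> S"
  using zlattice_add[of n M S "u - v" v] zlattice_diff[of n M S u "u - v"] by auto

lemma zlattice_mult_modulus: "zlattice n M S \<Longrightarrow> zlattice n (a * M) S"
  using zlattice_scale[of n M S _ a] by (auto simp: zlattice_def simp flip: zscale_zscale)

lemma zlattice_zred_diff: assumes "zlattice n M S" "v \<in> zvecs n" shows "zred M v - v \<in> S"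
proof -
  obtain u where u: "u \<in> zvecs n" "zred M v = v - M *z u" using assms zred_diff_obtain by blast
  have "zred M v - v = - (M *z u)" using u by simp
  then show ?thesis using zlattice_minus[OF assms(1) zlattice_modulus[OF assms(1) u(1)]] by metis
qed

lemma zlattice_zred_iff: "zlattice n M S \<Longrightarrow> v \<in> zvecs n \<Longrightarrow> zred M v \<in> S \<longleftrightarrow> v \<in> S"
  using zlattice_cong zlattice_zred_diff by blast

lemma zlattice_UNIV: "zlattice n M (zvecs n)"
  by (auto simp: zlattice_def)

lemma finite_zlattice_zbox: "M > 0 \<Longrightarrow> finite (S \<inter> zbox n M)"
  using card_zbox by blast

lemma zlattice_zbox_pos: "zlattice n M S \<Longrightarrow> M > 0 \<Longrightarrow> card (S \<inter> zbox n M) > 0"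
  using zlattice_0[of n M S] finite_zlattice_zbox[of M S n]
  by (auto simp: card_gt_0_iff zbox_def zvecs_def pointwise)

lemma zred_add_eqD:
  assumes "u \<in> zbox n M" "v \<in> zbox n M" "zred M (u + z) = zred M (v + z)" shows "u = v"
proof -
  have "u i mod M = v i mod M" for i
    using fun_cong[OF assms(3), of i] mod_diff_cong[of "u i + z i" M "v i + z i" "z i" "z i"]
    by (simp add: zred_def pointwise)
  then have "zred M u = zred M v" by (simp add: zred_def)
  then show ?thesis using assms zred_zbox by metis
qed

text \<open>Translation by the difference of two centres, followed by reduction modulo
  \<open>M\<close>, injects one coset into the other; comparing with the centre \<open>0\<close> in
  both directions gives equality.\<close>

lemma card_zlattice_coset:
  assumes S: "zlattice n M S" and M: "M > 0" and z: "z \<in> zvecs n"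
  shows "card {v \<in> zbox n M. v - z \<in> S} = card (S \<inter> zbox n M)"
proof (rule antisym)
  have 1: "card {v \<in> zbox n M. v - z \<in> S} \<le> card {v \<in> zbox n M. v - z' \<in> S}"
    if z: "z \<in> zvecs n" and z': "z' \<in> zvecs n" for z z'
  proof (rule card_inj_on_le[where f = "\<lambda>v. zred M (v + (z' - z))"])
    show "inj_on (\<lambda>v. zred M (v + (z' - z))) {v \<in> zbox n M. v - z \<in> S}"
      by (auto simp: inj_on_def dest: zred_add_eqD)
    show "finite {v \<in> zbox n M. v - z' \<in> S}" using card_zbox(2)[OF M] by simp
    show "(\<lambda>v. zred M (v + (z' - z))) ` {v \<in> zbox n M. v - z \<in> S} \<subseteq> {v \<in> zbox n M. v - z' \<in> S}"
    proof safe
      fix v assume v: "v \<in> zbox n M" "v - z \<in> S"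
      have vz: "v + (z' - z) \<in> zvecs n" using v z z' by (auto dest: zbox_zvecs)
      show "zred M (v + (z' - z)) \<in> zbox n M" using M vz zred_in_zbox by blast
      have "zred M (v + (z' - z)) - (v + (z' - z)) + (v - z) \<in> S"
        using S v vz zlattice_zred_diff zlattice_add by blast
      then show "zred M (v + (z' - z)) - z' \<in> S" by (simp add: algebra_simps)
    qed
  qed
  have eq: "{v \<in> zbox n M. v - 0 \<in> S} = S \<inter> zbox n M" by auto
  show "card {v \<in> zbox n M. v - z \<in> S} \<le> card (S \<inter> zbox n M)" using 1[OF z, of 0] eq by simp
  show "card (S \<inter> zbox n M) \<le> card {v \<in> zbox n M. v - z \<in> S}" using 1[OF _ z, of 0] eq by simp
qed

lemma zlattice_scaled:
  assumes "zlattice n M S" shows "zlattice n (a * M) ((*z) a ` S)"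
proof -
  have S: "0 \<in> S" "S \<subseteq> zvecs n" using assms by (auto simp: zlattice_def)
  show ?thesis unfolding zlattice_def
  proof (intro conjI ballI)
    show "(*z) a ` S \<subseteq> zvecs n" using S by auto
    show "0 \<in> (*z) a ` S" using S by (metis image_eqI zscale_simps(3))
    fix u assume u: "u \<in> (*z) a ` S"
    show "- u \<in> (*z) a ` S" using u assms by (auto simp: zscale_minus[symmetric] intro: zlattice_minus)
    show "u + v \<in> (*z) a ` S" if "v \<in> (*z) a ` S" for v
      using u that assms by (auto simp: zscale_add[symmetric] intro: zlattice_add)
  next
    fix v assume "v \<in> zvecs n"
    then show "(a * M) *z v \<in> (*z) a ` S"
      using assms by (auto simp: zscale_zscale[symmetric] intro: zlattice_modulus)
  qed
qed

lemma zscale_cancel: "a \<noteq> 0 \<Longrightarrow> a *z u = a *z v \<longleftrightarrow> u = v"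
  by (auto simp: fun_eq_iff pointwise)

lemma zscale_mem_scaled: "a \<noteq> 0 \<Longrightarrow> a *z u \<in> (*z) a ` S \<longleftrightarrow> u \<in> S"
  by (auto simp: zscale_cancel)

lemma scaled_subset: "zlattice n M S \<Longrightarrow> (*z) a ` S \<subseteq> S"
  by (auto intro: zlattice_scale)

lemma div_less_iff_less_mult_int:
  fixes a M p :: int assumes M: "M > 0" shows "a div M < p \<longleftrightarrow> a < p * M"
proof -
  have a: "a = M * (a div M) + a mod M" "0 \<le> a mod M" "a mod M < M" using M by auto
  show ?thesis
  proof
    assume "a div M < p"
    then have "M * (a div M) \<le> M * (p - 1)" using M by simp
    then have "M * (a div M) + M \<le> p * M" by (simp add: algebra_simps)
    then show "a < p * M" using a by linarith
  next
    assume *: "a < p * M"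
    show "a div M < p"
    proof (rule ccontr)
      assume "\<not> a div M < p"
      then have "M * p \<le> M * (a div M)" using M by simp
      then have "p * M \<le> M * (a div M)" by (simp add: mult.commute)
      then show False using a * by linarith
    qed
  qed
qed

text \<open>This is the index \<open>[S : p S] = p ^ n\<close>, counted modulo \<open>p * M\<close>
  because \<open>p S\<close> contains \<open>p M Z ^ n\<close>. The points of \<open>p S\<close> in
  the large box are \<open>p\<close> times those of \<open>S\<close> in the small one, and division
  by \<open>M\<close> splits the large box into the small box times \<open>zbox n p\<close>.\<close>

lemma card_scaled:
  assumes S: "zlattice n M S" and M: "M > 0" and p: "p > 0"
  shows "card (S \<inter> zbox n (p * M)) = nat p ^ n * card ((*z) p ` S \<inter> zbox n (p * M))"
proof -
  have "(*z) p ` S \<inter> zbox n (p * M) = (*z) p ` (S \<inter> zbox n M)"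
    using p zlattice_sub[OF S] by (auto simp: zbox_def zvecs_def pointwise zero_le_mult_iff)
  moreover have "inj_on ((*z) p) (S \<inter> zbox n M)" using p by (auto simp: inj_on_def zscale_cancel)
  ultimately have 1: "card ((*z) p ` S \<inter> zbox n (p * M)) = card (S \<inter> zbox n M)"
    by (simp add: card_image)
  have A: "zred M (w + M *z u) = w" "(\<lambda>i. (w + M *z u) i div M) = u"
    if "w \<in> zbox n M" "u \<in> zbox n p" for w u
  proof -
    have "0 \<le> w i \<and> w i < M" for i using that M by (cases "i < n") (auto simp: zbox_def zvecs_def pointwise)
    then show "zred M (w + M *z u) = w" "(\<lambda>i. (w + M *z u) i div M) = u"
      using M by (auto simp: fun_eq_iff pointwise zred_def div_pos_pos_trivial)
  qed
  have B: "w + M *z u \<in> S \<inter> zbox n (p * M)" if w: "w \<in> S \<inter> zbox n M" and u: "u \<in> zbox n p" for w u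
  proof -
    have "w + M *z u \<in> S" using S w u zlattice_add zlattice_modulus zbox_zvecs by blast
    moreover have "w i + M * u i < p * M" if "i < n" for i
    proof -
      have "w i < M" "u i \<le> p - 1" using w u that by (auto simp: zbox_def)
      then have "w i + M * u i < M + M * (p - 1)" using M by (intro add_less_le_mono mult_left_mono) auto
      then show ?thesis by (simp add: algebra_simps)
    qed
    ultimately show ?thesis using w u M by (auto simp: zbox_def zvecs_def pointwise)
  qed
  have C: "zred M v + M *z (\<lambda>i. v i div M) = v" for v by (auto simp: zred_def fun_eq_iff pointwise)
  have D: "zred M v \<in> S \<inter> zbox n M" "(\<lambda>i. v i div M) \<in> zbox n p"
    if v: "v \<in> S \<inter> zbox n (p * M)" for v
  proof -
    show "zred M v \<in> S \<inter> zbox n M" using v M S zbox_zvecs zlattice_zred_iff zred_in_zbox by blast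
    have "v i div M < p" "0 \<le> v i div M" if "i < n" for i
      using v that M by (auto simp: zbox_def pos_imp_zdiv_nonneg_iff div_less_iff_less_mult_int)
    then show "(\<lambda>i. v i div M) \<in> zbox n p" using v by (auto simp: zbox_def zvecs_def pointwise)
  qed
  have "bij_betw (\<lambda>(w, u). w + M *z u) ((S \<inter> zbox n M) \<times> zbox n p) (S \<inter> zbox n (p * M))"
    by (rule bij_betw_byWitness[where f' = "\<lambda>v. (zred M v, \<lambda>i. v i div M)"])
      (use A B C D in \<open>simp_all add: split_beta image_subset_iff\<close>)
  then have "card (S \<inter> zbox n (p * M)) = card ((S \<inter> zbox n M) \<times> zbox n p)"
    by (metis bij_betw_same_card)
  then show ?thesis using 1 p by (simp add: card_cartesian_product card_zbox)
qed

section \<open>Polynomials in a matrix acting on integer vectors\<close>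

lemma lin_add: "lin n X (u + v) = lin n X u + lin n X v"
  by (auto simp: lin_def fun_eq_iff pointwise algebra_simps sum.distrib)

lemma lin_diff: "lin n X (u - v) = lin n X u - lin n X v"
  by (auto simp: lin_def fun_eq_iff pointwise algebra_simps sum_subtractf)

lemma lin_0 [simp]: "lin n X 0 = 0"
  by (auto simp: lin_def fun_eq_iff pointwise)

lemma lin_zscale: "lin n X (a *z v) = a *z lin n X v"
  by (auto simp: lin_def fun_eq_iff pointwise sum_distrib_left mult.assoc)

lemma lin_sum: "lin n X (\<Sum>i\<in>A. f i) = (\<Sum>i\<in>A. lin n X (f i))"
  by (induction A rule: infinite_finite_induct) (simp_all add: lin_add)

lemma lin_zvecs: "(\<And>l. l < n \<Longrightarrow> X l \<in> zvecs n) \<Longrightarrow> lin n X v \<in> zvecs n"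
  by (auto simp: lin_def zvecs_def)

text \<open>Horner's scheme on vectors: this is \<open>h(X) v\<close>, obtained without forming
  powers of a matrix, and \<open>pact_pCons\<close> makes it accessible to induction on
  \<open>h\<close>.\<close>

definition pact :: "nat \<Rightarrow> (nat \<Rightarrow> nat \<Rightarrow> int) \<Rightarrow> int poly \<Rightarrow> (nat \<Rightarrow> int) \<Rightarrow> nat \<Rightarrow> int" where
  "pact n X h v = fold_coeffs (\<lambda>a u. a *z v + lin n X u) h 0"

lemma pact_0 [simp]: "pact n X 0 v = 0"
  by (simp add: pact_def)

lemma pact_pCons: "pact n X (pCons a h) v = a *z v + lin n X (pact n X h v)"
proof (cases "a = 0 \<and> h = 0")
  case False
  then have "coeffs (pCons a h) = a # coeffs h" by (auto simp: cCons_def)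
  then show ?thesis by (simp add: pact_def fold_coeffs_def)
qed simp

lemma pact_1 [simp]: "pact n X 1 v = v"
  using pact_pCons[of n X 1 0 v] by (simp add: pCons_one)

lemma pact_const: "pact n X [:a:] v = a *z v"
  by (simp add: pact_pCons)

lemma pact_add: "pact n X (g + h) v = pact n X g v + pact n X h v"
  by (induction g h rule: poly_induct2) (simp_all add: pact_pCons zscale_add_left lin_add algebra_simps)

lemma pact_smult: "pact n X (smult a h) v = a *z pact n X h v"
  by (induction h) (simp_all add: pact_pCons zscale_add zscale_zscale lin_zscale)

lemma pact_vec_add: "pact n X h (u + v) = pact n X h u + pact n X h v"
  by (induction h) (simp_all add: pact_pCons zscale_add lin_add algebra_simps)

lemma pact_vec_zscale: "pact n X h (a *z v) = a *z pact n X h v"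
  by (induction h) (simp_all add: pact_pCons zscale_add zscale_zscale lin_zscale mult.commute)

lemma pact_vec_0 [simp]: "pact n X h 0 = 0"
  by (induction h) (simp_all add: pact_pCons)

lemma pact_vec_diff: "pact n X h (u - v) = pact n X h u - pact n X h v"
  using pact_vec_add[of n X h u "- 1 *z v"] pact_vec_zscale[of n X h "- 1" v] by simp

lemma pact_vec_sum: "pact n X h (\<Sum>i\<in>A. f i) = (\<Sum>i\<in>A. pact n X h (f i))"
  by (induction A rule: infinite_finite_induct) (simp_all add: pact_vec_add)

lemma pact_lin: "pact n X h (lin n X v) = lin n X (pact n X h v)"
  by (induction h) (simp_all add: pact_pCons lin_add lin_zscale)

lemma pact_mult: "pact n X (g * h) v = pact n X g (pact n X h v)"
  by (induction g) (simp_all add: pact_pCons pact_add pact_smult)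

lemma pact_sum: "pact n X (\<Sum>i\<in>A. f i) v = (\<Sum>i\<in>A. pact n X (f i) v)"
  by (induction A rule: infinite_finite_induct) (simp_all add: pact_add)

lemma pact_monom: "pact n X (monom a k) v = a *z (lin n X ^^ k) v"
  by (induction k) (simp_all add: pact_pCons monom_0 monom_Suc lin_zscale)

lemma pact_eq_sum:
  assumes "degree h \<le> d"
  shows "pact n X h v = (\<Sum>m\<le>d. coeff h m *z (lin n X ^^ m) v)"
proof -
  have "pact n X h v = pact n X (\<Sum>m\<le>d. monom (coeff h m) m) v"
    using poly_as_sum_of_monoms'[OF assms] by simp
  then show ?thesis by (simp add: pact_sum pact_monom)
qed

definition lin_stable :: "nat \<Rightarrow> (nat \<Rightarrow> nat \<Rightarrow> int) \<Rightarrow> (nat \<Rightarrow> int) set \<Rightarrow> bool" where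
  "lin_stable n X S \<longleftrightarrow> (\<forall>v\<in>S. lin n X v \<in> S)"

lemma pact_stable:
  assumes "zlattice n M S" "lin_stable n X S" "v \<in> S" shows "pact n X h v \<in> S"
proof (induction h)
  case 0 show ?case using zlattice_0[OF assms(1)] by simp
next
  case (pCons a h)
  have "lin n X (pact n X h v) \<in> S" using pCons assms(2) by (simp add: lin_stable_def)
  then show ?case using zlattice_add[OF assms(1) zlattice_scale[OF assms(1,3)]] by (simp add: pact_pCons)
qed

lemma funpow_stable: "lin_stable n X S \<Longrightarrow> v \<in> S \<Longrightarrow> (lin n X ^^ k) v \<in> S"
  by (induction k) (auto simp: lin_stable_def)

lemma lin_stable_zvecs: "(\<And>l. l < n \<Longrightarrow> X l \<in> zvecs n) \<Longrightarrow> lin_stable n X (zvecs n)"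
  by (simp add: lin_stable_def lin_zvecs)

lemma pact_zvecs: "(\<And>l. l < n \<Longrightarrow> X l \<in> zvecs n) \<Longrightarrow> v \<in> zvecs n \<Longrightarrow> pact n X h v \<in> zvecs n"
  using pact_stable[OF zlattice_UNIV lin_stable_zvecs] by blast

lemma lin_stable_scaled: "lin_stable n X S \<Longrightarrow> lin_stable n X ((*z) a ` S)"
  by (auto simp: lin_stable_def lin_zscale)

lemma pact_preimage_lattice:
  assumes S: "zlattice n M S" and st: "lin_stable n X S" and X: "\<And>l. l < n \<Longrightarrow> X l \<in> zvecs n"
  shows "zlattice n M {v \<in> zvecs n. pact n X h v \<in> S}"
  unfolding zlattice_def
proof (intro conjI ballI)
  show "0 \<in> {v \<in> zvecs n. pact n X h v \<in> S}" using zlattice_0[OF S] by simp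
  fix u assume u: "u \<in> {v \<in> zvecs n. pact n X h v \<in> S}"
  then show "- u \<in> {v \<in> zvecs n. pact n X h v \<in> S}"
    using pact_vec_diff[of n X h 0 u] zlattice_minus[OF S] by simp
  show "u + v \<in> {v \<in> zvecs n. pact n X h v \<in> S}" if "v \<in> {v \<in> zvecs n. pact n X h v \<in> S}" for v
    using u that zlattice_add[OF S] by (simp add: pact_vec_add)
next
  fix v assume v: "v \<in> zvecs n"
  have "M *z pact n X h v \<in> S" using zlattice_modulus[OF S] pact_zvecs[of n X v h] X v by blast
  then show "M *z v \<in> {v \<in> zvecs n. pact n X h v \<in> S}" using v by (simp add: pact_vec_zscale)
qed auto

section \<open>Ideals containing p and torsion by coprime polynomials\<close>

lemma Mp_eq_imp_diff:
  assumes "poly_mod.Mp m f = poly_mod.Mp m g" "m > 0"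
  shows "\<exists>h. f = g + smult m h"
proof -
  have "\<forall>i. coeff f i mod m = coeff g i mod m"
    using assms(1) poly_mod.Mp_coeff[of m f] poly_mod.Mp_coeff[of m g] by (metis poly_mod.M_def)
  then have *: "m dvd coeff (f - g) i" for i by (simp add: mod_eq_dvd_iff)
  have "f - g = smult m (map_poly (\<lambda>c. c div m) (f - g))"
    using * by (intro poly_eqI) (simp add: coeff_map_poly)
  then show ?thesis by (metis diff_add_cancel add.commute)
qed

lemma monic_division:
  fixes f g :: "int poly" assumes "lead_coeff f = 1"
  obtains k r where "g = f * k + r" "r = 0 \<or> degree r < degree f"
proof -
  obtain k r where kr: "pseudo_divmod g f = (k, r)" by fastforce
  have "f \<noteq> 0" using assms by auto
  from pseudo_divmod[OF this kr] assms show ?thesis using that by auto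
qed

text \<open>Such a set, when it is nonempty as here, is the preimage in \<open>Z[t]\<close> of an
  ideal of \<open>F_p[t]\<close>. Staying with integer polynomials lets annihilators of integer
  vectors be used directly.\<close>

definition poly_ideal :: "int \<Rightarrow> int poly set \<Rightarrow> bool" where
  "poly_ideal p I \<longleftrightarrow> (\<forall>f\<in>I. \<forall>g\<in>I. f + g \<in> I) \<and> (\<forall>f\<in>I. \<forall>h. h * f \<in> I) \<and> [:p:] \<in> I"

lemma poly_ideal_smult: assumes "poly_ideal p I" shows "smult p h \<in> I"
proof -
  have "h * [:p:] \<in> I" using assms unfolding poly_ideal_def by blast
  then show ?thesis by simp
qed

lemma poly_ideal_minus: assumes "poly_ideal p I" "f \<in> I" shows "- f \<in> I"
proof -
  have "- 1 * f \<in> I" using assms unfolding poly_ideal_def by blast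
  then show ?thesis by simp
qed

lemma poly_ideal_diff: assumes "poly_ideal p I" "f \<in> I" "g \<in> I" shows "f - g \<in> I"
proof -
  have "f + - g \<in> I" using assms poly_ideal_minus unfolding poly_ideal_def by blast
  then show ?thesis by simp
qed

lemma poly_ideal_cong:
  assumes "poly_ideal p I" "p > 0" "poly_mod.Mp p f = poly_mod.Mp p g" "g \<in> I"
  shows "f \<in> I"
  using Mp_eq_imp_diff[OF assms(3,2)] poly_ideal_smult[OF assms(1)] assms(1,4)
  unfolding poly_ideal_def by blast

text \<open>\<open>F_p[t]\<close> is principal: a monic member \<open>f\<close> of least degree
  divides every member modulo \<open>p\<close>. It divides the irreducible \<open>P\<close> in
  particular and is no unit, since \<open>1 \<notin> I\<close>; hence \<open>P\<close> is associated
  to \<open>f\<close> and also divides every member.\<close>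

lemma ideal_irreducible_dvd:
  fixes p :: nat
  assumes p: "prime p" and I: "poly_ideal (int p) I" and one: "1 \<notin> I"
    and P: "P \<in> I" "lead_coeff P = 1" "poly_mod.irreducible_m (int p) P" and h: "h \<in> I"
  shows "\<exists>k. poly_mod.Mp (int p) h = poly_mod.Mp (int p) (P * k)"
proof -
  interpret poly_mod "int p" .
  have p0: "int p > 0" using p prime_gt_0_nat by simp
  define D where "D = (LEAST e. \<exists>f\<in>I. lead_coeff f = 1 \<and> degree f = e)"
  have "\<exists>f\<in>I. lead_coeff f = 1 \<and> degree f = D"
    unfolding D_def by (rule LeastI[of _ "degree P"]) (use P in blast)
  then obtain f where f: "f \<in> I" "lead_coeff f = 1" "degree f = D" by blast
  have min: "D \<le> degree g" if "g \<in> I" "lead_coeff g = 1" for g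
    unfolding D_def by (rule Least_le) (use that in blast)
  have uminus: "- g \<in> I" if "g \<in> I" for g
    using I that poly_ideal_minus by blast
  have dvd: "\<exists>k. Mp g = Mp (f * k)" if g: "g \<in> I" for g
  proof -
    obtain k r where kr: "g = f * k + r" "r = 0 \<or> degree r < degree f" using monic_division[OF f(2)] by blast
    have "r = g + k * (- f)" using kr by simp
    then have rI: "r \<in> I" using I g f uminus unfolding poly_ideal_def by blast
    have "Mp r = 0"
    proof (rule ccontr)
      assume nz: "Mp r \<noteq> 0"
      define e where "e = degree (Mp r)"
      have MI: "Mp r \<in> I" by (rule poly_ideal_cong[OF I p0 _ rI]) simp
      have "lead_coeff (Mp r) \<noteq> 0" using nz by simp
      then have "\<not> int p dvd lead_coeff (Mp r)" 
        by (metis Mp_Mp Mp_coeff M_def dvd_imp_mod_0)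
      then have "coprime (lead_coeff (Mp r)) (int p)"
        using p prime_imp_coprime[of "int p" "lead_coeff (Mp r)"] by (simp add: ac_simps)
      then obtain s t where "s * lead_coeff (Mp r) + t * int p = 1"
        using bezout_int[of "lead_coeff (Mp r)" "int p"] by (auto simp: coprime_iff_gcd_eq_1)
      then have m: "lead_coeff (Mp r) * s = 1 + int p * (- t)" by (simp add: algebra_simps)
      define m where "m = - t"
      \<comment> \<open>The Bezout inverse \<open>s\<close> makes the leading coefficient 1 only
        modulo \<open>p\<close>. The added monomial, itself in the ideal, makes it exactly 1, so
        that minimality of \<open>D\<close> among monic members applies.\<close>
      define f' where "f' = smult s (Mp r) + smult (int p) (monom (- m) e)"
      have "[:s:] * Mp r \<in> I" using I MI unfolding poly_ideal_def by blast
      then have f'I: "f' \<in> I" unfolding f'_def using I poly_ideal_smult[OF I] unfolding poly_ideal_def by simp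
      have c: "coeff f' e = 1" using m by (simp add: f'_def e_def m_def mult.commute)
      have "degree f' \<le> e" unfolding f'_def
        by (intro degree_add_le order.trans[OF degree_smult_le] degree_monom_le) (simp add: e_def)
      then have "degree f' = e" using c by (simp add: antisym le_degree)
      then have "D \<le> e" using min[OF f'I] c by simp
      moreover have "e \<le> degree r" unfolding e_def by (rule degree_m_le_degree)
      moreover have "degree r < D" using kr f nz by auto
      ultimately show False by simp
    qed
    then have "Mp g = Mp (f * k)" using kr(1) by (metis add.right_neutral plus_Mp(2))
    then show ?thesis by blast
  qed
  \<comment> \<open>As \<open>f\<close> is not a unit modulo \<open>p\<close>, irreducibility makes
    the cofactor \<open>k\<close> one, so multiples of \<open>f\<close> are multiples of
    \<open>P\<close>.\<close>
  obtain k where k: "P =m f * k" using dvd[OF P(1)] by blast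
  then have "f dvdm 1 \<or> k dvdm 1" using P(3) unfolding irreducible_m_def by blast
  moreover have "\<not> f dvdm 1"
  proof
    assume "f dvdm 1"
    then obtain c where "1 =m f * c" unfolding dvdm_def by blast
    then have "1 \<in> I" using poly_ideal_cong[OF I p0, of 1 "f * c"] I f(1)
      unfolding poly_ideal_def by (metis mult.commute)
    then show False using one by simp
  qed
  ultimately obtain c where c: "1 =m k * c" unfolding dvdm_def by blast
  obtain k' where k': "h =m f * k'" using dvd[OF h] by blast
  have "Mp h = Mp (f * k' * 1)" using k' by simp
  also have "\<dots> = Mp (f * k' * (k * c))" using c by (metis mult_Mp(2))
  also have "\<dots> = Mp ((f * k) * (c * k'))" by (simp add: ac_simps)
  also have "\<dots> = Mp (P * (c * k'))" using k by (metis mult_Mp(1))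
  finally show ?thesis by blast
qed

text \<open>Modulo \<open>p\<close>, a member is a multiple of the monic \<open>P\<close>, and a
  nonzero multiple of \<open>P\<close> has degree at least \<open>degree P\<close>.\<close>

lemma ideal_irreducible_small:
  fixes p :: nat
  assumes p: "prime p" and I: "poly_ideal (int p) I" and one: "1 \<notin> I"
    and P: "P \<in> I" "lead_coeff P = 1" "poly_mod.irreducible_m (int p) P"
    and h: "h \<in> I" "degree h < degree P"
  shows "int p dvd coeff h i"
proof -
  interpret poly_mod "int p" .
  obtain k where k: "Mp h = Mp (P * k)" using ideal_irreducible_dvd[OF p I one P h(1)] by blast
  then have k: "Mp h = Mp (P * Mp k)" by simp
  have "Mp k = 0"
  proof (rule ccontr)
    assume nz: "Mp k \<noteq> 0"
    have "coeff (P * Mp k) (degree P + degree (Mp k)) = lead_coeff (Mp k)"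
      using P(2) by (simp add: coeff_mult_degree_sum)
    moreover have "coeff h (degree P + degree (Mp k)) = 0" using h(2) by (simp add: coeff_eq_0)
    ultimately have "lead_coeff (Mp k) mod int p = 0" using k by (metis Mp_coeff M_def mod_0)
    then have "lead_coeff (Mp k) = 0" by (metis Mp_Mp Mp_coeff M_def)
    then show False using nz by simp
  qed
  then have "Mp h = 0" using k by simp
  then have "coeff h i mod int p = 0" by (metis Mp_coeff M_def coeff_0)
  then show ?thesis by auto
qed

text \<open>In a proper ideal neither polynomial can have smaller degree than the other, by the
  preceding lemma. Their difference then loses the leading term, and the same lemma makes it vanish
  modulo \<open>p\<close>.\<close>

lemma ideal_two_irreducibles:
  fixes p :: nat
  assumes p: "prime p" and I: "poly_ideal (int p) I"
    and P: "P \<in> I" "lead_coeff P = 1" "poly_mod.irreducible_m (int p) P"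
    and Q: "Q \<in> I" "lead_coeff Q = 1" "poly_mod.irreducible_m (int p) Q"
    and ne: "poly_mod.Mp (int p) P \<noteq> poly_mod.Mp (int p) Q"
  shows "1 \<in> I"
proof (rule ccontr)
  assume one: "1 \<notin> I"
  interpret poly_mod "int p" .
  have p1: "\<not> int p dvd 1" using p by (simp add: prime_nat_iff)
  have "\<not> degree P < degree Q" using ideal_irreducible_small[OF p I one Q P(1), of "degree P"] P(2) p1 by auto
  moreover have "\<not> degree Q < degree P" using ideal_irreducible_small[OF p I one P Q(1), of "degree Q"] Q(2) p1 by auto
  ultimately have deg: "degree P = degree Q" by simp
  have "P - Q \<noteq> 0" using ne by auto
  then have "degree (P - Q) < degree P"
    using P(2) Q(2) deg degree_diff_le[of P "degree P" Q]
    by (metis coeff_diff diff_self leading_coeff_0_iff order_le_less order_refl)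
  moreover have "P - Q \<in> I"
    using I P(1) Q(1) poly_ideal_diff by blast
  ultimately have "int p dvd coeff (P - Q) i" for i using ideal_irreducible_small[OF p I one P] by blast
  then have "Mp P = Mp Q" by (intro poly_eqI) (simp add: Mp_coeff M_def mod_eq_dvd_iff)
  then show False using ne by simp
qed

text \<open>Annihilators modulo a stable lattice are the ideals to which the preceding lemmas are
  applied; \<open>p *z v \<in> S\<close> is what puts the constant \<open>p\<close> into
  them.\<close>

lemma torsion_ideal:
  assumes S: "zlattice n M S" and st: "lin_stable n X S" and v: "p *z v \<in> S"
  shows "poly_ideal p {h. pact n X h v \<in> S}"
  unfolding poly_ideal_def using zlattice_add[OF S] pact_stable[OF S st] v
  by (simp add: pact_add pact_mult pact_const)

text \<open>The annihilator of \<open>v\<close> modulo \<open>S\<close> contains a power of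
  \<open>p\<close> but perhaps not \<open>p\<close> itself. Hence \<open>v\<close> is replaced by
  the last multiple \<open>p ^ a v\<close> outside \<open>S\<close>, whose annihilator contains
  \<open>p\<close> and both polynomials, and therefore 1.\<close>

lemma coprime_torsion:
  fixes p :: nat
  assumes p: "prime p" and S: "zlattice n (int p ^ k) S" and st: "lin_stable n X S"
    and v: "v \<in> zvecs n"
    and P: "lead_coeff P = 1" "poly_mod.irreducible_m (int p) P" "pact n X P v \<in> S"
    and Q: "lead_coeff Q = 1" "poly_mod.irreducible_m (int p) Q" "pact n X Q v \<in> S"
    and ne: "poly_mod.Mp (int p) P \<noteq> poly_mod.Mp (int p) Q"
  shows "v \<in> S"
proof (rule ccontr)
  assume nv: "v \<notin> S"
  have ex: "int p ^ k *z v \<in> S" using zlattice_modulus[OF S v] .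
  define e where "e = (LEAST e. int p ^ e *z v \<in> S)"
  have e: "int p ^ e *z v \<in> S" unfolding e_def by (rule LeastI, rule ex)
  have "e \<noteq> 0" using e nv by (cases e) auto
  then obtain a where a: "e = Suc a" using not0_implies_Suc by blast
  have na: "int p ^ a *z v \<notin> S" using not_less_Least[of a "\<lambda>e. int p ^ e *z v \<in> S"] a e_def by auto
  let ?w = "int p ^ a *z v" let ?I = "{h. pact n X h ?w \<in> S}"
  have I: "poly_ideal (int p) ?I"
    by (rule torsion_ideal[OF S st]) (use e a in \<open>simp add: zscale_zscale\<close>)
  have "P \<in> ?I" "Q \<in> ?I" using P(3) Q(3) zlattice_scale[OF S] by (simp_all add: pact_vec_zscale)
  then have "1 \<in> ?I" using ideal_two_irreducibles[OF p I] P Q ne by blast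
  then show False using na by simp
qed

text \<open>One factor \<open>Q j\<close> is removed at a time; what it acts on is still killed by
  \<open>P\<close> modulo \<open>S\<close>, because polynomials in \<open>X\<close> commute.\<close>

lemma coprime_torsion_prod:
  fixes p :: nat
  assumes p: "prime p" and S: "zlattice n (int p ^ k) S" and st: "lin_stable n X S"
    and X: "\<And>l. l < n \<Longrightarrow> X l \<in> zvecs n" and v: "v \<in> zvecs n" and J: "finite J"
    and P: "lead_coeff P = 1" "poly_mod.irreducible_m (int p) P" "pact n X P v \<in> S"
    and Q: "\<And>j. j \<in> J \<Longrightarrow> lead_coeff (Q j) = 1 \<and> poly_mod.irreducible_m (int p) (Q j)
              \<and> poly_mod.Mp (int p) P \<noteq> poly_mod.Mp (int p) (Q j)"
    and prd: "pact n X (\<Prod>j\<in>J. Q j) v \<in> S"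
  shows "v \<in> S"
  using J Q prd
proof (induction J)
  case empty then show ?case by simp
next
  case (insert j J)
  let ?u = "pact n X (\<Prod>j\<in>J. Q j) v"
  have "pact n X (Q j) ?u \<in> S" using insert by (simp add: pact_mult)
  moreover have "pact n X P ?u \<in> S"
    using pact_stable[OF S st P(3), of "\<Prod>j\<in>J. Q j"] by (simp flip: pact_mult add: mult.commute)
  ultimately have "?u \<in> S"
    using coprime_torsion[OF p S st _ P(1,2), of ?u "Q j"] pact_zvecs[of n X v] X v insert.prems(1)[of j] by simp
  then show ?case using insert by simp
qed

text \<open>Components killed by coprime polynomials are independent. Applying \<open>P i\<close> to
  the relation removes \<open>u i\<close>, the induction hypothesis holds for the remaining
  \<open>P i (X) (u j)\<close>, and coprimality of \<open>P i\<close> and \<open>P j\<close> then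
  cancels \<open>P i\<close>.\<close>

lemma coprime_torsion_sum:
  fixes p :: nat
  assumes p: "prime p" and S: "zlattice n (int p ^ k) S" and st: "lin_stable n X S"
    and X: "\<And>l. l < n \<Longrightarrow> X l \<in> zvecs n" and J: "finite J"
    and P: "\<And>j. j \<in> J \<Longrightarrow> lead_coeff (P j) = 1 \<and> poly_mod.irreducible_m (int p) (P j)"
    and ne: "\<And>i j. i \<in> J \<Longrightarrow> j \<in> J \<Longrightarrow> i \<noteq> j \<Longrightarrow> poly_mod.Mp (int p) (P i) \<noteq> poly_mod.Mp (int p) (P j)"
    and u: "\<And>j. j \<in> J \<Longrightarrow> u j \<in> zvecs n \<and> pact n X (P j) (u j) \<in> S" and sm: "(\<Sum>j\<in>J. u j) \<in> S"
    and j: "j \<in> J"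
  shows "u j \<in> S"
  using J P ne u sm j
proof (induction J arbitrary: u j)
  case empty then show ?case by simp
next
  case (insert i J)
  have ui: "u i \<in> zvecs n" "pact n X (P i) (u i) \<in> S" using insert.prems by auto
  have "pact n X (P i) (u i) + (\<Sum>j\<in>J. pact n X (P i) (u j)) \<in> S"
    using pact_stable[OF S st insert.prems(4), of "P i"] insert.hyps
    by (simp add: pact_vec_add pact_vec_sum)
  then have "(\<Sum>j\<in>J. pact n X (P i) (u j)) \<in> S" using zlattice_diff[OF S _ ui(2)] by fastforce
  moreover have "pact n X (P i) (u j) \<in> zvecs n \<and> pact n X (P j) (pact n X (P i) (u j)) \<in> S" if "j \<in> J" for j
    using that insert.prems(3)[of j] pact_stable[OF S st, of "pact n X (P j) (u j)" "P i"]
    by (simp add: pact_zvecs[OF X] mult.commute flip: pact_mult)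
  ultimately have "pact n X (P i) (u j) \<in> S" if "j \<in> J" for j
    using insert.IH[of "\<lambda>j. pact n X (P i) (u j)"] insert.prems that by blast
  then have uj: "u j \<in> S" if "j \<in> J" for j
    using coprime_torsion[OF p S st, of "u j" "P i" "P j"] insert.prems(1,2,3) insert.hyps that
    by (metis insertCI)
  then have "(\<Sum>j\<in>J. u j) \<in> S" using zlattice_sum[OF S] by blast
  then have "u i \<in> S" using insert.prems(4) insert.hyps zlattice_diff[OF S] by fastforce
  then show ?case using uj insert.prems(5) by blast
qed

section \<open>Linear independence modulo p and dual functionals\<close>

text \<open>For vectors in \<open>zvecs n\<close> and prime \<open>p\<close> this is linear
  independence of the reductions over \<open>F_p\<close>, phrased with integer coefficients.\<close>

definition indep_mod :: "int \<Rightarrow> nat \<Rightarrow> 'b set \<Rightarrow> ('b \<Rightarrow> nat \<Rightarrow> int) \<Rightarrow> bool" where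
  "indep_mod p n J w \<longleftrightarrow> (\<forall>c. (\<Sum>b\<in>J. c b *z w b) \<in> (*z) p ` zvecs n \<longrightarrow> (\<forall>b\<in>J. p dvd c b))"

definition dot :: "nat \<Rightarrow> (nat \<Rightarrow> int) \<Rightarrow> (nat \<Rightarrow> int) \<Rightarrow> int" where
  "dot n f v = (\<Sum>i<n. f i * v i)"

lemma dot_diff: "dot n (f - g) v = dot n f v - dot n g v"
  by (simp add: dot_def pointwise left_diff_distrib sum_subtractf)

lemma dot_zscale: "dot n (a *z f) v = a * dot n f v"
  by (simp add: dot_def pointwise sum_distrib_left mult.assoc)

lemma mem_scaled_zvecs: "v \<in> (*z) p ` zvecs n \<longleftrightarrow> v \<in> zvecs n \<and> (\<forall>i. p dvd v i)"
proof
  assume R: "v \<in> zvecs n \<and> (\<forall>i. p dvd v i)"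
  then have "v = p *z (\<lambda>i. v i div p)" "(\<lambda>i. v i div p) \<in> zvecs n"
    by (auto simp: fun_eq_iff pointwise zvecs_def)
  then show "v \<in> (*z) p ` zvecs n" by blast
qed (auto simp: pointwise)

text \<open>Gram-Schmidt modulo \<open>p\<close>: independence makes the new vector, once cleared of
  its components along the old ones, nonzero modulo \<open>p\<close>, so that some coordinate
  detects it.\<close>

lemma dual_functionals:
  fixes w :: "'b \<Rightarrow> nat \<Rightarrow> int" and p :: nat
  assumes p: "prime p" and J: "finite J" and w: "\<And>b. b \<in> J \<Longrightarrow> w b \<in> zvecs n"
    and ind: "indep_mod (int p) n J w"
  shows "\<exists>f. \<forall>b\<in>J. \<forall>c\<in>J. int p dvd dot n (f b) (w c) - of_bool (b = c)"
  using J w ind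
proof (induction J)
  case empty show ?case by simp
next
  case (insert a J)
  have indJ: "indep_mod (int p) n J w" unfolding indep_mod_def
  proof (intro allI impI)
    fix c assume "(\<Sum>b\<in>J. c b *z w b) \<in> (*z) (int p) ` zvecs n"
    moreover define c0 where "c0 b = (if b = a then 0 else c b)" for b
    have "(\<Sum>b\<in>insert a J. c0 b *z w b) = (\<Sum>b\<in>J. c b *z w b)"
      using insert.hyps by (auto simp: c0_def intro!: sum.cong)
    ultimately have "\<forall>b\<in>insert a J. int p dvd c0 b"
      using insert.prems(2) unfolding indep_mod_def by simp
    then show "\<forall>b\<in>J. int p dvd c b" using insert.hyps by (auto simp: c0_def split: if_splits)
  qed
  then obtain f where f: "\<And>b c. b \<in> J \<Longrightarrow> c \<in> J \<Longrightarrow> int p dvd dot n (f b) (w c) - of_bool (b = c)"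
    using insert by (metis insertCI)
  \<comment> \<open>The component of \<open>w a\<close> not seen by the old functionals; were it
    zero modulo \<open>p\<close>, this would be a relation with coefficient 1 at
    \<open>a\<close>.\<close>
  define w' where "w' = w a - (\<Sum>b\<in>J. dot n (f b) (w a) *z w b)"
  have w'z: "w' \<in> zvecs n" unfolding w'_def using insert.prems(1) by auto
  have "w' \<notin> (*z) (int p) ` zvecs n"
  proof
    assume "w' \<in> (*z) (int p) ` zvecs n"
    moreover define c0 where "c0 b = (if b = a then 1 else - dot n (f b) (w a))" for b
    have "(\<Sum>b\<in>J. c0 b *z w b) = - (\<Sum>b\<in>J. dot n (f b) (w a) *z w b)"
      using insert.hyps
      by (auto simp: c0_def sum_negf[symmetric] fun_eq_iff pointwise sum_fun_apply intro!: sum.cong)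
    then have "w' = (\<Sum>b\<in>insert a J. c0 b *z w b)" using insert.hyps by (simp add: w'_def c0_def)
    ultimately have "(\<Sum>b\<in>insert a J. c0 b *z w b) \<in> (*z) (int p) ` zvecs n" by simp
    then have "\<forall>b\<in>insert a J. int p dvd c0 b" using insert.prems(2) unfolding indep_mod_def by blast
    then have "int p dvd 1" by (simp add: c0_def)
    then show False using p by (simp add: prime_nat_iff)
  qed
  then obtain i where i: "\<not> int p dvd w' i" using w'z mem_scaled_zvecs[of w' "int p" n] by auto
  have "w' k = 0" if "\<not> k < n" for k using w'z that by (simp add: zvecs_def)
  then have "i < n" using i by force
  obtain s where s: "int p dvd s * w' i - 1"
  proof -
    have "coprime (w' i) (int p)" using p i prime_imp_coprime[of "int p" "w' i"] by (simp add: ac_simps)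
    then obtain s t where "s * w' i + t * int p = 1"
      using bezout_int[of "w' i" "int p"] by (auto simp: coprime_iff_gcd_eq_1)
    then have "s * w' i - 1 = int p * (- t)" by (simp add: algebra_simps)
    then show ?thesis using that by (metis dvd_triv_left)
  qed
  \<comment> \<open>The coordinate \<open>i\<close>, corrected so as to vanish on the old vectors
    modulo \<open>p\<close> and scaled by the inverse \<open>s\<close> of \<open>w' i\<close> so as
    to take the value 1 on \<open>w a\<close>.\<close>
  define g where "g = s *z ((\<lambda>k. if k = i then 1 else 0) - (\<Sum>b\<in>J. w b i *z f b))"
  have dg: "dot n g v = s * (v i - (\<Sum>b\<in>J. w b i * dot n (f b) v))" for v
  proof -
    have "dot n g v = (\<Sum>k<n. s * ((if k = i then v k else 0) - (\<Sum>b\<in>J. w b i * (f b k * v k))))"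
      unfolding dot_def g_def by (intro sum.cong) (auto simp: pointwise sum_fun_apply algebra_simps sum_distrib_left sum_distrib_right)
    also have "\<dots> = s * ((\<Sum>k<n. if k = i then v k else 0) - (\<Sum>k<n. \<Sum>b\<in>J. w b i * (f b k * v k)))"
      by (simp only: sum_distrib_left[symmetric] sum_subtractf)
    also have "(\<Sum>k<n. \<Sum>b\<in>J. w b i * (f b k * v k)) = (\<Sum>b\<in>J. w b i * dot n (f b) v)"
      by (subst sum.swap) (simp add: dot_def sum_distrib_left)
    also have "(\<Sum>k<n. if k = i then v k else 0) = v i" using \<open>i < n\<close> by simp
    finally show ?thesis .
  qed
  have ga: "int p dvd dot n g (w a) - 1"
  proof -
    have "dot n g (w a) = s * w' i" unfolding dg by (simp add: w'_def pointwise sum_fun_apply mult.commute)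
    then show ?thesis using s by simp
  qed
  have gc: "int p dvd dot n g (w c)" if c: "c \<in> J" for c
  proof -
    have "w c i = (\<Sum>b\<in>J. w b i * of_bool (b = c))" using c insert.hyps by (simp add: if_distrib of_bool_def cong: if_cong)
    then have "dot n g (w c) = s * (\<Sum>b\<in>J. w b i * (of_bool (b = c) - dot n (f b) (w c)))"
      unfolding dg by (simp add: right_diff_distrib sum_subtractf)
    moreover have "int p dvd (of_bool (b = c) - dot n (f b) (w c))" if "b \<in> J" for b
      using f[OF that c] by (simp add: dvd_diff_commute)
    ultimately show ?thesis by (simp add: dvd_sum)
  qed
  \<comment> \<open>The old functionals are corrected by a multiple of \<open>g\<close> so as to
    vanish on \<open>w a\<close> as well; since \<open>g\<close> vanishes on the old vectors,
    nothing else changes modulo \<open>p\<close>.\<close>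
  define f' where "f' b = (if b = a then g else f b - dot n (f b) (w a) *z g)" for b
  have df': "dot n (f' b) v = (if b = a then dot n g v else dot n (f b) v - dot n (f b) (w a) * dot n g v)" for b v
    by (simp add: f'_def dot_diff dot_zscale)
  have "int p dvd dot n (f' b) (w c) - of_bool (b = c)" if bc: "b \<in> insert a J" "c \<in> insert a J" for b c
  proof (cases "b = a")
    case True then show ?thesis using bc ga gc insert.hyps by (auto simp: df')
  next
    case b: False
    show ?thesis
    proof (cases "c = a")
      case True
      have "dot n (f b) (w a) - dot n (f b) (w a) * dot n g (w a) = - (dot n (f b) (w a) * (dot n g (w a) - 1))"
        by (simp add: algebra_simps)
      then show ?thesis using b True ga by (simp add: df')
    next
      case False
      have "int p dvd (dot n (f b) (w c) - of_bool (b = c)) - dot n (f b) (w a) * dot n g (w c)"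
        using b False bc f[of b c] dvd_mult[OF gc[of c]] by (blast intro: dvd_diff)
      then show ?thesis using b by (simp add: df' algebra_simps)
    qed
  qed
  then show ?case by blast
qed

section \<open>Counting matrices with prescribed values\<close>

lemma card_double_count:
  assumes "finite A" "finite B"
  shows "(\<Sum>a\<in>A. card {b \<in> B. R a b}) = (\<Sum>b\<in>B. card {a \<in> A. R a b})"
proof -
  have "(\<Sum>a\<in>A. card {b \<in> B. R a b}) = (\<Sum>a\<in>A. \<Sum>b\<in>B. of_bool (R a b))"
    using assms by (simp add: of_bool_def sum.If_cases Int_def)
  also have "\<dots> = (\<Sum>b\<in>B. \<Sum>a\<in>A. of_bool (R a b))" by (rule sum.swap)
  also have "\<dots> = (\<Sum>b\<in>B. card {a \<in> A. R a b})"
    using assms by (simp add: of_bool_def sum.If_cases Int_def)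
  finally show ?thesis .
qed

lemma lin_eq_sum: "lin n X v = (\<Sum>l<n. v l *z X l)"
  by (auto simp: lin_def fun_eq_iff sum_fun_apply pointwise)

lemma lin_cong_lattice:
  assumes S: "zlattice n M S" and "\<And>l. l < n \<Longrightarrow> X l - Y l \<in> S"
  shows "lin n X v - lin n Y v \<in> S"
proof -
  have "lin n X v - lin n Y v = (\<Sum>l<n. v l *z (X l - Y l))"
    by (simp add: lin_eq_sum sum_subtractf zscale_diff)
  also have "\<dots> \<in> S" using assms(2) by (intro zlattice_sum[OF S] zlattice_scale[OF S]) simp
  finally show ?thesis .
qed

definition mats :: "nat \<Rightarrow> int \<Rightarrow> (nat \<Rightarrow> nat \<Rightarrow> int) set" where
  "mats n M = PiE {..<n} (\<lambda>_. zbox n M)"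

text \<open>For a fixed joint surjection with kernel \<open>K\<close>, the matrices intertwining it
  form exactly such a coset, with \<open>Y\<close> one of them.\<close>

definition mats_over :: "nat \<Rightarrow> int \<Rightarrow> (nat \<Rightarrow> int) set \<Rightarrow> (nat \<Rightarrow> nat \<Rightarrow> int) \<Rightarrow> (nat \<Rightarrow> nat \<Rightarrow> int) set" where
  "mats_over n M K Y = {X \<in> mats n M. \<forall>l<n. X l - Y l \<in> K}"

lemma finite_mats: "M > 0 \<Longrightarrow> finite (mats n M)"
  by (simp add: mats_def finite_PiE card_zbox)

lemma mats_zvecs: "X \<in> mats n M \<Longrightarrow> l < n \<Longrightarrow> X l \<in> zvecs n"
  unfolding mats_def by (metis PiE_mem lessThan_iff zbox_zvecs)

lemma card_mats_over:
  assumes K: "zlattice n M K" and M: "M > 0" and Y: "\<And>l. l < n \<Longrightarrow> Y l \<in> zvecs n"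
  shows "card (mats_over n M K Y) = card (K \<inter> zbox n M) ^ n"
proof -
  have "mats_over n M K Y = PiE {..<n} (\<lambda>l. {v \<in> zbox n M. v - Y l \<in> K})" (is "?L = ?R")
  proof (rule Set.set_eqI)
    fix X show "X \<in> ?L \<longleftrightarrow> X \<in> ?R" unfolding mats_over_def mats_def PiE_iff by blast
  qed
  then show ?thesis using card_zlattice_coset[OF K M Y] by (simp add: card_PiE)
qed

text \<open>As \<open>X\<close> runs through the coset, the residues of \<open>X (w b) - z b\<close>
  are equidistributed in \<open>(K / p K) ^ J\<close>, because columns built from dual functionals
  shift them at will. The statement is the resulting probability, cleared of denominators.\<close>

lemma card_prescribed_values:
  fixes p :: nat and w z :: "'b \<Rightarrow> nat \<Rightarrow> int"
  assumes p: "prime p" and M: "M > 0" and K: "zlattice n M K" and R: "zlattice n M ((*z) (int p) ` K)"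
    and Y: "\<And>l. l < n \<Longrightarrow> Y l \<in> zvecs n" and J: "finite J"
    and w: "\<And>b. b \<in> J \<Longrightarrow> w b \<in> zvecs n" and ind: "indep_mod (int p) n J w"
    and z: "\<And>b. b \<in> J \<Longrightarrow> z b \<in> zvecs n"
    and comp: "\<And>b. b \<in> J \<Longrightarrow> lin n Y (w b) - z b \<in> K"
  shows "card {X \<in> mats_over n M K Y. \<forall>b\<in>J. lin n X (w b) - z b \<in> (*z) (int p) ` K} * card (K \<inter> zbox n M) ^ card J
     = card (mats_over n M K Y) * card ((*z) (int p) ` K \<inter> zbox n M) ^ card J"
proof -
  let ?R = "(*z) (int p) ` K"
  let ?XX = "mats_over n M K Y"
  \<comment> \<open>The fibre over the residues \<open>k\<close>; the wanted set is the fibre over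
    \<open>0\<close>.\<close>
  define A where "A k = {X \<in> ?XX. \<forall>b\<in>J. lin n X (w b) - z b - k b \<in> ?R}" for k
  obtain f where f: "\<And>b c. b \<in> J \<Longrightarrow> c \<in> J \<Longrightarrow> int p dvd dot n (f b) (w c) - of_bool (b = c)"
    using dual_functionals[OF p J w ind] by blast
  have finXX: "finite ?XX" using finite_mats[OF M] by (simp add: mats_over_def)
  have le: "card (A k) \<le> card (A k')" if k: "\<And>b. b \<in> J \<Longrightarrow> k b \<in> K" and k': "\<And>b. b \<in> J \<Longrightarrow> k' b \<in> K" for k k'
  proof -
    \<comment> \<open>Column \<open>l\<close> of the matrix that adds
      \<open>\<Sum>b. f b (v) (k' b - k b)\<close> to the image of \<open>v\<close>. At
      \<open>v = w c\<close> the sum collapses modulo \<open>p K\<close> to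
      \<open>k' c - k c\<close>.\<close>
    define D where "D l = (\<Sum>b\<in>J. f b l *z (k' b - k b))" for l
    have e: "k' b - k b \<in> K" if "b \<in> J" for b using that k k' zlattice_diff[OF K] by blast
    have DK: "D l \<in> K" for l unfolding D_def by (intro zlattice_sum[OF K] zlattice_scale[OF K] e)
    define \<tau> where "\<tau> X = (\<lambda>l\<in>{..<n}. zred M (X l + D l))" for X :: "nat \<Rightarrow> nat \<Rightarrow> int"
    have Dz: "D l \<in> zvecs n" for l using DK zlattice_zvecs[OF K] by blast
    show ?thesis
    proof (rule card_inj_on_le[where f = \<tau>])
      show "finite (A k')" using finXX by (simp add: A_def)
      show "inj_on \<tau> (A k)"
      proof (rule inj_onI)
        fix X X' assume X: "X \<in> A k" "X' \<in> A k" "\<tau> X = \<tau> X'"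
        then have XX: "X \<in> mats n M" "X' \<in> mats n M" by (auto simp: A_def mats_over_def)
        have "X l = X' l" if "l < n" for l
          using fun_cong[OF X(3), of l] that XX zred_add_eqD[of "X l" n M "X' l" "D l"]
          by (auto simp: \<tau>_def mats_def)
        then show "X = X'" using XX unfolding mats_def by (metis PiE_ext lessThan_iff)
      qed
      show "\<tau> ` A k \<subseteq> A k'"
      proof safe
        fix X assume X: "X \<in> A k"
        then have Xm: "X \<in> mats n M" and Xl: "\<And>l. l < n \<Longrightarrow> X l - Y l \<in> K" by (auto simp: A_def mats_over_def)
        have XDz: "X l + D l \<in> zvecs n" if "l < n" for l using Dz mats_zvecs[OF Xm that] by blast
        have red: "\<tau> X l - (X l + D l) \<in> ?R" if "l < n" for l
          using zlattice_zred_diff[OF R XDz[OF that]] that by (simp add: \<tau>_def)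
        have "\<tau> X \<in> mats n M" using zred_in_zbox[OF M] XDz by (auto simp: \<tau>_def mats_def)
        moreover have "\<tau> X l - Y l \<in> K" if "l < n" for l
        proof -
          have "\<tau> X l - (X l + D l) \<in> K" using red[OF that] scaled_subset[OF K] by blast
          then have "(\<tau> X l - (X l + D l)) + (X l - Y l) + D l \<in> K"
            using Xl[OF that] DK zlattice_add[OF K] by blast
          then show ?thesis by (simp add: algebra_simps)
        qed
        ultimately have "\<tau> X \<in> ?XX" by (simp add: mats_over_def)
        moreover have "lin n (\<tau> X) (w c) - z c - k' c \<in> ?R" if c: "c \<in> J" for c
        proof -
          have 1: "lin n (\<tau> X) (w c) - lin n (\<lambda>l. X l + D l) (w c) \<in> ?R"
            by (rule lin_cong_lattice[OF R]) (rule red)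
          have "lin n (\<lambda>l. X l + D l) (w c) = lin n X (w c) + lin n D (w c)"
            by (simp add: lin_eq_sum zscale_add sum.distrib)
          moreover have "lin n D (w c) = (\<Sum>b\<in>J. dot n (f b) (w c) *z (k' b - k b))"
          proof -
            have "lin n D (w c) = (\<Sum>l<n. \<Sum>b\<in>J. (w c l * f b l) *z (k' b - k b))"
              by (simp add: lin_eq_sum D_def zscale_sum zscale_zscale)
            also have "\<dots> = (\<Sum>b\<in>J. \<Sum>l<n. (w c l * f b l) *z (k' b - k b))" by (rule sum.swap)
            also have "\<dots> = (\<Sum>b\<in>J. dot n (f b) (w c) *z (k' b - k b))"
              by (intro sum.cong refl) (auto simp: dot_def fun_eq_iff pointwise sum_fun_apply sum_distrib_left mult_ac)
            finally show ?thesis .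
          qed
          moreover have "(\<Sum>b\<in>J. dot n (f b) (w c) *z (k' b - k b)) - (k' c - k c)
             = (\<Sum>b\<in>J. (dot n (f b) (w c) - of_bool (b = c)) *z (k' b - k b))"
          proof -
            have "(\<Sum>b\<in>J. of_bool (b = c) *z (k' b - k b)) = (\<Sum>b\<in>J. if b = c then k' b - k b else 0)"
              by (intro sum.cong) auto
            also have "\<dots> = k' c - k c" using c J by simp
            finally show ?thesis by (simp add: zscale_diff_left sum_subtractf)
          qed
          moreover have "(\<Sum>b\<in>J. (dot n (f b) (w c) - of_bool (b = c)) *z (k' b - k b)) \<in> ?R"
          proof (rule zlattice_sum[OF R])
            fix b assume b: "b \<in> J"
            then obtain m where m: "dot n (f b) (w c) - of_bool (b = c) = int p * m" using f[OF b c] by blast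
            have "m *z (k' b - k b) \<in> K" using e[OF b] zlattice_scale[OF K] by blast
            then show "(dot n (f b) (w c) - of_bool (b = c)) *z (k' b - k b) \<in> ?R"
              unfolding m zscale_zscale[symmetric] by blast
          qed
          moreover have "lin n X (w c) - z c - k c \<in> ?R" using X c by (simp add: A_def)
          ultimately have "(lin n (\<tau> X) (w c) - (lin n X (w c) + lin n D (w c)))
              + (lin n D (w c) - (k' c - k c)) + (lin n X (w c) - z c - k c) \<in> ?R"
            using 1 zlattice_add[OF R] by metis
          then show ?thesis by (simp add: algebra_simps)
        qed
        ultimately show "\<tau> X \<in> A k'" by (simp add: A_def)
      qed
    qed
  qed
  have eq: "card (A k) = card (A (\<lambda>_. 0))" if "\<And>b. b \<in> J \<Longrightarrow> k b \<in> K" for k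
    using le[of k "\<lambda>_. 0"] le[of "\<lambda>_. 0" k] that zlattice_0[OF K] by (simp add: antisym)
  \<comment> \<open>All fibres being equally large, it remains to count pairs of a matrix and a
    tuple \<open>k\<close> in the box: each matrix lies over one residue class, which has
    \<open>card (p K \<inter> box) ^ card J\<close> representatives.\<close>
  let ?KK = "PiE J (\<lambda>_. K \<inter> zbox n M)"
  have finKK: "finite ?KK" using J finite_zlattice_zbox[OF M] by (simp add: finite_PiE)
  have "(\<Sum>k\<in>?KK. card {X \<in> ?XX. \<forall>b\<in>J. lin n X (w b) - z b - k b \<in> ?R})
      = (\<Sum>X\<in>?XX. card {k \<in> ?KK. \<forall>b\<in>J. lin n X (w b) - z b - k b \<in> ?R})"
    by (rule card_double_count[OF finKK finXX])
  moreover have "(\<Sum>k\<in>?KK. card {X \<in> ?XX. \<forall>b\<in>J. lin n X (w b) - z b - k b \<in> ?R})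
     = (\<Sum>k\<in>?KK. card (A (\<lambda>_. 0)))"
  proof (rule sum.cong[OF refl])
    fix k assume "k \<in> ?KK"
    then have "card (A k) = card (A (\<lambda>_. 0))" by (intro eq) auto
    then show "card {X \<in> ?XX. \<forall>b\<in>J. lin n X (w b) - z b - k b \<in> ?R} = card (A (\<lambda>_. 0))"
      by (simp add: A_def)
  qed
  moreover have "card {k \<in> ?KK. \<forall>b\<in>J. lin n X (w b) - z b - k b \<in> ?R} = card (?R \<inter> zbox n M) ^ card J"
    if X: "X \<in> ?XX" for X
  proof -
    have Xz: "X l \<in> zvecs n" if "l < n" for l using X that mats_zvecs by (auto simp: mats_over_def)
    have yK: "lin n X (w b) - z b \<in> K" if b: "b \<in> J" for b
    proof -
      have "(lin n X (w b) - lin n Y (w b)) + (lin n Y (w b) - z b) \<in> K"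
        using X comp[OF b] by (intro zlattice_add[OF K] lin_cong_lattice[OF K]) (auto simp: mats_over_def)
      then show ?thesis by (simp add: algebra_simps)
    qed
    have "{k \<in> ?KK. \<forall>b\<in>J. lin n X (w b) - z b - k b \<in> ?R}
        = PiE J (\<lambda>b. {u \<in> zbox n M. u - (lin n X (w b) - z b) \<in> ?R})" (is "?L = ?Q")
    proof (intro equalityI subsetI)
      fix k assume k: "k \<in> ?L"
      have "k b - (lin n X (w b) - z b) \<in> ?R" if "b \<in> J" for b
      proof -
        have "- (lin n X (w b) - z b - k b) \<in> ?R" using k that zlattice_minus[OF R] by blast
        then show ?thesis by (simp add: algebra_simps)
      qed
      then show "k \<in> ?Q" using k by (auto simp: PiE_def Pi_def)
    next
      fix k assume k: "k \<in> ?Q"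
      have 1: "lin n X (w b) - z b - k b \<in> ?R" "k b \<in> K" if b: "b \<in> J" for b
      proof -
        have *: "k b - (lin n X (w b) - z b) \<in> ?R" using k b by (auto simp: PiE_def Pi_def)
        from zlattice_minus[OF R *] show "lin n X (w b) - z b - k b \<in> ?R" by (simp add: algebra_simps)
        show "k b \<in> K" using zlattice_cong[OF K] * yK[OF b] scaled_subset[OF K] by blast
      qed
      then show "k \<in> ?L" using k by (auto simp: PiE_def Pi_def)
    qed
    moreover have "card {u \<in> zbox n M. u - (lin n X (w b) - z b) \<in> ?R} = card (?R \<inter> zbox n M)" if "b \<in> J" for b
      by (rule card_zlattice_coset[OF R M]) (use yK[OF that] zlattice_zvecs[OF K] in blast)
    ultimately show ?thesis using J by (simp add: card_PiE)
  qed
  ultimately have "card ?KK * card (A (\<lambda>_. 0)) = card ?XX * card (?R \<inter> zbox n M) ^ card J" by simp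
  moreover have "card ?KK = card (K \<inter> zbox n M) ^ card J" using J by (simp add: card_PiE)
  moreover have "A (\<lambda>_. 0) = {X \<in> ?XX. \<forall>b\<in>J. lin n X (w b) - z b \<in> ?R}" by (simp add: A_def)
  ultimately show ?thesis by (simp add: mult.commute)
qed

section \<open>Chains: the polynomial condition made linear in the matrix\<close>

lemma card_group:
  assumes "finite S" "finite T" "g ` S \<subseteq> T"
  shows "card S = (\<Sum>y\<in>T. card {x \<in> S. g x = y})"
  using sum.group[OF assms, of "\<lambda>_. 1::nat"] by simp

lemma indep_mod_cong:
  assumes "finite J" and L: "zlattice n M ((*z) p ` zvecs n)" and d: "\<And>b. b \<in> J \<Longrightarrow> w b - w' b \<in> (*z) p ` zvecs n"
  shows "indep_mod p n J w \<longleftrightarrow> indep_mod p n J w'"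
proof -
  have "(\<Sum>b\<in>J. c b *z w b) \<in> (*z) p ` zvecs n \<longleftrightarrow> (\<Sum>b\<in>J. c b *z w' b) \<in> (*z) p ` zvecs n" for c
  proof (rule zlattice_cong[OF L])
    have "(\<Sum>b\<in>J. c b *z w b) - (\<Sum>b\<in>J. c b *z w' b) = (\<Sum>b\<in>J. c b *z (w b - w' b))"
      by (simp add: sum_subtractf zscale_diff)
    also have "\<dots> \<in> (*z) p ` zvecs n" by (intro zlattice_sum[OF L] zlattice_scale[OF L] d)
    finally show "(\<Sum>b\<in>J. c b *z w b) - (\<Sum>b\<in>J. c b *z w' b) \<in> (*z) p ` zvecs n" .
  qed
  then show ?thesis unfolding indep_mod_def by simp
qed

text \<open>If \<open>w 0, \<dots>, w (d - 1)\<close> is an orbit \<open>v, X v, \<dots>\<close> with \<open>P(X) v = 0\<close>, then \<open>X w t\<close> is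
  the following value.\<close>
definition companion :: "int poly \<Rightarrow> (nat \<Rightarrow> nat \<Rightarrow> int) \<Rightarrow> nat \<Rightarrow> nat \<Rightarrow> int" where
  "companion P w t = (if Suc t < degree P then w (Suc t) else - (\<Sum>m<degree P. coeff P m *z w m))"

lemma companion_diff: "companion P (\<lambda>t. w t - w' t) t = companion P w t - companion P w' t"
  by (simp add: companion_def zscale_diff sum_subtractf)

lemma companion_mem:
  assumes "zlattice n M S" "\<And>t. t < degree P \<Longrightarrow> w t \<in> S" shows "companion P w t \<in> S"
proof (cases "Suc t < degree P")
  case False
  have "(\<Sum>m<degree P. coeff P m *z w m) \<in> S"
    by (intro zlattice_sum[OF assms(1)] zlattice_scale[OF assms(1)] assms(2)) simp
  then show ?thesis using False zlattice_minus[OF assms(1)] by (simp add: companion_def)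
qed (use assms(2) in \<open>simp add: companion_def\<close>)

text \<open>Let \<open>e t\<close> be the deviation of \<open>w t\<close> from the orbit of
  \<open>w 0\<close>. Each link except the last reads \<open>X (e t) - e (t + 1) \<in> S\<close>
  with \<open>e 0 = 0\<close>, so all deviations lie in \<open>S\<close>; the last link then leaves
  exactly \<open>P(X) (w 0) \<in> S\<close>. The left side is linear in \<open>X\<close> for given
  \<open>w\<close>, the right side is the condition of interest.\<close>

lemma companion_iff:
  assumes S: "zlattice n M S" and st: "lin_stable n X S" and P: "lead_coeff P = 1" "degree P > 0"
  shows "(\<forall>t<degree P. lin n X (w t) - companion P w t \<in> S)
     \<longleftrightarrow> (\<forall>t<degree P. w t - (lin n X ^^ t) (w 0) \<in> S) \<and> pact n X P (w 0) \<in> S"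
proof -
  define d where "d = degree P"
  define e where "e t = w t - (lin n X ^^ t) (w 0)" for t
  have stab: "lin n X v \<in> S" if "v \<in> S" for v using st that by (simp add: lin_stable_def)
  have step: "lin n X (w t) - companion P w t = lin n X (e t) - e (Suc t)" if "Suc t < d" for t
    using that by (simp add: companion_def d_def e_def lin_diff)
  \<comment> \<open>Since \<open>P\<close> is monic, subtracting the last companion value adds all
    lower terms of \<open>P\<close>, which completes \<open>P(X) (w 0)\<close> up to
    deviations.\<close>
  have last: "lin n X (w (d - 1)) - companion P w (d - 1)
      = pact n X P (w 0) + lin n X (e (d - 1)) + (\<Sum>m<d. coeff P m *z e m)"
  proof -
    obtain d' where d': "d = Suc d'" using P(2) unfolding d_def using gr0_implies_Suc by blast
    have "pact n X P (w 0) = (\<Sum>m\<le>d. coeff P m *z (lin n X ^^ m) (w 0))"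
      by (rule pact_eq_sum) (simp add: d_def)
    also have "\<dots> = (\<Sum>m<d. coeff P m *z (lin n X ^^ m) (w 0)) + coeff P d *z (lin n X ^^ d) (w 0)"
      by (simp add: lessThan_Suc_atMost[symmetric])
    also have "coeff P d = 1" using P(1) by (simp add: d_def)
    finally have "pact n X P (w 0) = (\<Sum>m<d. coeff P m *z (lin n X ^^ m) (w 0)) + (lin n X ^^ d) (w 0)" by simp
    moreover have "lin n X (e (d - 1)) = lin n X (w (d - 1)) - (lin n X ^^ d) (w 0)"
      by (simp add: e_def lin_diff d')
    moreover have "(\<Sum>m<d. coeff P m *z e m) = (\<Sum>m<d. coeff P m *z w m) - (\<Sum>m<d. coeff P m *z (lin n X ^^ m) (w 0))"
      by (simp add: e_def zscale_diff sum_subtractf)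
    moreover have "companion P w (d - 1) = - (\<Sum>m<d. coeff P m *z w m)"
      using P(2) by (simp add: companion_def d_def)
    ultimately show ?thesis by simp
  qed
  show ?thesis
  proof (intro iffI conjI allI impI)
    assume A: "\<forall>t<degree P. lin n X (w t) - companion P w t \<in> S"
    have et: "e t \<in> S" if "t < d" for t
      using that
    proof (induction t)
      case 0 show ?case using zlattice_0[OF S] by (simp add: e_def)
    next
      case (Suc t)
      have "lin n X (e t) - (lin n X (w t) - companion P w t) \<in> S"
        using zlattice_diff[OF S stab[OF Suc.IH], of "lin n X (w t) - companion P w t"] Suc.prems A by (simp add: d_def)
      then show ?case using step[OF Suc.prems] by simp
    qed
    then show "\<And>t. t < degree P \<Longrightarrow> w t - (lin n X ^^ t) (w 0) \<in> S" by (simp add: e_def d_def)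
    have 1: "(\<Sum>m<d. coeff P m *z e m) \<in> S" by (intro zlattice_sum[OF S] zlattice_scale[OF S] et) simp
    have 2: "lin n X (e (d - 1)) \<in> S" using et P(2) stab by (simp add: d_def)
    have "lin n X (w (d - 1)) - companion P w (d - 1) \<in> S" using A P(2) by (simp add: d_def)
    then have "(lin n X (w (d - 1)) - companion P w (d - 1)) - (lin n X (e (d - 1)) + (\<Sum>m<d. coeff P m *z e m)) \<in> S"
      using zlattice_diff[OF S] zlattice_add[OF S 2 1] by blast
    then show "pact n X P (w 0) \<in> S" unfolding last by (simp add: algebra_simps)
  next
    fix t assume A: "(\<forall>t<degree P. w t - (lin n X ^^ t) (w 0) \<in> S) \<and> pact n X P (w 0) \<in> S" and t: "t < degree P"
    have et: "e t \<in> S" if "t < d" for t using A that by (simp add: e_def d_def)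
    show "lin n X (w t) - companion P w t \<in> S"
    proof (cases "Suc t < d")
      case True
      then show ?thesis unfolding step[OF True] using et stab by (intro zlattice_diff[OF S]) auto
    next
      case False
      then have t': "t = d - 1" using t by (simp add: d_def)
      have 1: "(\<Sum>m<d. coeff P m *z e m) \<in> S" by (intro zlattice_sum[OF S] zlattice_scale[OF S] et) simp
      have 2: "lin n X (e (d - 1)) \<in> S" using et P(2) stab by (simp add: d_def)
      show ?thesis unfolding t' last using A 1 2 zlattice_add[OF S] by blast
    qed
  qed
qed

section \<open>Moments over a coset of intertwining matrices\<close>

locale lattice_model =
  fixes p n :: nat and M' :: int and K :: "(nat \<Rightarrow> int) set" and Y :: "nat \<Rightarrow> nat \<Rightarrow> int"
  assumes p: "prime p" and M': "M' > 0" and K: "zlattice n M' K"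
    and Y: "\<And>l. l < n \<Longrightarrow> Y l \<in> zvecs n" and Yst: "lin_stable n Y K"
begin

text \<open>\<open>K\<close> contains \<open>M' Z ^ n\<close>; the extra factor \<open>p\<close>
  makes \<open>p K\<close> and \<open>p Z ^ n\<close> contain \<open>M Z ^ n\<close>, so that all
  three lattices are counted in the same box.\<close>

definition M where "M = int p * M'"
abbreviation "R \<equiv> (*z) (int p) ` K"
abbreviation "pL \<equiv> (*z) (int p) ` zvecs n"
abbreviation "B \<equiv> zbox n M"
abbreviation "XX \<equiv> mats_over n M K Y"
abbreviation "cK \<equiv> card (K \<inter> B)"
abbreviation "cR \<equiv> card (R \<inter> B)"

lemma p0: "int p > 0" using p prime_gt_0_nat by simp
lemma M0: "M > 0" using p0 M' by (simp add: M_def)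
lemma KM: "zlattice n M K" using K unfolding M_def by (rule zlattice_mult_modulus)
lemma RM: "zlattice n M R" using K unfolding M_def by (rule zlattice_scaled)
lemma pLM: "zlattice n M pL" unfolding M_def by (rule zlattice_scaled) (rule zlattice_UNIV)
lemma R_sub_K: "R \<subseteq> K" using scaled_subset[OF K] .
lemma R_sub_pL: "R \<subseteq> pL" using zlattice_sub[OF K] by blast
lemma cK_eq: "cK = p ^ n * cR" using card_scaled[OF K M' p0] by (simp add: M_def)
lemma cR_pos: "cR > 0" using zlattice_zbox_pos[OF RM M0] .
lemma cK_pos: "cK > 0" using zlattice_zbox_pos[OF KM M0] .
lemma card_pL: "card B = p ^ n * card (pL \<inter> B)"
proof -
  have "zvecs n \<inter> B = B" by (auto dest: zbox_zvecs)
  then show ?thesis using card_scaled[OF zlattice_UNIV M' p0, of n] by (simp add: M_def)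
qed
lemma finB: "finite B" using card_zbox(2)[OF M0] .
lemma finXX: "finite XX" using finite_mats[OF M0] by (simp add: mats_over_def)

lemma XX_zvecs: "X \<in> XX \<Longrightarrow> l < n \<Longrightarrow> X l \<in> zvecs n"
  unfolding mats_over_def using mats_zvecs by blast

lemma lin_XX: "X \<in> XX \<Longrightarrow> lin n X v - lin n Y v \<in> K"
  by (rule lin_cong_lattice[OF KM]) (simp add: mats_over_def)

lemma XX_stable: assumes X: "X \<in> XX"
  shows "lin_stable n X K" "lin_stable n X R" "lin_stable n X (zvecs n)" "lin_stable n X pL"
proof -
  have "lin n X v \<in> K" if "v \<in> K" for v
    using zlattice_cong[OF KM lin_XX[OF X, of v]] Yst that by (simp add: lin_stable_def)
  then show 1: "lin_stable n X K" by (simp add: lin_stable_def)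
  then show "lin_stable n X R" by (rule lin_stable_scaled)
  show 2: "lin_stable n X (zvecs n)" by (rule lin_stable_zvecs) (rule XX_zvecs[OF X])
  then show "lin_stable n X pL" by (rule lin_stable_scaled)
qed

lemma pact_XX:
  assumes X: "X \<in> XX" shows "pact n X h v - pact n Y h v \<in> K"
proof (induction h)
  case 0 show ?case using zlattice_0[OF KM] by simp
next
  case (pCons a h)
  have "pact n X (pCons a h) v - pact n Y (pCons a h) v
     = (lin n X (pact n X h v) - lin n Y (pact n X h v)) + lin n Y (pact n X h v - pact n Y h v)"
    by (simp add: pact_pCons lin_diff)
  also have "\<dots> \<in> K" using lin_XX[OF X] pCons Yst unfolding lin_stable_def by (intro zlattice_add[OF KM]) auto
  finally show ?case .
qed

end

text \<open>\<open>Idx\<close> indexes the vectors of a tuple, and \<open>P b\<close> is the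
  polynomial that has to send the vector with index \<open>b\<close> into \<open>p K\<close>.
  Different indices may carry the same polynomial.\<close>

locale chain_model = lattice_model p n M' K Y
  for p n :: nat and M' :: int and K and Y +
  fixes Idx :: "'b set" and P :: "'b \<Rightarrow> int poly"
  assumes fin: "finite Idx" and mon: "\<And>b. b \<in> Idx \<Longrightarrow> lead_coeff (P b) = 1"
    and deg: "\<And>b. b \<in> Idx \<Longrightarrow> degree (P b) > 0"
begin

text \<open>\<open>J\<close> lists all places in all chains, \<open>J'\<close> the places after the
  first. Once the starting vectors are fixed, the entries at \<open>J'\<close> are determined modulo
  \<open>S\<close>.\<close>

definition J where "J = (SIGMA b:Idx. {..<degree (P b)})"
definition J' where "J' = {x \<in> J. snd x \<noteq> 0}"

definition tgt :: "('b \<times> nat \<Rightarrow> nat \<Rightarrow> int) \<Rightarrow> 'b \<times> nat \<Rightarrow> nat \<Rightarrow> int" where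
  "tgt w = (\<lambda>(b, t). companion (P b) (\<lambda>t. w (b, t)) t)"

text \<open>Two cases matter: \<open>S = p K\<close> with a matrix \<open>X\<close> of the coset,
  and \<open>S = K\<close> with \<open>Y\<close>. The second is the condition that a family must
  satisfy in order to be a chain of any \<open>X\<close> congruent to \<open>Y\<close>.\<close>

definition chain_set :: "(nat \<Rightarrow> int) set \<Rightarrow> (nat \<Rightarrow> nat \<Rightarrow> int) \<Rightarrow> ('b \<times> nat \<Rightarrow> nat \<Rightarrow> int) set" where
  "chain_set S X = {w \<in> PiE J (\<lambda>_. B). \<forall>x\<in>J. lin n X (w x) - tgt w x \<in> S}"

definition orbit :: "(nat \<Rightarrow> nat \<Rightarrow> int) \<Rightarrow> ('b \<Rightarrow> nat \<Rightarrow> int) \<Rightarrow> 'b \<times> nat \<Rightarrow> nat \<Rightarrow> int" where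
  "orbit X v = (\<lambda>(b, t). (lin n X ^^ t) (v b))"

lemma finJ: "finite J" using fin by (simp add: J_def)

lemma card_J: "card J = card J' + card Idx"
proof -
  have "J = J' \<union> (\<lambda>b. (b, 0)) ` Idx" using deg by (auto simp: J'_def J_def)
  moreover have "J' \<inter> (\<lambda>b. (b, 0)) ` Idx = {}" by (auto simp: J'_def)
  moreover have "finite J'" using finJ by (simp add: J'_def)
  ultimately have "card J = card J' + card ((\<lambda>b. (b, 0::nat)) ` Idx)" using fin by (simp add: card_Un_disjoint)
  then show ?thesis by (simp add: card_image inj_on_def)
qed

lemma chain_set_iff:
  assumes "zlattice n M S" "lin_stable n X S"
  shows "w \<in> chain_set S X \<longleftrightarrow> w \<in> PiE J (\<lambda>_. B) \<and> (\<forall>x\<in>J. w x - orbit X (\<lambda>b. w (b, 0)) x \<in> S)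
            \<and> (\<forall>b\<in>Idx. pact n X (P b) (w (b, 0)) \<in> S)"
proof -
  have "(\<forall>x\<in>J. lin n X (w x) - tgt w x \<in> S) \<longleftrightarrow>
      (\<forall>b\<in>Idx. \<forall>t<degree (P b). lin n X (w (b, t)) - companion (P b) (\<lambda>t. w (b, t)) t \<in> S)"
    by (auto simp: J_def tgt_def)
  also have "\<dots> \<longleftrightarrow> (\<forall>b\<in>Idx. (\<forall>t<degree (P b). w (b, t) - (lin n X ^^ t) (w (b, 0)) \<in> S) \<and> pact n X (P b) (w (b, 0)) \<in> S)"
    by (intro ball_cong refl companion_iff[OF assms mon deg])
  also have "\<dots> \<longleftrightarrow> (\<forall>x\<in>J. w x - orbit X (\<lambda>b. w (b, 0)) x \<in> S) \<and> (\<forall>b\<in>Idx. pact n X (P b) (w (b, 0)) \<in> S)"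
    by (auto simp: J_def orbit_def)
  finally show ?thesis by (auto simp: chain_set_def)
qed

text \<open>By \<open>companion_iff\<close> a chain consists of admissible starting vectors and, at
  each later place, an arbitrary element of the coset of \<open>S\<close> around the orbit.\<close>

lemma card_chain_set:
  assumes S: "zlattice n M S" and st: "lin_stable n X S" and X: "\<And>l. l < n \<Longrightarrow> X l \<in> zvecs n"
  shows "card {w \<in> chain_set S X. Q (\<lambda>b\<in>Idx. w (b, 0))}
     = card {v \<in> PiE Idx (\<lambda>_. B). (\<forall>b\<in>Idx. pact n X (P b) (v b) \<in> S) \<and> Q v} * card (S \<inter> B) ^ card J'"
proof -
  let ?V = "{v \<in> PiE Idx (\<lambda>_. B). (\<forall>b\<in>Idx. pact n X (P b) (v b) \<in> S) \<and> Q v}"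
  let ?W = "{w \<in> chain_set S X. Q (\<lambda>b\<in>Idx. w (b, 0))}"
  let ?g = "\<lambda>w. \<lambda>b\<in>Idx. w (b, 0::nat)"
  have b0: "(b, 0) \<in> J" if "b \<in> Idx" for b using deg[OF that] that by (simp add: J_def)
  have finW: "finite ?W" using finJ finB by (simp add: chain_set_def finite_PiE)
  have finV: "finite ?V" using fin finB by (simp add: finite_PiE)
  have sub: "?g ` ?W \<subseteq> ?V"
    using b0 unfolding chain_set_iff[OF S st] by (auto simp: PiE_iff)
  have "card ?W = (\<Sum>v\<in>?V. card {w \<in> ?W. ?g w = v})" by (rule card_group[OF finW finV sub])
  also have "\<dots> = (\<Sum>v\<in>?V. card (S \<inter> B) ^ card J')"
  proof (rule sum.cong[OF refl])
    fix v assume v: "v \<in> ?V"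
    have fib: "{w \<in> ?W. ?g w = v} = PiE J (\<lambda>x. if snd x = 0 then {v (fst x)} else {u \<in> B. u - orbit X v x \<in> S})"
      (is "?L = ?F")
    proof (intro equalityI subsetI)
      fix w assume w: "w \<in> ?L"
      then have wv: "w (b, 0) = v b" if "b \<in> Idx" for b using that by (auto dest!: fun_cong[of _ v b])
      have "w x \<in> (if snd x = 0 then {v (fst x)} else {u \<in> B. u - orbit X v x \<in> S})" if x: "x \<in> J" for x
      proof -
        have bI: "fst x \<in> Idx" using x by (auto simp: J_def)
        have "orbit X (\<lambda>b. w (b, 0)) x = orbit X v x" using wv[OF bI] by (simp add: orbit_def split_beta)
        moreover have "w x - orbit X (\<lambda>b. w (b, 0)) x \<in> S" "w x \<in> B"
          using w x unfolding chain_set_iff[OF S st] by auto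
        ultimately show ?thesis using wv[OF bI] by (cases x) auto
      qed
      moreover have "w \<in> extensional J" using w by (auto simp: chain_set_def PiE_def)
      ultimately show "w \<in> ?F" unfolding PiE_def by (intro IntI Pi_I) blast+
    next
      fix w assume w: "w \<in> ?F"
      have w0: "w (b, 0) = v b" if "b \<in> Idx" for b using PiE_mem[OF w b0[OF that]] by simp
      have vB: "v b \<in> B" if "b \<in> Idx" for b using v that by auto
      have 1: "w x \<in> B \<and> w x - orbit X (\<lambda>b. w (b, 0)) x \<in> S" if x: "x \<in> J" for x
      proof -
        have bI: "fst x \<in> Idx" using x by (auto simp: J_def)
        have o: "orbit X (\<lambda>b. w (b, 0)) x = orbit X v x" using w0[OF bI] by (simp add: orbit_def split_beta)
        show ?thesis
        proof (cases "snd x = 0")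
          case True
          then have "w x = v (fst x)" using PiE_mem[OF w x] by simp
          moreover have "orbit X v x = v (fst x)" using True by (simp add: orbit_def split_beta)
          ultimately show ?thesis using o vB[OF bI] zlattice_0[OF S] by simp
        next
          case False then show ?thesis using PiE_mem[OF w x] o by simp
        qed
      qed
      have gv: "?g w = v" using v w0 by (auto simp: fun_eq_iff PiE_def extensional_def)
      have "w \<in> PiE J (\<lambda>_. B)" using w 1 by (auto simp: PiE_def)
      moreover have "\<forall>b\<in>Idx. pact n X (P b) (w (b, 0)) \<in> S" using v w0 by simp
      ultimately have "w \<in> chain_set S X" using 1 unfolding chain_set_iff[OF S st] by blast
      moreover have "Q (?g w)" unfolding gv using v by blast
      ultimately show "w \<in> ?L" using gv by blast
    qed
    have coset: "card {u \<in> B. u - orbit X v x \<in> S} = card (S \<inter> B)" if x: "x \<in> J" for x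
    proof (rule card_zlattice_coset[OF S M0])
      have "v (fst x) \<in> zvecs n" using v x by (auto simp: J_def dest: zbox_zvecs)
      then show "orbit X v x \<in> zvecs n"
        using funpow_stable[OF lin_stable_zvecs[OF X]] by (simp add: orbit_def split_beta)
    qed
    have "card ?F = (\<Prod>x\<in>J. card (if snd x = 0 then {v (fst x)} else {u \<in> B. u - orbit X v x \<in> S}))"
      by (rule card_PiE[OF finJ])
    also have "\<dots> = (\<Prod>x\<in>J. if snd x \<noteq> 0 then card (S \<inter> B) else 1)"
      by (intro prod.cong refl) (simp add: coset)
    also have "\<dots> = (\<Prod>x\<in>J'. card (S \<inter> B))"
      unfolding J'_def by (rule prod.inter_filter[OF finJ, symmetric])
    finally show "card {w \<in> ?W. ?g w = v} = card (S \<inter> B) ^ card J'" unfolding fib by simp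
  qed
  finally show ?thesis by simp
qed

end

context chain_model
begin

abbreviation "W \<equiv> chain_set K Y"
text \<open>The solutions inside \<open>p Z ^ n\<close> are \<open>p\<close> times
  \<open>Gam b\<close>, for every \<open>X\<close> of the coset alike. Their number
  \<open>eta b\<close> is the unit in which solutions are measured, as they are the ones that vanish
  modulo \<open>p\<close>.\<close>

definition Gam where "Gam b = {v \<in> zvecs n. pact n Y (P b) v \<in> K}"
definition eta where "eta b = card ((*z) (int p) ` Gam b \<inter> B)"
definition tuples where
  "tuples X = {v \<in> PiE Idx (\<lambda>_. B). (\<forall>b\<in>Idx. pact n X (P b) (v b) \<in> R) \<and> indep_mod (int p) n J (orbit X v)}"

lemma chain_set_B: "w \<in> chain_set S X \<Longrightarrow> x \<in> J \<Longrightarrow> w x \<in> B"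
  by (auto simp: chain_set_def)

lemma finW: "finite (chain_set S X)" using finJ finB by (simp add: chain_set_def finite_PiE)

lemma chain_set_shift:
  assumes w: "w \<in> W" and w': "w' \<in> PiE J (\<lambda>_. B)" and d: "\<And>x. x \<in> J \<Longrightarrow> w' x - w x \<in> K"
  shows "w' \<in> W"
proof -
  have "lin n Y (w' x) - tgt w' x \<in> K" if x: "x \<in> J" for x
  proof -
    obtain b t where bt: "x = (b, t)" by (cases x)
    have bI: "b \<in> Idx" using x bt by (simp add: J_def)
    have "lin n Y (w' x - w x) \<in> K" using d[OF x] Yst by (simp add: lin_stable_def)
    moreover have "companion (P b) (\<lambda>t. w' (b, t) - w (b, t)) t \<in> K"
      by (rule companion_mem[OF KM]) (use d bI in \<open>simp add: J_def\<close>)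
    moreover have "lin n Y (w x) - tgt w x \<in> K" using w x by (simp add: chain_set_def)
    ultimately have "(lin n Y (w' x - w x) - companion (P b) (\<lambda>t. w' (b, t) - w (b, t)) t) + (lin n Y (w x) - tgt w x) \<in> K"
      using zlattice_add[OF KM] zlattice_diff[OF KM] by blast
    then show ?thesis by (simp add: bt tgt_def companion_diff lin_diff algebra_simps)
  qed
  then show ?thesis using w' by (simp add: chain_set_def)
qed

text \<open>Since \<open>a x0\<close> is invertible modulo \<open>p\<close>, shifting the entry
  \<open>x0\<close> by \<open>k \<in> K\<close> preserves \<open>W\<close> but keeps the relation
  only for \<open>k\<close> in \<open>p Z ^ n\<close>. Hence a single relation holds for a share of
  at most \<open>card (pL \<inter> B) / cK\<close> of all chains.\<close>

lemma card_bad: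
  assumes x0: "x0 \<in> J" and a0: "\<not> int p dvd a x0"
  shows "card {w \<in> W. (\<Sum>x\<in>J. a x *z w x) \<in> pL} * cK \<le> card W * card (pL \<inter> B)"
proof -
  let ?S = "{w \<in> W. (\<Sum>x\<in>J. a x *z w x) \<in> pL} \<times> (K \<inter> B)"
  \<comment> \<open>The shift of the entry \<open>x0\<close> by \<open>k\<close>. Over a given
    value, \<open>k\<close> determines \<open>w\<close>, and the relation confines \<open>k\<close>
    to one coset of \<open>p Z ^ n\<close>.\<close>
  define g where "g = (\<lambda>(w, k). w(x0 := zred M (w x0 + k)))"
  have finS: "finite ?S" using finW finB by simp
  have wB: "w x \<in> zvecs n" if "w \<in> W" "x \<in> J" for w x using chain_set_B[OF that] zbox_zvecs by blast
  have gS: "g ` ?S \<subseteq> W"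
  proof safe
    fix w k assume w: "w \<in> W" and k: "k \<in> K" "k \<in> B"
    have z: "w x0 + k \<in> zvecs n" using wB[OF w x0] k zbox_zvecs by blast
    have "zred M (w x0 + k) - w x0 = (zred M (w x0 + k) - (w x0 + k)) + k" by simp
    also have "\<dots> \<in> K" using zlattice_zred_diff[OF KM z] k zlattice_add[OF KM] by blast
    finally have d: "zred M (w x0 + k) - w x0 \<in> K" .
    have gP: "g (w, k) \<in> PiE J (\<lambda>_. B)"
      using w x0 zred_in_zbox[OF M0 z] by (auto simp: g_def chain_set_def PiE_iff extensional_def)
    have gd: "g (w, k) x - w x \<in> K" for x
      using d zlattice_0[OF KM] by (simp add: g_def)
    show "g (w, k) \<in> W" by (rule chain_set_shift[OF w gP gd])
  qed
  have fib: "card {s \<in> ?S. g s = w'} \<le> card (pL \<inter> B)" if w': "w' \<in> W" for w'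
  proof (cases "{s \<in> ?S. g s = w'} = {}")
    case True then show ?thesis by (simp only: card.empty)
  next
    case False
    then obtain w0 k0 where w0: "(w0, k0) \<in> ?S" "g (w0, k0) = w'" by auto
    have key: "k - k0 \<in> pL" if s: "(w, k) \<in> ?S" "g (w, k) = w'" for w k
    proof -
      have "a x0 *z k - (\<Sum>x\<in>J. a x *z w' x) \<in> pL" if s: "(w, k) \<in> ?S" "g (w, k) = w'" for w k
      proof -
        have kz: "k \<in> zvecs n" and wz: "w x0 \<in> zvecs n" using s x0 wB zbox_zvecs by auto
        have z: "w x0 + k \<in> zvecs n" using kz wz by blast
        have "(\<Sum>x\<in>J. a x *z w' x) = a x0 *z w' x0 + (\<Sum>x\<in>J - {x0}. a x *z w' x)"
          using finJ x0 by (rule sum.remove)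
        also have "(\<Sum>x\<in>J - {x0}. a x *z w' x) = (\<Sum>x\<in>J - {x0}. a x *z w x)"
          using s by (intro sum.cong) (auto simp: g_def)
        also have "\<dots> = (\<Sum>x\<in>J. a x *z w x) - a x0 *z w x0"
          using sum.remove[OF finJ x0, of "\<lambda>x. a x *z w x"] by simp
        also have "w' x0 = zred M (w x0 + k)" using s by (auto simp: g_def)
        finally have "a x0 *z k - (\<Sum>x\<in>J. a x *z w' x) =
            - (a x0 *z (zred M (w x0 + k) - (w x0 + k))) - (\<Sum>x\<in>J. a x *z w x)"
          by (simp add: zscale_diff zscale_add algebra_simps)
        also have "\<dots> \<in> pL"
          using s zlattice_diff[OF pLM zlattice_minus[OF pLM zlattice_scale[OF pLM zlattice_zred_diff[OF pLM z]]]] by blast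
        finally show ?thesis .
      qed
      from zlattice_diff[OF pLM this[OF s] this[OF w0]]
      have "a x0 *z (k - k0) \<in> pL" by (simp add: zscale_diff)
      then have "int p dvd a x0 * (k - k0) i" for i by (simp add: mem_scaled_zvecs zscale_apply)
      then have "int p dvd (k - k0) i" for i
        using p a0 by (metis prime_dvd_mult_iff prime_nat_int_transfer)
      moreover have "k - k0 \<in> zvecs n" using s w0 zbox_zvecs by blast
      ultimately show ?thesis by (simp add: mem_scaled_zvecs)
    qed
    have "card {s \<in> ?S. g s = w'} \<le> card {k \<in> B. k - k0 \<in> pL}"
    proof (rule card_inj_on_le[where f = snd])
      show "inj_on snd {s \<in> ?S. g s = w'}"
      proof (rule inj_onI)
        fix s1 s2 assume s12: "s1 \<in> {s \<in> ?S. g s = w'}" "s2 \<in> {s \<in> ?S. g s = w'}" "snd s1 = snd s2"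
        obtain w k w2 where ww: "s1 = (w, k)" "s2 = (w2, k)" using s12(3) by (cases s1, cases s2) auto
        have s: "w \<in> W" "w2 \<in> W" "g (w, k) = w'" "g (w2, k) = w'" using s12(1,2) unfolding ww by simp_all
        have eq: "g (w, k) x = g (w2, k) x" for x using s by simp
        have "w = w2"
        proof
          fix x show "w x = w2 x"
          proof (cases "x = x0")
            case True
            have "zred M (w x0 + k) = zred M (w2 x0 + k)" using eq[of x0] by (simp add: g_def)
            then show ?thesis using True zred_add_eqD chain_set_B[OF s(1) x0] chain_set_B[OF s(2) x0] by blast
          next
            case False then show ?thesis using eq[of x] by (simp add: g_def)
          qed
        qed
        then show "s1 = s2" using ww by simp
      qed
      show "snd ` {s \<in> ?S. g s = w'} \<subseteq> {k \<in> B. k - k0 \<in> pL}"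
      proof (rule image_subsetI)
        fix s assume s: "s \<in> {s \<in> ?S. g s = w'}"
        obtain w k where ww: "s = (w, k)" by (cases s)
        have wk: "(w, k) \<in> ?S" "g (w, k) = w'" and kB: "k \<in> B" using s unfolding ww by simp_all
        show "snd s \<in> {k \<in> B. k - k0 \<in> pL}"
          unfolding ww snd_conv mem_Collect_eq using kB key[OF wk] by (rule conjI)
      qed
      show "finite {k \<in> B. k - k0 \<in> pL}" using finB by simp
    qed
    also have "\<dots> = card (pL \<inter> B)" by (rule card_zlattice_coset[OF pLM M0]) (use w0 zbox_zvecs in blast)
    finally show ?thesis .
  qed
  have "card ?S = (\<Sum>w'\<in>W. card {s \<in> ?S. g s = w'})" by (rule card_group[OF finS finW gS])
  also have "\<dots> \<le> (\<Sum>w'\<in>W. card (pL \<inter> B))" by (rule sum_mono) (rule fib)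
  finally show ?thesis by (simp add: card_cartesian_product)
qed

text \<open>A dependent family satisfies one of fewer than \<open>p ^ card J\<close> nonzero
  relations with reduced coefficients, each bounded by \<open>card_bad\<close>. As \<open>pL\<close>
  has index \<open>p ^ n\<close>, the share of dependent chains is at most
  \<open>p ^ card J * card B / cK / p ^ n\<close>: the source of the error term.\<close>

lemma card_dependent:
  "card {w \<in> W. \<not> indep_mod (int p) n J w} * cK \<le> p ^ card J * (card W * card (pL \<inter> B))"
proof -
  define A where "A = {a \<in> PiE J (\<lambda>_. {0..<int p}). \<exists>x\<in>J. a x \<noteq> 0}"
  define bad where "bad a = {w \<in> W. (\<Sum>x\<in>J. a x *z w x) \<in> pL}" for a
  have finA: "finite A" using finJ by (simp add: A_def finite_PiE)
  have "card A \<le> card (PiE J (\<lambda>_. {0..<int p}))"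
    using finJ by (intro card_mono) (auto simp: A_def finite_PiE)
  then have cA: "card A \<le> p ^ card J" using finJ by (simp add: card_PiE)
  have sub: "{w \<in> W. \<not> indep_mod (int p) n J w} \<subseteq> (\<Union>a\<in>A. bad a)"
  proof safe
    fix w assume w: "w \<in> W" and "\<not> indep_mod (int p) n J w"
    then obtain c x0 where c: "(\<Sum>x\<in>J. c x *z w x) \<in> pL" and x0: "x0 \<in> J" "\<not> int p dvd c x0"
      unfolding indep_mod_def by blast
    define a where "a = (\<lambda>x\<in>J. c x mod int p)"
    have "a \<in> A" using x0 p0 by (auto simp: A_def a_def mod_eq_0_iff_dvd intro!: bexI[of _ x0])
    moreover have "(\<Sum>x\<in>J. c x *z w x) - (\<Sum>x\<in>J. a x *z w x) \<in> pL"
    proof -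
      have "(\<Sum>x\<in>J. c x *z w x) - (\<Sum>x\<in>J. a x *z w x) = (\<Sum>x\<in>J. (c x - a x) *z w x)"
        by (simp add: sum_subtractf zscale_diff_left)
      also have "\<dots> \<in> pL"
      proof (rule zlattice_sum[OF pLM])
        fix x assume x: "x \<in> J"
        have "(c x - a x) *z w x = int p *z ((c x div int p) *z w x)"
          using x by (simp add: a_def zscale_zscale minus_mod_eq_mult_div)
        moreover have "(c x div int p) *z w x \<in> zvecs n" using chain_set_B[OF w x] zbox_zvecs by blast
        ultimately show "(c x - a x) *z w x \<in> pL" by simp
      qed
      finally show ?thesis .
    qed
    ultimately show "w \<in> (\<Union>a\<in>A. bad a)" using c w zlattice_cong[OF pLM] unfolding bad_def by blast
  qed
  have finbad: "finite (bad a)" for a using finW by (simp add: bad_def)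
  have "card {w \<in> W. \<not> indep_mod (int p) n J w} \<le> (\<Sum>a\<in>A. card (bad a))"
    using card_mono[OF _ sub] card_UN_le[OF finA, of bad] finA finbad by (meson finite_UN_I order_trans)
  then have "card {w \<in> W. \<not> indep_mod (int p) n J w} * cK \<le> (\<Sum>a\<in>A. card (bad a) * cK)"
    by (simp add: sum_distrib_right[symmetric])
  also have "\<dots> \<le> (\<Sum>a\<in>A. card W * card (pL \<inter> B))"
  proof (rule sum_mono)
    fix a assume "a \<in> A"
    then obtain x0 where x0: "x0 \<in> J" "a x0 \<noteq> 0" "0 \<le> a x0" "a x0 < int p" by (force simp: A_def PiE_iff)
    then have "\<not> int p dvd a x0" using zdvd_not_zless by force
    then show "card (bad a) * cK \<le> card W * card (pL \<inter> B)" unfolding bad_def using card_bad x0 by blast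
  qed
  also have "\<dots> \<le> p ^ card J * (card W * card (pL \<inter> B))" using cA by simp
  finally show ?thesis .
qed

text \<open>A chain differs from the orbit of its starting vectors by elements of
  \<open>p K\<close>, hence of \<open>p Z ^ n\<close>, so its independence depends on the starting
  vectors alone.\<close>

lemma card_indep_chains:
  assumes X: "X \<in> XX"
  shows "card {w \<in> chain_set R X. indep_mod (int p) n J w} = card (tuples X) * cR ^ card J'"
proof -
  have "{w \<in> chain_set R X. indep_mod (int p) n J w}
     = {w \<in> chain_set R X. indep_mod (int p) n J (orbit X (\<lambda>b\<in>Idx. w (b, 0)))}"
  proof (rule Collect_cong, rule conj_cong[OF refl])
    fix w assume w: "w \<in> chain_set R X"
    show "indep_mod (int p) n J w \<longleftrightarrow> indep_mod (int p) n J (orbit X (\<lambda>b\<in>Idx. w (b, 0)))"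
    proof (rule indep_mod_cong[OF finJ pLM])
      fix x assume x: "x \<in> J"
      then have "orbit X (\<lambda>b\<in>Idx. w (b, 0)) x = orbit X (\<lambda>b. w (b, 0)) x" by (auto simp: orbit_def J_def)
      moreover have "w x - orbit X (\<lambda>b. w (b, 0)) x \<in> R"
        using w x unfolding chain_set_iff[OF RM XX_stable(2)[OF X]] by blast
      ultimately show "w x - orbit X (\<lambda>b\<in>Idx. w (b, 0)) x \<in> pL" using R_sub_pL by auto
    qed
  qed
  also have "card \<dots> = card (tuples X) * cR ^ card J'"
    unfolding tuples_def by (rule card_chain_set[OF RM XX_stable(2)[OF X] XX_zvecs[OF X]])
  finally show ?thesis .
qed

text \<open>A starting vector ranges over \<open>Gam b\<close>, with \<open>p ^ n * eta b\<close>
  points in the box, and each later entry over a coset of \<open>K\<close>, with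
  \<open>p ^ n * cR\<close> points. The powers of \<open>p\<close> collect to one factor
  \<open>p ^ n\<close> for each place in \<open>J\<close>.\<close>

lemma card_W: "card W = p ^ (n * card J) * (\<Prod>b\<in>Idx. eta b) * cR ^ card J'"
proof -
  have "card W = card {w \<in> W. (\<lambda>_. True) (\<lambda>b\<in>Idx. w (b, 0::nat))}" by simp
  also have "\<dots> = card {v \<in> PiE Idx (\<lambda>_. B). (\<forall>b\<in>Idx. pact n Y (P b) (v b) \<in> K) \<and> True} * cK ^ card J'"
    by (rule card_chain_set[OF KM Yst Y])
  also have "{v \<in> PiE Idx (\<lambda>_. B). (\<forall>b\<in>Idx. pact n Y (P b) (v b) \<in> K) \<and> True} = PiE Idx (\<lambda>b. Gam b \<inter> B)"
    (is "?L = ?F")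
  proof (rule Set.set_eqI)
    fix v show "v \<in> ?L \<longleftrightarrow> v \<in> ?F" unfolding PiE_iff mem_Collect_eq Gam_def using zbox_zvecs by blast
  qed
  also have "card \<dots> = (\<Prod>b\<in>Idx. p ^ n * eta b)"
  proof -
    have "card (Gam b \<inter> B) = p ^ n * eta b" for b
      using card_scaled[OF pact_preimage_lattice[OF K Yst Y] M' p0, of "P b"] by (simp add: M_def eta_def Gam_def)
    then show ?thesis using fin by (simp add: card_PiE)
  qed
  also have "\<dots> = p ^ (n * card Idx) * (\<Prod>b\<in>Idx. eta b)" by (simp add: prod.distrib power_mult)
  also have "cK ^ card J' = p ^ (n * card J') * cR ^ card J'" by (simp add: cK_eq power_mult_distrib power_mult)
  finally show ?thesis by (simp add: card_J power_add distrib_left)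
qed

text \<open>Pairs of a matrix and an independent chain for it are counted both ways. The average
  number of independent tuples is therefore \<open>\<Prod>b. eta b\<close> times the share of
  independent chains in \<open>W\<close>, a share close to 1.\<close>

lemma sum_tuples:
  "(\<Sum>X\<in>XX. card (tuples X)) * card W = card {w \<in> W. indep_mod (int p) n J w} * card XX * (\<Prod>b\<in>Idx. eta b)"
proof -
  let ?i = "indep_mod (int p) n J"
  let ?E = "{w \<in> PiE J (\<lambda>_. B). ?i w}"
  let ?rel = "\<lambda>(X :: nat \<Rightarrow> nat \<Rightarrow> int) (w :: 'b \<times> nat \<Rightarrow> nat \<Rightarrow> int). \<forall>x\<in>J. lin n X (w x) - tgt w x \<in> R"
  have finE: "finite ?E" using finJ finB by (simp add: finite_PiE)
  have "(\<Sum>X\<in>XX. card (tuples X)) * cR ^ card J' = (\<Sum>X\<in>XX. card {w \<in> ?E. ?rel X w})"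
  proof -
    have "{w \<in> ?E. ?rel X w} = {w \<in> chain_set R X. ?i w}" for X by (auto simp: chain_set_def)
    then show ?thesis by (simp add: card_indep_chains sum_distrib_right)
  qed
  also have "\<dots> = (\<Sum>w\<in>?E. card {X \<in> XX. ?rel X w})" by (rule card_double_count[OF finXX finE])
  finally have 1: "(\<Sum>X\<in>XX. card (tuples X)) * cR ^ card J' = (\<Sum>w\<in>?E. card {X \<in> XX. ?rel X w})" .
  \<comment> \<open>Every independent chain compatible modulo \<open>K\<close> belongs to equally
    many matrices, and an incompatible one to none.\<close>
  have 2: "card {X \<in> XX. ?rel X w} * cK ^ card J = (if w \<in> W then card XX * cR ^ card J else 0)" if w: "w \<in> ?E" for w
  proof (cases "w \<in> W")
    case True
    have wz: "w x \<in> zvecs n" if "x \<in> J" for x using w that zbox_zvecs by (auto simp: PiE_iff)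
    have tz: "tgt w x \<in> zvecs n" if x: "x \<in> J" for x
    proof -
      obtain b t where bt: "x = (b, t)" by (cases x)
      have "companion (P b) (\<lambda>t. w (b, t)) t \<in> zvecs n"
        by (rule companion_mem[OF zlattice_UNIV]) (use wz x bt in \<open>simp add: J_def\<close>)
      then show ?thesis by (simp add: bt tgt_def)
    qed
    have iw: "indep_mod (int p) n J w" using w by blast
    have cw: "lin n Y (w x) - tgt w x \<in> K" if "x \<in> J" for x using True that by (simp add: chain_set_def)
    show ?thesis unfolding if_P[OF True]
      by (rule card_prescribed_values[where w = w and z = "tgt w" and Y = Y and K = K and J = J, OF p M0 KM RM Y finJ wz iw tz cw])
  next
    case False
    have nrel: "\<not> ?rel X w" if X: "X \<in> XX" for X
    proof
      assume r: "?rel X w"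
      have "lin n Y (w x) - tgt w x \<in> K" if x: "x \<in> J" for x
      proof -
        have a: "lin n X (w x) - tgt w x \<in> K" by (rule subsetD[OF R_sub_K]) (rule bspec[OF r x])
        show ?thesis using zlattice_diff[OF KM a lin_XX[OF X, of "w x"]] by simp
      qed
      then have "w \<in> W" using w by (simp add: chain_set_def)
      then show False using False by contradiction
    qed
    have "{X \<in> XX. ?rel X w} = {}"
    proof (rule equals0I)
      fix X assume X: "X \<in> {X \<in> XX. ?rel X w}"
      show False
        using nrel[OF conjunct1[OF CollectD[OF X]]] conjunct2[OF CollectD[OF X]] by contradiction
    qed
    then have "card {X \<in> XX. ?rel X w} = 0" by (simp only: card.empty)
    then show ?thesis unfolding if_not_P[OF False] by (simp only: mult_0)
  qed
  have "(\<Sum>X\<in>XX. card (tuples X)) * cR ^ card J' * cK ^ card J = (\<Sum>w\<in>?E. card {X \<in> XX. ?rel X w} * cK ^ card J)"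
    unfolding 1 by (rule sum_distrib_right)
  also have "\<dots> = (\<Sum>w\<in>?E. if w \<in> W then card XX * cR ^ card J else 0)"
    by (rule sum.cong[OF refl 2])
  also have "\<dots> = (\<Sum>w\<in>?E \<inter> W. card XX * cR ^ card J)" using finE by (simp add: sum.If_cases)
  also have "?E \<inter> W = {w \<in> W. ?i w}" by (auto simp: chain_set_def)
  finally have eq: "(\<Sum>X\<in>XX. card (tuples X)) * cR ^ card J' * p ^ (n * card J) * cR ^ card J
       = card {w \<in> W. ?i w} * card XX * cR ^ card J"
    by (simp add: cK_eq power_mult_distrib power_mult ac_simps)
  have nz: "cR ^ card J \<noteq> 0" using cR_pos by simp
  have "(\<Sum>X\<in>XX. card (tuples X)) * cR ^ card J' * p ^ (n * card J) = card {w \<in> W. ?i w} * card XX"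
    by (rule iffD1[OF mult_right_cancel[OF nz] eq])
  then have "(\<Sum>X\<in>XX. card (tuples X)) * cR ^ card J' * p ^ (n * card J) * (\<Prod>b\<in>Idx. eta b)
      = card {w \<in> W. ?i w} * card XX * (\<Prod>b\<in>Idx. eta b)" by (rule arg_cong)
  then show ?thesis unfolding card_W by (simp only: ac_simps)
qed

end

section \<open>The solution space of one polynomial and its dimension\<close>

lemma indep_mod_subset:
  assumes "indep_mod p n J w" "J' \<subseteq> J" "finite J"
  shows "indep_mod p n J' w"
  unfolding indep_mod_def
proof (intro allI impI)
  fix c assume c: "(\<Sum>b\<in>J'. c b *z w b) \<in> (*z) p ` zvecs n"
  define c' where "c' b = (if b \<in> J' then c b else 0)" for b
  have "(\<Sum>b\<in>J. c' b *z w b) = (\<Sum>b\<in>J'. c b *z w b)"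
    using assms(2,3) by (intro sum.mono_neutral_cong_right) (auto simp: c'_def)
  then have "\<forall>b\<in>J. p dvd c' b" using assms(1) c unfolding indep_mod_def by simp
  show "\<forall>b\<in>J'. p dvd c b"
  proof
    fix b assume b: "b \<in> J'"
    then have "p dvd c' b" using assms(2) \<open>\<forall>b\<in>J. p dvd c' b\<close> by blast
    then show "p dvd c b" using b by (simp add: c'_def)
  qed
qed

lemma reduce_coeffs:
  assumes "\<And>x. x \<in> J \<Longrightarrow> w x \<in> zvecs n"
  shows "(\<Sum>x\<in>J. c x *z w x) - (\<Sum>x\<in>J. (\<lambda>x\<in>J. c x mod p) x *z w x) \<in> (*z) p ` zvecs n"
proof -
  have L: "zlattice n (p * 1) ((*z) p ` zvecs n)" by (rule zlattice_scaled) (rule zlattice_UNIV)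
  have "(\<Sum>x\<in>J. c x *z w x) - (\<Sum>x\<in>J. (\<lambda>x\<in>J. c x mod p) x *z w x) = (\<Sum>x\<in>J. p *z ((c x div p) *z w x))"
    unfolding sum_subtractf[symmetric]
    by (intro sum.cong refl) (simp add: zscale_zscale minus_mod_eq_mult_div flip: zscale_diff_left)
  also have "\<dots> \<in> (*z) p ` zvecs n"
    by (rule zlattice_sum[OF L]) (use assms in blast)
  finally show ?thesis .
qed

text \<open>Each such vector is a combination with coefficients in \<open>{0..<p}\<close> plus an
  element of \<open>H \<inter> p Z ^ n\<close>, up to reduction modulo \<open>M\<close>;
  independence makes the coefficients unique.\<close>

lemma card_span:
  fixes p :: nat
  assumes p: "int p > 0" and M: "M > 0" and L: "zlattice n M ((*z) (int p) ` zvecs n)" and H: "zlattice n M H"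
    and J: "finite J" and w: "\<And>x. x \<in> J \<Longrightarrow> w x \<in> H" and ind: "indep_mod (int p) n J w"
  shows "card {u \<in> H \<inter> zbox n M. \<exists>c. u - (\<Sum>x\<in>J. c x *z w x) \<in> (*z) (int p) ` zvecs n}
     = p ^ card J * card ((H \<inter> (*z) (int p) ` zvecs n) \<inter> zbox n M)"
proof -
  let ?L = "(*z) (int p) ` zvecs n" and ?B = "zbox n M" and ?C = "PiE J (\<lambda>_. {0..<int p})"
  define s where "s c = (\<Sum>x\<in>J. c x *z w x)" for c
  define f where "f = (\<lambda>(c, u). zred M (u + s c))"
  let ?D = "?C \<times> ((H \<inter> ?L) \<inter> ?B)"
  let ?T = "{u \<in> H \<inter> ?B. \<exists>c. u - s c \<in> ?L}"
  have sH: "s c \<in> H" for c unfolding s_def by (intro zlattice_sum[OF H] zlattice_scale[OF H] w)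
  have sz: "s c \<in> zvecs n" for c using zlattice_zvecs[OF H sH] .
  have wz: "w x \<in> zvecs n" if "x \<in> J" for x using zlattice_zvecs[OF H w[OF that]] .
  have inj: "inj_on f ?D"
  proof (rule inj_onI)
    fix d d' assume d: "d \<in> ?D" "d' \<in> ?D" "f d = f d'"
    obtain c u c' u' where cu: "d = (c, u)" "d' = (c', u')" by (cases d, cases d')
    have c: "c \<in> ?C" "c' \<in> ?C" and u: "u \<in> H" "u \<in> ?L" "u \<in> ?B" and u': "u' \<in> H" "u' \<in> ?L" "u' \<in> ?B"
      using d(1,2) unfolding cu by simp_all
    have eq: "zred M (u + s c) = zred M (u' + s c')" using d(3) unfolding cu f_def by simp
    have z: "u + s c \<in> zvecs n" "u' + s c' \<in> zvecs n" using u u' sz zbox_zvecs by blast+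
    have "(u + s c) - (u' + s c') = (zred M (u' + s c') - (u' + s c')) - (zred M (u + s c) - (u + s c))"
      using eq by simp
    also have "\<dots> \<in> ?L" by (intro zlattice_diff[OF L zlattice_zred_diff[OF L z(2)] zlattice_zred_diff[OF L z(1)]])
    finally have "((u + s c) - (u' + s c')) - (u - u') \<in> ?L"
      using zlattice_diff[OF L _ zlattice_diff[OF L u(2) u'(2)]] by blast
    moreover have "((u + s c) - (u' + s c')) - (u - u') = (\<Sum>x\<in>J. (c x - c' x) *z w x)"
      by (simp add: s_def zscale_diff_left sum_subtractf)
    ultimately have "(\<Sum>x\<in>J. (c x - c' x) *z w x) \<in> ?L" by simp
    then have "\<forall>x\<in>J. int p dvd c x - c' x" using spec[OF ind[unfolded indep_mod_def], of "\<lambda>x. c x - c' x"] by simp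
    moreover have "0 \<le> c x \<and> c x < int p \<and> 0 \<le> c' x \<and> c' x < int p" if "x \<in> J" for x
      using PiE_mem[OF c(1) that] PiE_mem[OF c(2) that] by simp
    ultimately have "c x = c' x" if "x \<in> J" for x
      using that by (metis mod_eq_dvd_iff mod_pos_pos_trivial)
    then have cc: "c = c'" using c by (intro PiE_ext[OF c]) simp
    have "u = u'" using zred_add_eqD[OF u(3) u'(3)] eq cc by simp
    then show "d = d'" using cc cu by simp
  qed
  have img: "f ` ?D = ?T"
  proof (intro equalityI image_subsetI subsetI)
    fix d assume d: "d \<in> ?D"
    obtain c u where cu: "d = (c, u)" by (cases d)
    have u: "u \<in> H" "u \<in> ?L" "u \<in> ?B" using d unfolding cu by simp_all
    have z: "u + s c \<in> zvecs n" using u sz zbox_zvecs by blast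
    have "zred M (u + s c) \<in> H" using zlattice_zred_iff[OF H z] zlattice_add[OF H u(1) sH] by simp
    moreover have "zred M (u + s c) \<in> ?B" using zred_in_zbox[OF M z] .
    moreover have "zred M (u + s c) - s c \<in> ?L"
      using zlattice_add[OF L zlattice_zred_diff[OF L z] u(2)] by simp
    ultimately show "f d \<in> ?T" unfolding cu f_def prod.case mem_Collect_eq Int_iff by (intro conjI exI)
  next
    fix h assume h: "h \<in> ?T"
    then obtain c where c: "h - s c \<in> ?L" by blast
    have hH: "h \<in> H" "h \<in> ?B" using h by simp_all
    define c0 where "c0 = (\<lambda>x\<in>J. c x mod int p)"
    have c0C: "c0 \<in> ?C" using p by (simp add: c0_def)
    have "s c - s c0 \<in> ?L" unfolding s_def c0_def by (rule reduce_coeffs[OF wz])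
    then have "(h - s c) + (s c - s c0) \<in> ?L" using zlattice_add[OF L c] by blast
    then have hL: "h - s c0 \<in> ?L" by simp
    have hH': "h - s c0 \<in> H" using zlattice_diff[OF H hH(1) sH] .
    have z: "h - s c0 \<in> zvecs n" using zlattice_zvecs[OF H hH'] .
    define u where "u = zred M (h - s c0)"
    have "u \<in> H" "u \<in> ?L" unfolding u_def using zlattice_zred_iff[OF H z] zlattice_zred_iff[OF L z] hH' hL by blast+
    moreover have "u \<in> ?B" unfolding u_def by (rule zred_in_zbox[OF M z])
    ultimately have "(c0, u) \<in> ?D" using c0C by simp
    moreover have "f (c0, u) = h"
    proof -
      have "f (c0, u) = zred M h"
        by (simp add: f_def u_def zred_def fun_eq_iff pointwise mod_add_left_eq)
      then show ?thesis using zred_zbox[OF hH(2)] by simp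
    qed
    ultimately show "h \<in> f ` ?D" by (metis imageI)
  qed
  have "card ?T = card ?D" using card_image[OF inj] img by simp
  also have "\<dots> = card ?C * card ((H \<inter> ?L) \<inter> ?B)" by (rule card_cartesian_product)
  also have "card ?C = p ^ card J" using J by (simp add: card_PiE)
  finally show ?thesis unfolding s_def .
qed

context lattice_model
begin

text \<open>\<open>H X Q\<close> is the solution set \<open>U j\<close> of the overview for one
  polynomial. \<open>Gm\<close> and \<open>et\<close> play the part of \<open>Gam\<close> and
  \<open>eta\<close>, but depend on the polynomial rather than on an index set.\<close>

definition H where "H X Q = {v \<in> zvecs n. pact n X Q v \<in> R}"
definition Gm where "Gm Q = {v \<in> zvecs n. pact n Y Q v \<in> K}"
definition et where "et Q = card ((*z) (int p) ` Gm Q \<inter> B)"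
definition orb :: "(nat \<Rightarrow> nat \<Rightarrow> int) \<Rightarrow> (nat \<Rightarrow> nat \<Rightarrow> int) \<Rightarrow> nat \<times> nat \<Rightarrow> nat \<Rightarrow> int" where
  "orb X v = (\<lambda>(a, t). (lin n X ^^ t) (v a))"
text \<open>For irreducible \<open>Q\<close> these are the \<open>s\<close>-tuples that are
  independent over the field \<open>F_p[t] / (Q)\<close>: \<open>F_p\<close>-independence of all
  \<open>X ^ t (v a)\<close> with \<open>t < degree Q\<close> expresses it without naming the
  field.\<close>

definition seqs where
  "seqs X Q s = {v \<in> PiE {..<s} (\<lambda>_. H X Q \<inter> B). indep_mod (int p) n ({..<s} \<times> {..<degree Q}) (orb X v)}"

lemma H_lattice: "X \<in> XX \<Longrightarrow> zlattice n M (H X Q)"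
  unfolding H_def by (rule pact_preimage_lattice[OF RM XX_stable(2) XX_zvecs])

lemma H_stable: assumes X: "X \<in> XX" shows "lin_stable n X (H X Q)"
  unfolding lin_stable_def
proof
  fix v assume v: "v \<in> H X Q"
  then have r: "pact n X Q v \<in> R" by (simp only: H_def mem_Collect_eq)
  have "lin n X (pact n X Q v) \<in> R" by (rule bspec[OF XX_stable(2)[OF X, unfolded lin_stable_def] r])
  then show "lin n X v \<in> H X Q" using lin_zvecs[OF XX_zvecs[OF X]] by (simp add: H_def pact_lin)
qed

text \<open>Cancelling \<open>p\<close> turns the condition modulo \<open>p K\<close> into one
  modulo \<open>K\<close>, where \<open>X\<close> may be replaced by \<open>Y\<close>. So the
  trivial part of \<open>H X Q\<close> is the same for all \<open>X\<close> of the coset.\<close>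

lemma H_pL: assumes X: "X \<in> XX" shows "H X Q \<inter> pL = (*z) (int p) ` Gm Q"
proof -
  have 1: "int p *z w \<in> H X Q \<longleftrightarrow> w \<in> Gm Q" if w: "w \<in> zvecs n" for w
  proof -
    have "int p *z w \<in> H X Q \<longleftrightarrow> int p *z pact n X Q w \<in> R" using w by (simp add: H_def pact_vec_zscale)
    also have "\<dots> \<longleftrightarrow> pact n X Q w \<in> K" by (rule zscale_mem_scaled) (use p0 in simp)
    also have "\<dots> \<longleftrightarrow> pact n Y Q w \<in> K" by (rule zlattice_cong[OF KM pact_XX[OF X]])
    finally show ?thesis using w by (simp add: Gm_def)
  qed
  show ?thesis
  proof (intro equalityI subsetI)
    fix v assume "v \<in> H X Q \<inter> pL"
    then obtain w where "w \<in> zvecs n" "v = int p *z w" "v \<in> H X Q" by blast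
    then show "v \<in> (*z) (int p) ` Gm Q" using 1 by blast
  next
    fix v assume "v \<in> (*z) (int p) ` Gm Q"
    then obtain w where w: "w \<in> Gm Q" "v = int p *z w" by blast
    then have "w \<in> zvecs n" by (simp add: Gm_def)
    then show "v \<in> H X Q \<inter> pL" using 1 w by blast
  qed
qed

lemma et_eq: "X \<in> XX \<Longrightarrow> card ((H X Q \<inter> pL) \<inter> B) = et Q"
  unfolding et_def by (simp only: H_pL)

lemma orb_mem: "X \<in> XX \<Longrightarrow> v a \<in> H X Q \<Longrightarrow> orb X v (a, t) \<in> H X Q"
  unfolding orb_def prod.case by (rule funpow_stable[OF H_stable])

definition spanset where
  "spanset X Q s v = {u \<in> zvecs n. \<exists>c. u - (\<Sum>x\<in>{..<s} \<times> {..<degree Q}. c x *z orb X v x) \<in> pL}"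

text \<open>Stability under \<open>X\<close> is the point: the image of the last power in an orbit
  is rewritten through \<open>Q(X) (v a) \<in> p K\<close> with \<open>Q\<close> monic. The span is
  thus a submodule over \<open>Z[t]\<close>, and annihilators modulo it are ideals.\<close>

lemma spanset_lattice:
  assumes X: "X \<in> XX" and v: "\<And>a. a < s \<Longrightarrow> v a \<in> H X Q" and Q: "lead_coeff Q = 1" "degree Q > 0"
  shows "zlattice n M (spanset X Q s v)" "lin_stable n X (spanset X Q s v)" "pL \<subseteq> spanset X Q s v"
proof -
  let ?J = "{..<s} \<times> {..<degree Q}" and ?S = "spanset X Q s v"
  define sm where "sm c = (\<Sum>x\<in>?J. c x *z orb X v x)" for c
  have S: "u \<in> ?S \<longleftrightarrow> u \<in> zvecs n \<and> (\<exists>c. u - sm c \<in> pL)" for u unfolding spanset_def sm_def by blast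
  have pLz: "u \<in> zvecs n" if "u \<in> pL" for u using zlattice_zvecs[OF pLM that] .
  have smadd: "sm (\<lambda>x. c x + c' x) = sm c + sm c'" for c c' by (simp add: sm_def zscale_add_left sum.distrib)
  have smneg: "sm (\<lambda>x. - c x) = - sm c" for c
    using smadd[of c "\<lambda>x. - c x"] by (simp add: sm_def eq_neg_iff_add_eq_0 add.commute)
  have sm0: "sm (\<lambda>_. 0) = 0" by (simp add: sm_def)
  show 3: "pL \<subseteq> ?S"
  proof
    fix u assume u: "u \<in> pL"
    then have "u - sm (\<lambda>_. 0) \<in> pL" by (simp only: sm0 diff_zero)
    then show "u \<in> ?S" unfolding S using pLz[OF u] by blast
  qed
  show 1: "zlattice n M ?S"
    unfolding zlattice_def
  proof (intro conjI ballI)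
    show "?S \<subseteq> zvecs n" unfolding spanset_def by blast
    show "0 \<in> ?S" using 3 zlattice_0[OF pLM] by blast
    fix u assume u: "u \<in> ?S"
    then obtain c where c: "u \<in> zvecs n" "u - sm c \<in> pL" unfolding S by blast
    have "- u - sm (\<lambda>x. - c x) = - (u - sm c)" by (simp add: smneg)
    then have "- u - sm (\<lambda>x. - c x) \<in> pL" using zlattice_minus[OF pLM c(2)] by (simp only:)
    then show "- u \<in> ?S" unfolding S using c(1) by blast
    fix u' assume u': "u' \<in> ?S"
    then obtain c' where c': "u' \<in> zvecs n" "u' - sm c' \<in> pL" unfolding S by blast
    have "u + u' - sm (\<lambda>x. c x + c' x) = (u - sm c) + (u' - sm c')" by (simp add: smadd)
    then have "u + u' - sm (\<lambda>x. c x + c' x) \<in> pL" using zlattice_add[OF pLM c(2) c'(2)] by (simp only:)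
    then show "u + u' \<in> ?S" unfolding S using c(1) c'(1) by blast
  next
    fix u assume "u \<in> zvecs n"
    then show "M *z u \<in> ?S" using 3 zlattice_modulus[OF pLM] by blast
  qed
  have ox: "orb X v x \<in> ?S" if x: "x \<in> ?J" for x
  proof -
    have "sm (\<lambda>y. of_bool (y = x)) = (\<Sum>y\<in>?J. if y = x then orb X v y else 0)"
      unfolding sm_def by (intro sum.cong) auto
    also have "\<dots> = orb X v x" using x by simp
    finally have "orb X v x - sm (\<lambda>y. of_bool (y = x)) = 0" by simp
    then have "orb X v x - sm (\<lambda>y. of_bool (y = x)) \<in> pL" using zlattice_0[OF pLM] by (simp only:)
    moreover have "orb X v x \<in> zvecs n"
      using zlattice_zvecs[OF H_lattice[OF X] orb_mem[OF X v]] x by (cases x) auto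
    ultimately show ?thesis unfolding S by blast
  qed
  have lo: "lin n X (orb X v x) \<in> ?S" if x: "x \<in> ?J" for x
  proof -
    obtain a t where at: "x = (a, t)" by (cases x)
    have a: "a < s" "t < degree Q" using x at by auto
    show ?thesis
    proof (cases "Suc t < degree Q")
      case True
      have "lin n X (orb X v x) = orb X v (a, Suc t)" by (simp add: at orb_def)
      then show ?thesis using ox[of "(a, Suc t)"] True a by simp
    next
      case False
      then have t: "Suc t = degree Q" using a by simp
      have "pact n X Q (v a) = (\<Sum>m\<le>degree Q. coeff Q m *z (lin n X ^^ m) (v a))" by (rule pact_eq_sum) simp
      also have "\<dots> = (\<Sum>m<degree Q. coeff Q m *z orb X v (a, m)) + (lin n X ^^ degree Q) (v a)"
        using Q(1) by (simp add: lessThan_Suc_atMost[symmetric] orb_def)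
      also have "(lin n X ^^ degree Q) (v a) = lin n X (orb X v x)" by (simp add: t[symmetric] at orb_def)
      finally have "lin n X (orb X v x) = pact n X Q (v a) - (\<Sum>m<degree Q. coeff Q m *z orb X v (a, m))" by simp
      moreover have "pact n X Q (v a) \<in> ?S" using v[OF a(1)] R_sub_pL 3 unfolding H_def by blast
      moreover have "(\<Sum>m<degree Q. coeff Q m *z orb X v (a, m)) \<in> ?S"
        using a by (intro zlattice_sum[OF 1] zlattice_scale[OF 1] ox) simp
      ultimately show ?thesis using zlattice_diff[OF 1] by (simp only:)
    qed
  qed
  show "lin_stable n X ?S"
    unfolding lin_stable_def
  proof
    fix u assume u: "u \<in> ?S"
    then obtain c where c: "u \<in> zvecs n" "u - sm c \<in> pL" unfolding S by blast
    have "lin n X (u - sm c) \<in> ?S" using c(2) XX_stable(4)[OF X] 3 unfolding lin_stable_def by blast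
    moreover have "lin n X (sm c) \<in> ?S" unfolding sm_def lin_sum lin_zscale
      by (intro zlattice_sum[OF 1] zlattice_scale[OF 1] lo)
    ultimately have "lin n X (u - sm c) + lin n X (sm c) \<in> ?S" by (rule zlattice_add[OF 1])
    then show "lin n X u \<in> ?S" by (simp add: lin_diff)
  qed
qed

lemma sum_Suc_times: "(\<Sum>x\<in>{..<Suc s} \<times> {..<d}. f x) = (\<Sum>x\<in>{..<s} \<times> {..<d}. f x) + (\<Sum>t<d. f (s, t))"
  for f :: "nat \<times> nat \<Rightarrow> 'c::comm_monoid_add"
  by (simp add: sum.cartesian_product[symmetric, of "\<lambda>a t. f (a, t)", simplified])

text \<open>In the quotient by the span, \<open>u\<close> is killed by \<open>p\<close> and by
  \<open>Q(X)\<close>. If \<open>u\<close> is nonzero there, irreducibility of \<open>Q\<close>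
  forces every \<open>h\<close> with \<open>degree h < degree Q\<close> and \<open>h(X) u\<close> in
  the span to vanish modulo \<open>p\<close>. So \<open>u\<close> adds either nothing or a full set
  of \<open>degree Q\<close> directions.\<close>

lemma extend_indep:
  assumes X: "X \<in> XX" and v: "\<And>a. a < s \<Longrightarrow> v a \<in> H X Q"
    and Q: "lead_coeff Q = 1" "degree Q > 0" "poly_mod.irreducible_m (int p) Q"
    and ind: "indep_mod (int p) n ({..<s} \<times> {..<degree Q}) (orb X v)" and u: "u \<in> H X Q"
  shows "indep_mod (int p) n ({..<Suc s} \<times> {..<degree Q}) (orb X (v(s := u))) \<longleftrightarrow> u \<notin> spanset X Q s v"
proof -
  let ?J = "{..<s} \<times> {..<degree Q}" and ?S = "spanset X Q s v" and ?d = "degree Q"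
  have S: "zlattice n M ?S" "lin_stable n X ?S" "pL \<subseteq> ?S" by (rule spanset_lattice[OF X v Q(1,2)]; assumption)+
  have uz: "u \<in> zvecs n" using zlattice_zvecs[OF H_lattice[OF X] u] .
  have split: "(\<Sum>x\<in>{..<Suc s} \<times> {..<?d}. c x *z orb X (v(s := u)) x)
      = (\<Sum>x\<in>?J. c x *z orb X v x) + (\<Sum>t<?d. c (s, t) *z (lin n X ^^ t) u)" for c
  proof -
    have "(\<Sum>x\<in>?J. c x *z orb X (v(s := u)) x) = (\<Sum>x\<in>?J. c x *z orb X v x)"
      by (intro sum.cong) (auto simp: orb_def)
    then show ?thesis by (simp add: sum_Suc_times orb_def)
  qed
  show ?thesis
  proof
    assume I: "indep_mod (int p) n ({..<Suc s} \<times> {..<?d}) (orb X (v(s := u)))"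
    show "u \<notin> ?S"
    proof
      assume "u \<in> ?S"
      then obtain c where c: "u - (\<Sum>x\<in>?J. c x *z orb X v x) \<in> pL" unfolding spanset_def by blast
      \<comment> \<open>Membership in the span rewritten as a relation whose coefficient at
        \<open>u\<close> itself, the place \<open>(s, 0)\<close>, is 1.\<close>
      define c' where "c' x = (if x = (s, 0) then 1 else if fst x = s then 0 else - c x)" for x :: "nat \<times> nat"
      have "(\<Sum>x\<in>?J. c' x *z orb X v x) = (\<Sum>x\<in>?J. - (c x *z orb X v x))"
        by (intro sum.cong) (auto simp: c'_def fun_eq_iff pointwise)
      moreover have "(\<Sum>t<?d. c' (s, t) *z (lin n X ^^ t) u) = (\<Sum>t<?d. if t = 0 then u else 0)"
        by (intro sum.cong) (auto simp: c'_def)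
      ultimately have "(\<Sum>x\<in>{..<Suc s} \<times> {..<?d}. c' x *z orb X (v(s := u)) x) = u - (\<Sum>x\<in>?J. c x *z orb X v x)"
        using Q(2) by (simp add: split sum_negf)
      then have "\<forall>b\<in>{..<Suc s} \<times> {..<?d}. int p dvd c' b"
        using spec[OF I[unfolded indep_mod_def], of c'] c by simp
      then have "int p dvd c' (s, 0)" using Q(2) by blast
      then show False using p by (simp add: c'_def prime_nat_iff)
    qed
  next
    assume nS: "u \<notin> ?S"
    show "indep_mod (int p) n ({..<Suc s} \<times> {..<?d}) (orb X (v(s := u)))"
      unfolding indep_mod_def
    proof (rule allI, rule impI)
      fix c assume c: "(\<Sum>x\<in>{..<Suc s} \<times> {..<?d}. c x *z orb X (v(s := u)) x) \<in> pL"
      \<comment> \<open>The part of the relation that involves \<open>u\<close> is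
        \<open>h(X) u\<close>, and it lies in the span of the old sequence.\<close>
      define h where "h = (\<Sum>t<?d. monom (c (s, t)) t)"
      let ?o = "\<Sum>x\<in>?J. c x *z orb X v x"
      have ph: "pact n X h u = (\<Sum>t<?d. c (s, t) *z (lin n X ^^ t) u)" by (simp add: h_def pact_sum pact_monom)
      have tot: "?o + pact n X h u \<in> pL" using c unfolding split ph .
      have "pact n X h u - (\<Sum>x\<in>?J. (- c x) *z orb X v x) = ?o + pact n X h u"
      proof -
        have "(\<Sum>x\<in>?J. (- c x) *z orb X v x) = (\<Sum>x\<in>?J. - (c x *z orb X v x))"
          by (intro sum.cong) (auto simp: fun_eq_iff pointwise)
        then show ?thesis by (simp add: sum_negf)
      qed
      then have "pact n X h u - (\<Sum>x\<in>?J. (- c x) *z orb X v x) \<in> pL" using tot by (simp only:)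
      then have hS: "pact n X h u \<in> ?S"
        unfolding spanset_def mem_Collect_eq using pact_zvecs[OF XX_zvecs[OF X] uz]
        by (intro conjI exI[of _ "\<lambda>x. - c x"])
      have pu: "int p *z u \<in> ?S" using S(3) uz by blast
      have I: "poly_ideal (int p) {h. pact n X h u \<in> ?S}" by (rule torsion_ideal[OF S(1,2) pu])
      have one: "1 \<notin> {h. pact n X h u \<in> ?S}" using nS by simp
      have "pact n X Q u \<in> ?S" using u R_sub_pL S(3) unfolding H_def by blast
      then have QI: "Q \<in> {h. pact n X h u \<in> ?S}" by simp
      have "degree h \<le> ?d - 1" unfolding h_def
        by (rule degree_sum_le) (auto intro!: order.trans[OF degree_monom_le])
      then have dh: "degree h < ?d" using Q(2) by simp
      have coeff: "coeff h t = c (s, t)" if "t < ?d" for t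
        using that by (simp add: h_def coeff_sum sum.delta' if_distrib cong: if_cong)
      have hI: "h \<in> {h. pact n X h u \<in> ?S}" using hS by simp
      have cs: "int p dvd c (s, t)" if "t < ?d" for t
        using ideal_irreducible_small[OF p I one QI Q(1,3) hI dh, of t] coeff[OF that] by simp
      have "pact n X h u \<in> pL" unfolding ph
      proof (rule zlattice_sum[OF pLM])
        fix t assume t: "t \<in> {..<?d}"
        then obtain m where m: "c (s, t) = int p * m" using cs by blast
        have "m *z (lin n X ^^ t) u \<in> zvecs n"
          using funpow_stable[OF XX_stable(3)[OF X] uz] by blast
        then show "c (s, t) *z (lin n X ^^ t) u \<in> pL" unfolding m zscale_zscale[symmetric] by blast
      qed
      from zlattice_diff[OF pLM tot this] have "?o \<in> pL" by (simp only: add_diff_cancel_right')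
      then have old: "\<forall>x\<in>?J. int p dvd c x" using spec[OF ind[unfolded indep_mod_def], of c] by simp
      show "\<forall>x\<in>{..<Suc s} \<times> {..<?d}. int p dvd c x"
      proof
        fix x assume x: "x \<in> {..<Suc s} \<times> {..<?d}"
        obtain a t where at: "x = (a, t)" by (cases x)
        show "int p dvd c x"
        proof (cases "a = s")
          case True then show ?thesis using cs x at by simp
        next
          case False then show ?thesis using old x at by simp
        qed
      qed
    qed
  qed
qed

text \<open>A sequence extends by any vector of \<open>H X Q\<close> outside its span, and by
  \<open>card_span\<close> the span has \<open>q ^ s * et Q\<close> points for
  \<open>q = p ^ degree Q\<close>. Over the reals the formula stays valid when there is no sequence
  of length \<open>s\<close>.\<close>

lemma card_seqs_Suc:
  assumes X: "X \<in> XX"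
    and Q: "lead_coeff Q = 1" "degree Q > 0" "poly_mod.irreducible_m (int p) Q"
  shows "real (card (seqs X Q (Suc s)))
    = real (card (seqs X Q s)) * (real (card (H X Q \<inter> B)) - real (p ^ degree Q) ^ s * real (et Q))"
proof -
  let ?d = "degree Q" and ?g = "\<lambda>v. restrict v {..<s}"
  let ?good = "\<lambda>v. {u \<in> H X Q \<inter> B. u \<notin> spanset X Q s v}"
  have fin: "finite (seqs X Q s)" for s
    using finB by (simp add: seqs_def finite_PiE)
  have seqsD: "v a \<in> H X Q" "v a \<in> B" if "v \<in> seqs X Q s" "a < s" for v a s
    using that by (auto simp: seqs_def PiE_iff)
  have orbcong: "indep_mod (int p) n ({..<s} \<times> {..<?d}) (orb X v) \<longleftrightarrow> indep_mod (int p) n ({..<s} \<times> {..<?d}) (orb X v')"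
    if "\<And>a. a < s \<Longrightarrow> v a = v' a" for v v'
    by (rule indep_mod_cong[OF _ pLM]) (use that zlattice_0[OF pLM] in \<open>auto simp: orb_def\<close>)
  have sub: "?g ` seqs X Q (Suc s) \<subseteq> seqs X Q s"
  proof (rule image_subsetI)
    fix v assume v: "v \<in> seqs X Q (Suc s)"
    then have "indep_mod (int p) n ({..<Suc s} \<times> {..<?d}) (orb X v)" by (simp add: seqs_def)
    then have "indep_mod (int p) n ({..<s} \<times> {..<?d}) (orb X v)" by (rule indep_mod_subset) auto
    then have "indep_mod (int p) n ({..<s} \<times> {..<?d}) (orb X (?g v))" using orbcong[of v "?g v"] by simp
    moreover have "?g v \<in> PiE {..<s} (\<lambda>_. H X Q \<inter> B)" using seqsD[OF v] by simp
    ultimately show "?g v \<in> seqs X Q s" by (simp add: seqs_def)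
  qed
  have fibre: "{v' \<in> seqs X Q (Suc s). ?g v' = v} = (\<lambda>u. v(s := u)) ` ?good v" if v: "v \<in> seqs X Q s" for v
  proof (intro equalityI subsetI)
    have vi: "indep_mod (int p) n ({..<s} \<times> {..<?d}) (orb X v)" using v by (simp add: seqs_def)
    have ext: "indep_mod (int p) n ({..<Suc s} \<times> {..<?d}) (orb X (v(s := u))) \<longleftrightarrow> u \<notin> spanset X Q s v"
      if "u \<in> H X Q" for u by (rule extend_indep[OF X _ Q vi that]) (rule seqsD(1)[OF v])
    {
      fix v' assume "v' \<in> {v' \<in> seqs X Q (Suc s). ?g v' = v}"
      then have v': "v' \<in> seqs X Q (Suc s)" "?g v' = v" by simp_all
      have e: "v' = v(s := v' s)"
      proof
        fix a show "v' a = (v(s := v' s)) a"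
        proof (cases "a < s")
          case True then show ?thesis using fun_cong[OF v'(2), of a] by simp
        next
          case False
          then have "a = s \<or> a > s" by auto
          then show ?thesis
          proof
            assume "a > s"
            then have "v' a = undefined" "v a = undefined"
              using v' v unfolding seqs_def by (auto simp: PiE_def extensional_def)
            then show ?thesis using \<open>a > s\<close> by simp
          qed simp
        qed
      qed
      have uH: "v' s \<in> H X Q" "v' s \<in> B" using seqsD[OF v'(1), of s] by auto
      have "indep_mod (int p) n ({..<Suc s} \<times> {..<?d}) (orb X (v(s := v' s)))"
        using v'(1) e by (simp add: seqs_def)
      then have "v' s \<notin> spanset X Q s v" using ext[OF uH(1)] by blast
      then have "v' s \<in> ?good v" using uH by simp
      then show "v' \<in> (\<lambda>u. v(s := u)) ` ?good v" by (rule image_eqI[where f = "\<lambda>u. v(s := u)" and x = "v' s", OF e])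
    }
    fix v' assume "v' \<in> (\<lambda>u. v(s := u)) ` ?good v"
    then obtain u where u: "u \<in> H X Q" "u \<in> B" "u \<notin> spanset X Q s v" "v' = v(s := u)" by blast
    have "indep_mod (int p) n ({..<Suc s} \<times> {..<?d}) (orb X v')" using ext[OF u(1)] u(3,4) by simp
    moreover have "v' \<in> PiE {..<Suc s} (\<lambda>_. H X Q \<inter> B)"
      using v u(1,2) unfolding u(4) seqs_def by (auto simp: PiE_def extensional_def Pi_def)
    moreover have "?g v' = v" using v unfolding u(4) seqs_def by (auto simp: PiE_def extensional_def fun_eq_iff)
    ultimately show "v' \<in> {v' \<in> seqs X Q (Suc s). ?g v' = v}" by (simp add: seqs_def)
  qed
  have card_fibre: "real (card {v' \<in> seqs X Q (Suc s). ?g v' = v}) = real (card (H X Q \<inter> B)) - real (p ^ ?d) ^ s * real (et Q)"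
    if v: "v \<in> seqs X Q s" for v
  proof -
    have vi: "indep_mod (int p) n ({..<s} \<times> {..<?d}) (orb X v)" using v by (simp add: seqs_def)
    have om: "orb X v x \<in> H X Q" if "x \<in> {..<s} \<times> {..<?d}" for x
      using that orb_mem[OF X seqsD(1)[OF v]] by (cases x) auto
    let ?bad = "{u \<in> H X Q \<inter> B. \<exists>c. u - (\<Sum>x\<in>{..<s} \<times> {..<?d}. c x *z orb X v x) \<in> pL}"
    have bad: "card ?bad = p ^ (s * ?d) * et Q"
      using card_span[OF p0 M0 pLM H_lattice[OF X] _ om vi] et_eq[OF X, of Q] by simp
    have g: "?good v = (H X Q \<inter> B) - ?bad"
      unfolding spanset_def H_def by blast
    have "inj_on (\<lambda>u. v(s := u)) (?good v)" by (rule inj_onI) (metis fun_upd_same)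
    then have "card {v' \<in> seqs X Q (Suc s). ?g v' = v} = card (?good v)" unfolding fibre[OF v] by (rule card_image)
    also have "\<dots> = card (H X Q \<inter> B) - card ?bad" unfolding g
      by (rule card_Diff_subset) (use finB in auto)
    finally have "card {v' \<in> seqs X Q (Suc s). ?g v' = v} = card (H X Q \<inter> B) - p ^ (s * ?d) * et Q" unfolding bad .
    moreover have "card ?bad \<le> card (H X Q \<inter> B)" by (rule card_mono) (use finB in auto)
    ultimately show ?thesis unfolding bad by (simp add: of_nat_diff mult.commute[of s] power_mult)
  qed
  have "card (seqs X Q (Suc s)) = (\<Sum>v\<in>seqs X Q s. card {v' \<in> seqs X Q (Suc s). ?g v' = v})"
    by (rule card_group[OF fin fin sub])
  then have "real (card (seqs X Q (Suc s))) = (\<Sum>v\<in>seqs X Q s. real (card {v' \<in> seqs X Q (Suc s). ?g v' = v}))" by simp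
  also have "\<dots> = (\<Sum>v\<in>seqs X Q s. real (card (H X Q \<inter> B)) - real (p ^ ?d) ^ s * real (et Q))"
    by (rule sum.cong[OF refl card_fibre])
  finally show ?thesis by simp
qed

lemma card_seqs:
  assumes X: "X \<in> XX"
    and Q: "lead_coeff Q = 1" "degree Q > 0" "poly_mod.irreducible_m (int p) Q"
  shows "real (card (seqs X Q i)) = (\<Prod>s<i. real (card (H X Q \<inter> B)) - real (p ^ degree Q) ^ s * real (et Q))"
proof (induction i)
  case 0
  have "indep_mod (int p) n {} w" for w :: "nat \<times> nat \<Rightarrow> nat \<Rightarrow> int" by (simp add: indep_mod_def)
  then have "seqs X Q 0 = {\<lambda>_. undefined}" by (simp add: seqs_def)
  then show ?case by simp
next
  case (Suc i) then show ?case by (simp add: card_seqs_Suc[OF X Q])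
qed

lemma et_pos: "et Q > 0"
proof -
  have "zlattice n M ((*z) (int p) ` Gm Q)" unfolding M_def Gm_def
    by (rule zlattice_scaled[OF pact_preimage_lattice[OF K Yst Y]])
  then show ?thesis unfolding et_def by (rule zlattice_zbox_pos[OF _ M0])
qed

text \<open>The dimension comes from counting instead of a basis. The number of sequences is never
  negative, so the factors in \<open>card_seqs\<close> can turn negative only after one of them has
  vanished; and one must vanish, as \<open>q ^ s\<close> grows without bound. The crude bound on
  \<open>k\<close> serves to truncate the later sums.\<close>

lemma card_H:
  assumes X: "X \<in> XX"
    and Q: "lead_coeff Q = 1" "degree Q > 0" "poly_mod.irreducible_m (int p) Q"
  shows "\<exists>k<card B. card (H X Q \<inter> B) = (p ^ degree Q) ^ k * et Q"
proof -
  let ?h = "card (H X Q \<inter> B)" and ?q = "p ^ degree Q"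
  have q2: "?q \<ge> 2" using p prime_ge_2_nat[OF p] Q(2) by (metis order.trans self_le_power le_trans one_le_numeral)
  have hB: "?h \<le> card B" by (rule card_mono[OF finB]) simp
  have kB: "k < card B" if "?h = ?q ^ k * et Q" for k
  proof -
    have "k < 2 ^ k" by (rule less_exp)
    also have "\<dots> \<le> ?q ^ k" by (rule power_mono[OF q2]) simp
    also have "\<dots> \<le> ?h" using that et_pos[of Q] by simp
    finally show ?thesis using hB by simp
  qed
  have "\<exists>k. ?h = ?q ^ k * et Q"
  proof (rule ccontr)
    assume no: "\<nexists>k. ?h = ?q ^ k * et Q"
    have lt: "?q ^ s * et Q < ?h" for s
    proof -
      have nn: "0 < real ?h - real ?q ^ s * real (et Q)"
      proof (induction s)
        case 0
        have "et Q \<le> ?h" unfolding et_eq[OF X, symmetric] by (rule card_mono) (use finB in auto)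
        moreover have "et Q \<noteq> ?h" using no[simplified, rule_format, of 0] by simp
        ultimately show ?case by simp
      next
        case (Suc s)
        have "real 1 \<le> real ?q" using q2 by (intro of_nat_mono) simp
        then have q1: "1 \<le> real p ^ degree Q" by simp
        have all: "real ?h - real ?q ^ t * real (et Q) > 0" if "t \<le> s" for t
        proof -
          have "real ?q ^ t * real (et Q) \<le> real ?q ^ s * real (et Q)"
            using that q1 by (intro mult_right_mono power_increasing) auto
          then show ?thesis using Suc by simp
        qed
        \<comment> \<open>The count of sequences of length \<open>s + 2\<close> is a positive
          product times the next factor, so that factor is nonnegative; it is nonzero by
          \<open>no\<close>.\<close>
        have "0 \<le> real (card (seqs X Q (Suc (Suc s))))" by simp
        also have "\<dots> = (\<Prod>t<Suc s. real ?h - real ?q ^ t * real (et Q)) * (real ?h - real ?q ^ Suc s * real (et Q))"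
          unfolding card_seqs[OF X Q] by (rule prod.lessThan_Suc)
        finally have "0 \<le> real ?h - real ?q ^ Suc s * real (et Q)"
          using prod_pos[of "{..<Suc s}" "\<lambda>t. real ?h - real ?q ^ t * real (et Q)"] all
          by (auto simp: zero_le_mult_iff less_Suc_eq_le)
        moreover have "real ?h \<noteq> real (?q ^ Suc s * et Q)" using no of_nat_eq_iff by blast
        ultimately show ?case by simp
      qed
      then have "real (?q ^ s * et Q) < real ?h" by simp
      then show ?thesis by (simp only: of_nat_less_iff)
    qed
    have "?h < 2 ^ ?h" by (rule less_exp)
    also have "\<dots> \<le> ?q ^ ?h" by (rule power_mono[OF q2]) simp
    also have "\<dots> \<le> ?q ^ ?h * et Q" using et_pos[of Q] by simp
    finally show False using lt[of ?h] by simp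
  qed
  then show ?thesis using kB by blast
qed

end

section \<open>Coefficients of Euler's expansion\<close>

text \<open>The denominator is the order of \<open>GL_i\<close> over the field with \<open>q\<close>
  elements, which turns independent \<open>i\<close>-tuples into \<open>i\<close>-dimensional
  subspaces. The numerator is the Moebius function of the lattice of subspaces, so the combination
  is Moebius inversion.\<close>

definition qcoef :: "real \<Rightarrow> nat \<Rightarrow> real" where
  "qcoef q i = (- 1) ^ i * q ^ (i choose 2) / (\<Prod>s<i. q ^ i - q ^ s)"

lemma qcoef_Suc:
  assumes "q > 1"
  shows "qcoef q (Suc i) = - qcoef q i / (q ^ Suc i - 1)"
proof -
  have "(\<Prod>s<Suc i. q ^ Suc i - q ^ s) = (q ^ Suc i - 1) * (\<Prod>s<i. q ^ Suc i - q ^ Suc s)"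
    by (subst prod.lessThan_Suc_shift) simp
  also have "(\<Prod>s<i. q ^ Suc i - q ^ Suc s) = (\<Prod>s<i. q * (q ^ i - q ^ s))"
    by (intro prod.cong) (simp_all add: algebra_simps)
  also have "\<dots> = q ^ i * (\<Prod>s<i. q ^ i - q ^ s)" by (simp add: prod.distrib)
  finally have 1: "(\<Prod>s<Suc i. q ^ Suc i - q ^ s) = (q ^ Suc i - 1) * (q ^ i * (\<Prod>s<i. q ^ i - q ^ s))" .
  have "Suc i choose 2 = i + (i choose 2)" by (simp add: numeral_2_eq_2)
  then have 2: "q ^ (Suc i choose 2) = q ^ i * q ^ (i choose 2)" by (simp add: power_add)
  show ?thesis unfolding qcoef_def 1 2 using assms by simp
qed

text \<open>A truncated \<open>q\<close>-binomial identity: passing from \<open>m\<close> to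
  \<open>m + 1\<close> multiplies the right side by \<open>1 + (1 - x) / (q ^ Suc m - 1)\<close>,
  and the excess is exactly the new term. The product form displays the value 1 at
  \<open>x = 1\<close> and the zeros \<open>q, ..., q ^ m\<close>.\<close>

lemma qcoef_partial_sum:
  assumes q: "q > 1"
  shows "(\<Sum>i\<le>m. qcoef q i * (\<Prod>s<i. x - q ^ s)) = (\<Prod>s=1..m. (q ^ s - x) / (q ^ s - 1))"
proof -
  have ne: "q ^ Suc m - 1 \<noteq> 0" for m using one_less_power[OF q, of "Suc m"] by simp
  have qc: "qcoef q m * (\<Prod>s<m. q ^ s - x) * (- 1) ^ m = (\<Prod>s=1..m. q ^ (s - 1) - x) / (\<Prod>s=1..m. q ^ s - 1)" for m
  proof (induction m)
    case (Suc m)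
    have "qcoef q (Suc m) * (\<Prod>s<Suc m. q ^ s - x) * (- 1) ^ Suc m
        = qcoef q m * (\<Prod>s<m. q ^ s - x) * (- 1) ^ m * ((q ^ m - x) / (q ^ Suc m - 1))"
      by (simp add: qcoef_Suc[OF q] divide_simps)
    then show ?case unfolding Suc by (simp add: atLeastAtMostSuc_conv mult.commute)
  qed (simp add: qcoef_def numeral_2_eq_2)
  have neg: "(\<Prod>s<m. x - q ^ s) = (- 1) ^ m * (\<Prod>s<m. q ^ s - x)" for m
    by (induction m) (simp_all add: algebra_simps)
  show ?thesis
  proof (induction m)
    case 0 show ?case by (simp add: qcoef_def numeral_2_eq_2)
  next
    case (Suc m)
    have shift: "(\<Prod>s=1..Suc m. q ^ (s - 1) - x) = (1 - x) * (\<Prod>s=1..m. q ^ s - x)"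
    proof (induction m)
      case (Suc m)
      have "(\<Prod>s=1..Suc (Suc m). q ^ (s - 1) - x) = (\<Prod>s=1..Suc m. q ^ (s - 1) - x) * (q ^ Suc m - x)"
        by (simp add: prod.nat_ivl_Suc')
      then show ?case unfolding Suc by (simp add: prod.nat_ivl_Suc')
    qed simp
    have "qcoef q (Suc m) * (\<Prod>s<Suc m. x - q ^ s) = qcoef q (Suc m) * (\<Prod>s<Suc m. q ^ s - x) * (- 1) ^ Suc m"
      unfolding neg by simp
    also have "\<dots> = (1 - x) * (\<Prod>s=1..m. q ^ s - x) / ((\<Prod>s=1..m. q ^ s - 1) * (q ^ Suc m - 1))"
      unfolding qc shift by (simp add: prod.nat_ivl_Suc' mult.commute)
    also have "\<dots> = (\<Prod>s=1..m. (q ^ s - x) / (q ^ s - 1)) * ((1 - x) / (q ^ Suc m - 1))"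
      by (simp add: prod_dividef)
    finally have "(\<Sum>i\<le>Suc m. qcoef q i * (\<Prod>s<i. x - q ^ s))
       = (\<Prod>s=1..m. (q ^ s - x) / (q ^ s - 1)) * (1 + (1 - x) / (q ^ Suc m - 1))"
      using Suc by (simp add: algebra_simps)
    also have "1 + (1 - x) / (q ^ Suc m - 1) = (q ^ Suc m - x) / (q ^ Suc m - 1)"
      using ne[of m] by (simp add: divide_simps)
    finally show ?case by (simp add: prod.nat_ivl_Suc' mult.commute)
  qed
qed

lemma qcoef_indicator:
  assumes q: "q > 1" and k: "k \<le> m"
  shows "(\<Sum>i\<le>m. qcoef q i * (\<Prod>s<i. q ^ k - q ^ s)) = of_bool (k = 0)"
proof (cases "k = 0")
  case True
  have "(q ^ s - 1) / (q ^ s - 1) = 1" if "s \<in> {1..m}" for s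
    using one_less_power[OF q, of s] that by simp
  then show ?thesis using True by (simp add: qcoef_partial_sum[OF q])
next
  case False
  then have "(\<Prod>s=1..m. (q ^ s - q ^ k) / (q ^ s - 1)) = 0" using k by (intro prod_zero) auto
  then show ?thesis using False by (simp add: qcoef_partial_sum[OF q])
qed

section \<open>Joint moments for several polynomials\<close>

locale poly_model = lattice_model p n M' K Y
  for p n :: nat and M' :: int and K and Y +
  fixes l :: nat and Pj :: "nat \<Rightarrow> int poly"
  assumes mon: "\<And>j. j < l \<Longrightarrow> lead_coeff (Pj j) = 1" and dg: "\<And>j. j < l \<Longrightarrow> degree (Pj j) > 0"
    and irr: "\<And>j. j < l \<Longrightarrow> poly_mod.irreducible_m (int p) (Pj j)"
    and dist: "\<And>i j. i < l \<Longrightarrow> j < l \<Longrightarrow> i \<noteq> j \<Longrightarrow> poly_mod.Mp (int p) (Pj i) \<noteq> poly_mod.Mp (int p) (Pj j)"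
begin

text \<open>\<open>i j\<close> is the order of the moment taken for the polynomial \<open>j\<close>:
  the tuple contains \<open>i j\<close> vectors \<open>(j, a)\<close>, all subject to
  \<open>Pj j\<close>.\<close>

abbreviation "Ix i \<equiv> (SIGMA j:{..<l}. {..<i j})"
abbreviation "Pb \<equiv> (\<lambda>b::nat \<times> nat. Pj (fst b))"

lemma chain: "chain_model p n M' K Y (Ix i) Pb"
  by unfold_locales (use mon dg in auto)

text \<open>With \<open>orbt\<close> below, a copy of the chain notions that can be used for varying
  \<open>i\<close> outside an interpretation of \<open>chain_model\<close>.\<close>

definition JJ :: "(nat \<Rightarrow> nat) \<Rightarrow> ((nat \<times> nat) \<times> nat) set" where
  "JJ i = (SIGMA b:Ix i. {..<degree (Pb b)})"

lemma sum_JJ: "(\<Sum>x\<in>JJ i. f x) = (\<Sum>j<l. \<Sum>y\<in>{..<i j} \<times> {..<degree (Pj j)}. f ((j, fst y), snd y))"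
  for f :: "(nat \<times> nat) \<times> nat \<Rightarrow> 'c::comm_monoid_add"
proof -
  have "(\<Sum>x\<in>JJ i. f x) = (\<Sum>b\<in>Ix i. \<Sum>t<degree (Pb b). f (b, t))"
    unfolding JJ_def by (subst sum.Sigma) auto
  also have "\<dots> = (\<Sum>j<l. \<Sum>a<i j. \<Sum>t<degree (Pj j). f ((j, a), t))"
    by (subst sum.Sigma) (auto intro!: sum.cong)
  also have "\<dots> = (\<Sum>j<l. \<Sum>y\<in>{..<i j} \<times> {..<degree (Pj j)}. f ((j, fst y), snd y))"
    by (simp add: sum.cartesian_product split_beta)
  finally show ?thesis .
qed

lemma card_JJ: "card (JJ i) = (\<Sum>j<l. i j * degree (Pj j))"
proof -
  have "card (JJ i) = (\<Sum>x\<in>JJ i. 1)" by simp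
  also have "\<dots> = (\<Sum>j<l. i j * degree (Pj j))" unfolding sum_JJ by (simp add: card_cartesian_product)
  finally show ?thesis .
qed

definition orbt :: "(nat \<Rightarrow> nat \<Rightarrow> int) \<Rightarrow> (nat \<times> nat \<Rightarrow> nat \<Rightarrow> int) \<Rightarrow> (nat \<times> nat) \<times> nat \<Rightarrow> nat \<Rightarrow> int" where
  "orbt X v = (\<lambda>(b, t). (lin n X ^^ t) (v b))"

text \<open>The solution spaces of different \<open>j\<close> are killed modulo \<open>p\<close> by
  coprime polynomials. A joint relation thus splits, by \<open>coprime_torsion_sum\<close> for the
  lattice \<open>p Z ^ n\<close>, into one relation for each \<open>j\<close>.\<close>

lemma joint_indep:
  assumes X: "X \<in> XX" and v: "\<And>j a. j < l \<Longrightarrow> a < i j \<Longrightarrow> v (j, a) \<in> H X (Pj j)"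
  shows "indep_mod (int p) n (JJ i) (orbt X v)
    \<longleftrightarrow> (\<forall>j<l. indep_mod (int p) n ({..<i j} \<times> {..<degree (Pj j)}) (orb X (\<lambda>a. v (j, a))))"
proof -
  have sum: "(\<Sum>x\<in>JJ i. c x *z orbt X v x)
     = (\<Sum>j<l. \<Sum>y\<in>{..<i j} \<times> {..<degree (Pj j)}. c ((j, fst y), snd y) *z orb X (\<lambda>a. v (j, a)) y)" for c
    unfolding sum_JJ by (simp add: orbt_def orb_def split_beta)
  have memJJ: "((j, a), t) \<in> JJ i \<longleftrightarrow> j < l \<and> a < i j \<and> t < degree (Pj j)" for j a t
    by (auto simp: JJ_def)
  show ?thesis
  proof
    assume I: "indep_mod (int p) n (JJ i) (orbt X v)"
    show "\<forall>j<l. indep_mod (int p) n ({..<i j} \<times> {..<degree (Pj j)}) (orb X (\<lambda>a. v (j, a)))"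
    proof (rule allI, rule impI)
      fix j assume j: "j < l"
      show "indep_mod (int p) n ({..<i j} \<times> {..<degree (Pj j)}) (orb X (\<lambda>a. v (j, a)))"
        unfolding indep_mod_def
      proof (rule allI, rule impI)
        fix c assume c: "(\<Sum>y\<in>{..<i j} \<times> {..<degree (Pj j)}. c y *z orb X (\<lambda>a. v (j, a)) y) \<in> pL"
        define c' where "c' x = (if fst (fst x) = j then c (snd (fst x), snd x) else 0)" for x :: "(nat \<times> nat) \<times> nat"
        have "(\<Sum>x\<in>JJ i. c' x *z orbt X v x)
           = (\<Sum>k<l. if k = j then (\<Sum>y\<in>{..<i j} \<times> {..<degree (Pj j)}. c y *z orb X (\<lambda>a. v (j, a)) y) else 0)"
          unfolding sum by (intro sum.cong refl) (auto simp: c'_def)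
        also have "\<dots> = (\<Sum>y\<in>{..<i j} \<times> {..<degree (Pj j)}. c y *z orb X (\<lambda>a. v (j, a)) y)" using j by simp
        finally have "(\<Sum>x\<in>JJ i. c' x *z orbt X v x) \<in> pL" using c by (simp only:)
        then have d: "\<forall>x\<in>JJ i. int p dvd c' x" using spec[OF I[unfolded indep_mod_def], of c'] by blast
        show "\<forall>y\<in>{..<i j} \<times> {..<degree (Pj j)}. int p dvd c y"
        proof
          fix y assume y: "y \<in> {..<i j} \<times> {..<degree (Pj j)}"
          have "((j, fst y), snd y) \<in> JJ i" using y j memJJ by auto
          from bspec[OF d this] show "int p dvd c y" by (simp add: c'_def)
        qed
      qed
    qed
  next
    assume A: "\<forall>j<l. indep_mod (int p) n ({..<i j} \<times> {..<degree (Pj j)}) (orb X (\<lambda>a. v (j, a)))"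
    show "indep_mod (int p) n (JJ i) (orbt X v)"
      unfolding indep_mod_def
    proof (rule allI, rule impI)
      fix c assume c: "(\<Sum>x\<in>JJ i. c x *z orbt X v x) \<in> pL"
      define u where "u j = (\<Sum>y\<in>{..<i j} \<times> {..<degree (Pj j)}. c ((j, fst y), snd y) *z orb X (\<lambda>a. v (j, a)) y)" for j
      have uH: "u j \<in> H X (Pj j)" if j: "j < l" for j
        unfolding u_def
      proof (intro zlattice_sum[OF H_lattice[OF X]] zlattice_scale[OF H_lattice[OF X]])
        fix y assume "y \<in> {..<i j} \<times> {..<degree (Pj j)}"
        then show "orb X (\<lambda>a. v (j, a)) y \<in> H X (Pj j)"
          using orb_mem[OF X, of "\<lambda>a. v (j, a)" "fst y" "Pj j" "snd y"] v[OF j] by auto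
      qed
      have pL1: "zlattice n (int p ^ 1) pL" using zlattice_scaled[OF zlattice_UNIV[of n 1], of "int p"] by simp
      have u2: "u j \<in> zvecs n \<and> pact n X (Pj j) (u j) \<in> pL" if "j \<in> {..<l}" for j
        using uH[of j] that R_sub_pL unfolding H_def by blast
      have sm: "(\<Sum>j\<in>{..<l}. u j) \<in> pL" using c unfolding sum u_def .
      have uL: "u j \<in> pL" if j: "j < l" for j
        by (rule coprime_torsion_sum[where P = Pj and J = "{..<l}" and u = u, OF p pL1 XX_stable(4)[OF X] XX_zvecs[OF X] _ _ _ u2 sm])
          (use mon irr dist j in auto)
      have dv: "int p dvd c ((j, fst y), snd y)" if j: "j < l" and y: "y \<in> {..<i j} \<times> {..<degree (Pj j)}" for j y
        using spec[OF A[rule_format, OF j, unfolded indep_mod_def], of "\<lambda>y. c ((j, fst y), snd y)"] uL[OF j] y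
        unfolding u_def by blast
      show "\<forall>x\<in>JJ i. int p dvd c x"
      proof
        fix x assume x: "x \<in> JJ i"
        obtain j a t where jat: "x = ((j, a), t)" by (cases x) (metis surj_pair)
        then show "int p dvd c x" using dv[of j "(a, t)"] x memJJ by simp
      qed
    qed
  qed
qed

text \<open>Currying \<open>(j, a)\<close> is a bijection from joint tuples to families of
  sequences, because \<open>joint_indep\<close> imposes no condition linking different
  \<open>j\<close>.\<close>

lemma card_tuples:
  assumes X: "X \<in> XX"
  shows "card (chain_model.tuples p n M' K (Ix i) Pb X) = (\<Prod>j<l. card (seqs X (Pj j) (i j)))"
proof -
  interpret C: chain_model p n M' K Y "Ix i" Pb by (rule chain)
  have J: "C.J = JJ i" by (simp add: C.J_def JJ_def)
  have orb: "C.orbit X v = orbt X v" for v by (simp add: C.orbit_def orbt_def)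
  let ?F = "\<lambda>v. \<lambda>j\<in>{..<l}. \<lambda>a\<in>{..<i j}. v (j, a)"
  let ?G = "\<lambda>u. \<lambda>b\<in>Ix i. u (fst b) (snd b)"
  let ?T = "PiE {..<l} (\<lambda>j. seqs X (Pj j) (i j))"
  have orbcong: "indep_mod (int p) n ({..<s} \<times> {..<d}) (orb X v) \<longleftrightarrow> indep_mod (int p) n ({..<s} \<times> {..<d}) (orb X v')"
    if "\<And>a. a < s \<Longrightarrow> v a = v' a" for v v' s d
    by (rule indep_mod_cong[OF _ pLM]) (use that zlattice_0[OF pLM] in \<open>auto simp: orb_def\<close>)
  have T: "v \<in> C.tuples X \<longleftrightarrow> v \<in> PiE (Ix i) (\<lambda>_. B) \<and> (\<forall>j<l. \<forall>a<i j. v (j, a) \<in> H X (Pj j)) \<and> indep_mod (int p) n (JJ i) (orbt X v)" for v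
  proof -
    have "(\<forall>b\<in>Ix i. pact n X (Pb b) (v b) \<in> R) \<longleftrightarrow> (\<forall>j<l. \<forall>a<i j. v (j, a) \<in> H X (Pj j))" if "v \<in> PiE (Ix i) (\<lambda>_. B)"
    proof -
      have "v (j, a) \<in> zvecs n" if "j < l" "a < i j" for j a
        using PiE_mem[OF \<open>v \<in> PiE (Ix i) (\<lambda>_. B)\<close>, of "(j, a)"] that zbox_zvecs by simp
      then show ?thesis by (simp add: H_def Ball_def imp_conjL)
    qed
    then show ?thesis unfolding C.tuples_def J orb by blast
  qed
  have F: "?F v \<in> ?T" if v: "v \<in> C.tuples X" for v
  proof (rule restrict_PiE_iff[THEN iffD2], rule ballI)
    fix j assume "j \<in> {..<l}"
    then have j: "j < l" by simp
    have vH: "v (j, a) \<in> H X (Pj j)" if "j < l" "a < i j" for j a using v that unfolding T by blast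
    have vB: "v (j, a) \<in> B" if "a < i j" for a using v that j unfolding T by (auto simp: PiE_iff)
    have "indep_mod (int p) n ({..<i j} \<times> {..<degree (Pj j)}) (orb X (\<lambda>a. v (j, a)))"
      using joint_indep[OF X vH] v j unfolding T by blast
    then have "indep_mod (int p) n ({..<i j} \<times> {..<degree (Pj j)}) (orb X (\<lambda>a\<in>{..<i j}. v (j, a)))"
      using orbcong[of "i j" "\<lambda>a. v (j, a)" "\<lambda>a\<in>{..<i j}. v (j, a)"] by simp
    then show "(\<lambda>a\<in>{..<i j}. v (j, a)) \<in> seqs X (Pj j) (i j)"
      unfolding seqs_def using vH[OF j] vB by simp
  qed
  have G: "?G u \<in> C.tuples X" if u: "u \<in> ?T" for u
  proof -
    have us: "u j \<in> seqs X (Pj j) (i j)" if "j < l" for j using u that by (simp add: PiE_iff)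
    have uH: "u j a \<in> H X (Pj j)" "u j a \<in> B" if "j < l" "a < i j" for j a
      using us[OF that(1)] that(2) by (auto simp: seqs_def PiE_iff)
    have GH: "?G u (j, a) \<in> H X (Pj j)" if "j < l" "a < i j" for j a using uH that by simp
    have "indep_mod (int p) n ({..<i j} \<times> {..<degree (Pj j)}) (orb X (\<lambda>a. ?G u (j, a)))" if j: "j < l" for j
      using us[OF j] orbcong[of "i j" "u j" "\<lambda>a. ?G u (j, a)"] j by (simp add: seqs_def)
    then have "indep_mod (int p) n (JJ i) (orbt X (?G u))" using joint_indep[OF X GH] by blast
    moreover have "?G u \<in> PiE (Ix i) (\<lambda>_. B)" using uH(2) by auto
    ultimately show ?thesis unfolding T using GH by blast
  qed
  have GF: "?G (?F v) = v" if v: "v \<in> C.tuples X" for v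
  proof
    fix b show "?G (?F v) b = v b"
    proof (cases "b \<in> Ix i")
      case True then show ?thesis by auto
    next
      case False
      have "v \<in> PiE (Ix i) (\<lambda>_. B)" using v unfolding T by blast
      from PiE_arb[OF this False] show ?thesis using False by (simp only: restrict_apply if_False)
    qed
  qed
  have FG: "?F (?G u) = u" if u: "u \<in> ?T" for u
  proof
    fix j show "?F (?G u) j = u j"
    proof (cases "j < l")
      case True
      then have "u j \<in> extensional {..<i j}" using u by (auto simp: PiE_iff seqs_def)
      then show ?thesis using True by (auto simp: fun_eq_iff extensional_def)
    next
      case False
      then have "u j = undefined" using u by (auto simp: PiE_def extensional_def)
      then show ?thesis using False by simp
    qed
  qed
  have "bij_betw ?F (C.tuples X) ?T"
    by (rule bij_betw_byWitness[where f' = ?G]) (use F G GF FG in blast)+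
  then have "card (C.tuples X) = card ?T" by (rule bij_betw_same_card)
  then show ?thesis by (simp add: card_PiE)
qed

lemma H_subset_iff:
  assumes X: "X \<in> XX"
  shows "H X Q \<subseteq> pL \<longleftrightarrow> card (H X Q \<inter> B) = et Q"
proof -
  have sub: "(H X Q \<inter> pL) \<inter> B \<subseteq> H X Q \<inter> B" by blast
  have fin: "finite (H X Q \<inter> B)" using finB by blast
  show ?thesis
  proof
    assume "H X Q \<subseteq> pL"
    then have "(H X Q \<inter> pL) \<inter> B = H X Q \<inter> B" by blast
    then show "card (H X Q \<inter> B) = et Q" using et_eq[OF X, of Q] by simp
  next
    assume "card (H X Q \<inter> B) = et Q"
    then have eq: "(H X Q \<inter> pL) \<inter> B = H X Q \<inter> B"
      using card_subset_eq[OF fin sub] et_eq[OF X, of Q] by simp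
    show "H X Q \<subseteq> pL"
    proof
      fix v assume v: "v \<in> H X Q"
      have vz: "v \<in> zvecs n" using zlattice_zvecs[OF H_lattice[OF X] v] .
      have "zred M v \<in> H X Q \<inter> B" using zlattice_zred_iff[OF H_lattice[OF X] vz] v zred_in_zbox[OF M0 vz] by simp
      then have "zred M v \<in> pL" using eq by blast
      then show "v \<in> pL" using zlattice_zred_iff[OF pLM vz] by blast
    qed
  qed
qed

definition qd where "qd j = real (p ^ degree (Pj j))"

lemma qd_gt_1: "j < l \<Longrightarrow> qd j > 1"
  using one_less_power[OF prime_gt_1_nat[OF p] dg] unfolding qd_def by (metis of_nat_1 of_nat_less_iff)

text \<open>\<open>E\<close> is the share of independent chains in \<open>W\<close>. Dividing
  \<open>sum_tuples\<close> by the trivial solutions \<open>et\<close> leaves the average over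
  \<open>X\<close> of the number of independent tuples in spaces of dimensions \<open>k X j\<close>,
  and \<open>card_dependent\<close> bounds \<open>1 - E\<close>.\<close>

lemma moments:
  assumes k: "\<And>X j. X \<in> XX \<Longrightarrow> j < l \<Longrightarrow> card (H X (Pj j) \<inter> B) = (p ^ degree (Pj j)) ^ k X j * et (Pj j)"
  shows "\<exists>E\<le>1. 1 - E \<le> real (card B) / real cK / real p ^ n * (\<Prod>j<l. qd j ^ i j) \<and>
     (\<Sum>X\<in>XX. \<Prod>j<l. \<Prod>s<i j. qd j ^ k X j - qd j ^ s) = real (card XX) * E"
proof -
  interpret C: chain_model p n M' K Y "Ix i" Pb by (rule chain)
  have J: "C.J = JJ i" by (simp add: C.J_def JJ_def)
  let ?W = "C.chain_set K Y"
  let ?Wi = "{w \<in> ?W. indep_mod (int p) n (JJ i) w}" and ?Wd = "{w \<in> ?W. \<not> indep_mod (int p) n (JJ i) w}"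
  have eta: "C.eta b = et (Pb b)" for b by (simp add: C.eta_def et_def C.Gam_def Gm_def)
  have eta_prod: "(\<Prod>b\<in>Ix i. C.eta b) = (\<Prod>j<l. et (Pj j) ^ i j)"
  proof -
    have "(\<Prod>b\<in>Ix i. et (Pb b)) = (\<Prod>j<l. \<Prod>a<i j. et (Pj j))" by (subst prod.Sigma) (auto simp: split_beta)
    then show ?thesis unfolding eta by simp
  qed
  have etp: "(\<Prod>j<l. et (Pj j) ^ i j) > 0" using et_pos by (intro prod_pos) simp
  have Wpos: "card ?W > 0" unfolding C.card_W eta_prod using etp cR_pos p0 by simp
  have split: "card ?W = card ?Wi + card ?Wd"
  proof -
    have "?W = ?Wi \<union> ?Wd" "?Wi \<inter> ?Wd = {}" by blast+
    then show ?thesis using card_Un_disjoint[of ?Wi ?Wd] C.finW[of K Y] by simp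
  qed
  define E where "E = real (card ?Wi) / real (card ?W)"
  define w wi wd where "w = real (card ?W)" and "wi = real (card ?Wi)" and "wd = real (card ?Wd)"
  have w: "w > 0" "w = wi + wd" "wi \<ge> 0" "wd \<ge> 0" "E = wi / w"
    using Wpos arg_cong[OF split, of real] unfolding w_def wi_def wd_def E_def
    by (simp_all only: of_nat_add of_nat_0_less_iff of_nat_0_le_iff)
  have "E \<le> 1" using w by simp
  moreover have "1 - E \<le> real (card B) / real cK / real p ^ n * (\<Prod>j<l. qd j ^ i j)"
  proof -
    define c b L where "c = real cK" and "b = real (card B)" and "L = real p ^ n"
    have c: "c > 0" using cK_pos by (simp add: c_def)
    have "wd * c \<le> real p ^ card (JJ i) * (w * real (card (pL \<inter> B)))"
      using of_nat_mono[OF C.card_dependent[unfolded J], where 'a = real] by (simp add: wd_def w_def c_def)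
    moreover have "real (card (pL \<inter> B)) = b / L" using card_pL p0 by (simp add: b_def L_def)
    moreover have "real p ^ card (JJ i) = (\<Prod>j<l. qd j ^ i j)"
      unfolding card_JJ by (simp add: power_sum qd_def power_mult[symmetric] mult.commute)
    ultimately have 1: "wd * c \<le> (b / L * (\<Prod>j<l. qd j ^ i j)) * w" by (simp add: mult_ac)
    have "1 - E = wd / w" using w by (simp add: field_simps)
    also have "\<dots> \<le> b / L * (\<Prod>j<l. qd j ^ i j) / c"
      using 1 w(1) c by (simp only: pos_divide_le_eq pos_le_divide_eq times_divide_eq_left)
    finally show ?thesis unfolding c_def b_def L_def by (simp add: mult_ac)
  qed
  moreover have "(\<Sum>X\<in>XX. \<Prod>j<l. \<Prod>s<i j. qd j ^ k X j - qd j ^ s) = real (card XX) * E"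
  proof -
    have seq: "real (card (seqs X (Pj j) (i j))) = real (et (Pj j)) ^ i j * (\<Prod>s<i j. qd j ^ k X j - qd j ^ s)"
      if X: "X \<in> XX" and j: "j < l" for X j
    proof -
      have "real (card (seqs X (Pj j) (i j))) = (\<Prod>s<i j. real (et (Pj j)) * (qd j ^ k X j - qd j ^ s))"
        unfolding card_seqs[OF X mon[OF j] dg[OF j] irr[OF j]] k[OF X j] qd_def
        by (intro prod.cong) (simp_all add: algebra_simps)
      then show ?thesis by (simp add: prod.distrib)
    qed
    have "real (card (C.tuples X)) = real (\<Prod>j<l. et (Pj j) ^ i j) * (\<Prod>j<l. \<Prod>s<i j. qd j ^ k X j - qd j ^ s)"
      if X: "X \<in> XX" for X
    proof -
      have "real (card (C.tuples X)) = (\<Prod>j<l. real (card (seqs X (Pj j) (i j))))" unfolding card_tuples[OF X] by simp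
      also have "\<dots> = (\<Prod>j<l. real (et (Pj j)) ^ i j * (\<Prod>s<i j. qd j ^ k X j - qd j ^ s))"
        by (intro prod.cong refl seq[OF X]) simp
      finally show ?thesis by (simp add: prod.distrib)
    qed
    then have "(\<Sum>X\<in>XX. real (card (C.tuples X)))
       = real (\<Prod>j<l. et (Pj j) ^ i j) * (\<Sum>X\<in>XX. \<Prod>j<l. \<Prod>s<i j. qd j ^ k X j - qd j ^ s)"
      by (simp add: sum_distrib_left)
    moreover have "(\<Sum>X\<in>XX. real (card (C.tuples X))) * real (card ?W)
        = real (card ?Wi) * real (card XX) * real (\<Prod>j<l. et (Pj j) ^ i j)"
      using arg_cong[OF C.sum_tuples[unfolded J eta_prod], of real] by simp
    ultimately have eq: "real (\<Prod>j<l. et (Pj j) ^ i j) * ((\<Sum>X\<in>XX. \<Prod>j<l. \<Prod>s<i j. qd j ^ k X j - qd j ^ s) * real (card ?W))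
        = real (\<Prod>j<l. et (Pj j) ^ i j) * (real (card ?Wi) * real (card XX))" by (simp only: ac_simps)
    have nz: "real (\<Prod>j<l. et (Pj j) ^ i j) \<noteq> 0" using etp by linarith
    have "(\<Sum>X\<in>XX. \<Prod>j<l. \<Prod>s<i j. qd j ^ k X j - qd j ^ s) * real (card ?W) = real (card ?Wi) * real (card XX)"
      by (rule iffD1[OF mult_left_cancel[OF nz] eq])
    then have "(\<Sum>X\<in>XX. \<Prod>j<l. \<Prod>s<i j. qd j ^ k X j - qd j ^ s) * w = wi * real (card XX)"
      by (simp only: w_def wi_def)
    then show ?thesis using w(1) unfolding w(5) by (simp add: field_simps)
  qed
  ultimately show ?thesis by blast
qed

text \<open>The indicator that all solution spaces vanish is a product over \<open>j\<close> of
  alternating sums of moments; replacing each moment by 1 gives the main term. Here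
  \<open>card B / cK\<close> is the index of \<open>K\<close> in \<open>Z ^ n\<close>, a fixed
  number in the application, so the bound is of order \<open>p ^ - n\<close>.\<close>

lemma torsion_free_fraction:
  "\<bar>real (card {X \<in> XX. \<forall>j<l. H X (Pj j) \<subseteq> pL}) / real (card XX) - (\<Prod>j<l. \<Sum>i\<le>card B. qcoef (qd j) i)\<bar>
    \<le> real (card B) / real cK / real p ^ n * (\<Prod>j<l. \<Sum>i\<le>card B. \<bar>qcoef (qd j) i\<bar> * qd j ^ i)"
proof -
  let ?b = "card B" and ?g = "real (card B) / real cK / real p ^ n"
  have "\<exists>k. k < ?b \<and> card (H X (Pj j) \<inter> B) = (p ^ degree (Pj j)) ^ k * et (Pj j)" if "X \<in> XX" "j < l" for X j
    using card_H[OF that(1) mon[OF that(2)] dg[OF that(2)] irr[OF that(2)]] by blast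
  then obtain k where k: "\<And>X j. X \<in> XX \<Longrightarrow> j < l \<Longrightarrow> k X j < ?b"
      "\<And>X j. X \<in> XX \<Longrightarrow> j < l \<Longrightarrow> card (H X (Pj j) \<inter> B) = (p ^ degree (Pj j)) ^ k X j * et (Pj j)"
    by metis
  have k0: "H X (Pj j) \<subseteq> pL \<longleftrightarrow> k X j = 0" if X: "X \<in> XX" and j: "j < l" for X j
  proof -
    have q: "p ^ degree (Pj j) > 1" using one_less_power[OF prime_gt_1_nat[OF p] dg[OF j]] .
    have "(p ^ degree (Pj j)) ^ k X j = 1 \<longleftrightarrow> k X j = 0"
      using one_less_power[OF q, of "k X j"] dg[OF j] by (cases "k X j") auto
    then show ?thesis unfolding H_subset_iff[OF X] k(2)[OF X j] using et_pos[of "Pj j"] by simp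
  qed
  have "\<forall>i. \<exists>E\<le>1. 1 - E \<le> ?g * (\<Prod>j<l. qd j ^ i j) \<and>
     (\<Sum>X\<in>XX. \<Prod>j<l. \<Prod>s<i j. qd j ^ k X j - qd j ^ s) = real (card XX) * E"
    by (rule allI) (rule moments[OF k(2)])
  from choice[OF this] obtain E where E0: "\<forall>i. E i \<le> 1 \<and> 1 - E i \<le> ?g * (\<Prod>j<l. qd j ^ i j) \<and>
     (\<Sum>X\<in>XX. \<Prod>j<l. \<Prod>s<i j. qd j ^ k X j - qd j ^ s) = real (card XX) * E i" ..
  have E: "E i \<le> 1" "1 - E i \<le> ?g * (\<Prod>j<l. qd j ^ i j)"
     "(\<Sum>X\<in>XX. \<Prod>j<l. \<Prod>s<i j. qd j ^ k X j - qd j ^ s) = real (card XX) * E i" for i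
    by (rule conjunct1[OF spec[OF E0]], rule conjunct1[OF conjunct2[OF spec[OF E0]]],
        rule conjunct2[OF conjunct2[OF spec[OF E0]]])
  let ?I = "PiE {..<l} (\<lambda>_. {..?b})"
  have finI: "finite ?I" by (simp add: finite_PiE)
  have XXpos: "real (card XX) > 0" using card_mats_over[OF KM M0 Y] cK_pos by simp
  have "real (card {X \<in> XX. \<forall>j<l. H X (Pj j) \<subseteq> pL}) = (\<Sum>X\<in>XX. of_bool (\<forall>j<l. H X (Pj j) \<subseteq> pL))"
    using finXX by (simp add: of_bool_def sum.If_cases Int_def)
  also have "\<dots> = (\<Sum>X\<in>XX. \<Prod>j<l. of_bool (k X j = 0))"
  proof (rule sum.cong[OF refl])
    fix X assume X: "X \<in> XX"
    have "(\<Prod>j<l. of_bool (k X j = 0) :: real) = of_bool (\<forall>j<l. k X j = 0)"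
      by (induction l) (auto simp: less_Suc_eq)
    then show "(of_bool (\<forall>j<l. H X (Pj j) \<subseteq> pL) :: real) = (\<Prod>j<l. of_bool (k X j = 0))" using k0[OF X] by simp
  qed
  \<comment> \<open>Cutting the sums at \<open>?b\<close> loses nothing, since every dimension
    \<open>k X j\<close> is smaller.\<close>
  also have "\<dots> = (\<Sum>X\<in>XX. \<Prod>j<l. \<Sum>i\<le>?b. qcoef (qd j) i * (\<Prod>s<i. qd j ^ k X j - qd j ^ s))"
    by (intro sum.cong prod.cong refl) (use k(1) qd_gt_1 in \<open>simp add: qcoef_indicator less_imp_le\<close>)
  also have "\<dots> = (\<Sum>X\<in>XX. \<Sum>i\<in>?I. \<Prod>j<l. qcoef (qd j) (i j) * (\<Prod>s<i j. qd j ^ k X j - qd j ^ s))"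
    by (intro sum.cong refl prod_sum_PiE) auto
  also have "\<dots> = (\<Sum>i\<in>?I. \<Sum>X\<in>XX. \<Prod>j<l. qcoef (qd j) (i j) * (\<Prod>s<i j. qd j ^ k X j - qd j ^ s))"
    by (rule sum.swap)
  also have "\<dots> = (\<Sum>i\<in>?I. (\<Prod>j<l. qcoef (qd j) (i j)) * (\<Sum>X\<in>XX. \<Prod>j<l. \<Prod>s<i j. qd j ^ k X j - qd j ^ s))"
    by (simp add: prod.distrib sum_distrib_left)
  also have "\<dots> = real (card XX) * (\<Sum>i\<in>?I. (\<Prod>j<l. qcoef (qd j) (i j)) * E i)"
    unfolding E(3) by (simp add: sum_distrib_left mult_ac)
  finally have frac: "real (card {X \<in> XX. \<forall>j<l. H X (Pj j) \<subseteq> pL}) / real (card XX) = (\<Sum>i\<in>?I. (\<Prod>j<l. qcoef (qd j) (i j)) * E i)"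
    using XXpos by simp
  have lim: "(\<Prod>j<l. \<Sum>i\<le>?b. qcoef (qd j) i) = (\<Sum>i\<in>?I. \<Prod>j<l. qcoef (qd j) (i j))"
    by (rule prod_sum_PiE) auto
  have "\<bar>(\<Sum>i\<in>?I. (\<Prod>j<l. qcoef (qd j) (i j)) * E i) - (\<Sum>i\<in>?I. \<Prod>j<l. qcoef (qd j) (i j))\<bar>
     = \<bar>\<Sum>i\<in>?I. (\<Prod>j<l. qcoef (qd j) (i j)) * (E i - 1)\<bar>"
    by (simp add: sum_subtractf[symmetric] right_diff_distrib)
  also have "\<dots> \<le> (\<Sum>i\<in>?I. \<bar>(\<Prod>j<l. qcoef (qd j) (i j)) * (E i - 1)\<bar>)" by (rule sum_abs)
  also have "\<dots> \<le> (\<Sum>i\<in>?I. ?g * (\<Prod>j<l. \<bar>qcoef (qd j) (i j)\<bar> * qd j ^ i j))"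
  proof (rule sum_mono)
    fix i
    have "\<bar>(\<Prod>j<l. qcoef (qd j) (i j)) * (E i - 1)\<bar> = (\<Prod>j<l. \<bar>qcoef (qd j) (i j)\<bar>) * (1 - E i)"
      using E(1)[of i] by (simp add: abs_mult abs_prod)
    also have "\<dots> \<le> (\<Prod>j<l. \<bar>qcoef (qd j) (i j)\<bar>) * (?g * (\<Prod>j<l. qd j ^ i j))"
      by (rule mult_left_mono[OF E(2)]) (simp add: prod_nonneg)
    finally show "\<bar>(\<Prod>j<l. qcoef (qd j) (i j)) * (E i - 1)\<bar> \<le> ?g * (\<Prod>j<l. \<bar>qcoef (qd j) (i j)\<bar> * qd j ^ i j)"
      by (simp add: prod.distrib mult_ac)
  qed
  also have "\<dots> = ?g * (\<Prod>j<l. \<Sum>i\<le>?b. \<bar>qcoef (qd j) i\<bar> * qd j ^ i)"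
    unfolding sum_distrib_left[symmetric] by (subst prod_sum_PiE) auto
  finally show ?thesis unfolding frac lim .
qed

end

section \<open>Convergence of Euler's expansion\<close>

lemma qcoef_0: "qcoef q 0 = 1"
  by (simp add: qcoef_def numeral_2_eq_2)

text \<open>Successive terms have ratio \<open>\<bar>z\<bar> / (q ^ Suc i - 1)\<close>, eventually
  at most 1/2. The value \<open>z = q\<close> bounds the error term; general \<open>z\<close> is
  needed for the power series in Euler's identity.\<close>

lemma summable_qcoef:
  assumes q: "q > 1" shows "summable (\<lambda>i. \<bar>qcoef q i\<bar> * \<bar>z\<bar> ^ i)"
proof -
  obtain N where N: "\<And>i. i \<ge> N \<Longrightarrow> 2 * \<bar>z\<bar> + 1 < q ^ i"
  proof -
    obtain N where "2 * \<bar>z\<bar> + 1 < q ^ N" using real_arch_pow[OF q] by blast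
    moreover have "q ^ N \<le> q ^ i" if "i \<ge> N" for i using power_increasing[OF that, of q] q by simp
    ultimately show ?thesis using that[of N] by (meson less_le_trans)
  qed
  show ?thesis
  proof (rule summable_ratio_test[where c = "1/2" and N = N])
    fix i assume "i \<ge> N"
    then have i: "2 * \<bar>z\<bar> + 1 < q ^ Suc i" using N[of "Suc i"] by simp
    then have d: "q ^ Suc i - 1 > 0" "2 * \<bar>z\<bar> \<le> q ^ Suc i - 1" by auto
    have r: "\<bar>z\<bar> / (q ^ Suc i - 1) \<le> 1/2" using d by (simp add: divide_simps)
    have "norm (\<bar>qcoef q (Suc i)\<bar> * \<bar>z\<bar> ^ Suc i) = (\<bar>qcoef q i\<bar> * \<bar>z\<bar> ^ i) * (\<bar>z\<bar> / (q ^ Suc i - 1))"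
      unfolding qcoef_Suc[OF q] using d(1) by (simp add: abs_mult)
    also have "\<dots> \<le> (\<bar>qcoef q i\<bar> * \<bar>z\<bar> ^ i) * (1/2)" by (rule mult_left_mono[OF r]) simp
    finally show "norm (\<bar>qcoef q (Suc i)\<bar> * \<bar>z\<bar> ^ Suc i) \<le> 1/2 * norm (\<bar>qcoef q i\<bar> * \<bar>z\<bar> ^ i)" by simp
  qed simp
qed

lemma summable_qcoef': assumes q: "q > 1" shows "summable (\<lambda>i. qcoef q i * z ^ i)"
  by (rule summable_rabs_cancel) (use summable_qcoef[OF q, of z] in \<open>simp add: abs_mult power_abs\<close>)

text \<open>Euler's identity, from the functional equation \<open>f(q w) = (1 - w) f(w)\<close> of \<open>f(z) = \<Sum> c_i z^i\<close>.\<close>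
lemma sums_qcoef:
  assumes q: "q > 1"
  shows "(\<lambda>m. \<Sum>i\<le>m. qcoef q i) \<longlonglongrightarrow> (\<Prod>i. 1 - 1 / q ^ Suc i)"
proof -
  define f where "f z = (\<Sum>i. qcoef q i * z ^ i)" for z
  have fe: "f (q * w) = (1 - w) * f w" for w
  proof -
    have "f (q * w) - f w = (\<Sum>i. qcoef q i * (q * w) ^ i - qcoef q i * w ^ i)"
      unfolding f_def by (rule suminf_diff) (rule summable_qcoef'[OF q])+
    also have "\<dots> = (\<Sum>i. qcoef q (Suc i) * (q * w) ^ Suc i - qcoef q (Suc i) * w ^ Suc i)"
      using suminf_split_head[OF summable_diff[OF summable_qcoef'[OF q, of "q * w"] summable_qcoef'[OF q, of w]]] by simp
    also have "\<dots> = (\<Sum>i. - w * (qcoef q i * w ^ i))"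
    proof (rule suminf_cong)
      fix i
      have "q ^ Suc i - 1 \<noteq> 0" using one_less_power[OF q, of "Suc i"] by simp
      then have "qcoef q (Suc i) * (q ^ Suc i - 1) = - qcoef q i" unfolding qcoef_Suc[OF q] by simp
      then have "qcoef q (Suc i) * (q ^ Suc i - 1) * w ^ Suc i = - qcoef q i * w ^ Suc i" by simp
      then show "qcoef q (Suc i) * (q * w) ^ Suc i - qcoef q (Suc i) * w ^ Suc i = - w * (qcoef q i * w ^ i)"
        by (simp add: power_mult_distrib algebra_simps)
    qed
    also have "\<dots> = - w * f w" unfolding f_def by (rule suminf_mult[OF summable_qcoef'[OF q]])
    finally show ?thesis by (simp add: algebra_simps)
  qed
  have f1: "f 1 = (\<Prod>s<m. 1 - 1 / q ^ Suc s) * f (1 / q ^ m)" for m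
  proof (induction m)
    case (Suc m)
    have "f (1 / q ^ m) = (1 - 1 / q ^ Suc m) * f (1 / q ^ Suc m)" using fe[of "1 / q ^ Suc m"] q by simp
    then show ?case using Suc by simp
  qed simp
  have "isCont f 0" unfolding f_def
    by (rule isCont_powser[where K = 1]) (use summable_qcoef'[OF q, of 1] in simp_all)
  moreover have z: "(\<lambda>m. 1 / q ^ m) \<longlonglongrightarrow> 0"
  proof -
    have "(\<lambda>m. (1 / q) ^ m) \<longlonglongrightarrow> 0" by (rule LIMSEQ_power_zero) (use q in simp)
    then show ?thesis by (simp add: power_divide)
  qed
  ultimately have "(\<lambda>m. f (1 / q ^ m)) \<longlonglongrightarrow> f 0" using isCont_tendsto_compose by blast
  moreover have "f 0 = 1" unfolding f_def using powser_zero[of "qcoef q"] by (simp add: qcoef_0)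
  ultimately have fl: "(\<lambda>m. f (1 / q ^ m)) \<longlonglongrightarrow> 1" by simp
  have "summable (\<lambda>i. norm ((1 - 1 / q ^ Suc i) - 1))"
  proof -
    have "summable (\<lambda>i. (1 / q) ^ Suc i)" by (rule summable_ignore_initial_segment[of _ 1, simplified]) (use q in \<open>simp add: summable_geometric\<close>)
    then show ?thesis using q by (simp add: power_divide)
  qed
  then have "abs_convergent_prod (\<lambda>i. 1 - 1 / q ^ Suc i)" by (simp add: abs_convergent_prod_conv_summable)
  then have "convergent_prod (\<lambda>i. 1 - 1 / q ^ Suc i)" by (rule abs_convergent_prod_imp_convergent_prod)
  then have "(\<lambda>m. \<Prod>i\<le>m. 1 - 1 / q ^ Suc i) \<longlonglongrightarrow> (\<Prod>i. 1 - 1 / q ^ Suc i)" by (rule convergent_prod_LIMSEQ)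
  then have "(\<lambda>m. \<Prod>i<Suc m. 1 - 1 / q ^ Suc i) \<longlonglongrightarrow> (\<Prod>i. 1 - 1 / q ^ Suc i)"
    by (simp only: lessThan_Suc_atMost)
  then have "(\<lambda>m. \<Prod>i<m. 1 - 1 / q ^ Suc i) \<longlonglongrightarrow> (\<Prod>i. 1 - 1 / q ^ Suc i)"
    by (rule LIMSEQ_imp_Suc)
  from tendsto_mult[OF this fl] have "(\<lambda>m. f 1) \<longlonglongrightarrow> (\<Prod>i. 1 - 1 / q ^ Suc i) * 1" by (simp only: f1[symmetric])
  then have "f 1 = (\<Prod>i. 1 - 1 / q ^ Suc i)" by (simp add: LIMSEQ_const_iff)
  moreover have "(\<lambda>m. \<Sum>i\<le>m. qcoef q i) \<longlonglongrightarrow> f 1"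
    using summable_LIMSEQ'[OF summable_qcoef'[OF q, of 1]] by (simp add: f_def)
  ultimately show ?thesis by simp
qed

section \<open>From the image condition to injectivity modulo p\<close>

lemma card_inj_iff_surj:
  assumes "finite A" "finite C" "card A = card C" "f ` A \<subseteq> C"
  shows "inj_on f A \<longleftrightarrow> C \<subseteq> f ` A"
proof
  assume "inj_on f A"
  then have "card (f ` A) = card C" using assms by (simp add: card_image)
  then show "C \<subseteq> f ` A" using card_subset_eq[OF assms(2,4)] by simp
next
  assume "C \<subseteq> f ` A"
  then have "f ` A = C" using assms by blast
  then show "inj_on f A" using assms by (intro eq_card_imp_inj_on) simp_all
qed

text \<open>\<open>Q(X)\<close> induces a map from \<open>Z ^ n / p\<close> to
  \<open>K / p K\<close>. Both have \<open>p ^ n\<close> elements by \<open>card_scaled\<close>, so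
  injectivity and surjectivity of this map agree.\<close>

lemma injective_iff_surjective_mod_p:
  fixes p :: nat
  assumes p: "prime p" and M': "M' > 0" and K: "zlattice n M' K" and X: "\<And>l. l < n \<Longrightarrow> X l \<in> zvecs n"
    and im: "\<And>v. v \<in> zvecs n \<Longrightarrow> pact n X Q v \<in> K"
  shows "(\<forall>v\<in>zvecs n. pact n X Q v \<in> (*z) (int p) ` K \<longrightarrow> v \<in> (*z) (int p) ` zvecs n)
     \<longleftrightarrow> (\<forall>k\<in>K. \<exists>w\<in>zvecs n. k - pact n X Q w \<in> (*z) (int p) ` K)"
proof -
  let ?R = "(*z) (int p) ` K" and ?L = "(*z) (int p) ` zvecs n"
  define M where "M = int p * M'"
  let ?B = "zbox n M" and ?C = "zbox n (int p)"
  have p0: "int p > 0" using p prime_gt_0_nat by simp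
  have M: "M > 0" using p0 M' by (simp add: M_def)
  have KM: "zlattice n M K" unfolding M_def by (rule zlattice_mult_modulus[OF K])
  have RM: "zlattice n M ?R" unfolding M_def by (rule zlattice_scaled[OF K])
  have L1: "zlattice n (int p) ?L" using zlattice_scaled[OF zlattice_UNIV[of n 1], of "int p"] by simp
  \<comment> \<open>A map between boxes in place of the map between quotients: the summand
    \<open>r\<close> runs through representatives of \<open>p K\<close>, so that source and target
    have the same size and \<open>f\<close> is injective or surjective exactly when the induced map
    is.\<close>
  define f where "f = (\<lambda>(w, r). zred M (r + pact n X Q w))"
  let ?A = "?C \<times> (?R \<inter> ?B)"
  have fin: "finite ?A" "finite (K \<inter> ?B)" using card_zbox(2)[OF M] card_zbox(2)[OF p0] by simp_all
  have crd: "card ?A = card (K \<inter> ?B)"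
    using card_scaled[OF K M' p0] card_zbox(1)[OF p0] by (simp add: card_cartesian_product M_def)
  have RK: "r \<in> K" if "r \<in> ?R" for r using scaled_subset[OF K] that by blast
  have KZ: "r \<in> zvecs n" if "r \<in> K" for r using zlattice_zvecs[OF K that] .
  have pw: "pact n X Q v - pact n X Q (zred (int p) v) \<in> ?R" if v: "v \<in> zvecs n" for v
  proof -
    obtain u where u: "u \<in> zvecs n" "zred (int p) v = v - int p *z u" using zred_diff_obtain[OF v] .
    have "pact n X Q v - pact n X Q (zred (int p) v) = int p *z pact n X Q u"
      by (simp add: u(2) pact_vec_diff pact_vec_zscale)
    then show ?thesis using im[OF u(1)] by simp
  qed
  have img: "f ` ?A \<subseteq> K \<inter> ?B"
  proof (rule image_subsetI)
    fix a assume a: "a \<in> ?A"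
    obtain w r where wr: "a = (w, r)" by (cases a)
    have w: "w \<in> zvecs n" and r: "r \<in> ?R" using a zbox_zvecs unfolding wr by blast+
    have s: "r + pact n X Q w \<in> K" using zlattice_add[OF K RK[OF r] im[OF w]] .
    show "f a \<in> K \<inter> ?B" unfolding wr f_def prod.case
      using zlattice_zred_iff[OF KM KZ[OF s]] s zred_in_zbox[OF M KZ[OF s]] by blast
  qed
  have inj: "inj_on f ?A \<longleftrightarrow> (\<forall>v\<in>zvecs n. pact n X Q v \<in> ?R \<longrightarrow> v \<in> ?L)"
  proof
    assume inj: "inj_on f ?A"
    show "\<forall>v\<in>zvecs n. pact n X Q v \<in> ?R \<longrightarrow> v \<in> ?L"
    proof (rule ballI, rule impI)
      fix v assume v: "v \<in> zvecs n" and vR: "pact n X Q v \<in> ?R"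
      let ?w = "zred (int p) v"
      have wC: "?w \<in> ?C" by (rule zred_in_zbox[OF p0 v])
      have "pact n X Q v - (pact n X Q v - pact n X Q ?w) \<in> ?R" by (rule zlattice_diff[OF RM vR pw[OF v]])
      then have wR: "pact n X Q ?w \<in> ?R" by simp
      define r where "r = zred M (- pact n X Q ?w)"
      have z: "- pact n X Q ?w \<in> zvecs n" using zlattice_zvecs[OF RM zlattice_minus[OF RM wR]] .
      have rA: "r \<in> ?R \<inter> ?B" unfolding r_def
        using zlattice_zred_iff[OF RM z] zlattice_minus[OF RM wR] zred_in_zbox[OF M z] by blast
      have f0: "f (?w, r) = f (0, 0)"
        by (simp add: f_def r_def zred_def fun_eq_iff pointwise mod_add_left_eq)
      have zA: "(0, 0) \<in> ?A" using zlattice_0[OF RM] p0 M by (simp add: zbox_def pointwise)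
      have "(?w, r) \<in> ?A" using wC rA by simp
      from inj_onD[OF inj f0 this zA] have "?w = 0" by simp
      then show "v \<in> ?L" using zlattice_zred_iff[OF L1 v] zlattice_0[OF L1] by simp
    qed
  next
    assume A: "\<forall>v\<in>zvecs n. pact n X Q v \<in> ?R \<longrightarrow> v \<in> ?L"
    show "inj_on f ?A"
    proof (rule inj_onI)
      fix a a' assume a: "a \<in> ?A" "a' \<in> ?A" "f a = f a'"
      obtain w r w' r' where wr: "a = (w, r)" "a' = (w', r')" by (cases a, cases a')
      have w: "w \<in> ?C" "w' \<in> ?C" and r: "r \<in> ?R" "r \<in> ?B" "r' \<in> ?R" "r' \<in> ?B" using a(1,2) unfolding wr by simp_all
      have wz: "w \<in> zvecs n" "w' \<in> zvecs n" using w zbox_zvecs by blast+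
      have eq: "zred M (r + pact n X Q w) = zred M (r' + pact n X Q w')" using a(3) unfolding wr f_def by simp
      have s: "r + pact n X Q w \<in> zvecs n" "r' + pact n X Q w' \<in> zvecs n"
        using zlattice_add[OF K RK[OF r(1)] im[OF wz(1)]] zlattice_add[OF K RK[OF r(3)] im[OF wz(2)]] KZ by blast+
      have "pact n X Q (w - w') = (zred M (r' + pact n X Q w') - (r' + pact n X Q w'))
          - (zred M (r + pact n X Q w) - (r + pact n X Q w)) + (r' - r)"
        using eq by (simp add: pact_vec_diff)
      also have "\<dots> \<in> ?R"
        by (rule zlattice_add[OF RM zlattice_diff[OF RM zlattice_zred_diff[OF RM s(2)] zlattice_zred_diff[OF RM s(1)]]
              zlattice_diff[OF RM r(3) r(1)]])
      finally have "w - w' \<in> ?L" using A wz by blast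
      then have "w i mod int p = w' i mod int p" for i by (simp add: mem_scaled_zvecs mod_eq_dvd_iff pointwise)
      then have "zred (int p) w = zred (int p) w'" by (simp add: zred_def)
      then have ww: "w = w'" using w zred_zbox by metis
      have "r = r'" using zred_add_eqD[OF r(2,4)] eq ww by simp
      then show "a = a'" using ww wr by simp
    qed
  qed
  have surj: "K \<inter> ?B \<subseteq> f ` ?A \<longleftrightarrow> (\<forall>k\<in>K. \<exists>w\<in>zvecs n. k - pact n X Q w \<in> ?R)"
  proof
    assume S: "K \<inter> ?B \<subseteq> f ` ?A"
    show "\<forall>k\<in>K. \<exists>w\<in>zvecs n. k - pact n X Q w \<in> ?R"
    proof
      fix k assume k: "k \<in> K"
      have "zred M k \<in> K \<inter> ?B" using zlattice_zred_iff[OF KM KZ[OF k]] k zred_in_zbox[OF M KZ[OF k]] by blast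
      then obtain a where a: "a \<in> ?A" "zred M k = f a" using S by blast
      obtain w r where wr: "a = (w, r)" by (cases a)
      have w: "w \<in> zvecs n" and r: "r \<in> ?R" using a zbox_zvecs unfolding wr by blast+
      have s: "r + pact n X Q w \<in> zvecs n" using KZ[OF zlattice_add[OF K RK[OF r] im[OF w]]] .
      have eq: "zred M k = zred M (r + pact n X Q w)" using a(2) unfolding wr f_def by simp
      have "k - pact n X Q w = (zred M (r + pact n X Q w) - (r + pact n X Q w)) - (zred M k - k) + r"
        using eq by simp
      also have "\<dots> \<in> ?R"
        by (rule zlattice_add[OF RM zlattice_diff[OF RM zlattice_zred_diff[OF RM s] zlattice_zred_diff[OF RM KZ[OF k]]] r])
      finally show "\<exists>w\<in>zvecs n. k - pact n X Q w \<in> ?R" using w by blast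
    qed
  next
    assume S: "\<forall>k\<in>K. \<exists>w\<in>zvecs n. k - pact n X Q w \<in> ?R"
    show "K \<inter> ?B \<subseteq> f ` ?A"
    proof
      fix k assume k: "k \<in> K \<inter> ?B"
      then obtain w where w: "w \<in> zvecs n" "k - pact n X Q w \<in> ?R" using S by blast
      let ?w = "zred (int p) w"
      have "(k - pact n X Q w) + (pact n X Q w - pact n X Q ?w) \<in> ?R" by (rule zlattice_add[OF RM w(2) pw[OF w(1)]])
      then have r: "k - pact n X Q ?w \<in> ?R" by simp
      have z: "k - pact n X Q ?w \<in> zvecs n" using zlattice_zvecs[OF RM r] .
      define r' where "r' = zred M (k - pact n X Q ?w)"
      have "r' \<in> ?R \<inter> ?B" unfolding r'_def using zlattice_zred_iff[OF RM z] r zred_in_zbox[OF M z] by blast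
      then have mem: "(?w, r') \<in> ?A" using zred_in_zbox[OF p0 w(1)] by simp
      have "f (?w, r') = zred M k" by (simp add: f_def r'_def zred_def fun_eq_iff pointwise mod_add_left_eq)
      also have "\<dots> = k" using zred_zbox k by blast
      finally have "k = f (?w, r')" by simp
      then show "k \<in> f ` ?A" using mem by (rule image_eqI)
    qed
  qed
  show ?thesis using card_inj_iff_surj[OF fin crd img] inj surj by simp
qed

text \<open>Nakayama's argument by successive approximation. Since
  \<open>p ^ m Z ^ n \<subseteq> K\<close>, the multiples of \<open>p ^ Suc m\<close> lie in
  \<open>p K\<close>; hence \<open>m + 1\<close> levels of precision decide whether
  \<open>Q(X)\<close> reaches all of \<open>K\<close>.\<close>

lemma surjective_mod_p_iff:
  fixes p :: nat
  assumes K: "zlattice n (int p ^ m) K" and X: "\<And>l. l < n \<Longrightarrow> X l \<in> zvecs n"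
  shows "(\<forall>k\<in>K. \<exists>w\<in>zvecs n. k - pact n X Q w \<in> (*z) (int p) ` K)
     \<longleftrightarrow> (\<forall>k\<in>K. \<exists>w\<in>zvecs n. k - pact n X Q w \<in> (*z) (int p ^ Suc m) ` zvecs n)"
proof
  assume S: "\<forall>k\<in>K. \<exists>w\<in>zvecs n. k - pact n X Q w \<in> (*z) (int p) ` K"
  \<comment> \<open>Each round approximates the current remainder once more and gains a factor
    \<open>p\<close>; after \<open>m + 1\<close> rounds the error lies in
    \<open>p ^ Suc m Z ^ n\<close>.\<close>
  have it: "\<forall>k\<in>K. \<exists>w\<in>zvecs n. k - pact n X Q w \<in> (*z) (int p ^ e) ` K" for e
  proof (induction e)
    case 0
    show ?case
    proof
      fix k assume k: "k \<in> K"
      have "k - pact n X Q 0 = int p ^ 0 *z k" by simp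
      then show "\<exists>w\<in>zvecs n. k - pact n X Q w \<in> (*z) (int p ^ 0) ` K" using k by (intro bexI[of _ 0] image_eqI) auto
    qed
  next
    case (Suc e)
    show ?case
    proof
      fix k assume "k \<in> K"
      then obtain w k' where w: "w \<in> zvecs n" "k' \<in> K" "k - pact n X Q w = int p ^ e *z k'" using Suc by blast
      obtain w' k'' where w': "w' \<in> zvecs n" "k'' \<in> K" "k' - pact n X Q w' = int p *z k''" using S w(2) by blast
      have k': "k' = pact n X Q w' + int p *z k''" using w'(3) by (simp add: algebra_simps)
      have "k - pact n X Q (w + int p ^ e *z w') = int p ^ e *z k' - int p ^ e *z pact n X Q w'"
        using w(3) by (simp add: pact_vec_add pact_vec_zscale algebra_simps)
      also have "\<dots> = int p ^ Suc e *z k''" unfolding k' by (simp add: zscale_add zscale_zscale mult.commute)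
      finally show "\<exists>w\<in>zvecs n. k - pact n X Q w \<in> (*z) (int p ^ Suc e) ` K" using w(1) w'(1,2)
        by (intro bexI[of _ "w + int p ^ e *z w'"] image_eqI) auto
    qed
  qed
  show "\<forall>k\<in>K. \<exists>w\<in>zvecs n. k - pact n X Q w \<in> (*z) (int p ^ Suc m) ` zvecs n"
    using it[of "Suc m"] zlattice_sub[OF K] by blast
next
  assume S: "\<forall>k\<in>K. \<exists>w\<in>zvecs n. k - pact n X Q w \<in> (*z) (int p ^ Suc m) ` zvecs n"
  have sub: "(*z) (int p ^ Suc m) ` zvecs n \<subseteq> (*z) (int p) ` K"
  proof (rule image_subsetI)
    fix v assume "v \<in> zvecs n"
    then have "int p ^ m *z v \<in> K" by (rule zlattice_modulus[OF K])
    then show "int p ^ Suc m *z v \<in> (*z) (int p) ` K" by (intro image_eqI[of _ _ "int p ^ m *z v"]) (simp_all add: zscale_zscale)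
  qed
  show "\<forall>k\<in>K. \<exists>w\<in>zvecs n. k - pact n X Q w \<in> (*z) (int p) ` K"
  proof
    fix k assume "k \<in> K"
    from bspec[OF S this] obtain w where w: "w \<in> zvecs n" "k - pact n X Q w \<in> (*z) (int p ^ Suc m) ` zvecs n" ..
    show "\<exists>w\<in>zvecs n. k - pact n X Q w \<in> (*z) (int p) ` K"
      by (rule bexI[where x = w]) (rule subsetD[OF sub w(2)], rule w(1))
  qed
qed

text \<open>The lattices stand for the kernels of the individual surjections onto the
  \<open>G j\<close>. That \<open>P j (X)\<close> maps into \<open>Kj j\<close> reflects that
  \<open>P j\<close> annihilates \<open>G j\<close>.\<close>

locale lattice_family =
  fixes p n m l :: nat and X :: "nat \<Rightarrow> nat \<Rightarrow> int" and Pj :: "nat \<Rightarrow> int poly" and Kj :: "nat \<Rightarrow> (nat \<Rightarrow> int) set"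
  assumes p: "prime p" and X: "\<And>k. k < n \<Longrightarrow> X k \<in> zvecs n"
    and Kj: "\<And>j. j < l \<Longrightarrow> zlattice n (int p ^ m) (Kj j)"
    and st: "\<And>j. j < l \<Longrightarrow> lin_stable n X (Kj j)"
    and im: "\<And>j v. j < l \<Longrightarrow> v \<in> zvecs n \<Longrightarrow> pact n X (Pj j) v \<in> Kj j"
    and mon: "\<And>j. j < l \<Longrightarrow> lead_coeff (Pj j) = 1"
    and irr: "\<And>j. j < l \<Longrightarrow> poly_mod.irreducible_m (int p) (Pj j)"
    and dist: "\<And>i j. i < l \<Longrightarrow> j < l \<Longrightarrow> i \<noteq> j \<Longrightarrow> poly_mod.Mp (int p) (Pj i) \<noteq> poly_mod.Mp (int p) (Pj j)"
begin

definition Qj where "Qj j = (\<Prod>i\<in>{..<l} - {j}. Pj i)"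
definition KK where "KK = {v \<in> zvecs n. \<forall>j<l. v \<in> Kj j}"

lemma Qj_im: assumes "i < l" "i \<noteq> j" "v \<in> zvecs n" shows "pact n X (Qj j) v \<in> Kj i"
proof -
  have "Qj j = Pj i * (\<Prod>k\<in>{..<l} - {j} - {i}. Pj k)" unfolding Qj_def using assms by (intro prod.remove) auto
  then show ?thesis using im[OF assms(1) pact_zvecs[OF X assms(3)]] by (simp add: pact_mult)
qed

lemma Qj_torsion:
  assumes j: "j < l" and S: "zlattice n (int p ^ e) S" and stS: "lin_stable n X S" and v: "v \<in> zvecs n"
    and 1: "pact n X (Pj j) v \<in> S" and 2: "pact n X (Qj j) v \<in> S"
  shows "v \<in> S"
proof (rule coprime_torsion_prod[where J = "{..<l} - {j}" and Q = Pj, OF p S stS X v _ mon[OF j] irr[OF j] 1 _ 2[unfolded Qj_def]])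
  show "finite ({..<l} - {j})" by simp
  show "lead_coeff (Pj i) = 1 \<and> poly_mod.irreducible_m (int p) (Pj i) \<and> poly_mod.Mp (int p) (Pj j) \<noteq> poly_mod.Mp (int p) (Pj i)"
    if "i \<in> {..<l} - {j}" for i using that mon irr dist[OF j] by auto
qed

text \<open>Chinese remainder theorem: \<open>Qj j\<close> sends every vector into all
  \<open>Kj i\<close> with \<open>i \<noteq> j\<close>, while modulo \<open>Kj j\<close> its values
  fill everything because \<open>Qj j\<close> is coprime to \<open>Pj j\<close>. The corrections for
  different \<open>j\<close> therefore add up without interference.\<close>

lemma crt_lattice:
  assumes u: "\<And>j. j < l \<Longrightarrow> u j \<in> zvecs n"
  shows "\<exists>v\<in>zvecs n. \<forall>j<l. v - u j \<in> Kj j"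
proof -
  have ex: "\<exists>w\<in>zvecs n. u j - pact n X (Qj j) w \<in> Kj j" if j: "j < l" for j
  proof -
    \<comment> \<open>The sum of \<open>Kj j\<close> and the image of \<open>Qj j\<close>. Every
      vector is sent into it by \<open>Pj j\<close> and by \<open>Qj j\<close>, hence lies in it by
      coprimality.\<close>
    define S where "S = {v \<in> zvecs n. \<exists>w\<in>zvecs n. v - pact n X (Qj j) w \<in> Kj j}"
    note K = Kj[OF j]
    have sub: "v \<in> S" if "v \<in> Kj j" for v
      unfolding S_def using that zlattice_zvecs[OF K that] by (auto intro!: bexI[of _ 0])
    have Slat: "zlattice n (int p ^ m) S"
      unfolding zlattice_def
    proof (intro conjI ballI)
      show "S \<subseteq> zvecs n" unfolding S_def by blast
      show "0 \<in> S" using sub zlattice_0[OF K] by blast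
      fix a assume "a \<in> S"
      then obtain w where w: "a \<in> zvecs n" "w \<in> zvecs n" "a - pact n X (Qj j) w \<in> Kj j" unfolding S_def by blast
      have "- a - pact n X (Qj j) (- w) = - (a - pact n X (Qj j) w)" using pact_vec_diff[of n X "Qj j" 0 w] by simp
      then have "- a - pact n X (Qj j) (- w) \<in> Kj j" using zlattice_minus[OF K w(3)] by (simp only:)
      then show "- a \<in> S" unfolding S_def using w(1,2) by blast
      fix b assume "b \<in> S"
      then obtain w' where w': "b \<in> zvecs n" "w' \<in> zvecs n" "b - pact n X (Qj j) w' \<in> Kj j" unfolding S_def by blast
      have "a + b - pact n X (Qj j) (w + w') = (a - pact n X (Qj j) w) + (b - pact n X (Qj j) w')"
        by (simp add: pact_vec_add)
      then have "a + b - pact n X (Qj j) (w + w') \<in> Kj j" using zlattice_add[OF K w(3) w'(3)] by (simp only:)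
      then show "a + b \<in> S" unfolding S_def using w(1,2) w'(1,2) by blast
    next
      fix v assume "v \<in> zvecs n"
      then show "int p ^ m *z v \<in> S" using sub zlattice_modulus[OF K] by blast
    qed
    have Sst: "lin_stable n X S"
      unfolding lin_stable_def
    proof
      fix a assume "a \<in> S"
      then obtain w where w: "a \<in> zvecs n" "w \<in> zvecs n" "a - pact n X (Qj j) w \<in> Kj j" unfolding S_def by blast
      have "lin n X a - pact n X (Qj j) (lin n X w) = lin n X (a - pact n X (Qj j) w)" by (simp add: pact_lin lin_diff)
      also have "\<dots> \<in> Kj j" using st[OF j] w(3) unfolding lin_stable_def by blast
      finally show "lin n X a \<in> S" unfolding S_def using lin_zvecs[where X = X, OF X] by blast
    qed
    have 1: "pact n X (Pj j) (u j) \<in> S" using sub im[OF j u[OF j]] by blast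
    have 2: "pact n X (Qj j) (u j) \<in> S"
      unfolding S_def using pact_zvecs[OF X u[OF j]] u[OF j] zlattice_0[OF K] by (auto intro!: bexI[of _ "u j"])
    have "u j \<in> S" by (rule Qj_torsion[OF j Slat Sst u[OF j] 1 2])
    then show ?thesis unfolding S_def by blast
  qed
  then have "\<forall>j\<in>{..<l}. \<exists>w. w \<in> zvecs n \<and> u j - pact n X (Qj j) w \<in> Kj j" by auto
  from bchoice[OF this] obtain w where w: "\<And>j. j < l \<Longrightarrow> w j \<in> zvecs n" "\<And>j. j < l \<Longrightarrow> u j - pact n X (Qj j) (w j) \<in> Kj j"
    by auto
  define v where "v = (\<Sum>j<l. pact n X (Qj j) (w j))"
  have "v - u j \<in> Kj j" if j: "j < l" for j
  proof -
    have "v = pact n X (Qj j) (w j) + (\<Sum>i\<in>{..<l} - {j}. pact n X (Qj i) (w i))"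
      unfolding v_def using j by (intro sum.remove) auto
    then have "v - u j = (\<Sum>i\<in>{..<l} - {j}. pact n X (Qj i) (w i)) - (u j - pact n X (Qj j) (w j))" by simp
    also have "\<dots> \<in> Kj j"
      using w j by (intro zlattice_diff[OF Kj[OF j] zlattice_sum[OF Kj[OF j]]] Qj_im) auto
    finally show ?thesis .
  qed
  moreover have "v \<in> zvecs n" unfolding v_def using pact_zvecs[OF X w(1)] by (intro zvecs_sum) simp
  ultimately show ?thesis by blast
qed

text \<open>Besides the two preceding equivalences this replaces each \<open>Kj j\<close> by the
  joint lattice \<open>KK\<close>, so that a single coset of matrices can be used for all
  \<open>j\<close> at once.\<close>

lemma kernels_iff:
  "(\<forall>j<l. \<forall>k\<in>Kj j. \<exists>w\<in>zvecs n. k - pact n X (Pj j) w \<in> (*z) (int p ^ Suc m) ` zvecs n)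
   \<longleftrightarrow> (\<forall>j<l. {v \<in> zvecs n. pact n X (Pj j) v \<in> (*z) (int p) ` KK} \<subseteq> (*z) (int p) ` zvecs n)"
proof -
  let ?L = "(*z) (int p) ` zvecs n"
  have pm: "int p ^ m > 0" using p prime_gt_0_nat by simp
  have L1: "zlattice n (int p ^ 1) ?L" using zlattice_scaled[OF zlattice_UNIV[of n 1], of "int p"] by simp
  have Lst: "lin_stable n X ?L" by (rule lin_stable_scaled[OF lin_stable_zvecs[OF X]])
  have "(\<forall>j<l. \<forall>k\<in>Kj j. \<exists>w\<in>zvecs n. k - pact n X (Pj j) w \<in> (*z) (int p ^ Suc m) ` zvecs n)
     \<longleftrightarrow> (\<forall>j<l. \<forall>v\<in>zvecs n. pact n X (Pj j) v \<in> (*z) (int p) ` Kj j \<longrightarrow> v \<in> ?L)"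
  proof (intro all_cong)
    fix j assume j: "j < l"
    show "(\<forall>k\<in>Kj j. \<exists>w\<in>zvecs n. k - pact n X (Pj j) w \<in> (*z) (int p ^ Suc m) ` zvecs n)
        \<longleftrightarrow> (\<forall>v\<in>zvecs n. pact n X (Pj j) v \<in> (*z) (int p) ` Kj j \<longrightarrow> v \<in> ?L)"
      by (rule trans[OF surjective_mod_p_iff[where X = X, OF Kj[OF j] X, symmetric]
            injective_iff_surjective_mod_p[where X = X, OF p pm Kj[OF j] X im[OF j], symmetric]])
  qed
  also have "\<dots> \<longleftrightarrow> (\<forall>j<l. {v \<in> zvecs n. pact n X (Pj j) v \<in> (*z) (int p) ` KK} \<subseteq> ?L)"
  proof
    assume A: "\<forall>j<l. \<forall>v\<in>zvecs n. pact n X (Pj j) v \<in> (*z) (int p) ` Kj j \<longrightarrow> v \<in> ?L"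
    show "\<forall>j<l. {v \<in> zvecs n. pact n X (Pj j) v \<in> (*z) (int p) ` KK} \<subseteq> ?L"
    proof (rule allI, rule impI, rule subsetI)
      fix j v assume j: "j < l" and v: "v \<in> {v \<in> zvecs n. pact n X (Pj j) v \<in> (*z) (int p) ` KK}"
      have "(*z) (int p) ` KK \<subseteq> (*z) (int p) ` Kj j" unfolding KK_def using j by blast
      then show "v \<in> ?L" using A j v by blast
    qed
  next
    assume A: "\<forall>j<l. {v \<in> zvecs n. pact n X (Pj j) v \<in> (*z) (int p) ` KK} \<subseteq> ?L"
    show "\<forall>j<l. \<forall>v\<in>zvecs n. pact n X (Pj j) v \<in> (*z) (int p) ` Kj j \<longrightarrow> v \<in> ?L"
    proof (rule allI, rule impI, rule ballI, rule impI)
      fix j v assume j: "j < l" and v: "v \<in> zvecs n" and vK: "pact n X (Pj j) v \<in> (*z) (int p) ` Kj j"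
      then obtain k where k: "k \<in> Kj j" "pact n X (Pj j) v = int p *z k" by blast
      have kz: "k \<in> zvecs n" using zlattice_zvecs[OF Kj[OF j] k(1)] .
      \<comment> \<open>Multiplying by \<open>Qj j\<close> moves the solution from
        \<open>p Kj j\<close> into \<open>p KK\<close>, so \<open>Qj j (X) v\<close> vanishes modulo
        \<open>p\<close>. As \<open>Pj j (X) v\<close> does too, coprimality gives the same for
        \<open>v\<close>.\<close>
      have "pact n X (Qj j) k \<in> Kj i" if i: "i < l" for i
        using pact_stable[OF Kj[OF j] st[OF j] k(1)] Qj_im[OF i _ kz] by (cases "i = j") auto
      then have "pact n X (Qj j) k \<in> KK" unfolding KK_def using pact_zvecs[where X = X, OF X kz] by blast
      moreover have "pact n X (Pj j) (pact n X (Qj j) v) = int p *z pact n X (Qj j) k"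
        using arg_cong[OF k(2), of "pact n X (Qj j)"] by (simp add: pact_vec_zscale mult.commute flip: pact_mult)
      ultimately have "pact n X (Pj j) (pact n X (Qj j) v) \<in> (*z) (int p) ` KK" by simp
      then have 2: "pact n X (Qj j) v \<in> ?L" using A j pact_zvecs[where X = X, OF X v] by blast
      have 1: "pact n X (Pj j) v \<in> ?L" unfolding k(2) using kz by blast
      show "v \<in> ?L" by (rule Qj_torsion[OF j L1 Lst v 1 2])
    qed
  qed
  finally show ?thesis .
qed

end

section \<open>Homomorphisms to finite abelian groups\<close>

text \<open>The homomorphism from integer vectors to \<open>G\<close> that sends the standard basis to \<open>F 0, \<dots>, F (n - 1)\<close>.\<close>
primrec gev :: "('a, 'b) monoid_scheme \<Rightarrow> (nat \<Rightarrow> 'a) \<Rightarrow> (nat \<Rightarrow> int) \<Rightarrow> nat \<Rightarrow> 'a" where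
  "gev G F v 0 = \<one>\<^bsub>G\<^esub>"
| "gev G F v (Suc k) = gev G F v k \<otimes>\<^bsub>G\<^esub> (F k [^]\<^bsub>G\<^esub> v k)"

context comm_group
begin

lemma gev_closed: "F \<in> {..<n} \<rightarrow> carrier G \<Longrightarrow> gev G F v n \<in> carrier G"
proof (induction n)
  case (Suc n)
  have "F \<in> {..<n} \<rightarrow> carrier G" "F n \<in> carrier G" using Suc.prems by auto
  then show ?case using Suc.IH by simp
qed simp

lemma gev_cong: "(\<And>k. k < n \<Longrightarrow> F k = F' k \<and> v k = v' k) \<Longrightarrow> gev G F v n = gev G F' v' n"
  by (induction n) simp_all

lemma gev_add:
  "F \<in> {..<n} \<rightarrow> carrier G \<Longrightarrow> gev G F (u + v) n = gev G F u n \<otimes> gev G F v n"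
proof (induction n)
  case (Suc n)
  have F': "F \<in> {..<n} \<rightarrow> carrier G" using Suc.prems by auto
  have F: "F n \<in> carrier G" "gev G F u n \<in> carrier G" "gev G F v n \<in> carrier G"
    using Suc.prems gev_closed[OF F'] by auto
  show ?case using Suc.IH[OF F'] F by (simp add: pointwise int_pow_mult m_ac)
qed simp

lemma gev_zero: "gev G F 0 n = \<one>"
  by (induction n) (simp_all add: pointwise)

lemma gev_minus:
  assumes "F \<in> {..<n} \<rightarrow> carrier G" shows "gev G F (- v) n = inv (gev G F v n)"
proof -
  have "gev G F (- v) n \<otimes> gev G F v n = \<one>" using gev_add[OF assms, of "- v" v] gev_zero by simp
  then show ?thesis using gev_closed[OF assms] by (simp add: inv_equality)
qed

lemma gev_diff:
  assumes "F \<in> {..<n} \<rightarrow> carrier G"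
  shows "gev G F (u - v) n = gev G F u n \<otimes> inv (gev G F v n)"
  using gev_add[OF assms, of u "- v"] gev_minus[OF assms, of v] by simp

lemma gev_diff_eq_one:
  assumes "F \<in> {..<n} \<rightarrow> carrier G"
  shows "gev G F (u - v) n = \<one> \<longleftrightarrow> gev G F u n = gev G F v n"
proof -
  have c: "gev G F u n \<in> carrier G" "gev G F v n \<in> carrier G" using gev_closed[OF assms] by blast+
  show ?thesis
  proof
    assume "gev G F (u - v) n = \<one>"
    then have "inv (inv (gev G F v n)) = gev G F u n"
      unfolding gev_diff[OF assms] using c by (intro inv_equality) auto
    then show "gev G F u n = gev G F v n" using c by simp
  next
    assume "gev G F u n = gev G F v n"
    then show "gev G F (u - v) n = \<one>" unfolding gev_diff[OF assms] using c by simp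
  qed
qed

lemma gev_zscale:
  "F \<in> {..<n} \<rightarrow> carrier G \<Longrightarrow> gev G F (a *z v) n = gev G F v n [^] a"
proof (induction n)
  case (Suc n)
  have F': "F \<in> {..<n} \<rightarrow> carrier G" using Suc.prems by auto
  have F: "F n \<in> carrier G" "gev G F v n \<in> carrier G"
    using Suc.prems gev_closed[OF F'] by auto
  show ?case using Suc.IH[OF F'] F by (simp add: pointwise int_pow_distrib int_pow_pow mult.commute)
qed simp

lemma gev_sum:
  assumes "F \<in> {..<n} \<rightarrow> carrier G"
  shows "gev G F (\<Sum>k<m. c k *z X k) n = gev G (\<lambda>k. gev G F (X k) n) c m"
  by (induction m) (simp_all add: gev_zero gev_add[OF assms] gev_zscale[OF assms])

lemma gev_lin:
  assumes "F \<in> {..<n} \<rightarrow> carrier G"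
  shows "gev G F (lin n X v) n = gev G (\<lambda>k. gev G F (X k) n) v n"
  unfolding lin_eq_sum by (rule gev_sum[OF assms])

lemma gev_unit:
  assumes "F \<in> {..<n} \<rightarrow> carrier G" "i < n"
  shows "gev G F (\<lambda>k. if k = i then 1 else 0) n = F i"
proof -
  have "gev G F (\<lambda>k. if k = i then 1 else 0) m = (if i < m then F i else \<one>)" if "m \<le> n" for m
    using that
  proof (induction m)
    case (Suc m)
    have "F m \<in> carrier G" "F i \<in> carrier G" using Suc.prems assms by auto
    then show ?case using Suc by (auto simp: less_Suc_eq)
  qed simp
  then show ?thesis using assms(2) by simp
qed

lemma hom_gev:
  assumes T: "T \<in> hom G G" and "F \<in> {..<n} \<rightarrow> carrier G"
  shows "T (gev G F v n) = gev G (\<lambda>k. T (F k)) v n"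
  using assms(2)
proof (induction n)
  case 0
  interpret h: group_hom G G T using T by unfold_locales
  show ?case by simp
next
  case (Suc n)
  interpret h: group_hom G G T using T by unfold_locales
  have F': "F \<in> {..<n} \<rightarrow> carrier G" "F n \<in> carrier G" using Suc.prems by auto
  show ?case using Suc.IH[OF F'(1)] gev_closed[OF F'(1), of v] F'(2) by (simp add: h.hom_int_pow)
qed

text \<open>\<open>F X = T F\<close>, tested on the standard basis.\<close>
definition intertwines :: "('a \<Rightarrow> 'a) \<Rightarrow> nat \<Rightarrow> (nat \<Rightarrow> 'a) \<Rightarrow> (nat \<Rightarrow> nat \<Rightarrow> int) \<Rightarrow> bool" where
  "intertwines T n F X \<longleftrightarrow> (\<forall>k<n. gev G F (X k) n = T (F k))"

lemma intertwines_lin: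
  assumes T: "T \<in> hom G G" and F: "F \<in> {..<n} \<rightarrow> carrier G" and tw: "intertwines T n F X"
  shows "gev G F (lin n X v) n = T (gev G F v n)"
proof -
  have "gev G (\<lambda>k. gev G F (X k) n) v n = gev G (\<lambda>k. T (F k)) v n"
    by (rule gev_cong) (use tw in \<open>simp add: intertwines_def\<close>)
  then show ?thesis by (simp add: gev_lin[OF F] hom_gev[OF T F])
qed

lemma intertwines_funpow:
  assumes T: "T \<in> hom G G" and F: "F \<in> {..<n} \<rightarrow> carrier G" and tw: "intertwines T n F X"
  shows "gev G F ((lin n X ^^ i) v) n = (T ^^ i) (gev G F v n)"
  by (induction i) (simp_all add: intertwines_lin[OF assms])

lemma gev_sum_atMost:
  fixes d :: nat
  assumes "F \<in> {..<n} \<rightarrow> carrier G"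
  shows "gev G F (\<Sum>i\<le>d. f i) n = finprod G (\<lambda>i. gev G F (f i) n) {..d}"
proof (induction d)
  case 0 then show ?case using gev_closed[OF assms] by simp
next
  case (Suc d)
  have "finprod G (\<lambda>i. gev G F (f i) n) {..Suc d} = gev G F (f (Suc d)) n \<otimes> finprod G (\<lambda>i. gev G F (f i) n) {..d}"
    unfolding atMost_Suc by (rule finprod_insert) (use gev_closed[OF assms] in auto)
  then show ?case using gev_closed[OF assms] Suc by (simp add: gev_add[OF assms] m_comm)
qed

text \<open>Carries \<open>Q(X)\<close> across \<open>F\<close> to \<open>Q(T)\<close>, in the
  product form in which \<open>finite_quot_module\<close> says that the polynomial annihilates the
  group.\<close>

lemma gev_pact:
  assumes T: "T \<in> hom G G" and F: "F \<in> {..<n} \<rightarrow> carrier G" and tw: "intertwines T n F X"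
    and d: "degree Q \<le> d"
  shows "gev G F (pact n X Q v) n = finprod G (\<lambda>m. ((T ^^ m) (gev G F v n)) [^] coeff Q m) {..d}"
  by (simp add: pact_eq_sum[OF d] gev_sum_atMost[OF F] gev_zscale[OF F] intertwines_funpow[OF assms(1-3)])

definition gker :: "nat \<Rightarrow> (nat \<Rightarrow> 'a) \<Rightarrow> (nat \<Rightarrow> int) set" where
  "gker n F = {v \<in> zvecs n. gev G F v n = \<one>}"

lemma gker_lattice:
  assumes F: "F \<in> {..<n} \<rightarrow> carrier G" and M: "\<And>x. x \<in> carrier G \<Longrightarrow> x [^] M = \<one>"
  shows "zlattice n M (gker n F)"
  unfolding zlattice_def gker_def
  using gev_add[OF F] gev_minus[OF F] gev_zscale[OF F] M[OF gev_closed[OF F]] gev_zero by auto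

lemma gker_stable:
  assumes T: "T \<in> hom G G" and F: "F \<in> {..<n} \<rightarrow> carrier G" and tw: "intertwines T n F X"
    and X: "\<And>k. k < n \<Longrightarrow> X k \<in> zvecs n"
  shows "lin_stable n X (gker n F)"
proof -
  interpret h: group_hom G G T using T by unfold_locales
  show ?thesis unfolding lin_stable_def gker_def using intertwines_lin[OF T F tw] lin_zvecs[where X = X, OF X] by auto
qed

end

text \<open>The exponent \<open>e\<close> is smaller than the order \<open>p ^ e\<close>, so
  \<open>p\<close> raised to the order already kills the group. This crude exponent is the one built
  into \<open>padic_smul\<close>.\<close>

lemma finite_p_group_pow:
  fixes G (structure) and p :: nat
  assumes G: "comm_group G" "finite (carrier G)" "card (carrier G) = p ^ e" and p: "prime p"
    and N: "card (carrier G) \<le> N" and x: "x \<in> carrier G"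
  shows "x [^] (int p ^ N) = \<one>"
proof -
  interpret comm_group G by fact
  have "e < 2 ^ e" by (rule less_exp)
  also have "\<dots> \<le> p ^ e" using prime_ge_2_nat[OF p] by (rule power_mono) simp
  finally have eN: "e \<le> N" using N G(3) by simp
  have "x [^] card (carrier G) = \<one>" by (rule power_order_eq_one[OF G(2) x])
  then have "x [^] (p ^ e) = \<one>" by (simp add: G(3))
  then have "(x [^] (p ^ e)) [^] (p ^ (N - e)) = \<one>" by simp
  then have "x [^] (p ^ e * p ^ (N - e)) = \<one>" using x by (simp add: nat_pow_pow)
  then have "x [^] (p ^ N) = \<one>" using eN by (simp flip: power_add)
  moreover have "x [^] (int p ^ N) = x [^] (p ^ N)" using int_pow_int[of G x "p ^ N"] by simp
  ultimately show ?thesis by simp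
qed

lemma pow_eq_if_mod_eq:
  fixes G (structure) and m a b :: int
  assumes G: "group G" and x: "x \<in> carrier G" "x [^] m = \<one>" and ab: "a mod m = b mod m"
  shows "x [^] a = x [^] b"
proof -
  interpret group G by fact
  have "x [^] c = x [^] (c mod m)" for c
  proof -
    have "c = m * (c div m) + c mod m" by simp
    then have "x [^] c = x [^] (m * (c div m)) \<otimes> x [^] (c mod m)" using int_pow_mult[OF x(1)] by metis
    also have "x [^] (m * (c div m)) = (x [^] m) [^] (c div m)" using int_pow_pow[OF x(1)] by simp
    finally show ?thesis using x by simp
  qed
  then show ?thesis using ab by metis
qed

section \<open>Tuples of homomorphisms and joint surjectivity\<close>

text \<open>Here \<open>p ^ m\<close> kills every \<open>G j\<close>, and the \<open>Pj j\<close>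
  are integer polynomials. In the application they hold the residues of the given coefficients at
  level \<open>m + 1\<close>, which is why \<open>M\<close> below is
  \<open>p ^ Suc m\<close>.\<close>

locale module_family =
  fixes p l m :: nat and G :: "nat \<Rightarrow> ('a, 'b) monoid_scheme" and T :: "nat \<Rightarrow> 'a \<Rightarrow> 'a" and Pj :: "nat \<Rightarrow> int poly"
  assumes p: "prime p"
    and G: "\<And>j. j < l \<Longrightarrow> comm_group (G j)" and finG: "\<And>j. j < l \<Longrightarrow> finite (carrier (G j))"
    and pgrp: "\<And>j. j < l \<Longrightarrow> \<exists>e. card (carrier (G j)) = p ^ e"
    and T: "\<And>j. j < l \<Longrightarrow> T j \<in> hom (G j) (G j)"
    and expo: "\<And>j x. j < l \<Longrightarrow> x \<in> carrier (G j) \<Longrightarrow> x [^]\<^bsub>G j\<^esub> (int p ^ m) = \<one>\<^bsub>G j\<^esub>"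
    and ann: "\<And>j g. j < l \<Longrightarrow> g \<in> carrier (G j) \<Longrightarrow>
        finprod (G j) (\<lambda>k. ((T j ^^ k) g) [^]\<^bsub>G j\<^esub> coeff (Pj j) k) {..degree (Pj j)} = \<one>\<^bsub>G j\<^esub>"
    and mon: "\<And>j. j < l \<Longrightarrow> lead_coeff (Pj j) = 1" and dg: "\<And>j. j < l \<Longrightarrow> degree (Pj j) > 0"
    and irr: "\<And>j. j < l \<Longrightarrow> poly_mod.irreducible_m (int p) (Pj j)"
    and dist: "\<And>i j. i < l \<Longrightarrow> j < l \<Longrightarrow> i \<noteq> j \<Longrightarrow> poly_mod.Mp (int p) (Pj i) \<noteq> poly_mod.Mp (int p) (Pj j)"
begin

definition M where "M = int p ^ Suc m"
text \<open>A homomorphism from \<open>Z ^ n\<close> to \<open>G j\<close> is stored as the images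
  of the standard basis, extensionally, so that \<open>Ft\<close> and \<open>Fs\<close> are finite
  sets counting homomorphisms exactly.\<close>

definition Ft where "Ft (n::nat) j = PiE {..<n} (\<lambda>_. carrier (G j))"
definition Fs where "Fs n = PiE {..<l} (Ft n)"
definition GG where "GG = PiE {..<l} (\<lambda>j. carrier (G j))"
definition hv where "hv n F v = (\<lambda>j\<in>{..<l}. gev (G j) (F j) v n)"
definition KF where "KF n F = {v \<in> zvecs n. \<forall>j<l. v \<in> comm_group.gker (G j) n (F j)}"
definition jsurj where "jsurj n F \<longleftrightarrow> GG \<subseteq> hv n F ` zvecs n"

text \<open>Such an \<open>f\<close> is the level \<open>M\<close> trace of an isomorphism from the
  cokernel to \<open>G j\<close>: its kernel is the image of \<open>Pj j (X)\<close> up to multiples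
  of \<open>M\<close>.\<close>

definition good :: "nat \<Rightarrow> nat \<Rightarrow> (nat \<Rightarrow> 'a) \<Rightarrow> (nat \<Rightarrow> nat \<Rightarrow> int) \<Rightarrow> bool" where
  "good n j f X \<longleftrightarrow> (\<forall>y\<in>carrier (G j). \<exists>v\<in>zvecs n. gev (G j) f v n = y) \<and> comm_group.intertwines (G j) (T j) n f X
     \<and> (\<forall>v\<in>zvecs n. gev (G j) f v n = \<one>\<^bsub>G j\<^esub> \<longleftrightarrow> (\<exists>w\<in>zvecs n. v - pact n X (Pj j) w \<in> (*z) M ` zvecs n))"

lemma p0: "int p > 0" using p prime_gt_0_nat by simp
lemma M0: "M > 0" using p0 by (simp add: M_def)

lemma Ft_funcset: "f \<in> Ft n j \<Longrightarrow> f \<in> {..<n} \<rightarrow> carrier (G j)"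
  by (auto simp: Ft_def PiE_def)

lemma Fs_Ft: "F \<in> Fs n \<Longrightarrow> j < l \<Longrightarrow> F j \<in> Ft n j"
  by (auto simp: Fs_def PiE_def)

lemma Fs_funcset: "F \<in> Fs n \<Longrightarrow> j < l \<Longrightarrow> F j \<in> {..<n} \<rightarrow> carrier (G j)"
  using Fs_Ft Ft_funcset by blast

lemma finFt: "j < l \<Longrightarrow> finite (Ft n j)" unfolding Ft_def by (rule finite_PiE) (use finG in auto)
lemma finGG: "finite GG" unfolding GG_def by (rule finite_PiE) (use finG in auto)

lemma gkerI: assumes "j < l" shows "v \<in> comm_group.gker (G j) n f \<longleftrightarrow> v \<in> zvecs n \<and> gev (G j) f v n = \<one>\<^bsub>G j\<^esub>"
  using comm_group.gker_def[OF G[OF assms], of n f] by simp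

lemma gker_lat: "j < l \<Longrightarrow> f \<in> {..<n} \<rightarrow> carrier (G j) \<Longrightarrow> zlattice n (int p ^ m) (comm_group.gker (G j) n f)"
  using comm_group.gker_lattice[OF G] expo by blast

lemma KF_lattice: assumes F: "F \<in> Fs n" shows "zlattice n (int p ^ m) (KF n F)"
proof -
  have L: "zlattice n (int p ^ m) (comm_group.gker (G j) n (F j))" if "j < l" for j
    using gker_lat[OF that Fs_funcset[OF F that]] .
  show ?thesis unfolding zlattice_def KF_def
    using zlattice_0[OF L] zlattice_add[OF L] zlattice_minus[OF L] zlattice_modulus[OF L] by auto
qed

lemma KF_M: "F \<in> Fs n \<Longrightarrow> zlattice n M (KF n F)"
  unfolding M_def power_Suc by (rule zlattice_mult_modulus[OF KF_lattice])

lemma hv_eq_iff: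
  assumes F: "F \<in> Fs n" and u: "u \<in> zvecs n" and v: "v \<in> zvecs n"
  shows "hv n F u = hv n F v \<longleftrightarrow> u - v \<in> KF n F"
proof -
  have "hv n F u = hv n F v \<longleftrightarrow> (\<forall>j<l. gev (G j) (F j) u n = gev (G j) (F j) v n)"
    unfolding hv_def by (auto simp: fun_eq_iff restrict_def)
  also have "\<dots> \<longleftrightarrow> (\<forall>j<l. gev (G j) (F j) (u - v) n = \<one>\<^bsub>G j\<^esub>)"
    using comm_group.gev_diff_eq_one[OF G Fs_funcset[OF F]] by simp
  also have "\<dots> \<longleftrightarrow> u - v \<in> KF n F" using u v by (auto simp: KF_def gkerI)
  finally show ?thesis .
qed

lemma hv_GG: "F \<in> Fs n \<Longrightarrow> hv n F v \<in> GG"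
  unfolding hv_def GG_def using comm_group.gev_closed[OF G Fs_funcset] by simp

text \<open>The order of \<open>Z ^ n / M\<close> is the order of the image times that of the
  kernel; the fibres are cosets of \<open>KF\<close>.\<close>

lemma card_image_hv:
  assumes F: "F \<in> Fs n"
  shows "card (zbox n M) = card (hv n F ` zvecs n) * card (KF n F \<inter> zbox n M)"
proof -
  let ?B = "zbox n M"
  have img: "hv n F ` zvecs n = hv n F ` ?B"
  proof (intro equalityI image_subsetI)
    fix v assume v: "v \<in> zvecs n"
    have "hv n F (zred M v) = hv n F v"
      using hv_eq_iff[OF F, of "zred M v" v] zlattice_zred_diff[OF KF_M[OF F] v] v by blast
    then show "hv n F v \<in> hv n F ` ?B" using zred_in_zbox[OF M0 v] by (metis imageI)
  qed (use zbox_zvecs in blast)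
  have "card ?B = (\<Sum>y\<in>hv n F ` ?B. card {v \<in> ?B. hv n F v = y})"
    using card_zbox(2)[OF M0, of n] by (intro card_group) auto
  also have "\<dots> = (\<Sum>y\<in>hv n F ` ?B. card (KF n F \<inter> ?B))"
  proof (rule sum.cong[OF refl])
    fix y assume "y \<in> hv n F ` ?B"
    then obtain z where z: "z \<in> ?B" "y = hv n F z" by blast
    have zz: "z \<in> zvecs n" using z zbox_zvecs by blast
    have "{v \<in> ?B. hv n F v = y} = {v \<in> ?B. v - z \<in> KF n F}"
      unfolding z(2) using hv_eq_iff[OF F zbox_zvecs zz] by blast
    then show "card {v \<in> ?B. hv n F v = y} = card (KF n F \<inter> ?B)"
      using card_zlattice_coset[OF KF_M[OF F] M0 zz] by simp
  qed
  finally show ?thesis unfolding img by simp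
qed

lemma card_B: "card (zbox n M) = p ^ (Suc m * n)"
proof -
  have "nat M = p ^ Suc m" by (simp add: M_def nat_power_eq nat_mult_distrib)
  then show ?thesis using card_zbox(1)[OF M0, of n] by (simp only: power_mult)
qed

lemma card_GG: "\<exists>b. card GG = p ^ b"
proof -
  obtain e where e: "\<And>j. j < l \<Longrightarrow> card (carrier (G j)) = p ^ e j" using pgrp by metis
  have "card GG = (\<Prod>j<l. p ^ e j)" unfolding GG_def using e by (simp add: card_PiE)
  then show ?thesis by (metis power_sum)
qed

text \<open>Both orders are powers of \<open>p\<close>, so a proper image has at most
  \<open>1 / p\<close> of the elements, hence at most half.\<close>

lemma nonsurj_image:
  assumes F: "F \<in> Fs n" and ns: "\<not> jsurj n F" shows "2 * card (hv n F ` zvecs n) \<le> card GG"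
proof -
  have sub: "hv n F ` zvecs n \<subset> GG" using ns hv_GG[OF F] unfolding jsurj_def by blast
  have lt: "card (hv n F ` zvecs n) < card GG" using psubset_card_mono[OF finGG sub] .
  have "card (hv n F ` zvecs n) dvd p ^ (Suc m * n)" using card_image_hv[OF F] card_B by (metis dvd_triv_left)
  then obtain a where a: "card (hv n F ` zvecs n) = p ^ a" using divides_primepow_nat[OF p] by blast
  obtain b where b: "card GG = p ^ b" using card_GG by blast
  have "a < b" using lt unfolding a b using power_less_imp_less_exp[OF prime_gt_1_nat[OF p]] by blast
  then have "p ^ Suc a \<le> p ^ b" using prime_gt_1_nat[OF p] by (intro power_increasing) auto
  moreover have "2 * p ^ a \<le> p * p ^ a" using prime_ge_2_nat[OF p] by (rule mult_right_mono) simp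
  ultimately show ?thesis unfolding a b by (simp only: power_Suc order.trans)
qed

lemma card_Fs: "card (Fs n) = card GG ^ n"
  unfolding Fs_def GG_def Ft_def by (simp add: card_PiE prod_power_distrib)

lemma finFs: "finite (Fs n)" unfolding Fs_def by (rule finite_PiE) (use finFt in auto)

text \<open>A tuple that is not jointly surjective has all its basis images in some \<open>S\<close>
  with at most half the elements of \<open>GG\<close>. There are at most \<open>2 ^ card GG\<close>
  sets \<open>S\<close>, each admitting \<open>card S ^ n\<close> choices.\<close>

lemma count_nonsurj: "card {F \<in> Fs n. \<not> jsurj n F} * 2 ^ n \<le> 2 ^ card GG * card GG ^ n"
proof -
  define SS where "SS = {S. S \<subseteq> GG \<and> 2 * card S \<le> card GG}"
  define FS where "FS S = {F \<in> Fs n. \<forall>k<n. (\<lambda>j\<in>{..<l}. F j k) \<in> S}" for S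
  have finSS: "finite SS" using finGG by (simp add: SS_def)
  have sub: "{F \<in> Fs n. \<not> jsurj n F} \<subseteq> (\<Union>S\<in>SS. FS S)"
  proof
    fix F assume "F \<in> {F \<in> Fs n. \<not> jsurj n F}"
    then have F: "F \<in> Fs n" "\<not> jsurj n F" by simp_all
    let ?S = "hv n F ` zvecs n"
    have "?S \<in> SS" unfolding SS_def using hv_GG[OF F(1)] nonsurj_image[OF F] by blast
    moreover have "(\<lambda>j\<in>{..<l}. F j k) \<in> ?S" if k: "k < n" for k
    proof -
      have e: "(\<lambda>i. if i = k then 1 else 0) \<in> zvecs n" using k by (simp add: zvecs_def)
      have "hv n F (\<lambda>i. if i = k then 1 else 0) = (\<lambda>j\<in>{..<l}. F j k)" unfolding hv_def
        using comm_group.gev_unit[OF G Fs_funcset[OF F(1)] k] by (intro restrict_ext) simp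
      then show ?thesis using e by (metis imageI)
    qed
    ultimately show "F \<in> (\<Union>S\<in>SS. FS S)" unfolding FS_def using F(1) by blast
  qed
  have FSle: "card (FS S) \<le> card S ^ n" if S: "S \<in> SS" for S
  proof -
    have finS: "finite S" using S finGG finite_subset by (auto simp: SS_def)
    have "card (FS S) \<le> card (PiE {..<n} (\<lambda>_. S))"
    proof (rule card_inj_on_le[where f = "\<lambda>F. \<lambda>k\<in>{..<n}. \<lambda>j\<in>{..<l}. F j k"])
      show "(\<lambda>F. \<lambda>k\<in>{..<n}. \<lambda>j\<in>{..<l}. F j k) ` FS S \<subseteq> PiE {..<n} (\<lambda>_. S)" by (auto simp: FS_def)
      show "finite (PiE {..<n} (\<lambda>_. S))" using finS by (simp add: finite_PiE)
      show "inj_on (\<lambda>F. \<lambda>k\<in>{..<n}. \<lambda>j\<in>{..<l}. F j k) (FS S)"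
      proof (rule inj_onI)
        fix F F' assume F: "F \<in> FS S" "F' \<in> FS S" and eq: "(\<lambda>k\<in>{..<n}. \<lambda>j\<in>{..<l}. F j k) = (\<lambda>k\<in>{..<n}. \<lambda>j\<in>{..<l}. F' j k)"
        have FF: "F \<in> Fs n" "F' \<in> Fs n" using F by (simp_all add: FS_def)
        have "F j = F' j" if j: "j \<in> {..<l}" for j
        proof (rule PiE_ext)
          show "F j \<in> PiE {..<n} (\<lambda>_. carrier (G j))" "F' j \<in> PiE {..<n} (\<lambda>_. carrier (G j))"
            using Fs_Ft[OF FF(1)] Fs_Ft[OF FF(2)] j by (auto simp: Ft_def)
          fix k assume k: "k \<in> {..<n}"
          show "F j k = F' j k" using fun_cong[OF fun_cong[OF eq, of k], of j] j k by simp
        qed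
        then show "F = F'" using FF unfolding Fs_def by (intro PiE_ext[of F "{..<l}" "Ft n" F']) auto
      qed
    qed
    then show ?thesis using card_PiE[of "{..<n}" "\<lambda>_. S"] by simp
  qed
  have "card {F \<in> Fs n. \<not> jsurj n F} \<le> card (\<Union>S\<in>SS. FS S)"
  proof (rule card_mono[OF _ sub])
    have "finite (FS S)" for S unfolding FS_def by (rule finite_subset[OF _ finFs[of n]]) blast
    then show "finite (\<Union>S\<in>SS. FS S)" using finSS by blast
  qed
  also have "\<dots> \<le> (\<Sum>S\<in>SS. card (FS S))" by (rule card_UN_le[OF finSS])
  finally have "card {F \<in> Fs n. \<not> jsurj n F} * 2 ^ n \<le> (\<Sum>S\<in>SS. card (FS S)) * 2 ^ n" by simp
  also have "\<dots> = (\<Sum>S\<in>SS. card (FS S) * 2 ^ n)" by (rule sum_distrib_right)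
  also have "\<dots> \<le> (\<Sum>S\<in>SS. card GG ^ n)"
  proof (rule sum_mono)
    fix S assume S: "S \<in> SS"
    have "card (FS S) * 2 ^ n \<le> card S ^ n * 2 ^ n" using FSle[OF S] by simp
    also have "\<dots> = (2 * card S) ^ n" by (simp add: power_mult_distrib)
    also have "\<dots> \<le> card GG ^ n" using S by (intro power_mono) (auto simp: SS_def)
    finally show "card (FS S) * 2 ^ n \<le> card GG ^ n" .
  qed
  also have "\<dots> = card SS * card GG ^ n" by simp
  also have "\<dots> \<le> 2 ^ card GG * card GG ^ n"
  proof -
    have "SS \<subseteq> Pow GG" by (auto simp: SS_def)
    then have "card SS \<le> card (Pow GG)" using finGG by (intro card_mono) auto
    then show ?thesis using finGG by (simp add: card_Pow)
  qed
  finally show ?thesis .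
qed

lemma family:
  assumes F: "F \<in> Fs n" and X: "\<And>k. k < n \<Longrightarrow> X k \<in> zvecs n"
    and tw: "\<And>j. j < l \<Longrightarrow> comm_group.intertwines (G j) (T j) n (F j) X"
  shows "lattice_family p n m l X Pj (\<lambda>j. comm_group.gker (G j) n (F j))"
proof
  fix j assume j: "j < l"
  note f = Fs_funcset[OF F j]
  show "zlattice n (int p ^ m) (comm_group.gker (G j) n (F j))" using gker_lat[OF j f] .
  show "lin_stable n X (comm_group.gker (G j) n (F j))"
    by (rule comm_group.gker_stable[OF G[OF j] T[OF j] f tw[OF j] X])
  show "lead_coeff (Pj j) = 1" "poly_mod.irreducible_m (int p) (Pj j)" using mon irr j by auto
  fix v assume v: "v \<in> zvecs n"
  have "gev (G j) (F j) (pact n X (Pj j) v) n = \<one>\<^bsub>G j\<^esub>"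
    unfolding comm_group.gev_pact[OF G[OF j] T[OF j] f tw[OF j] order_refl]
    by (rule ann[OF j comm_group.gev_closed[OF G[OF j] f]])
  then show "pact n X (Pj j) v \<in> comm_group.gker (G j) n (F j)"
    unfolding gkerI[OF j] using pact_zvecs[where X = X, OF X v] by simp
qed (use p X dist in auto)

text \<open>Separate surjectivity becomes joint surjectivity by \<open>crt_lattice\<close>, thanks
  to the coprime polynomials. Only jointly surjective tuples therefore contribute to the count of
  good pairs.\<close>

lemma good_jsurj:
  assumes F: "F \<in> Fs n" and X: "X \<in> mats n M" and gd: "\<And>j. j < l \<Longrightarrow> good n j (F j) X"
  shows "jsurj n F"
proof -
  interpret L: lattice_family p n m l X Pj "\<lambda>j. comm_group.gker (G j) n (F j)"
    by (rule family[where X = X, OF F mats_zvecs[OF X]]) (use gd in \<open>simp_all add: good_def\<close>)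
  show ?thesis unfolding jsurj_def
  proof
    fix y assume y: "y \<in> GG"
    have "\<forall>j\<in>{..<l}. \<exists>v. v \<in> zvecs n \<and> gev (G j) (F j) v n = y j"
    proof
      fix j assume j: "j \<in> {..<l}"
      then have "y j \<in> carrier (G j)" using y by (auto simp: GG_def)
      then show "\<exists>v. v \<in> zvecs n \<and> gev (G j) (F j) v n = y j" using gd[of j] j unfolding good_def by blast
    qed
    from bchoice[OF this] obtain u where u0: "\<forall>j\<in>{..<l}. u j \<in> zvecs n \<and> gev (G j) (F j) (u j) n = y j" ..
    have u: "u j \<in> zvecs n" "gev (G j) (F j) (u j) n = y j" if "j < l" for j using u0 that by simp_all
    have "\<exists>v\<in>zvecs n. \<forall>j<l. v - u j \<in> comm_group.gker (G j) n (F j)" by (rule L.crt_lattice) (rule u(1))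
    then obtain v where v: "v \<in> zvecs n" "\<forall>j<l. v - u j \<in> comm_group.gker (G j) n (F j)" ..
    have "gev (G j) (F j) v n = y j" if j: "j < l" for j
    proof -
      have "gev (G j) (F j) (v - u j) n = \<one>\<^bsub>G j\<^esub>" using v(2) j gkerI[OF j] by blast
      then show ?thesis using comm_group.gev_diff_eq_one[OF G[OF j] Fs_funcset[OF F j]] u(2)[OF j] by simp
    qed
    then have "hv n F v = y" using y unfolding hv_def GG_def by (auto simp: fun_eq_iff PiE_def extensional_def)
    then show "y \<in> hv n F ` zvecs n" using v(1) by blast
  qed
qed

definition qq where "qq j = real (p ^ degree (Pj j))"

text \<open>The matrices intertwining \<open>F\<close> form a coset of index
  \<open>card GG ^ n\<close> among all matrices. Multiplying by this factor gives the proportion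
  inside the coset, which \<open>torsion_free_fraction\<close> evaluates.\<close>

lemma fixed_F:
  assumes F: "F \<in> Fs n" and js: "jsurj n F"
  shows "\<bar>real (card {X \<in> mats n M. \<forall>j<l. good n j (F j) X}) * real (card GG) ^ n / real (card (mats n M))
      - (\<Prod>j<l. \<Sum>i\<le>card (zbox n M). qcoef (qq j) i)\<bar>
    \<le> real (card GG) / real p ^ n * (\<Prod>j<l. \<Sum>i\<le>card (zbox n M). \<bar>qcoef (qq j) i\<bar> * qq j ^ i)"
proof -
  let ?K = "KF n F" and ?B = "zbox n M"
  \<comment> \<open>Joint surjectivity solves \<open>F Y = T F\<close> for all \<open>j\<close>
    simultaneously, one column of \<open>Y\<close> at a time.\<close>
  have "\<forall>k\<in>{..<n}. \<exists>v. v \<in> zvecs n \<and> hv n F v = (\<lambda>j\<in>{..<l}. T j (F j k))"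
  proof
    fix k assume k: "k \<in> {..<n}"
    have "T j (F j k) \<in> carrier (G j)" if j: "j < l" for j
      using T[OF j] Fs_funcset[OF F j] k by (auto simp: hom_def)
    then have "(\<lambda>j\<in>{..<l}. T j (F j k)) \<in> GG" by (simp add: GG_def)
    then have "(\<lambda>j\<in>{..<l}. T j (F j k)) \<in> hv n F ` zvecs n" using js unfolding jsurj_def by blast
    then obtain v where v: "(\<lambda>j\<in>{..<l}. T j (F j k)) = hv n F v" "v \<in> zvecs n" by (rule imageE)
    show "\<exists>v. v \<in> zvecs n \<and> hv n F v = (\<lambda>j\<in>{..<l}. T j (F j k))"
      by (rule exI[of _ v]) (rule conjI[OF v(2) v(1)[symmetric]])
  qed
  from bchoice[OF this] obtain Y where Y0: "\<forall>k\<in>{..<n}. Y k \<in> zvecs n \<and> hv n F (Y k) = (\<lambda>j\<in>{..<l}. T j (F j k))" ..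
  have Y: "Y k \<in> zvecs n" "hv n F (Y k) = (\<lambda>j\<in>{..<l}. T j (F j k))" if "k < n" for k using bspec[OF Y0, of k] that by simp_all
  have tw_iff: "(\<forall>j<l. comm_group.intertwines (G j) (T j) n (F j) X) \<longleftrightarrow> (\<forall>k<n. X k - Y k \<in> ?K)"
    if X: "\<And>k. k < n \<Longrightarrow> X k \<in> zvecs n" for X
  proof -
    have "(\<forall>j<l. comm_group.intertwines (G j) (T j) n (F j) X) \<longleftrightarrow> (\<forall>j<l. \<forall>k<n. gev (G j) (F j) (X k) n = T j (F j k))"
      using comm_group.intertwines_def[OF G] by simp
    also have "\<dots> \<longleftrightarrow> (\<forall>k<n. \<forall>j<l. gev (G j) (F j) (X k) n = T j (F j k))" by blast
    also have "\<dots> \<longleftrightarrow> (\<forall>k<n. hv n F (X k) = hv n F (Y k))"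
    proof (intro all_cong)
      fix k assume k: "k < n"
      show "(\<forall>j<l. gev (G j) (F j) (X k) n = T j (F j k)) \<longleftrightarrow> hv n F (X k) = hv n F (Y k)"
        unfolding Y(2)[OF k] by (auto simp: hv_def fun_eq_iff restrict_def)
    qed
    also have "\<dots> \<longleftrightarrow> (\<forall>k<n. X k - Y k \<in> ?K)" using hv_eq_iff[OF F X Y(1)] by simp
    finally show ?thesis .
  qed
  have twY: "comm_group.intertwines (G j) (T j) n (F j) Y" if "j < l" for j
    using tw_iff[of Y] Y(1) zlattice_0[OF KF_M[OF F]] that by simp
  interpret LY: lattice_family p n m l Y Pj "\<lambda>j. comm_group.gker (G j) n (F j)"
    by (rule family[OF F Y(1) twY])
  have pm: "int p ^ m > 0" using p0 by simp
  have Yst: "lin_stable n Y ?K"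
    unfolding lin_stable_def KF_def using LY.st lin_zvecs[where X = Y, OF Y(1)] unfolding lin_stable_def by blast
  interpret PM: poly_model p n "int p ^ m" ?K Y l Pj
    by unfold_locales (use p pm KF_lattice[OF F] Y(1) Yst mon dg irr dist in auto)
  have MM: "PM.M = M" by (simp add: PM.M_def M_def)
  have qd: "PM.qd = qq" by (simp add: PM.qd_def qq_def fun_eq_iff)
  have set: "{X \<in> mats n M. \<forall>j<l. good n j (F j) X}
     = {X \<in> mats_over n M ?K Y. \<forall>j<l. PM.H X (Pj j) \<subseteq> (*z) (int p) ` zvecs n}"
  proof -
    have "(\<forall>j<l. good n j (F j) X) \<longleftrightarrow> (\<forall>k<n. X k - Y k \<in> ?K) \<and> (\<forall>j<l. PM.H X (Pj j) \<subseteq> (*z) (int p) ` zvecs n)"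
      if X: "X \<in> mats n M" for X
    proof (cases "\<forall>k<n. X k - Y k \<in> ?K")
      case False
      have "\<not> (\<forall>j<l. good n j (F j) X)"
      proof
        assume "\<forall>j<l. good n j (F j) X"
        then have "\<forall>j<l. comm_group.intertwines (G j) (T j) n (F j) X" unfolding good_def by blast
        then show False using False tw_iff[of X, OF mats_zvecs[OF X]] by blast
      qed
      then show ?thesis using False by blast
    next
      case True
      then have tw: "comm_group.intertwines (G j) (T j) n (F j) X" if "j < l" for j
        using tw_iff[of X, OF mats_zvecs[OF X]] that by blast
      interpret L: lattice_family p n m l X Pj "\<lambda>j. comm_group.gker (G j) n (F j)"
        by (rule family[where X = X, OF F mats_zvecs[OF X] tw])
      have KK: "L.KK = ?K" by (simp add: L.KK_def KF_def)
      have "good n j (F j) X \<longleftrightarrow> (\<forall>k\<in>comm_group.gker (G j) n (F j). \<exists>w\<in>zvecs n. k - pact n X (Pj j) w \<in> (*z) M ` zvecs n)"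
        if j: "j < l" for j
      proof -
        have sj: "\<forall>y\<in>carrier (G j). \<exists>v\<in>zvecs n. gev (G j) (F j) v n = y"
        proof
          fix y assume y: "y \<in> carrier (G j)"
          \<comment> \<open>Neutral away from \<open>j\<close>, so a joint preimage of it is a
            preimage of \<open>y\<close> under \<open>F j\<close>.\<close>
          define y' where "y' = (\<lambda>i\<in>{..<l}. if i = j then y else \<one>\<^bsub>G i\<^esub>)"
          have one: "\<one>\<^bsub>G i\<^esub> \<in> carrier (G i)" if "i < l" for i
          proof -
            interpret comm_group "G i" by (rule G[OF that])
            show ?thesis by simp
          qed
          have "y' \<in> GG" unfolding y'_def GG_def using y one by auto
          then have "y' \<in> hv n F ` zvecs n" using js unfolding jsurj_def by (rule rev_subsetD)
          then obtain v where v: "v \<in> zvecs n" "y' = hv n F v" by (rule imageE)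
          have "gev (G j) (F j) v n = y" using fun_cong[OF v(2), of j] j by (simp add: hv_def y'_def)
          then show "\<exists>v\<in>zvecs n. gev (G j) (F j) v n = y" using v(1) by blast
        qed
        have bk: "gev (G j) (F j) v n = \<one>\<^bsub>G j\<^esub>"
          if v: "v \<in> zvecs n" and w: "w \<in> zvecs n" "v - pact n X (Pj j) w \<in> (*z) M ` zvecs n" for v w
        proof -
          have LM: "zlattice n M (comm_group.gker (G j) n (F j))"
            unfolding M_def power_Suc by (rule zlattice_mult_modulus[OF L.Kj[OF j]])
          obtain u where u: "v - pact n X (Pj j) w = M *z u" "u \<in> zvecs n" using w(2) by (rule imageE)
          have d: "v - pact n X (Pj j) w \<in> comm_group.gker (G j) n (F j)"
            unfolding u(1) by (rule zlattice_modulus[OF LM u(2)])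
          have "v \<in> comm_group.gker (G j) n (F j)" by (rule iffD2[OF zlattice_cong[OF LM d] L.im[OF j w(1)]])
          then show ?thesis by (rule conjunct2[OF iffD1[OF gkerI[OF j]]])
        qed
        show ?thesis
        proof
          assume "good n j (F j) X"
          then have g: "\<forall>v\<in>zvecs n. gev (G j) (F j) v n = \<one>\<^bsub>G j\<^esub> \<longleftrightarrow>
              (\<exists>w\<in>zvecs n. v - pact n X (Pj j) w \<in> (*z) M ` zvecs n)"
            unfolding good_def by (elim conjE)
          show "\<forall>k\<in>comm_group.gker (G j) n (F j). \<exists>w\<in>zvecs n. k - pact n X (Pj j) w \<in> (*z) M ` zvecs n"
          proof
            fix k assume "k \<in> comm_group.gker (G j) n (F j)"
            then have k: "k \<in> zvecs n" "gev (G j) (F j) k n = \<one>\<^bsub>G j\<^esub>" using gkerI[OF j] by simp_all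
            show "\<exists>w\<in>zvecs n. k - pact n X (Pj j) w \<in> (*z) M ` zvecs n" by (rule iffD1[OF bspec[OF g k(1)] k(2)])
          qed
        next
          assume a: "\<forall>k\<in>comm_group.gker (G j) n (F j). \<exists>w\<in>zvecs n. k - pact n X (Pj j) w \<in> (*z) M ` zvecs n"
          show "good n j (F j) X" unfolding good_def
          proof (rule conjI[OF sj], rule conjI[OF tw[OF j]], rule ballI, rule iffI)
            fix v assume "v \<in> zvecs n" "gev (G j) (F j) v n = \<one>\<^bsub>G j\<^esub>"
            then have "v \<in> comm_group.gker (G j) n (F j)" using gkerI[OF j] by simp
            then show "\<exists>w\<in>zvecs n. v - pact n X (Pj j) w \<in> (*z) M ` zvecs n" by (rule bspec[OF a])
          next
            fix v assume v: "v \<in> zvecs n" and "\<exists>w\<in>zvecs n. v - pact n X (Pj j) w \<in> (*z) M ` zvecs n"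
            then obtain w where w: "w \<in> zvecs n" "v - pact n X (Pj j) w \<in> (*z) M ` zvecs n" by (elim bexE)
            show "gev (G j) (F j) v n = \<one>\<^bsub>G j\<^esub>" by (rule bk[OF v w])
          qed
        qed
      qed
      then have "(\<forall>j<l. good n j (F j) X) \<longleftrightarrow>
          (\<forall>j<l. \<forall>k\<in>comm_group.gker (G j) n (F j). \<exists>w\<in>zvecs n. k - pact n X (Pj j) w \<in> (*z) (int p ^ Suc m) ` zvecs n)"
        unfolding M_def by simp
      also have "\<dots> \<longleftrightarrow> (\<forall>j<l. PM.H X (Pj j) \<subseteq> (*z) (int p) ` zvecs n)"
        unfolding L.kernels_iff KK PM.H_def ..
      finally show ?thesis using True by blast
    qed
    then show ?thesis unfolding mats_over_def by blast
  qed
  have cB: "card ?B = card GG * card (?K \<inter> ?B)"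
  proof -
    have "hv n F ` zvecs n = GG" using js hv_GG[OF F] unfolding jsurj_def by blast
    then show ?thesis using card_image_hv[OF F] by simp
  qed
  have cKpos: "card (?K \<inter> ?B) > 0" by (rule zlattice_zbox_pos[OF KF_M[OF F] M0])
  have GGpos: "card GG > 0" using cB card_zbox(1)[OF M0, of n] M0 by (metis mult_0 nat_0_less_mult_iff neq0_conv zero_less_nat_eq zero_less_power)
  have cm: "card (mats n M) = card ?B ^ n" unfolding mats_def by (simp add: card_PiE)
  have cXX: "card (mats_over n M ?K Y) = card (?K \<inter> ?B) ^ n" by (rule card_mats_over[OF KF_M[OF F] M0 Y(1)])
  have r1: "real (card {X \<in> mats n M. \<forall>j<l. good n j (F j) X}) * real (card GG) ^ n / real (card (mats n M))
     = real (card {X \<in> mats_over n M ?K Y. \<forall>j<l. PM.H X (Pj j) \<subseteq> (*z) (int p) ` zvecs n}) / real (card (mats_over n M ?K Y))"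
    unfolding set cm cXX cB using GGpos by (simp add: power_mult_distrib)
  have r2: "real (card ?B) / real (card (?K \<inter> ?B)) = real (card GG)" unfolding cB using cKpos by simp
  show ?thesis using PM.torsion_free_fraction unfolding r1 qd MM r2 .
qed

end

section \<open>Automorphisms, averaging and the limit\<close>

context module_family
begin

lemma good_kernel:
  assumes "good n j f X" "v \<in> zvecs n"
  shows "gev (G j) f v n = \<one>\<^bsub>G j\<^esub> \<longleftrightarrow> (\<exists>w\<in>zvecs n. v - pact n X (Pj j) w \<in> (*z) M ` zvecs n)"
proof -
  have "\<forall>v\<in>zvecs n. gev (G j) f v n = \<one>\<^bsub>G j\<^esub> \<longleftrightarrow> (\<exists>w\<in>zvecs n. v - pact n X (Pj j) w \<in> (*z) M ` zvecs n)"
    using assms(1) unfolding good_def by (elim conjE)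
  from bspec[OF this assms(2)] show ?thesis .
qed

lemma good_surj:
  assumes "good n j f X" "y \<in> carrier (G j)" shows "\<exists>v\<in>zvecs n. gev (G j) f v n = y"
proof -
  have "\<forall>y\<in>carrier (G j). \<exists>v\<in>zvecs n. gev (G j) f v n = y" using assms(1) unfolding good_def by (elim conjE)
  from bspec[OF this assms(2)] show ?thesis .
qed

lemma good_intertwines: "good n j f X \<Longrightarrow> comm_group.intertwines (G j) (T j) n f X"
  unfolding good_def by (elim conjE)

text \<open>Two good maps have the same kernel, dictated by \<open>X\<close> alone, and both are
  surjective. Hence they differ by a unique automorphism, which commutes with \<open>T j\<close>
  because both maps intertwine it with \<open>X\<close>.\<close>

lemma card_good:
  assumes j: "j < l" and X: "\<And>k. k < n \<Longrightarrow> X k \<in> zvecs n" and f0: "f0 \<in> Ft n j" "good n j f0 X"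
  shows "card {f \<in> Ft n j. good n j f X} = card (mod_auts (G j) (T j))"
proof -
  interpret H: comm_group "G j" by (rule G[OF j])
  let ?C = "carrier (G j)" and ?D = "{f \<in> Ft n j. good n j f X}"
  let ?ev = "\<lambda>f v. gev (G j) f v n"
  define \<Phi> where "\<Phi> \<alpha> = (\<lambda>k\<in>{..<n}. \<alpha> (f0 k))" for \<alpha> :: "'a \<Rightarrow> 'a"
  have fs: "f \<in> {..<n} \<rightarrow> ?C" if "f \<in> Ft n j" for f using Ft_funcset[OF that] .
  note f0s = fs[OF f0(1)]
  have f0k: "f0 k \<in> ?C" if "k < n" for k using f0s that by auto
  have surj0: "\<exists>v\<in>zvecs n. ?ev f0 v = y" if "y \<in> ?C" for y by (rule good_surj[OF f0(2) that])
  have unit: "(\<lambda>i. if i = k then 1 else 0) \<in> zvecs n" if "k < n" for k using that by (simp add: zvecs_def)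
  have ev\<Phi>: "?ev (\<Phi> \<alpha>) v = \<alpha> (?ev f0 v)" if "\<alpha> \<in> hom (G j) (G j)" for \<alpha> v
  proof -
    have "\<alpha> (?ev f0 v) = ?ev (\<lambda>k. \<alpha> (f0 k)) v" by (rule H.hom_gev[OF that f0s])
    also have "\<dots> = ?ev (\<Phi> \<alpha>) v" by (rule H.gev_cong) (simp add: \<Phi>_def)
    finally show ?thesis by simp
  qed
  have "bij_betw \<Phi> (mod_auts (G j) (T j)) ?D"
    unfolding bij_betw_def
  proof
    show "inj_on \<Phi> (mod_auts (G j) (T j))"
    proof (rule inj_onI)
      fix \<alpha> \<beta> assume a: "\<alpha> \<in> mod_auts (G j) (T j)" and b: "\<beta> \<in> mod_auts (G j) (T j)" and eq: "\<Phi> \<alpha> = \<Phi> \<beta>"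
      have h: "\<alpha> \<in> hom (G j) (G j)" "\<beta> \<in> hom (G j) (G j)" "\<alpha> \<in> extensional ?C" "\<beta> \<in> extensional ?C"
        using a b by (auto simp: mod_auts_def iso_def)
      show "\<alpha> = \<beta>"
      proof (rule extensionalityI[OF h(3,4)])
        fix y assume yC: "y \<in> ?C"
        obtain v where "?ev f0 v = y" using surj0[OF yC] by (rule bexE)
        then show "\<alpha> y = \<beta> y" using ev\<Phi>[OF h(1), of v] ev\<Phi>[OF h(2), of v] eq by simp
      qed
    qed
    show "\<Phi> ` mod_auts (G j) (T j) = ?D"
    proof (intro equalityI image_subsetI subsetI)
      fix \<alpha> assume a: "\<alpha> \<in> mod_auts (G j) (T j)"
      have h: "\<alpha> \<in> hom (G j) (G j)" and bij: "bij_betw \<alpha> ?C ?C" and cT: "\<And>g. g \<in> ?C \<Longrightarrow> \<alpha> (T j g) = T j (\<alpha> g)"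
        using a by (auto simp: mod_auts_def iso_def)
      interpret a: group_hom "G j" "G j" \<alpha> using h by unfold_locales
      have E: "?ev (\<Phi> \<alpha>) v = \<alpha> (?ev f0 v)" for v by (rule ev\<Phi>[OF h])
      have "\<Phi> \<alpha> \<in> Ft n j" unfolding \<Phi>_def Ft_def restrict_PiE_iff
      proof
        fix k assume "k \<in> {..<n}"
        then show "\<alpha> (f0 k) \<in> ?C" using f0k[of k] h by (auto simp: hom_def)
      qed
      moreover have "good n j (\<Phi> \<alpha>) X"
      proof -
        have g1: "\<forall>y\<in>?C. \<exists>v\<in>zvecs n. ?ev (\<Phi> \<alpha>) v = y"
        proof
          fix y assume "y \<in> ?C"
          then have "y \<in> \<alpha> ` ?C" using bij by (simp add: bij_betw_def)
          then obtain x where x: "y = \<alpha> x" "x \<in> ?C" by (rule imageE)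
          obtain v where v: "v \<in> zvecs n" "?ev f0 v = x" using surj0[OF x(2)] by (rule bexE)
          have "?ev (\<Phi> \<alpha>) v = y" unfolding E v(2) by (rule x(1)[symmetric])
          then show "\<exists>v\<in>zvecs n. ?ev (\<Phi> \<alpha>) v = y" using v(1) by (rule bexI)
        qed
        have g2: "H.intertwines (T j) n (\<Phi> \<alpha>) X"
          unfolding H.intertwines_def
        proof (rule allI, rule impI)
          fix k assume k: "k < n"
          have "?ev f0 (X k) = T j (f0 k)" using good_intertwines[OF f0(2)] k unfolding H.intertwines_def by blast
          then show "?ev (\<Phi> \<alpha>) (X k) = T j (\<Phi> \<alpha> k)" unfolding E using cT[OF f0k[OF k]] k by (simp add: \<Phi>_def)
        qed
        have g3: "\<forall>v\<in>zvecs n. ?ev (\<Phi> \<alpha>) v = \<one>\<^bsub>G j\<^esub> \<longleftrightarrow> (\<exists>w\<in>zvecs n. v - pact n X (Pj j) w \<in> (*z) M ` zvecs n)"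
        proof
          fix v assume v: "v \<in> zvecs n"
          have "?ev (\<Phi> \<alpha>) v = \<one>\<^bsub>G j\<^esub> \<longleftrightarrow> ?ev f0 v = \<one>\<^bsub>G j\<^esub>"
            unfolding E
          proof
            assume "\<alpha> (?ev f0 v) = \<one>\<^bsub>G j\<^esub>"
            then have e: "\<alpha> (?ev f0 v) = \<alpha> \<one>\<^bsub>G j\<^esub>" by simp
            have inj: "inj_on \<alpha> ?C" using bij by (simp add: bij_betw_def)
            show "?ev f0 v = \<one>\<^bsub>G j\<^esub>" by (rule inj_onD[OF inj e H.gev_closed[OF f0s] H.one_closed])
          qed simp
          then show "?ev (\<Phi> \<alpha>) v = \<one>\<^bsub>G j\<^esub> \<longleftrightarrow> (\<exists>w\<in>zvecs n. v - pact n X (Pj j) w \<in> (*z) M ` zvecs n)"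
            by (rule trans[OF _ good_kernel[OF f0(2) v]])
        qed
        show ?thesis unfolding good_def by (rule conjI[OF g1 conjI[OF g2 g3]])
      qed
      ultimately show "\<Phi> \<alpha> \<in> ?D" by simp
    next
      fix f assume "f \<in> ?D"
      then have f: "f \<in> Ft n j" "good n j f X" by simp_all
      note fss = fs[OF f(1)]
      have ker: "?ev f0 v = \<one>\<^bsub>G j\<^esub> \<longleftrightarrow> ?ev f v = \<one>\<^bsub>G j\<^esub>" if v: "v \<in> zvecs n" for v
        by (rule trans[OF good_kernel[OF f0(2) v] good_kernel[OF f(2) v, symmetric]])
      have eqv: "?ev f0 v = ?ev f0 v' \<longleftrightarrow> ?ev f v = ?ev f v'" if v: "v \<in> zvecs n" "v' \<in> zvecs n" for v v'
        using ker[of "v - v'"] v H.gev_diff_eq_one[OF f0s, of v v'] H.gev_diff_eq_one[OF fss, of v v'] by simp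
      \<comment> \<open>The map induced by \<open>f\<close> on the quotient by the common kernel.
        The chosen preimage does not matter, by \<open>eqv\<close>.\<close>
      define \<alpha> where "\<alpha> = (\<lambda>y\<in>?C. ?ev f (SOME v. v \<in> zvecs n \<and> ?ev f0 v = y))"
      have \<alpha>: "\<alpha> (?ev f0 v) = ?ev f v" if v: "v \<in> zvecs n" for v
      proof -
        let ?v = "SOME u. u \<in> zvecs n \<and> ?ev f0 u = ?ev f0 v"
        have "?v \<in> zvecs n \<and> ?ev f0 ?v = ?ev f0 v" by (rule someI[of _ v]) (use v in simp)
        then have "?ev f ?v = ?ev f v" using eqv[of ?v v] v by simp
        then show ?thesis unfolding \<alpha>_def using H.gev_closed[OF f0s] by simp
      qed
      have "\<alpha> \<in> mod_auts (G j) (T j)"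
        unfolding mod_auts_def iso_def mem_Collect_eq
      proof (intro conjI ballI)
        show "\<alpha> \<in> extensional ?C" unfolding \<alpha>_def by simp
        show "\<alpha> \<in> hom (G j) (G j)"
        proof (rule homI)
          fix x assume xC: "x \<in> ?C"
          obtain v where v: "v \<in> zvecs n" "?ev f0 v = x" using surj0[OF xC] by (rule bexE)
          show "\<alpha> x \<in> ?C" using \<alpha>[OF v(1)] v(2) H.gev_closed[OF fss] by auto
          fix y assume yC: "y \<in> ?C"
          obtain u where u: "u \<in> zvecs n" "?ev f0 u = y" using surj0[OF yC] by (rule bexE)
          have "\<alpha> (?ev f0 (v + u)) = ?ev f (v + u)" using v u by (intro \<alpha>) blast
          then show "\<alpha> (x \<otimes>\<^bsub>G j\<^esub> y) = \<alpha> x \<otimes>\<^bsub>G j\<^esub> \<alpha> y"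
            unfolding H.gev_add[OF f0s] H.gev_add[OF fss] using \<alpha>[OF v(1)] \<alpha>[OF u(1)] v(2) u(2) by simp
        qed
        show "bij_betw \<alpha> ?C ?C"
          unfolding bij_betw_def
        proof
          show "inj_on \<alpha> ?C"
          proof (rule inj_onI)
            fix x y assume xC: "x \<in> ?C" and yC: "y \<in> ?C" and e: "\<alpha> x = \<alpha> y"
            obtain v where v: "v \<in> zvecs n" "?ev f0 v = x" using surj0[OF xC] by (rule bexE)
            obtain u where u: "u \<in> zvecs n" "?ev f0 u = y" using surj0[OF yC] by (rule bexE)
            have "?ev f v = ?ev f u" using \<alpha>[OF v(1)] \<alpha>[OF u(1)] v(2) u(2) e by simp
            then show "x = y" using eqv[OF v(1) u(1)] v(2) u(2) by simp
          qed
          show "\<alpha> ` ?C = ?C"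
          proof (intro equalityI image_subsetI subsetI)
            fix x assume xC: "x \<in> ?C"
            obtain v where v: "v \<in> zvecs n" "?ev f0 v = x" using surj0[OF xC] by (rule bexE)
            show "\<alpha> x \<in> ?C" using \<alpha>[OF v(1)] v(2) H.gev_closed[OF fss] by auto
          next
            fix y assume yC: "y \<in> ?C"
            obtain v where v: "v \<in> zvecs n" "?ev f v = y" using good_surj[OF f(2) yC] by (rule bexE)
            have "y = \<alpha> (?ev f0 v)" using \<alpha>[OF v(1)] v(2) by simp
            then show "y \<in> \<alpha> ` ?C" using H.gev_closed[OF f0s] by (rule image_eqI)
          qed
        qed
        fix g assume gC: "g \<in> ?C"
        obtain v where v: "v \<in> zvecs n" "?ev f0 v = g" using surj0[OF gC] by (rule bexE)
        have tw0: "H.intertwines (T j) n f0 X" and tw: "H.intertwines (T j) n f X"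
          by (rule good_intertwines[OF f0(2)], rule good_intertwines[OF f(2)])
        have "\<alpha> (?ev f0 (lin n X v)) = ?ev f (lin n X v)" by (rule \<alpha>) (rule lin_zvecs[where X = X, OF X])
        then show "\<alpha> (T j g) = T j (\<alpha> g)"
          unfolding H.intertwines_lin[OF T[OF j] f0s tw0] H.intertwines_lin[OF T[OF j] fss tw]
          using \<alpha>[OF v(1)] v(2) by simp
      qed
      moreover have "f = \<Phi> \<alpha>"
      proof (rule PiE_ext)
        show "f \<in> PiE {..<n} (\<lambda>_. ?C)" using f(1) by (simp add: Ft_def)
        have fk: "\<alpha> (f0 k) = f k" if k: "k < n" for k
          using \<alpha>[OF unit[OF k]] H.gev_unit[OF f0s k] H.gev_unit[OF fss k] by simp
        then show "\<Phi> \<alpha> \<in> PiE {..<n} (\<lambda>_. ?C)" using fss by (auto simp: \<Phi>_def)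
        fix k assume "k \<in> {..<n}"
        then show "f k = \<Phi> \<alpha> k" using fk by (simp add: \<Phi>_def)
      qed
      ultimately show "f \<in> \<Phi> ` mod_auts (G j) (T j)" by (intro image_eqI[of f \<Phi> \<alpha>])
    qed
  qed
  then show ?thesis by (metis bij_betw_same_card)
qed

lemma mod_auts_pos: assumes j: "j < l" shows "card (mod_auts (G j) (T j)) > 0"
proof -
  interpret H: comm_group "G j" by (rule G[OF j])
  have "restrict id (carrier (G j)) \<in> mod_auts (G j) (T j)"
    using T[OF j] by (auto simp: mod_auts_def iso_def hom_def bij_betw_def inj_on_def)
  moreover have "mod_auts (G j) (T j) \<subseteq> PiE (carrier (G j)) (\<lambda>_. carrier (G j))"
    by (auto simp: mod_auts_def iso_def hom_def PiE_def)
  moreover have "finite (PiE (carrier (G j)) (\<lambda>_. carrier (G j)))" by (rule finite_PiE) (use finG[OF j] in auto)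
  ultimately have "restrict id (carrier (G j)) \<in> mod_auts (G j) (T j)" "finite (mod_auts (G j) (T j))"
    using finite_subset by blast+
  then show ?thesis by (auto simp: card_gt_0_iff)
qed

definition realizable where "realizable n X \<longleftrightarrow> (\<forall>j<l. \<exists>f\<in>Ft n j. good n j f X)"

lemma sum_good:
  "(\<Sum>F\<in>Fs n. card {X \<in> mats n M. \<forall>j<l. good n j (F j) X})
     = card {X \<in> mats n M. realizable n X} * (\<Prod>j<l. card (mod_auts (G j) (T j)))"
proof -
  have fm: "finite (mats n M)" by (rule finite_mats[OF M0])
  have "(\<Sum>F\<in>Fs n. card {X \<in> mats n M. \<forall>j<l. good n j (F j) X})
      = (\<Sum>X\<in>mats n M. card {F \<in> Fs n. \<forall>j<l. good n j (F j) X})"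
    by (rule card_double_count[OF finFs fm])
  also have "\<dots> = (\<Sum>X\<in>mats n M. if realizable n X then (\<Prod>j<l. card (mod_auts (G j) (T j))) else 0)"
  proof (rule sum.cong[OF refl])
    fix X assume X: "X \<in> mats n M"
    have "{F \<in> Fs n. \<forall>j<l. good n j (F j) X} = PiE {..<l} (\<lambda>j. {f \<in> Ft n j. good n j f X})"
    proof (rule Set.set_eqI)
      fix F show "F \<in> {F \<in> Fs n. \<forall>j<l. good n j (F j) X} \<longleftrightarrow> F \<in> PiE {..<l} (\<lambda>j. {f \<in> Ft n j. good n j f X})"
        unfolding Fs_def PiE_iff mem_Collect_eq by blast
    qed
    then have c: "card {F \<in> Fs n. \<forall>j<l. good n j (F j) X} = (\<Prod>j<l. card {f \<in> Ft n j. good n j f X})"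
      by (simp add: card_PiE)
    show "card {F \<in> Fs n. \<forall>j<l. good n j (F j) X} = (if realizable n X then (\<Prod>j<l. card (mod_auts (G j) (T j))) else 0)"
    proof (cases "realizable n X")
      case True
      have "card {f \<in> Ft n j. good n j f X} = card (mod_auts (G j) (T j))" if j: "j < l" for j
      proof -
        obtain f0 where f0: "f0 \<in> Ft n j" "good n j f0 X" using True j unfolding realizable_def by blast
        show ?thesis by (rule card_good[OF j _ f0]) (rule mats_zvecs[OF X])
      qed
      then show ?thesis using True c by simp
    next
      case False
      then obtain j where "j < l" "{f \<in> Ft n j. good n j f X} = {}" unfolding realizable_def by blast
      then have "(\<Prod>j<l. card {f \<in> Ft n j. good n j f X}) = 0"
        by (intro prod_zero) (auto intro!: bexI[of _ j] simp only: card.empty)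
      then show ?thesis using False c by simp
    qed
  qed
  also have "\<dots> = card {X \<in> mats n M. realizable n X} * (\<Prod>j<l. card (mod_auts (G j) (T j)))"
    using fm by (simp add: sum.If_cases Int_def)
  finally show ?thesis .
qed

lemma qq_gt_1: "j < l \<Longrightarrow> qq j > 1"
  using one_less_power[OF prime_gt_1_nat[OF p] dg] unfolding qq_def by (metis of_nat_1 of_nat_less_iff)

lemma GG_pos: "card GG > 0"
  using card_GG p prime_gt_0_nat by (metis zero_less_power)

text \<open>Each realizable \<open>X\<close> is counted \<open>A\<close> times among the good pairs.
  Averaging \<open>fixed_F\<close> over the jointly surjective tuples puts \<open>r n * A\<close>
  within \<open>D n\<close> of \<open>s n * t n\<close>, where \<open>s n\<close> is their share and
  \<open>t n\<close> the truncated Euler product.\<close>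

lemma realizable_limit:
  "(\<lambda>n. real (card {X \<in> mats n M. realizable n X}) / real (card (mats n M)))
    \<longlonglongrightarrow> (\<Prod>j<l. 1 / real (card (mod_auts (G j) (T j))) * (\<Prod>i. 1 - 1 / qq j ^ Suc i))"
proof -
  define g where "g = real (card GG)"
  define A where "A = (\<Prod>j<l. real (card (mod_auts (G j) (T j))))"
  define t where "t n = (\<Prod>j<l. \<Sum>i\<le>card (zbox n M). qcoef (qq j) i)" for n
  \<comment> \<open>The full absolute series at \<open>z = qq j\<close> bounds the truncated sums of
    the error term uniformly in \<open>n\<close>.\<close>
  define S where "S = (\<Prod>j<l. \<Sum>i. \<bar>qcoef (qq j) i\<bar> * \<bar>qq j\<bar> ^ i)"
  define D where "D n = g / real p ^ n * S" for n
  define s where "s n = real (card {F \<in> Fs n. jsurj n F}) / g ^ n" for n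
  define r where "r n = real (card {X \<in> mats n M. realizable n X}) / real (card (mats n M))" for n
  have g0: "g > 0" using GG_pos by (simp add: g_def)
  have A0: "A > 0" unfolding A_def using mod_auts_pos by (intro prod_pos) simp
  have cm: "real (card (mats n M)) > 0" for n
    unfolding mats_def using card_zbox(1)[OF M0] M0 by (simp add: card_PiE)
  have split: "card (Fs n) = card {F \<in> Fs n. jsurj n F} + card {F \<in> Fs n. \<not> jsurj n F}" for n
  proof -
    have "Fs n = {F \<in> Fs n. jsurj n F} \<union> {F \<in> Fs n. \<not> jsurj n F}" by blast
    then show ?thesis using card_Un_disjoint[of "{F \<in> Fs n. jsurj n F}" "{F \<in> Fs n. \<not> jsurj n F}"] finFs by fastforce
  qed
  have s_eq: "1 - s n = real (card {F \<in> Fs n. \<not> jsurj n F}) / g ^ n" for n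
  proof -
    have "g ^ n = real (card {F \<in> Fs n. jsurj n F}) + real (card {F \<in> Fs n. \<not> jsurj n F})"
      using arg_cong[OF split[of n], of real] by (simp add: card_Fs g_def)
    moreover have "g ^ n > 0" using g0 by simp
    ultimately show ?thesis unfolding s_def by (simp add: field_simps)
  qed
  have s1: "s n \<le> 1" "0 \<le> s n" for n
  proof -
    have "0 \<le> 1 - s n" unfolding s_eq using g0 by simp
    then show "s n \<le> 1" by simp
    show "0 \<le> s n" unfolding s_def using g0 by simp
  qed
  have s_bound: "1 - s n \<le> 2 ^ card GG * (1 / 2) ^ n" for n
  proof -
    have "real (card {F \<in> Fs n. \<not> jsurj n F}) * 2 ^ n \<le> 2 ^ card GG * g ^ n"
      using of_nat_mono[OF count_nonsurj[of n], where 'a = real] by (simp add: g_def)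
    then have "real (card {F \<in> Fs n. \<not> jsurj n F}) / g ^ n \<le> 2 ^ card GG / 2 ^ n"
      using g0 by (simp add: field_simps)
    then show ?thesis unfolding s_eq by (simp add: power_divide)
  qed
  have D_bound: "g / real p ^ n * (\<Prod>j<l. \<Sum>i\<le>card (zbox n M). \<bar>qcoef (qq j) i\<bar> * qq j ^ i) \<le> D n" for n
  proof -
    have "(\<Prod>j<l. \<Sum>i\<le>card (zbox n M). \<bar>qcoef (qq j) i\<bar> * qq j ^ i) \<le> S"
      unfolding S_def
    proof (rule prod_mono, rule conjI)
      fix j assume "j \<in> {..<l}"
      then have q: "qq j > 1" using qq_gt_1 by simp
      show "0 \<le> (\<Sum>i\<le>card (zbox n M). \<bar>qcoef (qq j) i\<bar> * qq j ^ i)" using q by (intro sum_nonneg) simp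
      have "(\<Sum>i\<le>card (zbox n M). \<bar>qcoef (qq j) i\<bar> * \<bar>qq j\<bar> ^ i) \<le> (\<Sum>i. \<bar>qcoef (qq j) i\<bar> * \<bar>qq j\<bar> ^ i)"
        by (rule sum_le_suminf[OF summable_qcoef[OF q]]) auto
      then show "(\<Sum>i\<le>card (zbox n M). \<bar>qcoef (qq j) i\<bar> * qq j ^ i) \<le> (\<Sum>i. \<bar>qcoef (qq j) i\<bar> * \<bar>qq j\<bar> ^ i)"
        using q by simp
    qed
    then show ?thesis unfolding D_def using g0 by (intro mult_left_mono) auto
  qed
  have main: "\<bar>r n * A - s n * t n\<bar> \<le> D n" for n
  proof -
    define a where "a F = real (card {X \<in> mats n M. \<forall>j<l. good n j (F j) X}) * g ^ n / real (card (mats n M))" for F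
    let ?FS = "{F \<in> Fs n. jsurj n F}"
    have gn: "g ^ n > 0" using g0 by simp
    have "S \<ge> 0" unfolding S_def
      by (rule prod_nonneg) (auto intro!: suminf_nonneg summable_qcoef simp: qq_gt_1)
    then have D0: "D n \<ge> 0" unfolding D_def using g0 by simp
    have "real (card {X \<in> mats n M. realizable n X}) * A = (\<Sum>F\<in>Fs n. real (card {X \<in> mats n M. \<forall>j<l. good n j (F j) X}))"
      using arg_cong[OF sum_good[of n], of real] by (simp add: A_def)
    also have "\<dots> = (\<Sum>F\<in>?FS. real (card {X \<in> mats n M. \<forall>j<l. good n j (F j) X}))"
    proof (rule sum.mono_neutral_right[OF finFs])
      show "\<forall>F\<in>Fs n - ?FS. real (card {X \<in> mats n M. \<forall>j<l. good n j (F j) X}) = 0"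
      proof
        fix F assume F: "F \<in> Fs n - ?FS"
        have "{X \<in> mats n M. \<forall>j<l. good n j (F j) X} = {}" using good_jsurj[of F n] F by blast
        then show "real (card {X \<in> mats n M. \<forall>j<l. good n j (F j) X}) = 0" by (simp only: card.empty of_nat_0)
      qed
    qed blast
    finally have "r n * A = (\<Sum>F\<in>?FS. real (card {X \<in> mats n M. \<forall>j<l. good n j (F j) X})) / real (card (mats n M))"
      unfolding r_def by simp
    also have "\<dots> = (\<Sum>F\<in>?FS. a F) / g ^ n"
      unfolding a_def sum_divide_distrib using g0 by simp
    finally have "r n * A - s n * t n = (\<Sum>F\<in>?FS. a F - t n) / g ^ n"
      unfolding s_def by (simp add: sum_subtractf diff_divide_distrib)
    also have "\<bar>\<dots>\<bar> \<le> (\<Sum>F\<in>?FS. \<bar>a F - t n\<bar>) / g ^ n"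
      using gn sum_abs[of "\<lambda>F. a F - t n" ?FS] by (simp add: abs_divide divide_right_mono)
    also have "\<dots> \<le> (\<Sum>F\<in>?FS. D n) / g ^ n"
    proof (intro divide_right_mono sum_mono)
      fix F assume "F \<in> ?FS"
      then have F: "F \<in> Fs n" "jsurj n F" by simp_all
      show "\<bar>a F - t n\<bar> \<le> D n"
        using order.trans[OF fixed_F[OF F] D_bound[of n, unfolded g_def]] unfolding a_def t_def g_def .
    qed (use gn in simp)
    also have "\<dots> = s n * D n" unfolding s_def by simp
    also have "\<dots> \<le> 1 * D n" by (rule mult_right_mono[OF s1(1) D0])
    finally show ?thesis by simp
  qed
  have D_lim: "D \<longlonglongrightarrow> 0"
  proof -
    have "(\<lambda>n. (1 / real p) ^ n) \<longlonglongrightarrow> 0" using prime_gt_1_nat[OF p] by (intro LIMSEQ_power_zero) simp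
    then have "(\<lambda>n. g * S * (1 / real p) ^ n) \<longlonglongrightarrow> g * S * 0" by (rule tendsto_mult[OF tendsto_const])
    then show ?thesis unfolding D_def by (simp add: power_divide field_simps)
  qed
  have s_lim: "s \<longlonglongrightarrow> 1"
  proof -
    have "(\<lambda>n. (1 / 2 :: real) ^ n) \<longlonglongrightarrow> 0" by (rule LIMSEQ_power_zero) simp
    then have "(\<lambda>n. 2 ^ card GG * (1 / 2 :: real) ^ n) \<longlonglongrightarrow> 2 ^ card GG * 0" by (rule tendsto_mult[OF tendsto_const])
    then have z: "(\<lambda>n. 2 ^ card GG * (1 / 2 :: real) ^ n) \<longlonglongrightarrow> 0" by simp
    have "(\<lambda>n. 1 - s n) \<longlonglongrightarrow> 0"
      by (rule tendsto_sandwich[OF _ _ tendsto_const z]) (use s_bound s1 in auto)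
    then show ?thesis using tendsto_diff[OF tendsto_const, of "\<lambda>n. 1 - s n" 0 sequentially 1] by simp
  qed
  have t_lim: "t \<longlonglongrightarrow> (\<Prod>j<l. \<Prod>i. 1 - 1 / qq j ^ Suc i)"
    unfolding t_def
  proof (rule tendsto_prod)
    fix j assume "j \<in> {..<l}"
    then have q: "qq j > 1" using qq_gt_1 by simp
    \<comment> \<open>The truncation point grows with \<open>n\<close>, so the truncated sums
      converge to the full Euler expansion.\<close>
    have "n \<le> card (zbox n M)" for n
    proof -
      have "n < 2 ^ n" by (rule less_exp)
      also have "\<dots> \<le> p ^ n" by (rule power_mono[OF prime_ge_2_nat[OF p]]) simp
      also have "\<dots> \<le> p ^ (Suc m * n)" using prime_gt_0_nat[OF p] by (intro power_increasing) auto
      finally show ?thesis unfolding card_B by simp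
    qed
    then have "filterlim (\<lambda>n. card (zbox n M)) sequentially sequentially"
      by (intro filterlim_at_top_mono[OF filterlim_ident]) (auto intro: always_eventually)
    then show "(\<lambda>n. \<Sum>i\<le>card (zbox n M). qcoef (qq j) i) \<longlonglongrightarrow> (\<Prod>i. 1 - 1 / qq j ^ Suc i)"
      by (rule filterlim_compose[OF sums_qcoef[OF q]])
  qed
  have "(\<lambda>n. r n * A - s n * t n) \<longlonglongrightarrow> 0"
    by (rule tendsto_rabs_zero_cancel, rule tendsto_sandwich[OF _ _ tendsto_const D_lim]) (use main in auto)
  from tendsto_add[OF this tendsto_mult[OF s_lim t_lim]]
  have "(\<lambda>n. r n * A) \<longlonglongrightarrow> (\<Prod>j<l. \<Prod>i. 1 - 1 / qq j ^ Suc i)" by simp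
  from tendsto_divide[OF this tendsto_const, of A]
  have "r \<longlonglongrightarrow> (\<Prod>j<l. \<Prod>i. 1 - 1 / qq j ^ Suc i) / A" using A0 by simp
  also have "(\<Prod>j<l. \<Prod>i. 1 - 1 / qq j ^ Suc i) / A = (\<Prod>j<l. 1 / real (card (mod_auts (G j) (T j))) * (\<Prod>i. 1 - 1 / qq j ^ Suc i))"
    unfolding A_def by (simp add: prod_dividef prod.distrib)
  finally show ?thesis unfolding r_def .
qed

end

section \<open>Reductions of p-adic vectors\<close>

lemma padic_intI:
  assumes "p > 0" "\<And>k. y (Suc k) mod int p ^ k = y k mod int p ^ k"
  shows "(\<lambda>k. y k mod int p ^ k) \<in> padic_int p"
proof -
  have *: "y k mod int p ^ k = y (Suc k) mod int p ^ Suc k mod int p ^ k" for k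
    using assms(2)[of k] by (simp add: mod_mod_cancel)
  show ?thesis unfolding padic_int_def mem_Collect_eq
    by (intro allI conjI, simp add: assms(1), simp add: assms(1), rule *)
qed

lemma padic_int_bounds: "x \<in> padic_int p \<Longrightarrow> 0 \<le> x k" "x \<in> padic_int p \<Longrightarrow> x k < int p ^ k"
  unfolding padic_int_def by blast+

lemma padic_int_coherent: assumes "x \<in> padic_int p" shows "x (Suc k) mod int p ^ k = x k mod int p ^ k"
proof -
  have "x k = x (Suc k) mod int p ^ k" using assms unfolding padic_int_def by blast
  then have "x k mod int p ^ k = x (Suc k) mod int p ^ k mod int p ^ k" by (rule arg_cong)
  then show ?thesis by simp
qed

lemma padic_int_mod: "x \<in> padic_int p \<Longrightarrow> x k mod int p ^ k = x k"
  by (rule mod_pos_pos_trivial) (rule padic_int_bounds; assumption)+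

lemma padic_int_mod_add: "x \<in> padic_int p \<Longrightarrow> x (k + j) mod int p ^ k = x k"
proof (induction j)
  case 0 then show ?case by (simp add: padic_int_mod)
next
  case (Suc j)
  have "x (k + Suc j) mod int p ^ k = x (Suc (k + j)) mod int p ^ (k + j) mod int p ^ k"
    by (simp add: mod_mod_cancel power_add)
  also have "\<dots> = x (k + j) mod int p ^ k"
    using padic_int_coherent[OF Suc.prems, of "k + j"] padic_int_mod[OF Suc.prems, of "k + j"] by simp
  finally show ?case using Suc by simp
qed

lemma padic_int_mod_le: "x \<in> padic_int p \<Longrightarrow> k \<le> K \<Longrightarrow> x K mod int p ^ k = x k"
  using padic_int_mod_add[of x p k "K - k"] by simp

lemma mod_sum_prod_cong:
  fixes A B C D :: "'i \<Rightarrow> int"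
  assumes "\<And>i. i \<in> S \<Longrightarrow> A i mod q = C i mod q" "\<And>i. i \<in> S \<Longrightarrow> B i mod q = D i mod q"
  shows "(\<Sum>i\<in>S. A i * B i) mod q = (\<Sum>i\<in>S. C i * D i) mod q"
proof -
  have "(\<Sum>i\<in>S. A i * B i) mod q = (\<Sum>i\<in>S. (A i * B i) mod q) mod q" by (simp add: mod_sum_eq)
  also have "\<dots> = (\<Sum>i\<in>S. (C i * D i) mod q) mod q"
    by (intro arg_cong[of _ _ "\<lambda>x. x mod q"] sum.cong refl mod_mult_cong assms)
  finally show ?thesis by (simp add: mod_sum_eq)
qed

lemma mat_vec_padic:
  assumes p: "p > 0" and A: "\<And>i l. i < n \<Longrightarrow> l < n \<Longrightarrow> A i l \<in> padic_int p" and v: "v \<in> padic_vecs p n"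
  shows "mat_vec p n A v \<in> padic_vecs p n"
proof -
  have "mat_vec p n A v i \<in> padic_int p" if i: "i < n" for i
  proof -
    have "(\<lambda>k. (\<Sum>l<n. A i l k * v l k) mod int p ^ k) \<in> padic_int p"
      by (rule padic_intI[OF p], rule mod_sum_prod_cong)
        (use A[OF i] v in \<open>auto simp: padic_vecs_def padic_int_coherent\<close>)
    then show ?thesis using i by (simp add: mat_vec_def)
  qed
  then show ?thesis by (auto simp: padic_vecs_def mat_vec_def padic_zero_def)
qed

lemma mat_pow_padic:
  assumes p: "p > 0" and X: "\<And>i l. i < n \<Longrightarrow> l < n \<Longrightarrow> X i l \<in> padic_int p"
  shows "i < n \<Longrightarrow> l < n \<Longrightarrow> mat_pow p n X a i l \<in> padic_int p"
proof (induction a arbitrary: i l)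
  case 0
  have "(\<lambda>k. (if i = l then 1 else 0) mod int p ^ k) \<in> padic_int p" by (rule padic_intI[OF p]) simp
  moreover have "mat_pow p n X 0 i l = (\<lambda>k. (if i = l then 1 else 0) mod int p ^ k)"
    using 0 by (auto simp: mat_id_def fun_eq_iff)
  ultimately show ?case by simp
next
  case (Suc a)
  have "(\<lambda>k. (\<Sum>b<n. mat_pow p n X a i b k * X b l k) mod int p ^ k) \<in> padic_int p"
    by (rule padic_intI[OF p], rule mod_sum_prod_cong)
      (use Suc X in \<open>auto simp: padic_int_coherent\<close>)
  then show ?case using Suc.prems by (simp add: mat_mul_def)
qed

lemma mat_poly_eval_padic:
  assumes p: "p > 0" and X: "\<And>i l. i < n \<Longrightarrow> l < n \<Longrightarrow> X i l \<in> padic_int p" and c: "\<And>a. c a \<in> padic_int p"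
    and il: "i < n" "l < n"
  shows "mat_poly_eval p n c d X i l \<in> padic_int p"
proof -
  have "(\<lambda>k. (\<Sum>a\<le>d. c a k * mat_pow p n X a i l k) mod int p ^ k) \<in> padic_int p"
    by (rule padic_intI[OF p], rule mod_sum_prod_cong)
      (use mat_pow_padic[OF p X il] c in \<open>auto simp: padic_int_coherent\<close>)
  then show ?thesis using il by (simp add: mat_poly_eval_def)
qed

text \<open>\<open>emb\<close> places integer vectors inside \<open>Z_p ^ n\<close> and
  \<open>lev N\<close> returns residues modulo \<open>p ^ N\<close>. Going back and forth between
  the two carries all statements about p-adic vectors to integer ones.\<close>

definition emb :: "nat \<Rightarrow> (nat \<Rightarrow> int) \<Rightarrow> nat \<Rightarrow> nat \<Rightarrow> int" where
  "emb p v = (\<lambda>i k. v i mod int p ^ k)"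

definition lev :: "nat \<Rightarrow> (nat \<Rightarrow> nat \<Rightarrow> int) \<Rightarrow> nat \<Rightarrow> int" where
  "lev N v = (\<lambda>i. v i N)"

definition pscale :: "nat \<Rightarrow> int \<Rightarrow> (nat \<Rightarrow> nat \<Rightarrow> int) \<Rightarrow> nat \<Rightarrow> nat \<Rightarrow> int" where
  "pscale p a z = (\<lambda>i k. a * z i k mod int p ^ k)"

lemma emb_padic: assumes p: "p > 0" and v: "v \<in> zvecs n" shows "emb p v \<in> padic_vecs p n"
proof -
  have "(\<lambda>k. v i mod int p ^ k) \<in> padic_int p" for i by (rule padic_intI[OF p]) simp
  then show ?thesis using v by (simp add: padic_vecs_def emb_def zvecs_def padic_zero_def)
qed

lemma pscale_padic: assumes p: "p > 0" and z: "z \<in> padic_vecs p n" shows "pscale p a z \<in> padic_vecs p n"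
proof -
  have "(\<lambda>k. a * z i k mod int p ^ k) \<in> padic_int p" if "i < n" for i
    by (rule padic_intI[OF p], rule mod_mult_cong)
      (use z that in \<open>auto simp: padic_vecs_def padic_int_coherent\<close>)
  then show ?thesis using z by (auto simp: padic_vecs_def pscale_def padic_zero_def)
qed

lemma lev_zbox: "v \<in> padic_vecs p n \<Longrightarrow> lev N v \<in> zbox n (int p ^ N)"
  by (auto simp: padic_vecs_def lev_def zbox_def zvecs_def padic_zero_def padic_int_bounds)

lemma lev_zvecs: "v \<in> padic_vecs p n \<Longrightarrow> lev N v \<in> zvecs n"
  using lev_zbox zbox_zvecs by blast

lemma lev_emb: "lev N (emb p v) = zred (int p ^ N) v"
  by (simp add: lev_def emb_def zred_def)

lemma lev_vec_add:
  assumes "u \<in> padic_vecs p n" "v \<in> padic_vecs p n"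
  shows "lev N (vec_add p n u v) = zred (int p ^ N) (lev N u + lev N v)"
proof
  fix i show "lev N (vec_add p n u v) i = zred (int p ^ N) (lev N u + lev N v) i"
  proof (cases "i < n")
    case False
    then have "u i = padic_zero" "v i = padic_zero" using assms by (simp_all add: padic_vecs_def)
    then show ?thesis using False by (simp add: lev_def vec_add_def zred_def pointwise padic_zero_def)
  qed (simp add: lev_def vec_add_def zred_def pointwise)
qed

lemma vec_add_emb: "u \<in> zvecs n \<Longrightarrow> v \<in> zvecs n \<Longrightarrow> vec_add p n (emb p u) (emb p v) = emb p (u + v)"
proof (rule ext, rule ext)
  fix i k assume uv: "u \<in> zvecs n" "v \<in> zvecs n"
  show "vec_add p n (emb p u) (emb p v) i k = emb p (u + v) i k"
  proof (cases "i < n")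
    case False
    then have "u i = 0" "v i = 0" using uv by (simp_all add: zvecs_def)
    then show ?thesis using False by (simp add: vec_add_def emb_def pointwise)
  qed (simp add: vec_add_def emb_def pointwise mod_add_eq)
qed

lemma padic_vec_split:
  assumes p: "p > 0" and v: "v \<in> padic_vecs p n"
  obtains z where "z \<in> padic_vecs p n" "v = vec_add p n (emb p (lev N v)) (pscale p (int p ^ N) z)"
proof
  \<comment> \<open>Dividing by \<open>p ^ N\<close> costs \<open>N\<close> levels of precision, so
    level \<open>k\<close> of \<open>z\<close> is read off level \<open>k + N\<close> of
    \<open>v\<close>.\<close>
  define z where "z = (\<lambda>i k. v i (k + N) div int p ^ N)"
  have vi: "v i \<in> padic_int p" if "i < n" for i using v that by (simp add: padic_vecs_def)
  have v0: "v i k = 0" if "\<not> i < n" for i k using v that by (simp add: padic_vecs_def padic_zero_def)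
  have split: "v i (k + N) = int p ^ N * z i k + v i N" if i: "i < n" for i k
    using padic_int_mod_le[OF vi[OF i], of N "k + N"] mult_div_mod_eq[of "int p ^ N" "v i (k + N)"]
    by (simp add: z_def)
  show "z \<in> padic_vecs p n"
  proof -
    have "z i \<in> padic_int p" if i: "i < n" for i
      unfolding padic_int_def mem_Collect_eq
    proof (intro allI conjI)
      fix k
      have vk: "0 \<le> v i (k + N)" "v i (k + N) < int p ^ (k + N)" using padic_int_bounds[OF vi[OF i]] by blast+
      show "0 \<le> z i k" using vk p by (simp add: z_def pos_imp_zdiv_nonneg_iff)
      show "z i k < int p ^ k" using vk p by (simp add: z_def div_less_iff_less_mult_int power_add)
      have "v i (k + N) = v i (Suc k + N) mod (int p ^ N * int p ^ k)"
        using padic_int_mod_le[OF vi[OF i], of "k + N" "Suc k + N"] by (simp add: power_add mult.commute)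
      then have "v i (k + N) = int p ^ N * (v i (Suc k + N) div int p ^ N mod int p ^ k) + v i (Suc k + N) mod int p ^ N"
        using zmod_zmult2_eq[of "int p ^ k" "v i (Suc k + N)" "int p ^ N"] by simp
      then show "z i k = z i (Suc k) mod int p ^ k" using p by (simp add: z_def)
    qed
    then show ?thesis using v0 by (auto simp: padic_vecs_def z_def padic_zero_def fun_eq_iff)
  qed
  show "v = vec_add p n (emb p (lev N v)) (pscale p (int p ^ N) z)"
  proof (rule ext, rule ext)
    fix i k
    show "v i k = vec_add p n (emb p (lev N v)) (pscale p (int p ^ N) z) i k"
    proof (cases "i < n")
      case True
      have "v i k = v i (k + N) mod int p ^ k" using padic_int_mod_le[OF vi[OF True], of k "k + N"] by simp
      then show ?thesis using True split[OF True, of k]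
        by (simp add: vec_add_def emb_def lev_def pscale_def mod_add_eq add.commute)
    next
      case False then show ?thesis using v0 by (simp add: vec_add_def)
    qed
  qed
qed

text \<open>\<open>Xc\<close> stores columns, hence the exchanged indices. Powers of a p-adic matrix
  are reduced at every step, while iterating \<open>lin\<close> never reduces, so only a congruence
  can hold.\<close>

lemma lin_pow_level:
  assumes p: "p > 0" and X: "\<And>i l. i < n \<Longrightarrow> l < n \<Longrightarrow> X i l \<in> padic_int p"
    and Xc: "\<And>i l. i < n \<Longrightarrow> l < n \<Longrightarrow> Xc l i = X i l N" and i: "i < n"
  shows "(\<Sum>l<n. mat_pow p n X a i l N * w l) mod int p ^ N = (lin n Xc ^^ a) w i mod int p ^ N"
proof (induction a arbitrary: w)
  case 0
  have "(\<Sum>l<n. mat_pow p n X 0 i l N * w l) mod int p ^ N = (\<Sum>l<n. (if i = l then 1 else 0) * w l) mod int p ^ N"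
    by (rule mod_sum_prod_cong) (use i in \<open>auto simp: mat_id_def\<close>)
  also have "(\<Sum>l<n. (if i = l then 1 else 0) * w l) = w i" using i by (simp add: if_distrib[of "\<lambda>x. x * _"] cong: if_cong)
  finally show ?case by simp
next
  case (Suc a)
  have "(\<Sum>l<n. mat_pow p n X (Suc a) i l N * w l) mod int p ^ N
      = (\<Sum>l<n. (\<Sum>b<n. mat_pow p n X a i b N * X b l N) * w l) mod int p ^ N"
    by (rule mod_sum_prod_cong) (use i in \<open>auto simp: mat_mul_def\<close>)
  also have "(\<Sum>l<n. (\<Sum>b<n. mat_pow p n X a i b N * X b l N) * w l)
      = (\<Sum>b<n. mat_pow p n X a i b N * (\<Sum>l<n. w l * X b l N))"
    unfolding sum_distrib_right sum_distrib_left by (subst sum.swap) (simp add: mult_ac)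
  also have "\<dots> = (\<Sum>b<n. mat_pow p n X a i b N * lin n Xc w b)"
    by (intro sum.cong refl) (simp add: lin_def Xc)
  also have "\<dots> mod int p ^ N = (lin n Xc ^^ a) (lin n Xc w) i mod int p ^ N" by (rule Suc.IH)
  finally show ?case by (simp only: funpow_Suc_right o_apply)
qed

lemma pact_level:
  assumes p: "p > 0" and X: "\<And>i l. i < n \<Longrightarrow> l < n \<Longrightarrow> X i l \<in> padic_int p"
    and Xc: "\<And>i l. i < n \<Longrightarrow> l < n \<Longrightarrow> Xc l i = X i l N" and i: "i < n"
    and Q: "degree Q \<le> d" "\<And>a. a \<le> d \<Longrightarrow> coeff Q a = c a N"
  shows "(\<Sum>l<n. mat_poly_eval p n c d X i l N * w l) mod int p ^ N = pact n Xc Q w i mod int p ^ N"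
proof -
  have "(\<Sum>l<n. mat_poly_eval p n c d X i l N * w l) mod int p ^ N
     = (\<Sum>l<n. (\<Sum>a\<le>d. c a N * mat_pow p n X a i l N) * w l) mod int p ^ N"
    by (rule mod_sum_prod_cong) (use i in \<open>auto simp: mat_poly_eval_def\<close>)
  also have "(\<Sum>l<n. (\<Sum>a\<le>d. c a N * mat_pow p n X a i l N) * w l) = (\<Sum>a\<le>d. c a N * (\<Sum>l<n. mat_pow p n X a i l N * w l))"
    unfolding sum_distrib_right sum_distrib_left by (subst sum.swap) (simp add: mult_ac)
  also have "\<dots> mod int p ^ N = (\<Sum>a\<le>d. c a N * (lin n Xc ^^ a) w i) mod int p ^ N"
    by (rule mod_sum_prod_cong) (use lin_pow_level[where X = X and Xc = Xc, OF p X Xc i] in simp_all)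
  also have "(\<Sum>a\<le>d. c a N * (lin n Xc ^^ a) w i) = pact n Xc Q w i"
    unfolding pact_eq_sum[OF Q(1)] using Q(2) by (simp add: sum_fun_apply pointwise)
  finally show ?thesis .
qed

lemma additive_zscale:
  fixes \<psi> :: "(nat \<Rightarrow> int) \<Rightarrow> 'a" and G :: "('a, 'b) monoid_scheme"
  assumes G: "comm_group G" and cl: "\<And>v. v \<in> zvecs n \<Longrightarrow> \<psi> v \<in> carrier G"
    and add: "\<And>u v. u \<in> zvecs n \<Longrightarrow> v \<in> zvecs n \<Longrightarrow> \<psi> (u + v) = \<psi> u \<otimes>\<^bsub>G\<^esub> \<psi> v" and u: "u \<in> zvecs n"
  shows "\<psi> (a *z u) = \<psi> u [^]\<^bsub>G\<^esub> a"
proof -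
  interpret comm_group G by (rule G)
  have "\<psi> 0 \<otimes>\<^bsub>G\<^esub> \<psi> 0 = \<psi> 0" using add[of 0 0] by simp
  then have zero: "\<psi> 0 = \<one>\<^bsub>G\<^esub>" using cl[of 0] l_cancel_one'[of "\<psi> 0" "\<psi> 0"] by simp
  have step: "\<psi> ((i + 1) *z u) = \<psi> (i *z u) \<otimes>\<^bsub>G\<^esub> \<psi> u" for i
    using add[of "i *z u" u] u by (simp add: zscale_add_left)
  have pstep: "\<psi> u [^]\<^bsub>G\<^esub> (i + 1) = \<psi> u [^]\<^bsub>G\<^esub> i \<otimes>\<^bsub>G\<^esub> \<psi> u" for i :: int
    using int_pow_mult[OF cl[OF u], of i 1] cl[OF u] by simp
  show ?thesis
  proof (induction a rule: int_induct[where k = 0])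
    case base
    have "0 *z u = 0" by simp
    then show ?case using zero by (simp only: int_pow_0)
  next
    case (step1 i)
    show ?case unfolding step pstep by (simp only: step1.IH)
  next
    case (step2 i)
    have "\<psi> ((i - 1) *z u) \<otimes>\<^bsub>G\<^esub> \<psi> u = \<psi> u [^]\<^bsub>G\<^esub> (i - 1) \<otimes>\<^bsub>G\<^esub> \<psi> u"
      using step[of "i - 1"] pstep[of "i - 1"] step2.IH by simp
    then show ?case using cl[OF u] cl[of "(i - 1) *z u"] u by simp
  qed
qed

lemma gev_eq_additive:
  fixes \<psi> :: "(nat \<Rightarrow> int) \<Rightarrow> 'a" and G :: "('a, 'b) monoid_scheme"
  assumes G: "comm_group G" and cl: "\<And>v. v \<in> zvecs n \<Longrightarrow> \<psi> v \<in> carrier G"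
    and add: "\<And>u v. u \<in> zvecs n \<Longrightarrow> v \<in> zvecs n \<Longrightarrow> \<psi> (u + v) = \<psi> u \<otimes>\<^bsub>G\<^esub> \<psi> v" and v: "v \<in> zvecs n"
    and f: "\<And>k. k < n \<Longrightarrow> f k = \<psi> (\<lambda>i. if i = k then 1 else 0)"
  shows "gev G f v n = \<psi> v"
proof -
  interpret comm_group G by (rule G)
  have "\<psi> 0 \<otimes>\<^bsub>G\<^esub> \<psi> 0 = \<psi> 0" using add[of 0 0] by simp
  then have zero: "\<psi> 0 = \<one>\<^bsub>G\<^esub>" using cl[of 0] l_cancel_one'[of "\<psi> 0" "\<psi> 0"] by simp
  have "gev G f v k = \<psi> (\<lambda>i. if i < k then v i else 0)" if "k \<le> n" for k
    using that
  proof (induction k)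
    case 0
    have "(\<lambda>i. if i < 0 then v i else 0) = 0" by (simp add: fun_eq_iff pointwise)
    then show ?case using zero by (simp only: gev.simps)
  next
    case (Suc k)
    let ?e = "\<lambda>i. if i = k then 1 else (0::int)" and ?t = "\<lambda>i. if i < k then v i else 0"
    have e: "?e \<in> zvecs n" "?t \<in> zvecs n" using Suc.prems by (auto simp: zvecs_def)
    have "(\<lambda>i. if i < Suc k then v i else 0) = ?t + v k *z ?e" by (auto simp: fun_eq_iff pointwise less_Suc_eq)
    then have "\<psi> (\<lambda>i. if i < Suc k then v i else 0) = \<psi> (?t + v k *z ?e)" by (rule arg_cong)
    also have "\<dots> = \<psi> ?t \<otimes>\<^bsub>G\<^esub> \<psi> (v k *z ?e)" using e by (intro add) auto
    also have "\<psi> (v k *z ?e) = \<psi> ?e [^]\<^bsub>G\<^esub> v k" by (rule additive_zscale[OF G cl add e(1)])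
    finally show ?case using Suc f[of k] by simp
  qed
  moreover have "(\<lambda>i. if i < n then v i else 0) = v" using v by (auto simp: fun_eq_iff zvecs_def)
  ultimately show ?thesis by simp
qed

text \<open>Successive approximation: if \<open>A\<close> maps onto each \<open>v \<in> S\<close> up to \<open>p\<close> times another member
  of \<open>S\<close>, then the partial sums of the approximate preimages converge to a preimage.\<close>

lemma padic_lift:
  fixes A :: padic_mat
  assumes p: "p > 0" and S: "S \<subseteq> padic_vecs p n" and vS: "v \<in> S"
    and step: "\<And>v. v \<in> S \<Longrightarrow> \<exists>w v'. w \<in> zvecs n \<and> v' \<in> S \<and>
        (\<forall>i<n. \<forall>k. v i k mod int p ^ k = ((\<Sum>l<n. A i l k * w l) + int p * v' i k) mod int p ^ k)"
  shows "\<exists>w\<in>padic_vecs p n. v = mat_vec p n A w"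
proof -
  have "\<forall>v\<in>S. \<exists>x. fst x \<in> zvecs n \<and> snd x \<in> S \<and>
        (\<forall>i<n. \<forall>k. v i k mod int p ^ k = ((\<Sum>l<n. A i l k * fst x l) + int p * snd x i k) mod int p ^ k)"
  proof
    fix v assume v: "v \<in> S"
    obtain w v' where "w \<in> zvecs n \<and> v' \<in> S \<and>
        (\<forall>i<n. \<forall>k. v i k mod int p ^ k = ((\<Sum>l<n. A i l k * w l) + int p * v' i k) mod int p ^ k)"
      using step[OF v] by (elim exE)
    then show "\<exists>x. fst x \<in> zvecs n \<and> snd x \<in> S \<and>
        (\<forall>i<n. \<forall>k. v i k mod int p ^ k = ((\<Sum>l<n. A i l k * fst x l) + int p * snd x i k) mod int p ^ k)"
      by (intro exI[of _ "(w, v')"]) simp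
  qed
  then obtain F where F: "\<forall>v\<in>S. fst (F v) \<in> zvecs n \<and> snd (F v) \<in> S \<and>
        (\<forall>i<n. \<forall>k. v i k mod int p ^ k = ((\<Sum>l<n. A i l k * fst (F v) l) + int p * snd (F v) i k) mod int p ^ k)"
    by (rule bchoice[THEN exE])
  define vs where "vs r = ((\<lambda>v. snd (F v)) ^^ r) v" for r
  define ws where "ws r = fst (F (vs r))" for r
  define y where "y l r = (\<Sum>t<r. int p ^ t * ws t l)" for l r
  have vsS: "vs r \<in> S" for r
  proof (induction r)
    case 0 then show ?case using vS by (simp add: vs_def)
  next
    case (Suc r) then show ?case using F by (simp add: vs_def)
  qed
  have wsz: "ws r \<in> zvecs n" for r using F vsS by (simp add: ws_def)
  have vstep: "vs r i k mod int p ^ k = ((\<Sum>l<n. A i l k * ws r l) + int p * vs (Suc r) i k) mod int p ^ k" if "i < n" for r i k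
    using bspec[OF F vsS[of r]] that by (simp add: ws_def vs_def)
  have part: "v i k mod int p ^ k = ((\<Sum>l<n. A i l k * y l r) + int p ^ r * vs r i k) mod int p ^ k" if i: "i < n" for i k r
  proof (induction r)
    case 0 show ?case by (simp add: y_def vs_def)
  next
    case (Suc r)
    have "v i k mod int p ^ k = ((\<Sum>l<n. A i l k * y l r) + int p ^ r * ((\<Sum>l<n. A i l k * ws r l) + int p * vs (Suc r) i k)) mod int p ^ k"
      unfolding Suc.IH by (rule mod_add_cong[OF refl mod_mult_cong[OF refl vstep[OF i]]])
    also have "(\<Sum>l<n. A i l k * y l r) + int p ^ r * ((\<Sum>l<n. A i l k * ws r l) + int p * vs (Suc r) i k)
       = (\<Sum>l<n. A i l k * y l (Suc r)) + int p ^ Suc r * vs (Suc r) i k"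
      by (simp add: y_def distrib_left sum.distrib sum_distrib_left mult_ac)
    finally show ?case .
  qed
  define w where "w = (\<lambda>l k. y l k mod int p ^ k)"
  have "w \<in> padic_vecs p n"
  proof -
    have "(\<lambda>k. y l k mod int p ^ k) \<in> padic_int p" for l by (rule padic_intI[OF p]) (simp add: y_def)
    moreover have "w l = padic_zero" if "l \<ge> n" for l using wsz that by (simp add: w_def y_def zvecs_def padic_zero_def)
    ultimately show ?thesis by (simp add: padic_vecs_def w_def)
  qed
  moreover have "v = mat_vec p n A w"
  proof (rule ext, rule ext)
    fix i k
    show "v i k = mat_vec p n A w i k"
    proof (cases "i < n")
      case True
      have "v i k = v i k mod int p ^ k" using S vS True by (auto simp: padic_vecs_def padic_int_mod)
      also have "\<dots> = (\<Sum>l<n. A i l k * y l k) mod int p ^ k" unfolding part[OF True, of k k] by simp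
      also have "\<dots> = (\<Sum>l<n. A i l k * w l k) mod int p ^ k"
        by (rule mod_sum_prod_cong) (simp_all add: w_def)
      finally show ?thesis using True by (simp add: mat_vec_def)
    next
      case False
      then have "v i = padic_zero" using S vS by (auto simp: padic_vecs_def)
      then show ?thesis using False by (simp add: mat_vec_def padic_zero_def)
    qed
  qed
  ultimately show ?thesis by blast
qed

section \<open>The cokernel condition at level m + 1\<close>

context module_family
begin

lemma pow_M: assumes "j < l" "x \<in> carrier (G j)" shows "x [^]\<^bsub>G j\<^esub> M = \<one>\<^bsub>G j\<^esub>"
proof -
  interpret comm_group "G j" by (rule G[OF assms(1)])
  have "x [^]\<^bsub>G j\<^esub> M = (x [^]\<^bsub>G j\<^esub> (int p ^ m)) [^]\<^bsub>G j\<^esub> int p"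
    unfolding M_def power_Suc using int_pow_pow[OF assms(2)] by (simp add: mult.commute)
  then show ?thesis using expo[OF assms] by simp
qed

context
  fixes j n d :: nat and X :: "nat \<Rightarrow> nat \<Rightarrow> nat \<Rightarrow> int" and c :: "nat \<Rightarrow> nat \<Rightarrow> int" and Xc :: "nat \<Rightarrow> nat \<Rightarrow> int"
  assumes j: "j < l" and Xp: "\<And>i k. i < n \<Longrightarrow> k < n \<Longrightarrow> X i k \<in> padic_int p" and cp: "\<And>a. c a \<in> padic_int p"
    and Q: "degree (Pj j) \<le> d" "\<And>a. a \<le> d \<Longrightarrow> coeff (Pj j) a = c a (Suc m)"
    and Xc: "\<And>i k. i < n \<Longrightarrow> k < n \<Longrightarrow> Xc k i = X i k (Suc m)" and Xz: "\<And>k. k < n \<Longrightarrow> Xc k \<in> zvecs n"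
begin

abbreviation (input) "YY \<equiv> mat_poly_eval p n c d X"
abbreviation (input) "PV \<equiv> padic_vecs p n"
abbreviation (input) "lv \<equiv> lev (Suc m)"

lemma pp: "p > 0" using p prime_gt_0_nat by simp

lemma MN: "int p ^ Suc m = M" by (simp add: M_def)

lemma YY_padic: "i < n \<Longrightarrow> k < n \<Longrightarrow> YY i k \<in> padic_int p"
  by (rule mat_poly_eval_padic[where X = X, OF pp Xp cp])

lemma pactz: "w \<in> zvecs n \<Longrightarrow> pact n Xc (Pj j) w \<in> zvecs n"
  by (rule pact_zvecs[where X = Xc, OF Xz])

lemma lev_YY: assumes w: "w \<in> PV" shows "lv (mat_vec p n YY w) = zred M (pact n Xc (Pj j) (lv w))"
proof
  fix i show "lv (mat_vec p n YY w) i = zred M (pact n Xc (Pj j) (lv w)) i"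
  proof (cases "i < n")
    case True
    have "(\<Sum>k<n. YY i k (Suc m) * lv w k) mod int p ^ Suc m = pact n Xc (Pj j) (lv w) i mod int p ^ Suc m"
      by (rule pact_level[where X = X and Xc = Xc and c = c and Q = "Pj j" and N = "Suc m", OF pp Xp Xc True Q])
    then show ?thesis using True unfolding MN by (simp add: lev_def mat_vec_def zred_def M_def)
  next
    case False
    have "pact n Xc (Pj j) (lv w) i = 0" using pactz[OF lev_zvecs[OF w, of "Suc m"]] False by (simp add: zvecs_def)
    then show ?thesis using False by (simp add: lev_def mat_vec_def zred_def)
  qed
qed

lemma lev_XX: assumes v: "v \<in> PV" shows "lv (mat_vec p n X v) = zred M (lin n Xc (lv v))"
proof
  fix i show "lv (mat_vec p n X v) i = zred M (lin n Xc (lv v)) i"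
  proof (cases "i < n")
    case True
    have "(\<Sum>k<n. X i k (Suc m) * v k (Suc m)) = (\<Sum>k<n. v k (Suc m) * Xc k i)"
      by (intro sum.cong refl) (simp add: Xc[OF True])
    then show ?thesis using True by (simp add: lev_def mat_vec_def zred_def lin_def M_def)
  next
    case False
    have "lin n Xc (lv v) i = 0" using lin_zvecs[where X = Xc and v = "lv v", OF Xz] False by (simp add: zvecs_def)
    then show ?thesis using False by (simp add: lev_def mat_vec_def zred_def)
  qed
qed

lemma zred_cong: assumes "u - v \<in> (*z) M ` zvecs n" shows "zred M u = zred M v"
proof -
  obtain w where w: "u - v = M *z w" using assms by (rule imageE)
  have "u i mod M = v i mod M" for i
    using fun_cong[OF w, of i] by (simp add: pointwise mod_eq_dvd_iff)
  then show ?thesis by (simp add: zred_def)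
qed

lemma zred_diff_image: assumes "v \<in> zvecs n" shows "zred M v - v \<in> (*z) M ` zvecs n"
proof -
  have L: "zlattice n (M * 1) ((*z) M ` zvecs n)" by (rule zlattice_scaled) (rule zlattice_UNIV)
  then show ?thesis using zlattice_zred_diff[of n M "(*z) M ` zvecs n" v] assms by simp
qed

lemma lev_YY_emb: assumes w: "w \<in> zvecs n" shows "lv (mat_vec p n YY (emb p w)) = zred M (pact n Xc (Pj j) w)"
proof -
  have wP: "emb p w \<in> PV" by (rule emb_padic[OF pp w])
  have "lv (mat_vec p n YY (emb p w)) = zred M (pact n Xc (Pj j) (zred M w))"
    unfolding lev_YY[OF wP] lev_emb MN ..
  also have "\<dots> = zred M (pact n Xc (Pj j) w)"
  proof (rule zred_cong)
    obtain u where u: "zred M w - w = M *z u" "u \<in> zvecs n" using zred_diff_image[OF w] by (rule imageE)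
    have "pact n Xc (Pj j) (zred M w) - pact n Xc (Pj j) w = M *z pact n Xc (Pj j) u"
      unfolding pact_vec_diff[symmetric] u(1) pact_vec_zscale ..
    then show "pact n Xc (Pj j) (zred M w) - pact n Xc (Pj j) w \<in> (*z) M ` zvecs n"
      using pact_zvecs[where X = Xc, OF Xz u(2)] by (rule image_eqI)
  qed
  finally show ?thesis .
qed

text \<open>A map \<open>\<phi>\<close> onto \<open>G j\<close> kills
  \<open>p ^ Suc m Z_p ^ n\<close> and so depends only on residues at level \<open>m + 1\<close>.
  Its restriction \<open>\<psi>\<close> to integer vectors is additive, hence given by its values on
  the standard basis, and these form the required \<open>f\<close>.\<close>

lemma good_if_cok_iso:
  assumes "cok_iso p n YY X (G j) (T j)"
  shows "\<exists>f\<in>Ft n j. good n j f Xc"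
proof -
  interpret H: comm_group "G j" by (rule G[OF j])
  obtain \<phi> where img: "\<phi> ` PV = carrier (G j)"
    and add: "\<forall>u\<in>PV. \<forall>v\<in>PV. \<phi> (vec_add p n u v) = \<phi> u \<otimes>\<^bsub>G j\<^esub> \<phi> v"
    and ker: "\<forall>v\<in>PV. \<phi> v = \<one>\<^bsub>G j\<^esub> \<longleftrightarrow> (\<exists>w\<in>PV. v = mat_vec p n YY w)"
    and tw: "\<forall>v\<in>PV. \<phi> (mat_vec p n X v) = T j (\<phi> v)"
    using assms unfolding cok_iso_def by (elim exE conjE)
  define \<psi> where "\<psi> v = \<phi> (emb p v)" for v
  have cl: "\<phi> v \<in> carrier (G j)" if "v \<in> PV" for v using img that by blast
  have \<psi>cl: "\<psi> v \<in> carrier (G j)" if "v \<in> zvecs n" for v unfolding \<psi>_def by (rule cl[OF emb_padic[OF pp that]])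
  have \<psi>add: "\<psi> (u + v) = \<psi> u \<otimes>\<^bsub>G j\<^esub> \<psi> v" if "u \<in> zvecs n" "v \<in> zvecs n" for u v
    unfolding \<psi>_def vec_add_emb[OF that, symmetric]
    using add emb_padic[OF pp that(1)] emb_padic[OF pp that(2)] by blast
  have zero: "\<phi> (\<lambda>i k. 0) = \<one>\<^bsub>G j\<^esub>"
  proof -
    have z: "(\<lambda>i k. 0) \<in> PV" using emb_padic[OF pp, of 0 n] by (simp add: emb_def pointwise)
    have "vec_add p n (\<lambda>i k. 0) (\<lambda>i k. 0) = (\<lambda>i k. 0)" by (simp add: vec_add_def fun_eq_iff)
    then have "\<phi> (\<lambda>i k. 0) \<otimes>\<^bsub>G j\<^esub> \<phi> (\<lambda>i k. 0) = \<phi> (\<lambda>i k. 0)" using add z by metis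
    then show ?thesis using cl[OF z] H.l_cancel_one'[of "\<phi> (\<lambda>i k. 0)" "\<phi> (\<lambda>i k. 0)"] by simp
  qed
  have scale: "\<phi> (pscale p (int a) z) = \<phi> z [^]\<^bsub>G j\<^esub> a" if z: "z \<in> PV" for z a
  proof (induction a)
    case 0
    have "pscale p (int 0) z = (\<lambda>i k. 0)" by (simp add: pscale_def)
    then show ?case using zero by (simp only: H.nat_pow_0)
  next
    case (Suc a)
    have "pscale p (int (Suc a)) z = vec_add p n (pscale p (int a) z) z"
    proof (rule ext, rule ext)
      fix i k show "pscale p (int (Suc a)) z i k = vec_add p n (pscale p (int a) z) z i k"
      proof (cases "i < n")
        case True
        have "(z i k + int a * z i k) mod int p ^ k = (int a * z i k mod int p ^ k + z i k) mod int p ^ k"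
          by (simp add: mod_add_left_eq mod_add_right_eq add.commute)
        then show ?thesis using True by (simp add: pscale_def vec_add_def algebra_simps)
      next
        case False
        then have "z i = padic_zero" using z by (simp add: padic_vecs_def)
        then show ?thesis using False by (simp add: pscale_def vec_add_def padic_zero_def)
      qed
    qed
    then have "\<phi> (pscale p (int (Suc a)) z) = \<phi> (pscale p (int a) z) \<otimes>\<^bsub>G j\<^esub> \<phi> z"
      using add pscale_padic[OF pp z] z by simp
    then show ?case using Suc by simp
  qed
  \<comment> \<open>Splitting off the residue leaves a multiple of \<open>p ^ Suc m\<close>, which
    \<open>\<phi>\<close> sends to the neutral element.\<close>
  have lev: "\<phi> u = \<psi> (lv u)" if u: "u \<in> PV" for u
  proof -
    obtain z where z: "z \<in> PV" "u = vec_add p n (emb p (lv u)) (pscale p (int p ^ Suc m) z)"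
      using padic_vec_split[OF pp u, of "Suc m"] by blast
    have "\<phi> z [^]\<^bsub>G j\<^esub> (p ^ Suc m) = \<phi> z [^]\<^bsub>G j\<^esub> int (p ^ Suc m)" by (simp only: int_pow_int)
    also have "int (p ^ Suc m) = M" by (simp add: M_def)
    finally have "\<phi> (pscale p (int p ^ Suc m) z) = \<one>\<^bsub>G j\<^esub>"
      using scale[OF z(1), of "p ^ Suc m"] pow_M[OF j cl[OF z(1)]] by simp
    moreover have "\<phi> u = \<phi> (emb p (lv u)) \<otimes>\<^bsub>G j\<^esub> \<phi> (pscale p (int p ^ Suc m) z)"
      using add emb_padic[OF pp lev_zvecs[OF u]] pscale_padic[OF pp z(1)] arg_cong[OF z(2), of \<phi>] by simp
    ultimately show ?thesis using \<psi>cl[OF lev_zvecs[OF u]] unfolding \<psi>_def by simp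
  qed
  have \<psi>red: "\<psi> (zred M v) = \<psi> v" if v: "v \<in> zvecs n" for v
    using lev[OF emb_padic[OF pp v]] unfolding \<psi>_def lev_emb MN by simp
  define f where "f = (\<lambda>k\<in>{..<n}. \<psi> (\<lambda>i. if i = k then 1 else 0))"
  have unit: "(\<lambda>i. if i = k then 1 else 0) \<in> zvecs n" if "k < n" for k using that by (simp add: zvecs_def)
  have fFt: "f \<in> Ft n j" unfolding f_def Ft_def using \<psi>cl[OF unit] by simp
  have ev: "gev (G j) f v n = \<psi> v" if v: "v \<in> zvecs n" for v
    by (rule gev_eq_additive[OF G[OF j] \<psi>cl \<psi>add v]) (simp_all add: f_def)
  have "good n j f Xc"
  proof -
    have g1: "\<forall>y\<in>carrier (G j). \<exists>v\<in>zvecs n. gev (G j) f v n = y"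
    proof
      fix y assume "y \<in> carrier (G j)"
      then have "y \<in> \<phi> ` PV" using img by simp
      then obtain u where u: "y = \<phi> u" "u \<in> PV" by (rule imageE)
      have "gev (G j) f (lv u) n = y" using ev[OF lev_zvecs[OF u(2)]] lev[OF u(2)] u(1) by simp
      then show "\<exists>v\<in>zvecs n. gev (G j) f v n = y" using lev_zvecs[OF u(2)] by (rule bexI)
    qed
    have g2: "H.intertwines (T j) n f Xc"
      unfolding H.intertwines_def
    proof (rule allI, rule impI)
      fix k assume k: "k < n"
      let ?e = "\<lambda>i. if i = k then 1 else (0::int)"
      have eP: "emb p ?e \<in> PV" by (rule emb_padic[OF pp unit[OF k]])
      have "T j (f k) = T j (\<phi> (emb p ?e))" using k by (simp add: f_def \<psi>_def)
      also have "\<dots> = \<phi> (mat_vec p n X (emb p ?e))" using tw eP by simp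
      also have "\<dots> = \<psi> (lv (mat_vec p n X (emb p ?e)))" by (rule lev[OF mat_vec_padic[where A = X, OF pp Xp eP]])
      also have "lv (mat_vec p n X (emb p ?e)) = zred M (lin n Xc (zred M ?e))" unfolding lev_XX[OF eP] lev_emb MN ..
      also have "\<dots> = zred M (lin n Xc ?e)"
      proof (rule zred_cong)
        obtain u where u: "zred M ?e - ?e = M *z u" "u \<in> zvecs n" using zred_diff_image[OF unit[OF k]] by (rule imageE)
        have "lin n Xc (zred M ?e) - lin n Xc ?e = M *z lin n Xc u"
          unfolding lin_diff[symmetric] u(1) lin_zscale ..
        then show "lin n Xc (zred M ?e) - lin n Xc ?e \<in> (*z) M ` zvecs n" using lin_zvecs[where X = Xc and v = u, OF Xz] by (rule image_eqI)
      qed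
      also have "\<psi> (zred M (lin n Xc ?e)) = \<psi> (lin n Xc ?e)" by (rule \<psi>red[OF lin_zvecs[where X = Xc, OF Xz]])
      also have "lin n Xc ?e = Xc k" using k by (simp add: lin_def fun_eq_iff if_distrib[of "\<lambda>x. x * _"] cong: if_cong)
      finally show "gev (G j) f (Xc k) n = T j (f k)" using ev[OF Xz[OF k]] by simp
    qed
    have g3: "\<forall>v\<in>zvecs n. gev (G j) f v n = \<one>\<^bsub>G j\<^esub> \<longleftrightarrow> (\<exists>w\<in>zvecs n. v - pact n Xc (Pj j) w \<in> (*z) M ` zvecs n)"
    proof
      fix v assume v: "v \<in> zvecs n"
      have vP: "emb p v \<in> PV" by (rule emb_padic[OF pp v])
      show "gev (G j) f v n = \<one>\<^bsub>G j\<^esub> \<longleftrightarrow> (\<exists>w\<in>zvecs n. v - pact n Xc (Pj j) w \<in> (*z) M ` zvecs n)"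
        unfolding ev[OF v]
      proof
        assume "\<psi> v = \<one>\<^bsub>G j\<^esub>"
        then obtain w where w: "w \<in> PV" "emb p v = mat_vec p n YY w" using bspec[OF ker vP] unfolding \<psi>_def by blast
        have eq: "zred M v = zred M (pact n Xc (Pj j) (lv w))" using arg_cong[OF w(2), of lv] unfolding lev_emb MN lev_YY[OF w(1)] .
        have "v - pact n Xc (Pj j) (lv w) \<in> (*z) M ` zvecs n"
        proof -
          have "M dvd v i - pact n Xc (Pj j) (lv w) i" for i
            using fun_cong[OF eq, of i] by (simp add: zred_def mod_eq_dvd_iff)
          then show ?thesis unfolding mem_scaled_zvecs using v pactz[OF lev_zvecs[OF w(1)]] by (simp add: pointwise zvecs_closed)
        qed
        then show "\<exists>w\<in>zvecs n. v - pact n Xc (Pj j) w \<in> (*z) M ` zvecs n" using lev_zvecs[OF w(1)] by (rule bexI)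
      next
        assume "\<exists>w\<in>zvecs n. v - pact n Xc (Pj j) w \<in> (*z) M ` zvecs n"
        then obtain w where w: "w \<in> zvecs n" "v - pact n Xc (Pj j) w \<in> (*z) M ` zvecs n" by (rule bexE)
        have wP: "emb p w \<in> PV" by (rule emb_padic[OF pp w(1)])
        let ?u = "mat_vec p n YY (emb p w)"
        have uP: "?u \<in> PV" by (rule mat_vec_padic[where A = YY, OF pp YY_padic wP])
        have "\<phi> ?u = \<one>\<^bsub>G j\<^esub>" using bspec[OF ker uP] wP by blast
        then have 1: "\<psi> (lv ?u) = \<one>\<^bsub>G j\<^esub>" using lev[OF uP] by simp
        have "lv ?u = zred M (pact n Xc (Pj j) w)" by (rule lev_YY_emb[OF w(1)])
        also have "\<dots> = zred M v" by (rule zred_cong[OF w(2), symmetric])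
        finally have "\<psi> (zred M v) = \<one>\<^bsub>G j\<^esub>" using 1 by simp
        then show "\<psi> v = \<one>\<^bsub>G j\<^esub>" using \<psi>red[OF v] by simp
      qed
    qed
    show ?thesis unfolding good_def by (rule conjI[OF g1 conjI[OF g2 g3]])
  qed
  then show ?thesis using fFt by (rule bexI)
qed

lemma gev_zred:
  assumes f: "f \<in> Ft n j" and v: "v \<in> zvecs n" shows "gev (G j) f (zred M v) n = gev (G j) f v n"
proof -
  interpret H: comm_group "G j" by (rule G[OF j])
  have "zlattice n M (H.gker n f)" by (rule H.gker_lattice[OF Ft_funcset[OF f] pow_M[OF j]])
  then have "zred M v - v \<in> H.gker n f" using v by (rule zlattice_zred_diff)
  then show ?thesis unfolding H.gev_diff_eq_one[OF Ft_funcset[OF f], symmetric] gkerI[OF j] by simp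
qed

text \<open>A kernel vector agrees at level \<open>m + 1\<close> with a value of the matrix
  polynomial on an integer vector. The remainder is \<open>p\<close> times \<open>p ^ m z\<close>,
  and \<open>p ^ m z\<close> is again in the kernel because \<open>p ^ m\<close> kills
  \<open>G j\<close>; the approximation can thus be iterated.\<close>

lemma kernel_step:
  assumes f: "f \<in> Ft n j" "good n j f Xc" and v: "v \<in> PV" "gev (G j) f (lv v) n = \<one>\<^bsub>G j\<^esub>"
  shows "\<exists>w v'. w \<in> zvecs n \<and> v' \<in> {v \<in> PV. gev (G j) f (lv v) n = \<one>\<^bsub>G j\<^esub>} \<and>
        (\<forall>i<n. \<forall>k. v i k mod int p ^ k = ((\<Sum>b<n. YY i b k * w b) + int p * v' i k) mod int p ^ k)"
proof -
  have p0': "p > 0" using p prime_gt_0_nat by simp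
  obtain w where w: "w \<in> zvecs n" "lv v - pact n Xc (Pj j) w \<in> (*z) M ` zvecs n"
    using v(2) unfolding good_kernel[OF f(2) lev_zvecs[OF v(1)]] by (rule bexE)
  define u where "u = mat_vec p n YY (emb p w)"
  have uP: "u \<in> PV" unfolding u_def
    by (rule mat_vec_padic[where A = YY, OF p0' mat_poly_eval_padic[where X = X, OF p0' Xp cp] emb_padic[OF p0' w(1)]])
  define d' where "d' = (\<lambda>i k. (v i k - u i k) mod int p ^ k)"
  have dP: "d' \<in> PV"
  proof -
    have "(\<lambda>k. (v i k - u i k) mod int p ^ k) \<in> padic_int p" if "i < n" for i
      by (rule padic_intI[OF p0'], rule mod_diff_cong)
        (use v(1) uP that in \<open>auto simp: padic_vecs_def padic_int_coherent\<close>)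
    then show ?thesis using v(1) uP by (simp add: d'_def padic_vecs_def padic_zero_def)
  qed
  have red: "zred M (lv v) = lv u" unfolding u_def lev_YY_emb[OF w(1)] by (rule zred_cong[OF w(2)])
  have ld: "lv d' = 0"
  proof
    fix i
    have "v i (Suc m) mod M = u i (Suc m)" using fun_cong[OF red, of i] by (simp add: zred_def lev_def)
    then have "(v i (Suc m) - u i (Suc m)) mod M = 0" by (metis mod_diff_left_eq mod_0 diff_self mod_mod_trivial)
    then show "lv d' i = 0 i" by (simp add: lev_def d'_def M_def pointwise)
  qed
  obtain z where z: "z \<in> PV" "d' = vec_add p n (emb p (lv d')) (pscale p (int p ^ Suc m) z)"
    using padic_vec_split[OF p0' dP, of "Suc m"] by blast
  \<comment> \<open>One factor \<open>p\<close> of \<open>p ^ Suc m\<close> is the step gained; the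
    other \<open>m\<close> keep \<open>v'\<close> in the kernel.\<close>
  define v' where "v' = pscale p (int p ^ m) z"
  have v'P: "v' \<in> PV" unfolding v'_def by (rule pscale_padic[OF p0' z(1)])
  have "lv v' = zred M (int p ^ m *z lv z)" by (simp add: v'_def lev_def pscale_def zred_def pointwise M_def)
  then have "gev (G j) f (lv v') n = gev (G j) f (int p ^ m *z lv z) n"
    using gev_zred[OF f(1), of "int p ^ m *z lv z"] lev_zvecs[OF z(1), of "Suc m"] by simp
  also have "int p ^ m *z lv z \<in> comm_group.gker (G j) n f"
    by (rule zlattice_modulus[OF gker_lat[OF j Ft_funcset[OF f(1)]] lev_zvecs[OF z(1)]])
  then have "gev (G j) f (int p ^ m *z lv z) n = \<one>\<^bsub>G j\<^esub>" unfolding gkerI[OF j] by simp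
  finally have v'K: "gev (G j) f (lv v') n = \<one>\<^bsub>G j\<^esub>" .
  have "v i k mod int p ^ k = ((\<Sum>b<n. YY i b k * w b) + int p * v' i k) mod int p ^ k" if i: "i < n" for i k
  proof -
    have "d' i k = pscale p (int p ^ Suc m) z i k mod int p ^ k"
      using fun_cong[OF fun_cong[OF z(2), of i], of k] i by (simp add: ld vec_add_def emb_def pointwise)
    then have d1: "d' i k mod int p ^ k = int p * v' i k mod int p ^ k"
      by (simp add: pscale_def v'_def mod_mult_right_eq mult.assoc)
    have u1: "u i k mod int p ^ k = (\<Sum>b<n. YY i b k * w b) mod int p ^ k"
    proof -
      have "u i k mod int p ^ k = (\<Sum>b<n. YY i b k * emb p w b k) mod int p ^ k" using i by (simp add: u_def mat_vec_def)
      also have "\<dots> = (\<Sum>b<n. YY i b k * w b) mod int p ^ k" by (rule mod_sum_prod_cong) (simp_all add: emb_def)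
      finally show ?thesis .
    qed
    have "v i k mod int p ^ k = (u i k + d' i k) mod int p ^ k" by (simp add: d'_def mod_add_right_eq)
    also have "\<dots> = ((\<Sum>b<n. YY i b k * w b) + int p * v' i k) mod int p ^ k" by (rule mod_add_cong[OF u1 d1])
    finally show ?thesis .
  qed
  then show ?thesis using w(1) v'P v'K by (intro exI[of _ w] exI[of _ v']) simp
qed

text \<open>The isomorphism evaluates \<open>f\<close> on residues at level \<open>m + 1\<close>.
  That its kernel is an exact p-adic image, and not just one up to \<open>M\<close>, follows from
  \<open>padic_lift\<close> applied to the kernel itself.\<close>

lemma cok_iso_if_good:
  assumes f: "f \<in> Ft n j" "good n j f Xc"
  shows "cok_iso p n YY X (G j) (T j)"
proof -
  interpret H: comm_group "G j" by (rule G[OF j])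
  have p0': "p > 0" using p prime_gt_0_nat by simp
  note ff = Ft_funcset[OF f(1)]
  define \<phi> where "\<phi> v = gev (G j) f (lv v) n" for v
  have 1: "\<phi> ` PV = carrier (G j)"
  proof (rule equalityI; rule subsetI)
    fix y assume "y \<in> \<phi> ` PV" then show "y \<in> carrier (G j)"
      by (rule imageE) (simp add: \<phi>_def H.gev_closed[OF ff])
  next
    fix y assume "y \<in> carrier (G j)"
    then obtain v where v: "v \<in> zvecs n" "gev (G j) f v n = y" using good_surj[OF f(2)] by blast
    have "y = \<phi> (emb p v)" unfolding \<phi>_def lev_emb MN gev_zred[OF f(1) v(1)] v(2) ..
    then show "y \<in> \<phi> ` PV" using emb_padic[OF p0' v(1)] by (rule image_eqI)
  qed
  have 2: "\<phi> (vec_add p n u v) = \<phi> u \<otimes>\<^bsub>G j\<^esub> \<phi> v" if u: "u \<in> PV" and v: "v \<in> PV" for u v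
  proof -
    have s: "lv u + lv v \<in> zvecs n" using lev_zvecs[OF u] lev_zvecs[OF v] by simp
    show ?thesis unfolding \<phi>_def lev_vec_add[OF u v] MN gev_zred[OF f(1) s] by (rule H.gev_add[OF ff])
  qed
  have 3: "\<phi> v = \<one>\<^bsub>G j\<^esub> \<longleftrightarrow> (\<exists>w\<in>PV. v = mat_vec p n YY w)" if v: "v \<in> PV" for v
  proof
    assume a: "\<phi> v = \<one>\<^bsub>G j\<^esub>"
    show "\<exists>w\<in>PV. v = mat_vec p n YY w"
    proof (rule padic_lift[where S = "{v \<in> PV. gev (G j) f (lv v) n = \<one>\<^bsub>G j\<^esub>}", OF p0'])
      show "{v \<in> PV. gev (G j) f (lv v) n = \<one>\<^bsub>G j\<^esub>} \<subseteq> PV" by (rule Collect_restrict)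
      show "v \<in> {v \<in> PV. gev (G j) f (lv v) n = \<one>\<^bsub>G j\<^esub>}" using v a by (simp add: \<phi>_def)
    next
      fix v assume "v \<in> {v \<in> PV. gev (G j) f (lv v) n = \<one>\<^bsub>G j\<^esub>}"
      then have "v \<in> PV" "gev (G j) f (lv v) n = \<one>\<^bsub>G j\<^esub>" by simp_all
      then show "\<exists>w v'. w \<in> zvecs n \<and> v' \<in> {v \<in> PV. gev (G j) f (lv v) n = \<one>\<^bsub>G j\<^esub>} \<and>
        (\<forall>i<n. \<forall>k. v i k mod int p ^ k = ((\<Sum>b<n. YY i b k * w b) + int p * v' i k) mod int p ^ k)"
        by (rule kernel_step[OF f])
    qed
  next
    assume "\<exists>w\<in>PV. v = mat_vec p n YY w"
    then obtain w where w: "w \<in> PV" "v = mat_vec p n YY w" by (rule bexE)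
    let ?x = "pact n Xc (Pj j) (lv w)"
    have x: "?x \<in> zvecs n" by (rule pact_zvecs[where X = Xc, OF Xz lev_zvecs[OF w(1)]])
    have "gev (G j) f ?x n = \<one>\<^bsub>G j\<^esub>" unfolding good_kernel[OF f(2) x]
    proof (rule bexI[of _ "lv w"])
      show "?x - ?x \<in> (*z) M ` zvecs n" by (rule image_eqI[of _ _ 0]) simp_all
      show "lv w \<in> zvecs n" by (rule lev_zvecs[OF w(1)])
    qed
    then show "\<phi> v = \<one>\<^bsub>G j\<^esub>"
      unfolding \<phi>_def w(2) lev_YY[OF w(1)] gev_zred[OF f(1) x] .
  qed
  have 4: "\<phi> (mat_vec p n X v) = T j (\<phi> v)" if v: "v \<in> PV" for v
  proof -
    have x: "lin n Xc (lv v) \<in> zvecs n" by (rule lin_zvecs[where X = Xc, OF Xz])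
    show ?thesis unfolding \<phi>_def lev_XX[OF v] gev_zred[OF f(1) x]
      by (rule H.intertwines_lin[OF T[OF j] ff good_intertwines[OF f(2)]])
  qed
  show ?thesis unfolding cok_iso_def using 1 2 3 4 by (intro exI[of _ \<phi>] conjI ballI)
qed

lemma cok_iso_iff_good: "cok_iso p n YY X (G j) (T j) \<longleftrightarrow> (\<exists>f\<in>Ft n j. good n j f Xc)"
  using good_if_cok_iso cok_iso_if_good by blast

end

end

section \<open>Haar measure and finite levels\<close>

text \<open>The event depends on finitely many digits, so it is a union of cylinders of measure
  \<open>p ^ - card J\<close>. Digit values from \<open>p\<close> on occur in the space but carry no
  mass, so a restriction to proper digits almost everywhere gives the count.\<close>

lemma measure_finite_digits:
  fixes I J :: "'i set" and p :: nat and Q :: "('i \<Rightarrow> nat) \<Rightarrow> bool"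
  defines "D \<equiv> PiM I (\<lambda>_. measure_pmf (pmf_of_set {0..<p}))"
  assumes J: "finite J" "J \<subseteq> I" and p: "p > 0"
  shows "measure D {d \<in> space D. Q (restrict d J)}
    = real (card {e \<in> PiE J (\<lambda>_. {0..<p}). Q e}) / real p ^ card J"
proof -
  let ?N = "\<lambda>_::'i. measure_pmf (pmf_of_set {0..<p})"
  interpret product_prob_space ?N I by unfold_locales
  interpret D: prob_space D unfolding D_def by unfold_locales
  define cyl where "cyl e = {d \<in> space D. \<forall>i\<in>J. d i = e i}" for e :: "'i \<Rightarrow> nat"
  have cyl_emb: "cyl e = prod_emb I ?N J (PiE J (\<lambda>i. {e i}))" for e
    unfolding cyl_def D_def prod_emb_def using J(2) by (auto simp: space_PiM Pi_iff PiE_def)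
  have cyl_sets: "cyl e \<in> sets D" for e
    unfolding cyl_emb D_def by (rule sets_PiM_I) (use J in auto)
  have cyl_measure: "measure D (cyl e) = 1 / real p ^ card J" if e: "e \<in> PiE J (\<lambda>_. {0..<p})" for e
  proof -
    have "measure D (cyl e) = (\<Prod>i\<in>J. measure (?N i) {e i})"
      unfolding cyl_emb D_def by (rule measure_PiM_emb) (use J in auto)
    also have "\<dots> = (\<Prod>i\<in>J. 1 / real p)"
      by (rule prod.cong) (use e p in \<open>auto simp: measure_pmf_single pmf_of_set PiE_def Pi_def\<close>)
    finally show ?thesis by (simp add: power_one_over)
  qed
  have disj: "disjoint_family_on cyl (PiE J A)" for A :: "'i \<Rightarrow> nat set"
    unfolding disjoint_family_on_def
  proof (intro ballI impI)
    fix a b assume ab: "a \<in> PiE J A" "b \<in> PiE J A" "a \<noteq> b"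
    then obtain i where "i \<in> J" "a i \<noteq> b i" using PiE_ext by metis
    then show "cyl a \<inter> cyl b = {}" unfolding cyl_def by auto
  qed
  let ?B = "PiE J (\<lambda>_. {0..<p})" and ?E = "{d \<in> space D. Q (restrict d J)}"
  have finB: "finite ?B" using J by (simp add: finite_PiE)
  have mU: "measure D (\<Union>e\<in>S. cyl e) = real (card S) / real p ^ card J" if S: "S \<subseteq> ?B" for S
  proof -
    have "measure D (\<Union>e\<in>S. cyl e) = (\<Sum>e\<in>S. measure D (cyl e))"
      by (rule D.finite_measure_finite_Union[OF finite_subset[OF S finB]])
        (use cyl_sets disjoint_family_on_mono[OF S disj] in auto)
    also have "\<dots> = (\<Sum>e\<in>S. 1 / real p ^ card J)" by (rule sum.cong) (use S cyl_measure in auto)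
    finally show ?thesis by simp
  qed
  have U: "(\<Union>e\<in>?B. cyl e) \<in> sets D" using finB cyl_sets by auto
  have "measure D (\<Union>e\<in>?B. cyl e) = 1" unfolding mU[OF order_refl] using J p by (simp add: card_PiE)
  then have AE: "AE d in D. d \<in> (\<Union>e\<in>?B. cyl e)" using D.AE_in_set_eq_1[OF U] by simp
  have restr: "restrict d J = e" if "d \<in> cyl e" "e \<in> PiE J A" for d e A
    using that unfolding cyl_def by (auto simp: fun_eq_iff restrict_def PiE_def extensional_def)
  \<comment> \<open>Cylinders over all natural digit values are used here: they give
    \<open>?E\<close> itself as a countable union, hence its measurability.\<close>
  have "?E = (\<Union>e\<in>{e \<in> PiE J (\<lambda>_. UNIV). Q e}. cyl e)"
  proof (rule Set.set_eqI)
    fix d show "d \<in> ?E \<longleftrightarrow> d \<in> (\<Union>e\<in>{e \<in> PiE J (\<lambda>_. UNIV). Q e}. cyl e)"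
    proof
      assume "d \<in> ?E"
      then have "d \<in> cyl (restrict d J)" "restrict d J \<in> {e \<in> PiE J (\<lambda>_. UNIV). Q e}" by (auto simp: cyl_def)
      then show "d \<in> (\<Union>e\<in>{e \<in> PiE J (\<lambda>_. UNIV). Q e}. cyl e)" by blast
    next
      assume "d \<in> (\<Union>e\<in>{e \<in> PiE J (\<lambda>_. UNIV). Q e}. cyl e)"
      then obtain e where e: "e \<in> PiE J (\<lambda>_. UNIV)" "Q e" "d \<in> cyl e" by blast
      then show "d \<in> ?E" using restr[OF e(3,1)] by (simp add: cyl_def)
    qed
  qed
  moreover have "countable {e \<in> PiE J (\<lambda>_. UNIV :: nat set). Q e}"
    by (rule countable_subset[OF Collect_restrict countable_PiE]) (use J in auto)
  ultimately have E: "?E \<in> sets D" using cyl_sets by (auto intro: sets.countable_UN'')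
  let ?S = "{e \<in> ?B. Q e}"
  have SB: "?S \<subseteq> ?B" by (rule Collect_restrict)
  have "measure D ?E = measure D (\<Union>e\<in>?S. cyl e)"
  proof (rule D.finite_measure_eq_AE)
    show "AE d in D. d \<in> ?E \<longleftrightarrow> d \<in> (\<Union>e\<in>?S. cyl e)" using AE
    proof (rule AE_mp, intro AE_I2 impI)
      fix d assume d: "d \<in> space D" "d \<in> (\<Union>e\<in>?B. cyl e)"
      then obtain e where e: "e \<in> ?B" "d \<in> cyl e" by blast
      show "d \<in> ?E \<longleftrightarrow> d \<in> (\<Union>e\<in>?S. cyl e)"
      proof
        assume "d \<in> ?E" then have "Q e" using restr[OF e(2,1)] by simp
        then show "d \<in> (\<Union>e\<in>?S. cyl e)" using e by blast
      next
        assume "d \<in> (\<Union>e\<in>?S. cyl e)"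
        then obtain e' where e': "e' \<in> ?B" "Q e'" "d \<in> cyl e'" by blast
        then show "d \<in> ?E" using restr[OF e'(3,1)] d by simp
      qed
    qed
    show "(\<Union>e\<in>?S. cyl e) \<in> sets D" using finite_subset[OF SB finB] cyl_sets by auto
  qed (rule E)
  then show ?thesis unfolding mU[OF SB] .
qed

text \<open>The first \<open>N\<close> digits of every entry, stored by columns. The reduction keeps
  the entries in the box even for digits that are not below \<open>p\<close>.\<close>

definition digit_mat :: "nat \<Rightarrow> nat \<Rightarrow> nat \<Rightarrow> ((nat \<times> nat) \<times> nat \<Rightarrow> nat) \<Rightarrow> nat \<Rightarrow> nat \<Rightarrow> int" where
  "digit_mat p n N d = (\<lambda>k\<in>{..<n}. \<lambda>i. if i < n then (\<Sum>t<N. int (d ((i, k), t)) * int p ^ t) mod int p ^ N else 0)"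

lemma digit_sum_bounds:
  fixes d :: "nat \<Rightarrow> nat"
  assumes "\<And>t. t < N \<Longrightarrow> d t < p"
  shows "0 \<le> (\<Sum>t<N. int (d t) * int p ^ t) \<and> (\<Sum>t<N. int (d t) * int p ^ t) < int p ^ N"
  using assms
proof (induction N)
  case (Suc N)
  have "int (d N) + 1 \<le> int p" using Suc.prems[of N] by simp
  then have "(int (d N) + 1) * int p ^ N \<le> int p * int p ^ N" by (rule mult_right_mono) simp
  then show ?case using Suc by (simp add: algebra_simps)
qed simp

lemma digit_sum_inj:
  fixes d e :: "nat \<Rightarrow> nat"
  assumes "\<And>t. t < N \<Longrightarrow> d t < p" "\<And>t. t < N \<Longrightarrow> e t < p"
    and "(\<Sum>t<N. int (d t) * int p ^ t) = (\<Sum>t<N. int (e t) * int p ^ t)" and "t < N"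
  shows "d t = e t"
  using assms
proof (induction N)
  case (Suc N)
  let ?s = "\<lambda>d. \<Sum>t<N. int (d t) * int p ^ t"
  have b: "0 \<le> ?s d" "?s d < int p ^ N" "0 \<le> ?s e" "?s e < int p ^ N"
    using digit_sum_bounds[of N d p] digit_sum_bounds[of N e p] Suc.prems by auto
  have eq: "?s d + int (d N) * int p ^ N = ?s e + int (e N) * int p ^ N" using Suc.prems(3) by simp
  have m: "?s d = ?s e"
    using arg_cong[OF eq, of "\<lambda>x. x mod int p ^ N"] b by simp
  have "p > 0" using Suc.prems(1)[of N] by simp
  then have "d N = e N" using eq m by simp
  moreover have "d t = e t" if "t < N" using Suc.IH[OF _ _ m that] Suc.prems by simp
  ultimately show ?case using Suc.prems(4) less_Suc_eq by auto
qed simp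

lemma digit_mat_mats: "p > 0 \<Longrightarrow> digit_mat p n N d \<in> mats n (int p ^ N)"
  by (auto simp: digit_mat_def mats_def zbox_def zvecs_def)

lemma digit_mat_restrict: "digit_mat p n N (restrict d (({..<n} \<times> {..<n}) \<times> {..<N})) = digit_mat p n N d"
  unfolding digit_mat_def by (intro restrict_ext ext if_cong refl arg_cong[of _ _ "\<lambda>x. x mod _"] sum.cong) auto

text \<open>Base-\<open>p\<close> expansions are unique, which gives injectivity; both sets have
  \<open>p ^ (n * n * N)\<close> elements.\<close>

lemma digit_mat_bij:
  assumes p: "p > 0"
  shows "bij_betw (digit_mat p n N) (PiE (({..<n} \<times> {..<n}) \<times> {..<N}) (\<lambda>_. {0..<p})) (mats n (int p ^ N))"
proof -
  let ?J = "({..<n} \<times> {..<n}) \<times> {..<N}" and ?M = "int p ^ N"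
  have M0: "?M > 0" using p by simp
  have inj: "inj_on (digit_mat p n N) (PiE ?J (\<lambda>_. {0..<p}))"
  proof (rule inj_onI)
    fix a b assume a: "a \<in> PiE ?J (\<lambda>_. {0..<p})" and b: "b \<in> PiE ?J (\<lambda>_. {0..<p})" and eq: "digit_mat p n N a = digit_mat p n N b"
    show "a = b"
    proof (rule PiE_ext[OF a b])
      fix x assume "x \<in> ?J"
      then obtain i k t where x: "x = ((i, k), t)" "i < n" "k < n" "t < N" by auto
      have la: "a ((i, k), t) < p" if "t < N" for t using PiE_mem[OF a, of "((i, k), t)"] x that by simp
      have lb: "b ((i, k), t) < p" if "t < N" for t using PiE_mem[OF b, of "((i, k), t)"] x that by simp
      have "(\<Sum>t<N. int (a ((i, k), t)) * int p ^ t) mod ?M = (\<Sum>t<N. int (b ((i, k), t)) * int p ^ t) mod ?M"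
        using fun_cong[OF fun_cong[OF eq, of k], of i] x by (simp add: digit_mat_def)
      then have "(\<Sum>t<N. int (a ((i, k), t)) * int p ^ t) = (\<Sum>t<N. int (b ((i, k), t)) * int p ^ t)"
        using digit_sum_bounds[of N "\<lambda>t. a ((i, k), t)" p, OF la] digit_sum_bounds[of N "\<lambda>t. b ((i, k), t)" p, OF lb] by simp
      then show "a x = b x" unfolding x(1)
        using digit_sum_inj[of N "\<lambda>t. a ((i, k), t)" p "\<lambda>t. b ((i, k), t)" t, OF la lb _ x(4)] by simp
    qed
  qed
  have "card (PiE ?J (\<lambda>_. {0..<p})) = p ^ (n * n * N)" by (simp add: card_PiE card_cartesian_product)
  also have "\<dots> = card (mats n ?M)"
  proof -
    have "nat ?M = p ^ N" by (metis nat_int of_nat_power)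
    then have "card (mats n ?M) = ((p ^ N) ^ n) ^ n" unfolding mats_def by (simp add: card_PiE card_zbox[OF M0])
    also have "\<dots> = p ^ (n * n * N)" unfolding power_mult[symmetric] by (simp add: mult_ac)
    finally show ?thesis by simp
  qed
  finally have c: "card (PiE ?J (\<lambda>_. {0..<p})) = card (mats n ?M)" .
  have "digit_mat p n N ` PiE ?J (\<lambda>_. {0..<p}) = mats n ?M"
    by (rule card_subset_eq[OF finite_mats[OF M0]]) (use digit_mat_mats[OF p] c card_image[OF inj] in auto)
  then show ?thesis using inj by (simp add: bij_betw_def)
qed

lemma haar_prob_level:
  assumes p: "p > 0" and E: "\<And>d. E (mat_of_digits p n d) \<longleftrightarrow> R (digit_mat p n N d)"
  shows "haar_prob p n E = real (card {X \<in> mats n (int p ^ N). R X}) / real (card (mats n (int p ^ N)))"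
proof -
  let ?J = "({..<n} \<times> {..<n}) \<times> {..<N}" and ?M = "int p ^ N"
  let ?B = "PiE ?J (\<lambda>_. {0..<p})"
  have bij: "bij_betw (digit_mat p n N) ?B (mats n ?M)" by (rule digit_mat_bij[OF p])
  have "haar_prob p n E = real (card {e \<in> ?B. R (digit_mat p n N e)}) / real p ^ card ?J"
    unfolding haar_prob_def E digit_space_def
    using measure_finite_digits[of ?J "({..<n} \<times> {..<n}) \<times> UNIV" p "\<lambda>e. R (digit_mat p n N e)"] p
    unfolding digit_mat_restrict by auto
  also have "real p ^ card ?J = real (card ?B)" by (simp add: card_PiE)
  also have "card ?B = card (mats n ?M)" by (rule bij_betw_same_card[OF bij])
  also have "card {e \<in> ?B. R (digit_mat p n N e)} = card {X \<in> mats n ?M. R X}"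
  proof (rule bij_betw_same_card[of "digit_mat p n N"])
    show "bij_betw (digit_mat p n N) {e \<in> ?B. R (digit_mat p n N e)} {X \<in> mats n ?M. R X}"
      using bij unfolding bij_betw_def by (auto intro: inj_on_subset)
  qed
  finally show ?thesis .
qed

text \<open>Digits outside \<open>{0..<p}\<close> form a null set but do occur in the sample space; the resulting
  matrices are not normalised, which no operation below notices.\<close>

definition mat_norm :: "nat \<Rightarrow> padic_mat \<Rightarrow> padic_mat" where
  "mat_norm p X = (\<lambda>i k a. X i k a mod int p ^ a)"

lemma mat_vec_norm: "mat_vec p n (mat_norm p X) v = mat_vec p n X v"
  unfolding mat_vec_def mat_norm_def by (intro ext if_cong refl mod_sum_prod_cong) simp_all

lemma mat_pow_norm: "mat_pow p n (mat_norm p X) a = mat_pow p n X a"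
proof (induction a)
  case (Suc a)
  show ?case unfolding mat_pow.simps Suc.IH mat_mul_def
    by (intro ext if_cong refl mod_sum_prod_cong) (simp_all add: mat_norm_def)
qed simp

lemma cok_iso_norm:
  "cok_iso p n (mat_poly_eval p n c d (mat_norm p X)) (mat_norm p X) G T \<longleftrightarrow> cok_iso p n (mat_poly_eval p n c d X) X G T"
  unfolding cok_iso_def mat_poly_eval_def mat_pow_norm mat_vec_norm ..

lemma mat_norm_digits:
  assumes p: "p > 0" and "i < n" "k < n" shows "mat_norm p (mat_of_digits p n d) i k \<in> padic_int p"
  unfolding mat_norm_def by (rule padic_intI[OF p]) (use assms in \<open>simp add: mat_of_digits_def padic_of_digits_def\<close>)

lemma (in module_family) haar_prob_cok_iso:
  assumes P: "\<And>j a. j < l \<Longrightarrow> P j a \<in> padic_int p" and dP: "\<And>j. j < l \<Longrightarrow> degree (Pj j) \<le> deg j"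
    and cP: "\<And>j a. j < l \<Longrightarrow> a \<le> deg j \<Longrightarrow> coeff (Pj j) a = P j a (Suc m)"
  shows "haar_prob p n (\<lambda>X. \<forall>j<l. cok_iso p n (mat_poly_eval p n (P j) (deg j) X) X (G j) (T j))
    = real (card {X \<in> mats n M. realizable n X}) / real (card (mats n M))"
  unfolding M_def
proof (rule haar_prob_level)
  show p': "p > 0" using p prime_gt_0_nat by simp
  fix d
  let ?X = "mat_of_digits p n d"
  have "cok_iso p n (mat_poly_eval p n (P j) (deg j) ?X) ?X (G j) (T j) \<longleftrightarrow> (\<exists>f\<in>Ft n j. good n j f (digit_mat p n (Suc m) d))" if j: "j < l" for j
    unfolding cok_iso_norm[symmetric, of p n "P j" "deg j" ?X]
  proof (rule cok_iso_iff_good)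
    show "digit_mat p n (Suc m) d k \<in> zvecs n" if "k < n" for k
      using that by (simp add: digit_mat_def zvecs_def)
    show "digit_mat p n (Suc m) d k i = mat_norm p ?X i k (Suc m)" if "i < n" "k < n" for i k
      using that by (simp add: digit_mat_def mat_norm_def mat_of_digits_def padic_of_digits_def)
    show "mat_norm p ?X i k \<in> padic_int p" if "i < n" "k < n" for i k by (rule mat_norm_digits[OF p' that])
  qed (use j P dP cP in auto)
  then show "(\<forall>j<l. cok_iso p n (mat_poly_eval p n (P j) (deg j) ?X) ?X (G j) (T j)) \<longleftrightarrow> realizable n (digit_mat p n (Suc m) d)"
    unfolding realizable_def by blast
qed

section \<open>Passing to the given p-adic polynomials\<close>

lemma coeff_Poly_map_upt: "coeff (Poly (map f [0..<Suc d])) a = (if a \<le> d then f a else 0)"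
  by (simp add: nth_default_def del: upt_Suc)

text \<open>\<open>padic_smul\<close> reads the scalar at the level given by the order of the group.
  Any higher level gives the same power, since residues are coherent and \<open>p\<close> raised to
  the order kills the group.\<close>

lemma (in comm_group) padic_smul_eq_int_pow:
  assumes fin: "finite (carrier G)" "card (carrier G) = p ^ e" and p: "prime p" and c: "c \<in> padic_int p"
    and N: "card (carrier G) \<le> N" and x: "x \<in> carrier G"
  shows "padic_smul G p c x = x [^] c N"
proof -
  let ?k = "card (carrier G)"
  have "padic_smul G p c x = x [^] int (nat (c ?k))" unfolding padic_smul_def by (simp only: int_pow_int)
  also have "int (nat (c ?k)) = c ?k" using padic_int_bounds(1)[OF c] by simp
  also have "x [^] c ?k = x [^] c N"
  proof (rule pow_eq_if_mod_eq[where m = "int p ^ ?k"])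
    show "group G" by (rule is_group)
    show "x [^] (int p ^ ?k) = \<one>" by (rule finite_p_group_pow[OF comm_group_axioms fin p order_refl x])
    show "c ?k mod int p ^ ?k = c N mod int p ^ ?k"
      unfolding padic_int_mod_le[OF c N] by (rule padic_int_mod[OF c])
  qed (rule x)
  finally show ?thesis .
qed

lemma degree_pos_if_irreducible_m:
  assumes "lead_coeff f = 1" "poly_mod.irreducible_m q f" shows "degree f > 0"
proof (rule ccontr)
  assume "\<not> degree f > 0"
  then obtain c where c: "f = [:c:]" using degree_eq_zeroE[of f] by auto
  then have "c = 1" using assms(1) by simp
  then have "f = 1" unfolding c by (simp only: pCons_one)
  then have "poly_mod.dvdm q f 1" unfolding poly_mod.dvdm_def by (intro exI[of _ 1]) (simp only: mult_1)
  moreover have "\<not> poly_mod.dvdm q f 1" using assms(2) unfolding poly_mod.irreducible_m_def by (elim conjE)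
  ultimately show False by (rule notE[rotated])
qed

theorem theorem1p1:
  fixes p l :: nat
    and P :: "nat \<Rightarrow> nat \<Rightarrow> nat \<Rightarrow> int"   \<comment> \<open>P j m = m-th coefficient of P_j\<close>
    and deg :: "nat \<Rightarrow> nat"
    and G :: "nat \<Rightarrow> ('a, 'b) monoid_scheme"
    and T :: "nat \<Rightarrow> 'a \<Rightarrow> 'a"
  assumes "prime p"
    and "\<And>j m. j < l \<Longrightarrow> P j m \<in> padic_int p"
    and "\<And>j m. j < l \<Longrightarrow> deg j < m \<Longrightarrow> P j m = padic_zero"
    and "\<And>j. j < l \<Longrightarrow> P j (deg j) = padic_one p"
    and "\<And>j. j < l \<Longrightarrow> deg j \<le> 2"
    and "\<And>j. j < l \<Longrightarrow> poly_mod.irreducible_m (int p) (poly_mod_p (P j) (deg j))"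
    and "\<And>i j. i < l \<Longrightarrow> j < l \<Longrightarrow> i \<noteq> j \<Longrightarrow>
           poly_mod.Mp (int p) (poly_mod_p (P i) (deg i)) \<noteq> poly_mod.Mp (int p) (poly_mod_p (P j) (deg j))"
    and "\<And>j. j < l \<Longrightarrow> finite_quot_module p (P j) (deg j) (G j) (T j)"
  shows "(\<lambda>n. haar_prob p n (\<lambda>X. \<forall>j<l. cok_iso p n (mat_poly_eval p n (P j) (deg j) X) X (G j) (T j)))
         \<longlonglongrightarrow> (\<Prod>j<l. (1 / real (card (mod_auts (G j) (T j))))
                       * (\<Prod>i. 1 - 1 / real p ^ (Suc i * deg j)))"
proof -
  note pr = assms(1) and P = assms(2) and P1 = assms(4)
    and irr = assms(6) and dist = assms(7) and fqm = assms(8)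
  have p1: "p > 1" using prime_gt_1_nat[OF pr] .
  \<comment> \<open>The sum bounds every order, so \<open>p ^ m\<close> kills all the groups by
    \<open>finite_p_group_pow\<close>.\<close>
  define m where "m = (\<Sum>j<l. card (carrier (G j)))"
  \<comment> \<open>Integer polynomials with the residues of the coefficients at level
    \<open>m + 1\<close>; their values on integer matrices agree modulo \<open>p ^ Suc m\<close>
    with those of the p-adic polynomials.\<close>
  define Q where "Q j = Poly (map (\<lambda>a. P j a (Suc m)) [0..<Suc (deg j)])" for j
  have cm: "card (carrier (G j)) \<le> m" if "j < l" for j
    unfolding m_def by (rule member_le_sum) (use that in auto)
  have cQ: "coeff (Q j) a = (if a \<le> deg j then P j a (Suc m) else 0)" for j a
    unfolding Q_def by (rule coeff_Poly_map_upt)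
  \<comment> \<open>At level 0 every residue is 0, including that of 1; the positive level
    \<open>Suc m\<close> makes \<open>Q j\<close> exactly monic.\<close>
  have lead: "coeff (Q j) (deg j) = 1" if "j < l" for j
    using P1[OF that] one_less_power[of "int p" "Suc m"] p1 by (simp add: cQ padic_one_def)
  have dQ: "degree (Q j) = deg j" if "j < l" for j
    by (rule antisym[OF degree_le le_degree]) (use lead[OF that] in \<open>auto simp: cQ\<close>)
  have MpQ: "poly_mod.Mp (int p) (Q j) = poly_mod.Mp (int p) (poly_mod_p (P j) (deg j))" if "j < l" for j
  proof (rule poly_eqI)
    fix a
    have "P j a (Suc m) mod int p = P j a 1"
      using padic_int_mod_le[OF P[OF that, of a], of 1 "Suc m"] by simp
    then show "coeff (poly_mod.Mp (int p) (Q j)) a = coeff (poly_mod.Mp (int p) (poly_mod_p (P j) (deg j))) a"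
      unfolding poly_mod.Mp_coeff poly_mod.M_def poly_mod_p_def coeff_Poly_map_upt cQ
      using padic_int_mod[OF P[OF that, of a], of 1] by simp
  qed
  have irrQ: "poly_mod.irreducible_m (int p) (Q j)" if "j < l" for j
    using irr[OF that] poly_mod.eq_m_irreducible_m[OF MpQ[OF that]] by simp
  interpret module_family p l m G T Q
  proof (rule module_family.intro)
    fix j assume j: "j < l"
    note f = fqm[OF j, unfolded finite_quot_module_def]
    show G: "comm_group (G j)" and fin: "finite (carrier (G j))" and card: "\<exists>e. card (carrier (G j)) = p ^ e"
      and T: "T j \<in> hom (G j) (G j)" using f by blast+
    interpret H: comm_group "G j" by (rule G)
    obtain e where e: "card (carrier (G j)) = p ^ e" using card by blast
    show "x [^]\<^bsub>G j\<^esub> (int p ^ m) = \<one>\<^bsub>G j\<^esub>" if "x \<in> carrier (G j)" for x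
      by (rule finite_p_group_pow[OF G fin e pr cm[OF j] that])
    show "lead_coeff (Q j) = 1" using lead[OF j] dQ[OF j] by simp
    then show "degree (Q j) > 0" using irrQ[OF j] by (rule degree_pos_if_irreducible_m)
    show "poly_mod.irreducible_m (int p) (Q j)" by (rule irrQ[OF j])
    show "poly_mod.Mp (int p) (Q j) \<noteq> poly_mod.Mp (int p) (Q i)" if "i < l" "j \<noteq> i" for i
      using dist[OF j that] unfolding MpQ[OF j] MpQ[OF that(1)] .
    fix g assume g: "g \<in> carrier (G j)"
    have Tg: "(T j ^^ a) g \<in> carrier (G j)" for a
    proof (induction a)
      case (Suc a) then show ?case using T by (simp add: hom_in_carrier)
    qed (simp add: g)
    have "finprod (G j) (\<lambda>a. (T j ^^ a) g [^]\<^bsub>G j\<^esub> coeff (Q j) a) {..degree (Q j)}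
        = finprod (G j) (\<lambda>a. padic_smul (G j) p (P j a) ((T j ^^ a) g)) {..deg j}"
    proof (rule H.finprod_cong')
      show "{..degree (Q j)} = {..deg j}" using dQ[OF j] by simp
      show "(\<lambda>a. padic_smul (G j) p (P j a) ((T j ^^ a) g)) \<in> {..deg j} \<rightarrow> carrier (G j)"
        using Tg by (simp add: padic_smul_def)
      fix a assume a: "a \<in> {..deg j}"
      have "padic_smul (G j) p (P j a) ((T j ^^ a) g) = (T j ^^ a) g [^]\<^bsub>G j\<^esub> P j a (Suc m)"
        by (rule H.padic_smul_eq_int_pow[OF fin e pr P[OF j] _ Tg]) (use cm[OF j] in simp)
      then show "(T j ^^ a) g [^]\<^bsub>G j\<^esub> coeff (Q j) a = padic_smul (G j) p (P j a) ((T j ^^ a) g)" using a by (simp add: cQ)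
    qed
    then show "finprod (G j) (\<lambda>a. (T j ^^ a) g [^]\<^bsub>G j\<^esub> coeff (Q j) a) {..degree (Q j)} = \<one>\<^bsub>G j\<^esub>"
      using f g by simp
  qed (rule pr)
  have haar: "haar_prob p n (\<lambda>X. \<forall>j<l. cok_iso p n (mat_poly_eval p n (P j) (deg j) X) X (G j) (T j))
    = real (card {X \<in> mats n M. realizable n X}) / real (card (mats n M))" for n
    by (rule haar_prob_cok_iso) (use P dQ in \<open>auto simp: cQ\<close>)
  have "qq j ^ Suc i = real p ^ (Suc i * deg j)" if "j < l" for i j
    unfolding qq_def dQ[OF that] of_nat_power power_mult[symmetric] by (simp only: mult.commute)
  then have "(\<Prod>j<l. 1 / real (card (mod_auts (G j) (T j))) * (\<Prod>i. 1 - 1 / qq j ^ Suc i))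
      = (\<Prod>j<l. 1 / real (card (mod_auts (G j) (T j))) * (\<Prod>i. 1 - 1 / real p ^ (Suc i * deg j)))"
    by (intro prod.cong refl) (simp del: power_Suc mult_Suc)
  then show ?thesis using realizable_limit unfolding haar by simp
qed

end
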